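(* Let $(A,b)\in\mathcal B$ (setting $\mathcal B$). Then there exists a unique solution $r\in L^2_{\mathrm{per}}(Y)$ to $$-D^2:(Ar)+\nabla\cdot(br)=0\ \text{ in }Y,\qquad r\text{ is }Y\text{-periodic},\qquad\int_Y r=1,$$ and there holds $r\ge0$ a.e. in $\mathbb{R}^n$. Further, $$r=\frac{1}{\int_Y\gamma\tilde r}\,\gamma\tilde r,$$ where $\gamma:=\frac{\mathrm{tr}(A)}{|A|^2+|b|^2}$ and $\tilde r\in L^2_{\mathrm{per}}(Y)$ is the unique solution in $L^2_{\mathrm{per}}(Y)$ to $-D^2:(\tilde A\tilde r)+\nabla\cdot(\tilde b\tilde r)=0$ in $Y$, $\tilde r$ $Y$-periodic, $\int_Y\tilde r=1$, with $\tilde A:=\gamma A$, $\tilde b:=\gamma b$.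
   Context: $Y:=(0,1)^n\subset\mathbb{R}^n$. The subscript "per" denotes spaces of $Y$-periodic functions on $\mathbb{R}^n$ with the indicated (local) regularity. $|A|:=\sqrt{A:A}$ is the Frobenius norm, $|b|$ the Euclidean norm. Setting $\mathcal B$: $(A,b)\in\mathcal B$ means that $A\in L^\infty_{\mathrm{per}}(Y;\mathbb{R}^{n\times n}_{\mathrm{sym}})$, $b\in L^\infty_{\mathrm{per}}(Y;\mathbb{R}^n)$; $A$ is uniformly elliptic, i.e. there are $\lambda,\Lambda>0$ with $\lambda I_n\le A\le\Lambda I_n$ a.e. in $\mathbb{R}^n$; and the Cordes-type condition holds: there exists $\delta\in\left(\frac{n}{n+\pi^2},1\right]$ such that $\frac{|A|^2+|b|^2}{(\mathrm{tr}(A))^2}\le\frac{1}{n-1+\delta}$ a.e. in $\mathbb{R}^n$. $D^2:(Au):=\sum_{i,j}\partial^2_{ij}(a_{ij}u)$. Solutions $u\in L^2_{\mathrm{per}}(Y)$ of $-D^2:(Au)+\nabla\cdot(bu)=0$ in $Y$, $u$ $Y$-periodic, are understood in the very weak sense: $\int_Y u\,(A:D^2\varphi+b\cdot\nabla\varphi)=0$ for all $\varphi\in H^2_{\mathrm{per}}(Y)$ (and analogously with $(\tilde A,\tilde b)$). Existence and uniqueness of $\tilde r$ is established in the paper; concretely $\tilde r=1-\Delta\psi_1$, where $\psi_1\in H^2_{\mathrm{per}}(Y)$ is the unique mean-zero function with $\int_Y\Delta\psi_1(\tilde A:D^2\varphi+\tilde b\cdot\nabla\varphi)=\int_Y(\tilde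 A:D^2\varphi+\tilde b\cdot\nabla\varphi)$ for all mean-zero $\varphi\in H^2_{\mathrm{per}}(Y)$. *)

theory Defs
  imports "HOL-Analysis.Analysis"
begin

text \<open>
  Elements of Lebesgue and Sobolev spaces are represented by everywhere defined functions;
  periodicity and uniqueness are accordingly understood almost everywhere.
  On \<^typ>\<open>real ^ 'n ^ 'n\<close>, the inner product of the library is the product
  $A : B = \sum_{i,j} a_{ij} b_{ij}$, and \<^const>\<open>norm\<close> is therefore the Frobenius norm.
\<close>

definition unit_cell :: "(real ^ 'n::finite) set" where
  "unit_cell = {x. \<forall>i. 0 < x $ i \<and> x $ i < 1}"

definition periodic_ae :: "(real ^ 'n::finite \<Rightarrow> 'b) \<Rightarrow> bool" where
  "periodic_ae f \<longleftrightarrow> (\<forall>i. AE x in lebesgue. f (x + axis i 1) = f x)"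

definition Linf_per :: "(real ^ 'n::finite \<Rightarrow> 'b::real_normed_vector) \<Rightarrow> bool" where
  "Linf_per f \<longleftrightarrow>
     f \<in> borel_measurable lebesgue \<and> periodic_ae f \<and> (\<exists>C. AE x in lebesgue. norm (f x) \<le> C)"

definition L2_loc :: "(real ^ 'n::finite \<Rightarrow> real) \<Rightarrow> bool" where
  "L2_loc f \<longleftrightarrow>
     f \<in> borel_measurable lebesgue \<and>
     (\<forall>K. compact K \<longrightarrow> set_integrable lebesgue K (\<lambda>x. (f x)\<^sup>2))"

definition L2_per :: "(real ^ 'n::finite \<Rightarrow> real) \<Rightarrow> bool" where
  "L2_per f \<longleftrightarrow> L2_loc f \<and> periodic_ae f"

definition L1_loc :: "(real ^ 'n::finite \<Rightarrow> real) \<Rightarrow> bool" where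
  "L1_loc f \<longleftrightarrow> (\<forall>K. compact K \<longrightarrow> set_integrable lebesgue K f)"

definition partial_deriv :: "'n::finite \<Rightarrow> (real ^ 'n \<Rightarrow> real) \<Rightarrow> real ^ 'n \<Rightarrow> real" where
  "partial_deriv i f x = frechet_derivative f (at x) (axis i 1)"

primrec C_class :: "nat \<Rightarrow> (real ^ 'n::finite \<Rightarrow> real) \<Rightarrow> bool" where
  "C_class 0 f \<longleftrightarrow> continuous_on UNIV f"
| "C_class (Suc k) f \<longleftrightarrow>
     (\<forall>x. f differentiable (at x)) \<and> (\<forall>i. C_class k (partial_deriv i f))"

definition test_fun :: "(real ^ 'n::finite \<Rightarrow> real) \<Rightarrow> bool" where
  "test_fun \<phi> \<longleftrightarrow> (\<forall>k. C_class k \<phi>) \<and> compact (closure {x. \<phi> x \<noteq> 0})"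

definition has_weak_partial ::
  "'n::finite \<Rightarrow> (real ^ 'n \<Rightarrow> real) \<Rightarrow> (real ^ 'n \<Rightarrow> real) \<Rightarrow> bool" where
  "has_weak_partial i u g \<longleftrightarrow>
     L1_loc u \<and> L1_loc g \<and>
     (\<forall>\<phi>. test_fun \<phi> \<longrightarrow>
        (LINT x|lebesgue. u x * partial_deriv i \<phi> x) = - (LINT x|lebesgue. g x * \<phi> x))"

primrec H_loc :: "nat \<Rightarrow> (real ^ 'n::finite \<Rightarrow> real) \<Rightarrow> bool" where
  "H_loc 0 u \<longleftrightarrow> L2_loc u"
| "H_loc (Suc k) u \<longleftrightarrow> L2_loc u \<and> (\<forall>i. \<exists>g. has_weak_partial i u g \<and> H_loc k g)"

text \<open>The weak derivatives of a periodic function are periodic automatically.\<close>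

definition H2_per :: "(real ^ 'n::finite \<Rightarrow> real) \<Rightarrow> bool" where
  "H2_per u \<longleftrightarrow> H_loc 2 u \<and> periodic_ae u"

text \<open>
  Weak derivatives are determined up to null sets, so the choice below is immaterial
  under an integral (if the weak derivative exists, as it does on \<^const>\<open>H2_per\<close>).
\<close>

definition weak_partial :: "'n::finite \<Rightarrow> (real ^ 'n \<Rightarrow> real) \<Rightarrow> real ^ 'n \<Rightarrow> real" where
  "weak_partial i u = (SOME g. has_weak_partial i u g)"

definition weak_grad :: "(real ^ 'n::finite \<Rightarrow> real) \<Rightarrow> real ^ 'n \<Rightarrow> real ^ 'n" where
  "weak_grad u x = (\<chi> i. weak_partial i u x)"

definition weak_hessian :: "(real ^ 'n::finite \<Rightarrow> real) \<Rightarrow> real ^ 'n \<Rightarrow> real ^ 'n ^ 'n" where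
  "weak_hessian u x = (\<chi> i j. weak_partial i (weak_partial j u) x)"

definition setting_B ::
  "(real ^ 'n::finite \<Rightarrow> real ^ 'n ^ 'n) \<Rightarrow> (real ^ 'n \<Rightarrow> real ^ 'n) \<Rightarrow> bool" where
  "setting_B A b \<longleftrightarrow>
     Linf_per A \<and> Linf_per b \<and>
     (AE x in lebesgue. transpose (A x) = A x) \<and>
     (\<exists>lam>0. \<exists>Lam>0. AE x in lebesgue. \<forall>\<xi>.
        lam * (\<xi> \<bullet> \<xi>) \<le> \<xi> \<bullet> (A x *v \<xi>) \<and> \<xi> \<bullet> (A x *v \<xi>) \<le> Lam * (\<xi> \<bullet> \<xi>)) \<and>
     (\<exists>\<delta>::real. real CARD('n) / (real CARD('n) + pi\<^sup>2) < \<delta> \<and> \<delta> \<le> 1 \<and>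
        (AE x in lebesgue.
           ((norm (A x))\<^sup>2 + (norm (b x))\<^sup>2) / (trace (A x))\<^sup>2 \<le> 1 / (real CARD('n) - 1 + \<delta>)))"

text \<open>
  Very weak periodic solutions $u \in L^2_{per}$ of
  $-D^2 : (Au) + \nabla \cdot (bu) = 0$ in the unit cell.
\<close>

definition very_weak_solution ::
  "(real ^ 'n::finite \<Rightarrow> real ^ 'n ^ 'n) \<Rightarrow> (real ^ 'n \<Rightarrow> real ^ 'n) \<Rightarrow>
   (real ^ 'n \<Rightarrow> real) \<Rightarrow> bool" where
  "very_weak_solution A b u \<longleftrightarrow>
     L2_per u \<and>
     (\<forall>\<phi>. H2_per \<phi> \<longrightarrow>
        (LINT x:unit_cell|lebesgue.
           u x * (A x \<bullet> weak_hessian \<phi> x + b x \<bullet> weak_grad \<phi> x)) = 0)"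

definition normalized_solution ::
  "(real ^ 'n::finite \<Rightarrow> real ^ 'n ^ 'n) \<Rightarrow> (real ^ 'n \<Rightarrow> real ^ 'n) \<Rightarrow>
   (real ^ 'n \<Rightarrow> real) \<Rightarrow> bool" where
  "normalized_solution A b u \<longleftrightarrow>
     very_weak_solution A b u \<and> (LINT x:unit_cell|lebesgue. u x) = 1"

definition unique_normalized_solution ::
  "(real ^ 'n::finite \<Rightarrow> real ^ 'n ^ 'n) \<Rightarrow> (real ^ 'n \<Rightarrow> real ^ 'n) \<Rightarrow>
   (real ^ 'n \<Rightarrow> real) \<Rightarrow> bool" where
  "unique_normalized_solution A b u \<longleftrightarrow>
     normalized_solution A b u \<and>
     (\<forall>v. normalized_solution A b v \<longrightarrow> (AE x in lebesgue. v x = u x))"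

definition renorm ::
  "(real ^ 'n::finite \<Rightarrow> real ^ 'n ^ 'n) \<Rightarrow> (real ^ 'n \<Rightarrow> real ^ 'n) \<Rightarrow> real ^ 'n \<Rightarrow> real" where
  "renorm A b x = trace (A x) / ((norm (A x))\<^sup>2 + (norm (b x))\<^sup>2)"

end

theory Submission
  imports Defs
begin

text \<open>
  After multiplication by \<open>\<gamma>\<close> the Cordes condition reads \<open>|\<gamma>A - I|\<^sup>2 + |\<gamma>b|\<^sup>2 \<le> 1 - \<delta>\<close>.
  On trigonometric polynomials \<open>\<parallel>D\<^sup>2\<phi>\<parallel> = \<parallel>\<Delta>\<phi>\<parallel>\<close> and \<open>2\<pi>\<parallel>\<nabla>\<phi>\<parallel> \<le> \<parallel>\<Delta>\<phi>\<parallel>\<close> in \<open>L\<^sup>2\<close> of the cell, so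
  \<open>L = \<gamma>A : D\<^sup>2 + \<gamma>b \<bullet> \<nabla>\<close> satisfies \<open>\<parallel>L\<phi> - \<Delta>\<phi>\<parallel> \<le> \<kappa>\<parallel>\<Delta>\<phi>\<parallel>\<close> with \<open>\<kappa> < 1\<close>. Fejer means commute with weak
  derivatives, hence it suffices to test with trigonometric polynomials. A function orthogonal to
  the range of \<open>L\<close> is then determined by its mean, and the component of \<open>1\<close> orthogonal to this range is one with
  nonzero mean. For coefficients that are trigonometric polynomials the resolvent of \<open>L\<close> preserves
  positivity, so with \<open>r\<close> also \<open>r\<^sup>+\<close> is orthogonal to the range, which forces \<open>r \<ge> 0\<close>; Fejer means of the
  coefficients preserve the Cordes bound by convexity, and the general case follows by weak convergence.
  Finally \<open>u\<close> solves the problem for \<open>(A, b)\<close> iff \<open>u / \<gamma>\<close> solves the renormalized one.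
\<close>

subsection \<open>Square integrable functions\<close>

definition square_integrable :: "'a measure \<Rightarrow> ('a \<Rightarrow> real) \<Rightarrow> bool" where
  "square_integrable M f \<longleftrightarrow> f \<in> borel_measurable M \<and> integrable M (\<lambda>x. (f x)\<^sup>2)"

definition L2norm :: "'a measure \<Rightarrow> ('a \<Rightarrow> real) \<Rightarrow> real" where
  "L2norm M f = sqrt (\<integral>x. (f x)\<^sup>2 \<partial>M)"

lemma square_integrable_measurable [measurable_dest]:
  "square_integrable M f \<Longrightarrow> f \<in> borel_measurable M"
  by (simp add: square_integrable_def)

lemma square_integrable_square [simp]: "square_integrable M f \<Longrightarrow> integrable M (\<lambda>x. (f x)\<^sup>2)"
  by (simp add: square_integrable_def)

lemma square_integrable_mult [simp]:
  assumes "square_integrable M f" "square_integrable M g"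
  shows "integrable M (\<lambda>x. f x * g x)"
proof (rule Bochner_Integration.integrable_bound)
  show "integrable M (\<lambda>x. (f x)\<^sup>2 + (g x)\<^sup>2)"
    using assms by (auto intro: square_integrable_square)
  show "(\<lambda>x. f x * g x) \<in> borel_measurable M"
    using assms by (auto intro!: borel_measurable_times dest: square_integrable_measurable)
  have "\<bar>a * b\<bar> \<le> a\<^sup>2 + b\<^sup>2" for a b :: real
  proof -
    have "0 \<le> (\<bar>a\<bar> - \<bar>b\<bar>)\<^sup>2" by simp
    also have "\<dots> = a\<^sup>2 + b\<^sup>2 - 2 * \<bar>a * b\<bar>"
      by (simp add: power2_diff abs_mult)
    finally show ?thesis by simp
  qed
  then show "AE x in M. norm (f x * g x) \<le> norm ((f x)\<^sup>2 + (g x)\<^sup>2)" by auto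
qed

lemma square_integrable_scale [simp]:
  "square_integrable M f \<Longrightarrow> square_integrable M (\<lambda>x. c * f x)"
  by (auto simp: square_integrable_def power_mult_distrib)

lemma square_integrable_minus [simp]:
  "square_integrable M f \<Longrightarrow> square_integrable M (\<lambda>x. - f x)"
  by (auto simp: square_integrable_def)

lemma square_integrable_add [simp]:
  assumes "square_integrable M f" "square_integrable M g"
  shows "square_integrable M (\<lambda>x. f x + g x)"
proof -
  have "integrable M (\<lambda>x. (f x)\<^sup>2 + (g x)\<^sup>2 + 2 * (f x * g x))"
    using assms by (intro Bochner_Integration.integrable_add integrable_mult_right
        square_integrable_square square_integrable_mult) auto
  then show ?thesis
    using assms by (auto simp: square_integrable_def power2_sum algebra_simps)
qed

lemma square_integrable_diff [simp]:
  assumes "square_integrable M f" "square_integrable M g"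
  shows "square_integrable M (\<lambda>x. f x - g x)"
  using square_integrable_add[OF assms(1) square_integrable_minus[OF assms(2)]] by simp

lemma square_integrable_0 [simp]: "square_integrable M (\<lambda>x. 0)"
  by (simp add: square_integrable_def)

lemma square_integrable_sum [simp]:
  assumes "\<And>i. i \<in> I \<Longrightarrow> square_integrable M (f i)"
  shows "square_integrable M (\<lambda>x. \<Sum>i\<in>I. f i x)"
  using assms
  by (induction I rule: infinite_finite_induct) (auto intro: square_integrable_0 square_integrable_add)

lemma square_integrable_bounded_mult:
  assumes "f \<in> borel_measurable M" "AE x in M. \<bar>f x\<bar> \<le> C" "square_integrable M g"
  shows "square_integrable M (\<lambda>x. f x * g x)"
  unfolding square_integrable_def
proof
  have g: "g \<in> borel_measurable M" using assms(3) by (rule square_integrable_measurable)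
  then show m: "(\<lambda>x. f x * g x) \<in> borel_measurable M" using assms(1) by simp
  show "integrable M (\<lambda>x. (f x * g x)\<^sup>2)"
  proof (rule Bochner_Integration.integrable_bound)
    show "integrable M (\<lambda>x. C\<^sup>2 * (g x)\<^sup>2)"
      using assms(3) by (auto intro: square_integrable_square)
    show "(\<lambda>x. (f x * g x)\<^sup>2) \<in> borel_measurable M" using m by simp
    show "AE x in M. norm ((f x * g x)\<^sup>2) \<le> norm (C\<^sup>2 * (g x)\<^sup>2)"
      using assms(2)
      by eventually_elim
        (auto simp: power_mult_distrib intro!: mult_right_mono intro: abs_le_square_iff[THEN iffD1])
  qed
qed

lemma (in finite_measure) square_integrable_bounded:
  assumes "f \<in> borel_measurable M" "AE x in M. \<bar>f x\<bar> \<le> C"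
  shows "square_integrable M f"
  using square_integrable_bounded_mult[of f M C "\<lambda>_. 1"] assms
  by (simp add: square_integrable_def)

lemma (in finite_measure) square_integrable_const [simp]: "square_integrable M (\<lambda>x. c)"
  by (simp add: square_integrable_def)

lemma (in finite_measure) square_integrable_integrable:
  "square_integrable M f \<Longrightarrow> integrable M f"
  using square_integrable_mult[of M f "\<lambda>x. 1"] square_integrable_const by simp

lemma square_integrable_abs [simp]: "square_integrable M f \<Longrightarrow> square_integrable M (\<lambda>x. \<bar>f x\<bar>)"
  by (auto simp: square_integrable_def)

lemma square_integrable_max_0 [simp]: 
  assumes "square_integrable M f"
  shows "square_integrable M (\<lambda>x. max 0 (f x))"
proof -
  have "(\<lambda>x. max 0 (f x)) = (\<lambda>x. 1/2 * (f x + \<bar>f x\<bar>))" by (auto simp: max_def)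
  moreover have "square_integrable M (\<lambda>x. 1/2 * (f x + \<bar>f x\<bar>))"
    using assms by (intro square_integrable_scale square_integrable_add square_integrable_abs)
  ultimately show ?thesis by simp
qed

lemma square_integrable_cong_AE:
  assumes "square_integrable M f" "AE x in M. f x = g x" "g \<in> borel_measurable M"
  shows "square_integrable M g"
proof -
  have "integrable M (\<lambda>x. (f x)\<^sup>2) \<longleftrightarrow> integrable M (\<lambda>x. (g x)\<^sup>2)"
    using assms by (intro integrable_cong_AE) (auto dest: square_integrable_measurable)
  then show ?thesis using assms by (simp add: square_integrable_def)
qed

lemma L2norm_nonneg [simp]: "0 \<le> L2norm M f"
  by (simp add: L2norm_def)

lemma L2norm_power2: "(L2norm M f)\<^sup>2 = (\<integral>x. (f x)\<^sup>2 \<partial>M)"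
  by (simp add: L2norm_def)

lemma L2norm_scale: "L2norm M (\<lambda>x. c * f x) = \<bar>c\<bar> * L2norm M f"
  by (simp add: L2norm_def power_mult_distrib real_sqrt_mult)

lemma L2norm_minus_commute: "L2norm M (\<lambda>x. f x - g x) = L2norm M (\<lambda>x. g x - f x)"
  by (simp add: L2norm_def power2_commute)

lemma L2norm_eq_0:
  assumes "square_integrable M f" "L2norm M f = 0"
  shows "AE x in M. f x = 0"
proof -
  have "(\<integral>x. (f x)\<^sup>2 \<partial>M) = 0" using assms(2) by (simp add: L2norm_def)
  then have "AE x in M. (f x)\<^sup>2 = 0"
    using assms(1) integral_nonneg_eq_0_iff_AE[of M "\<lambda>x. (f x)\<^sup>2"] square_integrable_square by auto
  then show ?thesis by auto
qed

lemma L2norm_cong_AE: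
  assumes "AE x in M. f x = g x" "f \<in> borel_measurable M" "g \<in> borel_measurable M"
  shows "L2norm M f = L2norm M g"
  unfolding L2norm_def using assms by (intro arg_cong[of _ _ sqrt] integral_cong_AE) auto

lemma L2norm_mono:
  assumes "square_integrable M g" "AE x in M. \<bar>f x\<bar> \<le> \<bar>g x\<bar>"
  shows "L2norm M f \<le> L2norm M g"
proof -
  have "(\<integral>x. (f x)\<^sup>2 \<partial>M) \<le> (\<integral>x. (g x)\<^sup>2 \<partial>M)"
  proof (rule integral_mono_AE')
    show "integrable M (\<lambda>x. (g x)\<^sup>2)" by (rule square_integrable_square[OF assms(1)])
    show "AE x in M. (f x)\<^sup>2 \<le> (g x)\<^sup>2"
      using assms(2) by eventually_elim (simp add: abs_le_square_iff)
  qed auto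
  then show ?thesis by (simp add: L2norm_def)
qed

lemma L2_inner_add_power2:
  assumes "square_integrable M f" "square_integrable M g"
  shows "(L2norm M (\<lambda>x. f x + g x))\<^sup>2 = (L2norm M f)\<^sup>2 + 2 * (\<integral>x. f x * g x \<partial>M) + (L2norm M g)\<^sup>2"
proof -
  have "(\<integral>x. (f x + g x)\<^sup>2 \<partial>M) = (\<integral>x. (f x)\<^sup>2 + 2 * (f x * g x) + (g x)\<^sup>2 \<partial>M)"
    by (simp add: power2_sum algebra_simps)
  also have "\<dots> = (\<integral>x. (f x)\<^sup>2 \<partial>M) + 2 * (\<integral>x. f x * g x \<partial>M) + (\<integral>x. (g x)\<^sup>2 \<partial>M)"
    using assms by (simp add: square_integrable_square square_integrable_mult)
  finally show ?thesis by (simp add: L2norm_power2)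
qed

lemma L2_Cauchy_Schwarz:
  assumes "square_integrable M f" "square_integrable M g"
  shows "\<bar>\<integral>x. f x * g x \<partial>M\<bar> \<le> L2norm M f * L2norm M g"
proof -
  define a b c where "a = (L2norm M f)\<^sup>2" and "b = (\<integral>x. f x * g x \<partial>M)" and "c = (L2norm M g)\<^sup>2"
  have q: "0 \<le> s\<^sup>2 * a + 2 * s * t * b + t\<^sup>2 * c" for s t :: real
  proof -
    have "0 \<le> (L2norm M (\<lambda>x. s * f x + t * g x))\<^sup>2" by simp
    also have "\<dots> = (L2norm M (\<lambda>x. s * f x))\<^sup>2 + 2 * (\<integral>x. (s * f x) * (t * g x) \<partial>M) + (L2norm M (\<lambda>x. t * g x))\<^sup>2"
      using assms by (intro L2_inner_add_power2 square_integrable_scale)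
    also have "(\<lambda>x. (s * f x) * (t * g x)) = (\<lambda>x. (s * t) * (f x * g x))" by (auto simp: algebra_simps)
    finally show ?thesis by (simp add: a_def b_def c_def L2norm_scale power_mult_distrib)
  qed
  have ac: "a \<ge> 0" "c \<ge> 0" by (auto simp: a_def c_def)
  have "b\<^sup>2 \<le> a * c"
  proof (cases "c = 0")
    case True
    have "b = 0"
    proof (rule ccontr)
      assume "b \<noteq> 0"
      then have "1\<^sup>2 * a + 2 * 1 * (- (a + 1) / (2 * b)) * b + (- (a + 1) / (2 * b))\<^sup>2 * c = -1"
        using True by (simp add: field_simps)
      then show False using q[of 1 "- (a + 1) / (2 * b)"] by linarith
    qed
    then show ?thesis using True by simp
  next
    case False
    then have c: "c > 0" using ac by simp
    have "0 \<le> c\<^sup>2 * a + 2 * c * (- b) * b + (- b)\<^sup>2 * c" by (rule q)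
    also have "\<dots> = c * (a * c - b\<^sup>2)" by (simp add: power2_eq_square algebra_simps)
    finally show ?thesis using c by (simp add: zero_le_mult_iff)
  qed
  then have "\<bar>b\<bar> \<le> sqrt (a * c)" using real_le_rsqrt[of "\<bar>b\<bar>"] by simp
  then show ?thesis by (simp add: a_def b_def c_def real_sqrt_mult)
qed

lemma L2norm_triangle:
  assumes "square_integrable M f" "square_integrable M g"
  shows "L2norm M (\<lambda>x. f x + g x) \<le> L2norm M f + L2norm M g"
proof (rule power2_le_imp_le)
  show "(L2norm M (\<lambda>x. f x + g x))\<^sup>2 \<le> (L2norm M f + L2norm M g)\<^sup>2"
    using L2_inner_add_power2[OF assms] L2_Cauchy_Schwarz[OF assms] by (simp add: power2_sum)
qed simp

lemma L2norm_triangle_diff: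
  assumes "square_integrable M f" "square_integrable M g" "square_integrable M h"
  shows "L2norm M (\<lambda>x. f x - h x) \<le> L2norm M (\<lambda>x. f x - g x) + L2norm M (\<lambda>x. g x - h x)"
  using L2norm_triangle[of M "\<lambda>x. f x - g x" "\<lambda>x. g x - h x"] assms by simp

lemma L2_inner_tendsto:
  assumes "\<And>n. square_integrable M (u n)" "square_integrable M v" "square_integrable M g"
    and "(\<lambda>n. L2norm M (\<lambda>x. u n x - v x)) \<longlonglongrightarrow> 0"
  shows "(\<lambda>n. \<integral>x. u n x * g x \<partial>M) \<longlonglongrightarrow> (\<integral>x. v x * g x \<partial>M)"
proof (rule LIM_zero_cancel, rule Lim_null_comparison)
  show "(\<lambda>n. L2norm M (\<lambda>x. u n x - v x) * L2norm M g) \<longlonglongrightarrow> 0"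
    using tendsto_mult_left_zero[OF assms(4)] by simp
  show "\<forall>\<^sub>F n in sequentially. norm ((\<integral>x. u n x * g x \<partial>M) - (\<integral>x. v x * g x \<partial>M))
      \<le> L2norm M (\<lambda>x. u n x - v x) * L2norm M g"
  proof (rule always_eventually, rule allI)
    fix n
    have "(\<integral>x. u n x * g x \<partial>M) - (\<integral>x. v x * g x \<partial>M) = (\<integral>x. (u n x - v x) * g x \<partial>M)"
      using assms by (simp add: left_diff_distrib square_integrable_mult Bochner_Integration.integral_diff)
    then show "norm ((\<integral>x. u n x * g x \<partial>M) - (\<integral>x. v x * g x \<partial>M))
      \<le> L2norm M (\<lambda>x. u n x - v x) * L2norm M g"
      using L2_Cauchy_Schwarz[of M "\<lambda>x. u n x - v x" g] assms by simp
  qed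
qed

lemma L2norm_tendsto:
  assumes "\<And>n. square_integrable M (u n)" "square_integrable M v"
    and "(\<lambda>n. L2norm M (\<lambda>x. u n x - v x)) \<longlonglongrightarrow> 0"
  shows "(\<lambda>n. L2norm M (u n)) \<longlonglongrightarrow> L2norm M v"
proof (rule LIM_zero_cancel, rule Lim_null_comparison[OF _ assms(3)], rule always_eventually, rule allI)
  fix n
  have "L2norm M (u n) \<le> L2norm M (\<lambda>x. u n x - v x) + L2norm M v"
    using L2norm_triangle[of M "\<lambda>x. u n x - v x" v] assms by simp
  moreover have "L2norm M v \<le> L2norm M (\<lambda>x. v x - u n x) + L2norm M (u n)"
    using L2norm_triangle[of M "\<lambda>x. v x - u n x" "u n"] assms by simp
  ultimately show "norm (L2norm M (u n) - L2norm M v) \<le> L2norm M (\<lambda>x. u n x - v x)"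
    by (simp add: L2norm_minus_commute[of M v])
qed

text \<open>The limit is given as a pointwise limit so that it inherits measurability and
  periodicity on the whole space, although \<^term>\<open>M\<close> may only see a subset.\<close>

lemma (in finite_measure) L2_complete:
  fixes u :: "nat \<Rightarrow> 'a \<Rightarrow> real"
  assumes sq: "\<And>n. square_integrable M (u n)"
    and cauchy: "\<And>e. e > 0 \<Longrightarrow> \<exists>N. \<forall>m\<ge>N. \<forall>n\<ge>N. L2norm M (\<lambda>x. u m x - u n x) < e"
  shows "\<exists>r::nat \<Rightarrow> nat. square_integrable M (\<lambda>x. lim (\<lambda>k. u (r k) x)) \<and>
    (\<lambda>n. L2norm M (\<lambda>x. u n x - lim (\<lambda>k. u (r k) x))) \<longlonglongrightarrow> 0"
proof -
  have "\<exists>N. \<forall>k. (\<forall>m\<ge>N k. \<forall>n\<ge>N k. L2norm M (\<lambda>x. u m x - u n x) < (1/2)^k)"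
    using cauchy by (intro choice allI) simp
  then obtain N where N: "\<And>k m n. m \<ge> N k \<Longrightarrow> n \<ge> N k \<Longrightarrow> L2norm M (\<lambda>x. u m x - u n x) < (1/2)^k"
    by blast
  define r where "r k = k + (\<Sum>j\<le>k. N j)" for k
  have rN: "r k \<ge> N k" for k unfolding r_def by (rule trans_le_add2, rule member_le_sum) auto
  have rk: "r k \<ge> k" for k unfolding r_def by simp
  have rmono: "r k \<le> r (Suc k)" for k unfolding r_def by simp
  have mono: "mono r" using rmono by (simp add: mono_iff_le_Suc)
  have [measurable]: "u n \<in> borel_measurable M" for n using sq by (rule square_integrable_measurable)
  define d where "d k x = \<bar>u (r (Suc k)) x - u (r k) x\<bar>" for k x
  have dsq: "square_integrable M (d k)" for k
    unfolding d_def using sq by (intro square_integrable_abs square_integrable_diff)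
  have dint: "(\<integral>x. d k x \<partial>M) \<le> (1/2)^k * L2norm M (\<lambda>_. 1)" for k
  proof -
    have "(\<integral>x. d k x \<partial>M) \<le> L2norm M (d k) * L2norm M (\<lambda>_. 1)"
      using L2_Cauchy_Schwarz[OF dsq square_integrable_const[of 1]] by (simp add: abs_le_iff)
    also have "L2norm M (d k) = L2norm M (\<lambda>x. u (r (Suc k)) x - u (r k) x)"
      by (simp add: L2norm_def d_def)
    also have "\<dots> \<le> (1/2)^k"
      using N[of k "r (Suc k)" "r k"] rN[of k] rmono[of k] by linarith
    finally show ?thesis by (simp add: mult_right_mono)
  qed
  have "(\<integral>\<^sup>+x. (\<Sum>k. ennreal (d k x)) \<partial>M) = (\<Sum>k. \<integral>\<^sup>+x. ennreal (d k x) \<partial>M)"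
    by (rule nn_integral_suminf) (simp add: d_def)
  also have "\<dots> = (\<Sum>k. ennreal (\<integral>x. d k x \<partial>M))"
  proof (intro suminf_cong nn_integral_eq_integral)
    show "integrable M (d k)" for k by (rule square_integrable_integrable[OF dsq])
  qed (simp add: d_def)
  also have "\<dots> \<le> (\<Sum>k. ennreal ((1/2)^k * L2norm M (\<lambda>_. 1)))"
    using dint by (intro suminf_le) (auto intro: ennreal_leI)
  also have "\<dots> < \<infinity>"
  proof -
    have "summable (\<lambda>k. (1/2)^k * L2norm M (\<lambda>_. 1))"
      by (intro summable_mult2 summable_geometric) simp
    then show ?thesis by (subst suminf_ennreal2) auto
  qed
  finally have "(\<integral>\<^sup>+x. (\<Sum>k. ennreal (d k x)) \<partial>M) \<noteq> \<infinity>" by simp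
  then have "AE x in M. (\<Sum>k. ennreal (d k x)) \<noteq> \<infinity>"
    by (intro nn_integral_noteq_infinite) (auto simp: d_def)
  then have conv: "AE x in M. (\<lambda>k. u (r k) x) \<longlonglongrightarrow> lim (\<lambda>k. u (r k) x)"
  proof eventually_elim
    case (elim x)
    then have "summable (\<lambda>k. d k x)"
      by (intro summable_suminf_not_top) (auto simp: d_def)
    then have "summable (\<lambda>k. u (r (Suc k)) x - u (r k) x)"
      unfolding d_def by (rule summable_rabs_cancel)
    then have "convergent (\<lambda>n. \<Sum>k<n. u (r (Suc k)) x - u (r k) x)"
      by (simp add: summable_iff_convergent)
    then have "convergent (\<lambda>n. u (r n) x - u (r 0) x)"
      by (simp add: sum_lessThan_telescope[of "\<lambda>k. u (r k) x"])
    then have "convergent (\<lambda>n. (u (r n) x - u (r 0) x) + u (r 0) x)"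
      by (rule convergent_add) (rule convergent_const)
    then show ?case by (simp add: convergent_LIMSEQ_iff)
  qed
  define v where "v x = lim (\<lambda>k. u (r k) x)" for x
  have [measurable]: "v \<in> borel_measurable M" unfolding v_def by measurable
  have fatou: "(\<integral>\<^sup>+x. ennreal ((u n x - v x)\<^sup>2) \<partial>M) \<le> ennreal (e\<^sup>2)"
    if "e > 0" and n: "\<forall>m\<ge>K. L2norm M (\<lambda>x. u n x - u m x) < e" for n K e
  proof -
    have "(\<integral>\<^sup>+x. ennreal ((u n x - v x)\<^sup>2) \<partial>M) = (\<integral>\<^sup>+x. liminf (\<lambda>k. ennreal ((u n x - u (r (K + k)) x)\<^sup>2)) \<partial>M)"
    proof (rule nn_integral_cong_AE, use conv in eventually_elim)
      case (elim x)
      have "(\<lambda>k. u (r (K + k)) x) \<longlonglongrightarrow> v x"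
        using LIMSEQ_ignore_initial_segment[OF elim, of K] by (simp add: v_def add.commute)
      then have "(\<lambda>k. ennreal ((u n x - u (r (K + k)) x)\<^sup>2)) \<longlonglongrightarrow> ennreal ((u n x - v x)\<^sup>2)"
        by (intro tendsto_intros tendsto_ennrealI)
      from lim_imp_Liminf[OF sequentially_bot this] show ?case by simp
    qed
    also have "\<dots> \<le> liminf (\<lambda>k. \<integral>\<^sup>+x. ennreal ((u n x - u (r (K + k)) x)\<^sup>2) \<partial>M)"
      by (rule nn_integral_liminf) measurable
    also have "\<dots> = liminf (\<lambda>k. ennreal ((L2norm M (\<lambda>x. u n x - u (r (K + k)) x))\<^sup>2))"
      using sq by (simp add: L2norm_power2 nn_integral_eq_integral square_integrable_square square_integrable_diff)
    also have "\<dots> \<le> liminf (\<lambda>k::nat. ennreal (e\<^sup>2))"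
    proof (intro Liminf_mono always_eventually allI ennreal_leI power_mono L2norm_nonneg)
      fix k
      have "r (K + k) \<ge> K" using rk[of "K + k"] by linarith
      then show "L2norm M (\<lambda>x. u n x - u (r (K + k)) x) \<le> e" using n by (intro less_imp_le) auto
    qed
    finally show ?thesis by (simp add: Liminf_const)
  qed
  have vsq: "square_integrable M (\<lambda>x. u n x - v x) \<and> L2norm M (\<lambda>x. u n x - v x) \<le> e"
    if "e > 0" and n: "\<forall>m\<ge>K. L2norm M (\<lambda>x. u n x - u m x) < e" for n K e
  proof
    have i: "integrable M (\<lambda>x. (u n x - v x)\<^sup>2)"
      using fatou[OF that] by (intro integrableI_bounded) (auto intro: le_less_trans)
    then show "square_integrable M (\<lambda>x. u n x - v x)" by (simp add: square_integrable_def)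
    have "ennreal (\<integral>x. (u n x - v x)\<^sup>2 \<partial>M) \<le> ennreal (e\<^sup>2)"
      using fatou[OF that] nn_integral_eq_integral[OF i] by simp
    then have "(\<integral>x. (u n x - v x)\<^sup>2 \<partial>M) \<le> e\<^sup>2" by simp
    then show "L2norm M (\<lambda>x. u n x - v x) \<le> e"
      unfolding L2norm_def using \<open>e > 0\<close> by (intro real_le_lsqrt) auto
  qed
  have "square_integrable M v"
  proof -
    obtain K where "\<forall>m\<ge>K. \<forall>n\<ge>K. L2norm M (\<lambda>x. u m x - u n x) < 1" using cauchy[of 1] by auto
    then have "square_integrable M (\<lambda>x. u K x - v x)" using vsq[of 1 K K] by auto
    from square_integrable_diff[OF sq[of K] this] show ?thesis by simp
  qed
  moreover have "(\<lambda>n. L2norm M (\<lambda>x. u n x - v x)) \<longlonglongrightarrow> 0"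
  proof (rule LIMSEQ_I)
    fix e :: real assume "e > 0"
    then obtain K where "\<forall>m\<ge>K. \<forall>n\<ge>K. L2norm M (\<lambda>x. u m x - u n x) < e/2"
      using cauchy[of "e/2"] by auto
    then have "L2norm M (\<lambda>x. u n x - v x) \<le> e/2" if "n \<ge> K" for n
      using vsq[of "e/2" K n] that \<open>e > 0\<close> by auto
    then show "\<exists>K. \<forall>n\<ge>K. norm (L2norm M (\<lambda>x. u n x - v x) - 0) < e"
      using \<open>e > 0\<close> by (intro exI[of _ K]) fastforce
  qed
  ultimately show ?thesis unfolding v_def by blast
qed

subsection \<open>Translations and integrals over boxes\<close>

lemma distr_lebesgue_shift:
  fixes c :: "'a::euclidean_space"
  shows "distr lebesgue lebesgue (\<lambda>x. x + c) = lebesgue"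
    and lebesgue_measurable_shift [measurable]: "(\<lambda>x. x + c) \<in> lebesgue \<rightarrow>\<^sub>M lebesgue"
proof -
  have eq: "(\<lambda>x. c + (\<Sum>j\<in>Basis. (1 * (x \<bullet> j)) *\<^sub>R j)) = (\<lambda>x. x + c)"
    by (simp add: euclidean_representation add.commute)
  show "distr lebesgue lebesgue (\<lambda>x. x + c) = lebesgue"
    using lebesgue_affine_euclidean[of "\<lambda>_::'a. 1" c] unfolding eq by (simp add: density_1)
  show "(\<lambda>x. x + c) \<in> lebesgue \<rightarrow>\<^sub>M lebesgue"
    using lebesgue_affine_measurable[of "\<lambda>_::'a. 1" c] unfolding eq by simp
qed

lemma lebesgue_integral_shift:
  fixes f :: "'a::euclidean_space \<Rightarrow> 'b::{banach, second_countable_topology}"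
  assumes "f \<in> borel_measurable lebesgue"
  shows "(\<integral>x. f (x + c) \<partial>lebesgue) = (\<integral>x. f x \<partial>lebesgue)"
  using integral_distr[OF lebesgue_measurable_shift[of c] assms] by (simp add: distr_lebesgue_shift)

lemma integrable_lebesgue_shift:
  fixes f :: "'a::euclidean_space \<Rightarrow> 'b::{banach, second_countable_topology}"
  assumes "integrable lebesgue f"
  shows "integrable lebesgue (\<lambda>x. f (x + c))"
  using integrable_distr[OF lebesgue_measurable_shift[of c], of f] assms
  by (simp add: distr_lebesgue_shift)

lemma AE_lebesgue_shift:
  fixes c :: "'a::euclidean_space"
  assumes "AE x in lebesgue. P x"
  shows "AE x in lebesgue. P (x + c)"
  using AE_distrD[OF lebesgue_measurable_shift[of c], of P, unfolded distr_lebesgue_shift, OF assms] .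

lemma L1_locD: "L1_loc f \<Longrightarrow> compact K \<Longrightarrow> integrable lebesgue (\<lambda>x. indicator K x * f x)"
  by (simp add: L1_loc_def set_integrable_def)

lemma L1_loc_measurable:
  assumes "L1_loc f"
  shows "f \<in> borel_measurable lebesgue"
proof (rule borel_measurable_LIMSEQ_metric)
  fix n :: nat
  show "(\<lambda>x. indicator (cball 0 (real n)) x * f x) \<in> borel_measurable lebesgue"
    using L1_locD[OF assms compact_cball] by (rule borel_measurable_integrable)
next
  fix x :: "real^'a"
  obtain N where N: "norm x \<le> real N" using real_arch_simple by blast
  show "(\<lambda>n. indicator (cball 0 (real n)) x * f x) \<longlonglongrightarrow> f x"
    using N by (intro tendsto_eventually eventually_sequentiallyI[of N]) (auto simp: indicator_def)
qed

definition left_open_box :: "real ^ 'n::finite \<Rightarrow> real ^ 'n \<Rightarrow> (real ^ 'n) set" where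
  "left_open_box a b = {x. \<forall>i. a $ i < x $ i \<and> x $ i \<le> b $ i}"

lemma left_open_box_borel [measurable]: "left_open_box a b \<in> sets borel"
proof -
  have "left_open_box a b = (\<Inter>i. {x. x $ i > a $ i} \<inter> {x. x $ i \<le> b $ i})"
    by (auto simp: left_open_box_def)
  moreover have "{x. x $ i > a $ i} \<inter> {x. x $ i \<le> b $ i} \<in> sets borel" for i
    using borel_open[OF open_halfspace_component_gt_cart[of "a $ i" i]]
      borel_closed[OF closed_halfspace_component_le_cart[of i "b $ i"]] by blast
  ultimately show ?thesis by simp
qed

lemma left_open_box_lebesgue [measurable]: "left_open_box a b \<in> sets lebesgue"
  using left_open_box_borel by (simp add: sets_completionI_sets)

lemma left_open_box_subset: "left_open_box a b \<subseteq> cbox a b"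
  by (auto simp: left_open_box_def mem_box_cart less_imp_le)

lemma set_integrable_left_open_box:
  assumes "L1_loc f"
  shows "set_integrable lebesgue (left_open_box a b) f"
proof (rule set_integrable_subset[OF _ left_open_box_lebesgue left_open_box_subset])
  show "set_integrable lebesgue (cbox a b) f" using assms compact_cbox unfolding L1_loc_def by blast
qed

lemma set_integral_borel_eq_0:
  fixes W :: "real ^ 'n::finite \<Rightarrow> real"
  assumes W: "integrable lebesgue W"
    and atMost: "\<And>a. (LINT x:{..a}|lebesgue. W x) = 0"
    and total: "(LINT x|lebesgue. W x) = 0"
    and A: "A \<in> sets borel"
  shows "(LINT x:A|lebesgue. W x) = 0"
proof -
  have leb: "B \<in> sets lebesgue" if "B \<in> sets borel" for B :: "(real^'n) set"
    using that by (simp add: sets_completionI_sets)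
  have si: "set_integrable lebesgue B W" if "B \<in> sets borel" for B
    unfolding set_integrable_def by (rule integrable_mult_indicator[OF leb[OF that] W])
  have A': "A \<in> sigma_sets UNIV (range (\<lambda>a::real^'n. {..a}))"
    using A by (simp add: borel_eq_atMost)
  have sb: "sigma_sets UNIV (range (\<lambda>a::real^'n. {..a})) = sets borel"
    by (simp add: borel_eq_atMost)
  have Int: "Int_stable (range (\<lambda>a::real^'n. {..a}))"
    proof (rule Int_stableI)
      fix a b assume "a \<in> range (\<lambda>a::real^'n. {..a})" "b \<in> range (\<lambda>a::real^'n. {..a})"
      then obtain c d where "a = {..c}" "b = {..d}" by auto
      then have "a \<inter> b = {..inf c d}" by auto
      then show "a \<inter> b \<in> range (\<lambda>a::real^'n. {..a})" by blast
  qed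
  have PowUNIV: "range (\<lambda>a::real^'n. {..a}) \<subseteq> Pow UNIV" by simp
  show ?thesis
  proof (rule sigma_sets_induct_disjoint[OF Int PowUNIV A'])
    fix A assume "A \<in> range (\<lambda>a::real^'n. {..a})"
    then show "(LINT x:A|lebesgue. W x) = 0" using atMost by auto
  next
    show "(LINT x:{}|lebesgue. W x) = 0" by (simp add: set_lebesgue_integral_def)
  next
    fix A assume "A \<in> sigma_sets UNIV (range (\<lambda>a::real^'n. {..a}))"
      and IH: "(LINT x:A|lebesgue. W x) = 0"
    then have A: "A \<in> sets borel" using sb by simp
    have "(LINT x:UNIV - A|lebesgue. W x) = (LINT x|lebesgue. W x - indicator A x *\<^sub>R W x)"
      unfolding set_lebesgue_integral_def by (intro Bochner_Integration.integral_cong) (auto simp: indicator_def)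
    also have "\<dots> = (LINT x|lebesgue. W x) - (LINT x:A|lebesgue. W x)"
      unfolding set_lebesgue_integral_def
      using W si[OF A] by (intro Bochner_Integration.integral_diff) (auto simp: set_integrable_def)
    finally show "(LINT x:UNIV - A|lebesgue. W x) = 0" using IH total by simp
  next
    fix A :: "nat \<Rightarrow> (real^'n) set"
    assume dis: "disjoint_family A" and rng: "range A \<subseteq> sigma_sets UNIV (range (\<lambda>a::real^'n. {..a}))"
      and IH: "\<And>i. (LINT x:A i|lebesgue. W x) = 0"
    have A: "A i \<in> sets borel" for i using sb rng by auto
    have "(LINT x:(\<Union>i. A i)|lebesgue. W x) = (\<Sum>i. LINT x:A i|lebesgue. W x)"
    proof (rule lebesgue_integral_countable_add)
      show "A i \<in> sets lebesgue" for i by (rule leb[OF A])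
      show "A i \<inter> A j = {}" if "i \<noteq> j" for i j using dis that by (auto simp: disjoint_family_on_def)
      show "set_integrable lebesgue (\<Union>i. A i) W" using A by (intro si) auto
    qed
    then show "(LINT x:\<Union>(range A)|lebesgue. W x) = 0" using IH by simp
  qed
qed

lemma AE_eq_0_if_set_integral_borel:
  fixes W :: "real ^ 'n::finite \<Rightarrow> real"
  assumes W: "integrable lebesgue W"
    and borel: "\<And>A. A \<in> sets borel \<Longrightarrow> (LINT x:A|lebesgue. W x) = 0"
  shows "AE x in lebesgue. W x = 0"
proof (rule density_unique_real[of lebesgue W "\<lambda>_. 0"])
  fix A assume A: "A \<in> sets (lebesgue :: (real^'n) measure)"
  then obtain S N N' where S: "A = S \<union> N" "N \<subseteq> N'" "N' \<in> null_sets lborel" "S \<in> sets lborel"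
    by (rule sets_completionE)
  then have "AE x in lebesgue. x \<notin> N'"
    by (intro AE_not_in null_sets_completionI)
  then have ae: "AE x in lebesgue. indicator A x *\<^sub>R W x = indicator S x *\<^sub>R W x"
  proof eventually_elim
    case (elim x)
    then have "x \<in> A \<longleftrightarrow> x \<in> S" using S by auto
    then show ?case by (simp add: indicator_def)
  qed
  have S': "S \<in> sets lebesgue" using S by (simp add: sets_completionI_sets)
  have "(LINT x:A|lebesgue. W x) = (LINT x:S|lebesgue. W x)"
    unfolding set_lebesgue_integral_def
  proof (rule integral_cong_AE[OF _ _ ae])
    show "(\<lambda>x. indicator A x *\<^sub>R W x) \<in> borel_measurable lebesgue"
      using integrable_mult_indicator[OF A W] by (rule borel_measurable_integrable)
    show "(\<lambda>x. indicator S x *\<^sub>R W x) \<in> borel_measurable lebesgue"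
      using integrable_mult_indicator[OF S' W] by (rule borel_measurable_integrable)
  qed
  then show "(LINT x:A|lebesgue. W x) = (LINT x:A|lebesgue. 0)"
    using borel[of S] S by (simp add: set_lebesgue_integral_def)
qed (use W in auto)

lemma AE_eq_0_if_left_open_boxes:
  fixes w :: "real ^ 'n::finite \<Rightarrow> real"
  assumes w: "\<And>a b. set_integrable lebesgue (left_open_box a b) w"
    and box: "\<And>a b. (\<And>i. a $ i \<le> b $ i) \<Longrightarrow> (LINT x:left_open_box a b|lebesgue. w x) = 0"
  shows "AE x in lebesgue. w x = 0"
proof -
  define c :: "nat \<Rightarrow> real^'n" where "c n = (\<chi> i. real n)" for n
  define B where "B n = left_open_box (- c n) (c n)" for n
  have "AE x in lebesgue. indicator (B n) x * w x = 0" for n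
  proof (rule AE_eq_0_if_set_integral_borel)
    show W: "integrable lebesgue (\<lambda>x. indicator (B n) x * w x)"
      using w[of "- c n" "c n"] by (simp add: set_integrable_def B_def)
    fix A :: "(real^'n) set" assume A: "A \<in> sets borel"
    show "(LINT x:A|lebesgue. indicator (B n) x * w x) = 0"
    proof (rule set_integral_borel_eq_0[OF W _ _ A])
      show "(LINT x|lebesgue. indicator (B n) x * w x) = 0"
        using box[of "- c n" "c n"] by (simp add: set_lebesgue_integral_def B_def c_def)
      fix a :: "real^'n"
      show "(LINT x:{..a}|lebesgue. indicator (B n) x * w x) = 0"
      proof (cases "\<forall>i. - real n \<le> a $ i")
        case True
        have "left_open_box (- c n) (inf a (c n)) = {..a} \<inter> B n"
          by (auto simp: left_open_box_def B_def less_eq_vec_def inf_vec_def c_def)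
        moreover have "(LINT x:left_open_box (- c n) (inf a (c n))|lebesgue. w x) = 0"
          using True by (intro box) (auto simp: c_def inf_vec_def)
        ultimately show ?thesis
          by (simp add: set_lebesgue_integral_def indicator_inter_arith mult.assoc)
      next
        case False
        then obtain i where "a $ i < - real n" by (auto simp: not_le)
        then have "x \<notin> {..a} \<inter> B n" for x
          by (simp add: B_def left_open_box_def less_eq_vec_def c_def)
             (metis less_le_trans not_less order_less_trans)
        then have eq: "(\<lambda>x. indicator {..a} x *\<^sub>R (indicator (B n) x * w x)) = (\<lambda>x. 0)"
          by (auto simp: indicator_def fun_eq_iff)
        show ?thesis unfolding set_lebesgue_integral_def eq by simp
      qed
    qed
  qed
  then have "AE x in lebesgue. \<forall>n. indicator (B n) x * w x = 0" by (subst AE_all_countable) blast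
  then show ?thesis
  proof eventually_elim
    case (elim x)
    obtain n where n: "real n > norm x" using reals_Archimedean2 by blast
    have "\<bar>x $ i\<bar> < real n" for i using component_le_norm_cart[of x i] n by linarith
    then have "- real n < x $ i \<and> x $ i \<le> real n" for i by (simp add: abs_less_iff less_imp_le minus_less_iff)
    then have "x \<in> B n" by (simp add: B_def left_open_box_def c_def)
    then have "indicator (B n) x = (1::real)" by simp
    then show ?case using elim[rule_format, of n] by simp
  qed
qed

subsection \<open>Smooth functions of one variable\<close>

primrec Ck :: "nat \<Rightarrow> (real \<Rightarrow> real) \<Rightarrow> bool" where
  "Ck 0 f \<longleftrightarrow> continuous_on UNIV f"
| "Ck (Suc k) f \<longleftrightarrow> (\<forall>x. (f has_real_derivative deriv f x) (at x)) \<and> Ck k (deriv f)"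

definition smooth :: "(real \<Rightarrow> real) \<Rightarrow> bool" where
  "smooth f \<longleftrightarrow> (\<forall>k. Ck k f)"

lemma Ck_SucI:
  assumes "\<And>x. (f has_real_derivative f' x) (at x)" "Ck k f'"
  shows "Ck (Suc k) f"
proof -
  have "deriv f = f'" using assms(1) by (auto intro: DERIV_imp_deriv)
  then show ?thesis using assms by simp
qed

lemma Ck_SucD: "Ck (Suc k) f \<Longrightarrow> Ck k f"
proof (induction k arbitrary: f)
  case 0
  then show ?case by (auto intro!: DERIV_continuous_on intro: DERIV_subset)
next
  case (Suc k)
  then show ?case by simp
qed

lemma Ck_const: "Ck k (\<lambda>x. c)"
proof (induction k arbitrary: c)
  case (Suc k)
  show ?case by (rule Ck_SucI[OF _ Suc[of 0]]) auto
qed simp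

lemma Ck_add: "Ck k f \<Longrightarrow> Ck k g \<Longrightarrow> Ck k (\<lambda>x. f x + g x)"
proof (induction k arbitrary: f g)
  case 0 then show ?case by (auto intro: continuous_on_add)
next
  case (Suc k)
  have "((\<lambda>x. f x + g x) has_real_derivative deriv f x + deriv g x) (at x)" for x
    using Suc.prems by (intro DERIV_add) auto
  then show ?case using Suc.IH[of "deriv f" "deriv g"] Suc.prems by (intro Ck_SucI) auto
qed

lemma Ck_mult: "Ck k f \<Longrightarrow> Ck k g \<Longrightarrow> Ck k (\<lambda>x. f x * g x)"
proof (induction k arbitrary: f g)
  case 0 then show ?case by (auto intro: continuous_on_mult)
next
  case (Suc k)
  have "((\<lambda>x. f x * g x) has_real_derivative deriv f x * g x + deriv g x * f x) (at x)" for x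
    using Suc.prems by (intro DERIV_mult) auto
  moreover have "Ck k (\<lambda>x. deriv f x * g x + deriv g x * f x)"
    using Suc.prems Ck_SucD[OF Suc.prems(1)] Ck_SucD[OF Suc.prems(2)] by (intro Ck_add Suc.IH) auto
  ultimately show ?case by (rule Ck_SucI)
qed

lemma Ck_diff: "Ck k f \<Longrightarrow> Ck k g \<Longrightarrow> Ck k (\<lambda>x. f x - g x)"
  using Ck_add[of k f "\<lambda>x. (-1) * g x"] Ck_mult[of k "\<lambda>x. -1" g] Ck_const[of k "-1"] by simp

lemma Ck_inverse:
  assumes nz: "\<And>x. g x \<noteq> 0"
  shows "Ck k g \<Longrightarrow> Ck k (\<lambda>x. inverse (g x))"
proof (induction k)
  case 0 then show ?case using nz by (auto intro: continuous_on_inverse)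
next
  case (Suc k)
  have "((\<lambda>x. inverse (g x)) has_real_derivative (-1) * (deriv g x * (inverse (g x) * inverse (g x)))) (at x)" for x
    using DERIV_inverse_fun[of g "deriv g x" x UNIV] Suc.prems nz by (simp add: power2_eq_square)
  moreover have "Ck k (\<lambda>x. (-1) * (deriv g x * (inverse (g x) * inverse (g x))))"
    using Suc.prems Ck_SucD[OF Suc.prems] Suc.IH by (intro Ck_mult Ck_const) auto
  ultimately show ?case by (rule Ck_SucI)
qed

lemma Ck_affine: "Ck k f \<Longrightarrow> Ck k (\<lambda>x. f (a * x + b))"
proof (induction k arbitrary: f)
  case 0
  then show ?case by (auto intro!: continuous_intros continuous_on_compose2[of UNIV f])
next
  case (Suc k)
  have "((\<lambda>x. f (a * x + b)) has_real_derivative deriv f (a * x + b) * a) (at x)" for x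
  proof (rule DERIV_chain2[of f])
    show "(f has_real_derivative deriv f (a * x + b)) (at (a * x + b))" using Suc.prems by simp
    show "((\<lambda>x. a * x + b) has_real_derivative a) (at x)" by (auto intro!: derivative_eq_intros)
  qed
  moreover have "Ck k (\<lambda>x. deriv f (a * x + b) * a)"
    using Suc by (intro Ck_mult Ck_const) auto
  ultimately show ?case by (rule Ck_SucI)
qed

lemma smooth_const [simp]: "smooth (\<lambda>x. c)"
  by (simp add: smooth_def Ck_const)
lemma smooth_add: "smooth f \<Longrightarrow> smooth g \<Longrightarrow> smooth (\<lambda>x. f x + g x)"
  by (simp add: smooth_def Ck_add)
lemma smooth_diff: "smooth f \<Longrightarrow> smooth g \<Longrightarrow> smooth (\<lambda>x. f x - g x)"
  by (simp add: smooth_def Ck_diff)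
lemma smooth_mult: "smooth f \<Longrightarrow> smooth g \<Longrightarrow> smooth (\<lambda>x. f x * g x)"
  by (simp add: smooth_def Ck_mult)
lemma smooth_affine: "smooth f \<Longrightarrow> smooth (\<lambda>x. f (a * x + b))"
  by (simp add: smooth_def Ck_affine)
lemma smooth_DERIV: "smooth f \<Longrightarrow> (f has_real_derivative deriv f x) (at x)"
  unfolding smooth_def using Ck.simps(2) by blast
lemma smooth_deriv: "smooth f \<Longrightarrow> smooth (deriv f)"
  unfolding smooth_def using Ck.simps(2) by blast
lemma smooth_continuous: "smooth f \<Longrightarrow> continuous_on UNIV f"
  unfolding smooth_def using Ck.simps(1) by blast

definition flat :: "real poly \<Rightarrow> real \<Rightarrow> real" where
  "flat p t = (if t > 0 then poly p (1 / t) * exp (- (1 / t)) else 0)"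

lemma poly_mult_exp_tendsto_0: "((\<lambda>y. poly p y * exp (- y)) \<longlongrightarrow> (0::real)) at_top"
proof -
  have "((\<lambda>y. \<Sum>i\<le>degree p. coeff p i * (y ^ i / exp y)) \<longlongrightarrow> (\<Sum>i\<le>degree p. coeff p i * 0)) at_top"
    by (intro tendsto_sum tendsto_mult tendsto_const tendsto_power_div_exp_0)
  moreover have "poly p y * exp (- y) = (\<Sum>i\<le>degree p. coeff p i * (y ^ i / exp y))" for y :: real
    by (simp add: poly_altdef sum_distrib_right exp_minus divide_inverse mult.assoc)
  ultimately show ?thesis by simp
qed

lemma flat_DERIV: "(flat p has_real_derivative flat ([:0,0,1:] * (p - pderiv p)) t) (at t)"
proof -
  consider "t > 0" | "t < 0" | "t = 0" by linarith
  then show ?thesis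
  proof cases
    case 1
    have "((\<lambda>s. poly p (1 / s) * exp (- (1 / s))) has_real_derivative
        poly ([:0,0,1:] * (p - pderiv p)) (1 / t) * exp (- (1 / t))) (at t)"
      using 1 by (auto intro!: derivative_eq_intros simp: power2_eq_square field_simps)
    then have "(flat p has_real_derivative poly ([:0,0,1:] * (p - pderiv p)) (1 / t) * exp (- (1 / t))) (at t)"
      by (rule has_field_derivative_transform_within_open[of _ _ _ "{0<..}"]) (use 1 in \<open>auto simp: flat_def\<close>)
    then show ?thesis using 1 by (simp add: flat_def)
  next
    case 2
    have "(flat p has_real_derivative 0) (at t)"
      by (rule has_field_derivative_transform_within_open[of "\<lambda>_. 0" _ _ "{..<0}"]) (use 2 in \<open>auto simp: flat_def\<close>)
    then show ?thesis using 2 by (simp add: flat_def)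
  next
    case 3
    have "((\<lambda>h. flat p h / h) \<longlongrightarrow> 0) (at_left 0)"
      by (rule tendsto_eventually) (auto simp: flat_def eventually_at_filter)
    moreover have "((\<lambda>h. flat p h / h) \<longlongrightarrow> 0) (at_right 0)"
    proof (rule Lim_transform_eventually)
      show "((\<lambda>h. poly (pCons 0 p) (inverse h) * exp (- inverse h)) \<longlongrightarrow> 0) (at_right 0)"
        using filterlim_compose[OF poly_mult_exp_tendsto_0 filterlim_inverse_at_top_right] .
      show "\<forall>\<^sub>F h in at_right 0. poly (pCons 0 p) (inverse h) * exp (- inverse h) = flat p h / h"
        by (auto simp: flat_def field_simps eventually_at_filter)
    qed
    ultimately have "((\<lambda>h. flat p h / h) \<longlongrightarrow> 0) (at 0)" by (rule filterlim_split_at)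
    then show ?thesis using 3 by (simp add: has_field_derivative_iff flat_def)
  qed
qed

lemma smooth_flat: "smooth (flat p)"
proof -
  have "Ck k (flat p)" for k
  proof (induction k arbitrary: p)
    case 0
    show ?case using DERIV_continuous_on[OF flat_DERIV] by simp
  next
    case (Suc k)
    show ?case using flat_DERIV Suc by (rule Ck_SucI)
  qed
  then show ?thesis by (simp add: smooth_def)
qed

definition smooth_step :: "real \<Rightarrow> real" where
  "smooth_step t = flat 1 t * inverse (flat 1 t + flat 1 (1 - t))"

lemma smooth_step_denominator: "flat 1 t + flat 1 (1 - t) > 0"
  by (auto simp: flat_def intro: add_pos_pos)

lemma smooth_step_props:
  shows "t \<le> 0 \<Longrightarrow> smooth_step t = 0" "t \<ge> 1 \<Longrightarrow> smooth_step t = 1"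
    and "0 \<le> smooth_step t" "smooth_step t \<le> 1"
proof -
  have n: "flat 1 s \<ge> 0" for s by (simp add: flat_def)
  note p = smooth_step_denominator[of t]
  show "t \<le> 0 \<Longrightarrow> smooth_step t = 0" by (simp add: smooth_step_def flat_def)
  show "t \<ge> 1 \<Longrightarrow> smooth_step t = 1" by (simp add: smooth_step_def flat_def)
  show "0 \<le> smooth_step t" "smooth_step t \<le> 1"
    using n[of t] n[of "1 - t"] p by (auto simp: smooth_step_def field_simps)
qed

lemma smooth_smooth_step: "smooth smooth_step"
proof -
  have p: "flat 1 t + flat 1 (1 - t) \<noteq> 0" for t
    using smooth_step_denominator[of t] by simp
  have "smooth (\<lambda>t. flat 1 (1 - t))" using smooth_affine[OF smooth_flat, of 1 "-1" 1] by simp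
  then have "smooth (\<lambda>t. flat 1 t + flat 1 (1 - t))" by (intro smooth_add smooth_flat)
  then have "smooth (\<lambda>t. inverse (flat 1 t + flat 1 (1 - t)))"
    using Ck_inverse[of "\<lambda>t. flat 1 t + flat 1 (1 - t)"] p by (simp add: smooth_def)
  then have "smooth (\<lambda>t. flat 1 t * inverse (flat 1 t + flat 1 (1 - t)))"
    by (intro smooth_mult smooth_flat)
  then show ?thesis by (simp add: smooth_step_def[abs_def])
qed

definition smooth_cut :: "nat \<Rightarrow> real \<Rightarrow> real \<Rightarrow> real \<Rightarrow> real" where
  "smooth_cut N a b t = smooth_step (real (Suc N) * (t - a)) - smooth_step (real (Suc N) * (t - b))"

lemma smooth_smooth_cut: "smooth (smooth_cut N a b)"
proof -
  have "smooth (\<lambda>t. smooth_step (real (Suc N) * t + - real (Suc N) * a) - smooth_step (real (Suc N) * t + - real (Suc N) * b))"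
    by (intro smooth_diff smooth_affine smooth_smooth_step)
  moreover have "(\<lambda>t. smooth_step (real (Suc N) * t + - real (Suc N) * a) - smooth_step (real (Suc N) * t + - real (Suc N) * b)) = smooth_cut N a b"
    by (auto simp: smooth_cut_def right_diff_distrib fun_eq_iff simp del: of_nat_Suc)
  ultimately show ?thesis by simp
qed

lemma smooth_cut_bound: "\<bar>smooth_cut N a b t\<bar> \<le> 1"
  using smooth_step_props(3,4)[of "real (Suc N) * (t - a)"] smooth_step_props(3,4)[of "real (Suc N) * (t - b)"]
  by (simp only: smooth_cut_def abs_le_iff) linarith

lemma smooth_cut_eq_0:
  assumes "a \<le> b" "t \<notin> {a..b + 1}"
  shows "smooth_cut N a b t = 0"
proof (cases "t < a")
  case True
  then have "real (Suc N) * (t - a) \<le> 0" "real (Suc N) * (t - b) \<le> 0"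
    using assms by (auto intro!: mult_nonneg_nonpos simp del: of_nat_Suc)
  then show ?thesis by (simp only: smooth_cut_def smooth_step_props(1))
next
  case False
  then have "t - b \<ge> 1" "t - a \<ge> 1" using assms by auto
  then have "real (Suc N) * (t - a) \<ge> 1" "real (Suc N) * (t - b) \<ge> 1"
    using mult_mono[of 1 "real (Suc N)" 1 "t - a"] mult_mono[of 1 "real (Suc N)" 1 "t - b"] by auto
  then show ?thesis by (simp only: smooth_cut_def smooth_step_props(2))
qed

lemma smooth_step_scale_tendsto:
  "(\<lambda>N. smooth_step (real (Suc N) * t)) \<longlonglongrightarrow> (if t > 0 then 1 else 0)"
proof (cases "t > 0")
  case True
  obtain M where M: "1 / t < real M" using reals_Archimedean2 by blast
  have "smooth_step (real (Suc N) * t) = 1" if "N \<ge> M" for N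
  proof -
    have "1 / t \<le> real (Suc N)" using M that by simp
    then have "1 \<le> real (Suc N) * t" using True by (simp only: divide_le_eq if_True)
    then show ?thesis by (rule smooth_step_props(2))
  qed
  then show ?thesis using True by (intro tendsto_eventually eventually_sequentiallyI[of M]) auto
next
  case False
  then have "real (Suc N) * t \<le> 0" for N by (intro mult_nonneg_nonpos) auto
  then show ?thesis using False smooth_step_props(1) by simp
qed

lemma smooth_cut_tendsto:
  assumes "a \<le> b"
  shows "(\<lambda>N. smooth_cut N a b t) \<longlonglongrightarrow> indicator {a<..b} t"
proof -
  have "(\<lambda>N. smooth_cut N a b t) \<longlonglongrightarrow> (if t - a > 0 then 1 else 0) - (if t - b > 0 then 1 else 0)"
    unfolding smooth_cut_def by (intro tendsto_diff smooth_step_scale_tendsto)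
  moreover have "(if t - a > 0 then 1 else 0) - (if t - b > 0 then 1 else 0) = (indicator {a<..b} t :: real)"
    using assms by (auto simp: indicator_def)
  ultimately show ?thesis by simp
qed

subsection \<open>Tensor products\<close>

definition tensor :: "('n::finite \<Rightarrow> real \<Rightarrow> real) \<Rightarrow> real ^ 'n \<Rightarrow> real" where
  "tensor F x = (\<Prod>j\<in>UNIV. F j (x $ j))"

lemma tensor_mult: "tensor F x * tensor G x = tensor (\<lambda>j t. F j t * G j t) x"
  by (simp add: tensor_def prod.distrib)

lemma tensor_upd: "tensor (F(i := f)) x = f (x $ i) * (\<Prod>j\<in>UNIV - {i}. F j (x $ j))"
proof -
  have "tensor (F(i := f)) x = (F(i := f)) i (x $ i) * (\<Prod>j\<in>UNIV - {i}. (F(i := f)) j (x $ j))"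
    unfolding tensor_def by (rule prod.remove) auto
  also have "(\<Prod>j\<in>UNIV - {i}. (F(i := f)) j (x $ j)) = (\<Prod>j\<in>UNIV - {i}. F j (x $ j))"
    by (rule prod.cong) auto
  finally show ?thesis by (simp only: fun_upd_same)
qed

lemma tensor_remove: "tensor F x = F i (x $ i) * (\<Prod>j\<in>UNIV - {i}. F j (x $ j))"
  using tensor_upd[of F i "F i" x] by simp

lemma tensor_continuous:
  assumes "\<And>j. continuous_on UNIV (F j)"
  shows "continuous_on S (tensor F)"
  unfolding tensor_def[abs_def]
  by (intro continuous_on_prod continuous_on_compose2[OF assms] continuous_on_component continuous_on_id) auto

lemma tensor_shift:
  "tensor F (x + c *\<^sub>R axis i 1) = tensor (F(i := \<lambda>t. F i (t + c))) x"
  unfolding tensor_upd tensor_remove[of F _ i]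
  by (auto simp: axis_def intro!: arg_cong2[where f="(*)"] prod.cong)

lemma tensor_has_derivative:
  assumes "\<And>j t. (F j has_real_derivative F' j t) (at t)"
  shows "(tensor F has_derivative (\<lambda>v. \<Sum>j\<in>UNIV. F' j (x $ j) * v $ j * (\<Prod>k\<in>UNIV - {j}. F k (x $ k)))) (at x)"
proof -
  have "((\<lambda>x. F j (x $ j)) has_derivative (\<lambda>v. F' j (x $ j) * v $ j)) (at x)" for j
    using has_derivative_compose[OF bounded_linear_imp_has_derivative[OF bounded_linear_vec_nth[of j]],
        of "F j" "\<lambda>y. F' j (x $ j) * y" x UNIV] assms[of j "x $ j"]
    by (simp add: has_field_derivative_def)
  then show ?thesis unfolding tensor_def[abs_def] by (intro has_derivative_prod)
qed

lemma partial_deriv_tensor: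
  assumes "\<And>j. smooth (F j)"
  shows "tensor F differentiable (at x)" "partial_deriv i (tensor F) = tensor (F(i := deriv (F i)))"
proof -
  note d = tensor_has_derivative[of F "\<lambda>j. deriv (F j)", OF smooth_DERIV[OF assms]]
  show "tensor F differentiable (at x)" using d by (auto simp: differentiable_def)
  show "partial_deriv i (tensor F) = tensor (F(i := deriv (F i)))"
  proof
    fix x
    have "partial_deriv i (tensor F) x = (\<Sum>j\<in>UNIV. if j = i then deriv (F j) (x $ j) * (\<Prod>k\<in>UNIV - {j}. F k (x $ k)) else 0)"
      unfolding partial_deriv_def frechet_derivative_at[OF d, symmetric]
      by (intro sum.cong) (auto simp: axis_def)
    then show "partial_deriv i (tensor F) x = tensor (F(i := deriv (F i))) x"
      by (simp add: tensor_upd)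
  qed
qed

lemma C_class_tensor: "(\<And>j. smooth (F j)) \<Longrightarrow> C_class k (tensor F)"
proof (induction k arbitrary: F)
  case 0
  then show ?case by (simp add: tensor_continuous smooth_continuous)
next
  case (Suc k)
  have "C_class k (tensor (F(i := deriv (F i))))" for i
    by (rule Suc.IH) (auto simp: Suc.prems smooth_deriv)
  then show ?case using partial_deriv_tensor[of F, OF Suc.prems] by simp
qed

lemma tensor_eq_0:
  assumes "\<And>j t. t \<notin> {a $ j..b $ j} \<Longrightarrow> F j t = 0" "x \<notin> cbox a b"
  shows "tensor F x = 0"
proof -
  obtain j where "x $ j \<notin> {a $ j..b $ j}" using assms(2) by (auto simp: mem_box_cart)
  then show ?thesis unfolding tensor_def using assms(1) by (intro prod_zero) auto
qed

lemma test_fun_tensor: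
  assumes "\<And>j. smooth (F j)" "\<And>j t. t \<notin> {a $ j..b $ j} \<Longrightarrow> F j t = 0"
  shows "test_fun (tensor F)"
  unfolding test_fun_def
proof
  show "\<forall>k. C_class k (tensor F)" using C_class_tensor[of F, OF assms(1)] by simp
  have "{x. tensor F x \<noteq> 0} \<subseteq> cbox a b" using tensor_eq_0[of a b F, OF assms(2)] by blast
  then have "closure {x. tensor F x \<noteq> 0} \<subseteq> cbox a b" by (rule closure_minimal) (rule closed_cbox)
  then show "compact (closure {x. tensor F x \<noteq> 0})"
    using compact_cbox closed_closure by (metis compact_Int_closed inf.absorb_iff2)
qed

lemma continuous_lebesgue_measurable:
  fixes f :: "real ^ 'n::finite \<Rightarrow> real"
  shows "continuous_on UNIV f \<Longrightarrow> f \<in> borel_measurable lebesgue"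
  using continuous_imp_measurable_on_sets_lebesgue[of UNIV f] by simp

lemma smooth_cut_tensor_tendsto:
  assumes f: "L1_loc f" and ab: "\<And>j. a $ j \<le> b $ j"
  shows "(\<lambda>N. LINT x|lebesgue. f x * tensor (\<lambda>j. smooth_cut N (a $ j) (b $ j)) x)
    \<longlonglongrightarrow> (LINT x:left_open_box a b|lebesgue. f x)"
  unfolding set_lebesgue_integral_def
proof (rule integral_dominated_convergence)
  let ?h = "\<lambda>N. tensor (\<lambda>j. smooth_cut N (a $ j) (b $ j))"
  let ?K = "cbox a (b + 1)"
  have m: "f \<in> borel_measurable lebesgue" by (rule L1_loc_measurable[OF f])
  show "integrable lebesgue (\<lambda>x. norm (indicator ?K x * f x))"
    using L1_locD[OF f compact_cbox] by (rule integrable_norm)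
  show "(\<lambda>x. indicator (left_open_box a b) x *\<^sub>R f x) \<in> borel_measurable lebesgue"
    using m by measurable
  show "(\<lambda>x. f x * ?h N x) \<in> borel_measurable lebesgue" for N
    by (rule borel_measurable_times[OF m])
      (intro continuous_lebesgue_measurable tensor_continuous smooth_continuous smooth_smooth_cut)
  have "?h N x = 0" if "x \<notin> ?K" for N x
    using that ab by (intro tensor_eq_0[of a "b + 1"]) (auto intro!: smooth_cut_eq_0)
  moreover have "\<bar>?h N x\<bar> \<le> 1" for N x
    unfolding tensor_def abs_prod by (rule prod_le_1) (auto simp: smooth_cut_bound)
  ultimately show "AE x in lebesgue. norm (f x * ?h N x) \<le> norm (indicator ?K x * f x)" for N
    by (intro AE_I2) (auto simp: indicator_def abs_mult mult_left_le)
  have "(\<lambda>N. ?h N x) \<longlonglongrightarrow> (\<Prod>j\<in>UNIV. indicator {a $ j<..b $ j} (x $ j))" for x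
    unfolding tensor_def using ab by (intro tendsto_prod smooth_cut_tendsto)
  moreover have "(\<Prod>j\<in>UNIV. indicator {a $ j<..b $ j} (x $ j)) = (indicator (left_open_box a b) x :: real)" for x
    by (auto simp: indicator_def left_open_box_def prod_zero_iff)
  ultimately show "AE x in lebesgue. (\<lambda>N. f x * ?h N x) \<longlonglongrightarrow> indicator (left_open_box a b) x *\<^sub>R f x"
    by (intro AE_I2) (simp add: mult.commute[of "indicator _ _"] tendsto_mult_left)
qed

lemma AE_eq_0_if_test_fun:
  assumes f: "L1_loc f" and 0: "\<And>\<phi>. test_fun \<phi> \<Longrightarrow> (LINT x|lebesgue. f x * \<phi> x) = 0"
  shows "AE x in lebesgue. f x = 0"
proof (rule AE_eq_0_if_left_open_boxes)
  show "set_integrable lebesgue (left_open_box a b) f" for a b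
    by (rule set_integrable_left_open_box[OF f])
  fix a b :: "real^'a" assume ab: "\<And>i. a $ i \<le> b $ i"
  have "test_fun (tensor (\<lambda>j. smooth_cut N (a $ j) (b $ j)))" for N
    using ab by (intro test_fun_tensor[of _ a "b + 1"] smooth_smooth_cut smooth_cut_eq_0) auto
  then have "(LINT x|lebesgue. f x * tensor (\<lambda>j. smooth_cut N (a $ j) (b $ j)) x) = 0" for N by (rule 0)
  then show "(LINT x:left_open_box a b|lebesgue. f x) = 0"
    using smooth_cut_tensor_tendsto[OF f ab] by (simp add: LIMSEQ_const_iff)
qed

subsection \<open>Weak derivatives\<close>

lemma L1_loc_mult_continuous:
  assumes "L1_loc f" "continuous_on UNIV h"
  shows "L1_loc (\<lambda>x. f x * h x)"
  unfolding L1_loc_def set_integrable_def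
proof (intro allI impI)
  fix K :: "(real^'a) set" assume K: "compact K"
  then have "bounded (h ` K)"
    using compact_continuous_image[OF continuous_on_subset[OF assms(2)] K] compact_imp_bounded by auto
  then obtain C where C: "\<And>x. x \<in> K \<Longrightarrow> \<bar>h x\<bar> \<le> C" unfolding bounded_iff by auto
  show "integrable lebesgue (\<lambda>x. indicator K x *\<^sub>R (f x * h x))"
  proof (rule Bochner_Integration.integrable_bound)
    show "integrable lebesgue (\<lambda>x. C * (indicator K x * f x))" using L1_locD[OF assms(1) K] by simp
    show "(\<lambda>x. indicator K x *\<^sub>R (f x * h x)) \<in> borel_measurable lebesgue"
      using L1_loc_measurable[OF assms(1)] continuous_lebesgue_measurable[OF assms(2)] lmeasurable_compact[OF K]
      by (intro borel_measurable_scaleR borel_measurable_indicator borel_measurable_times) auto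
    show "AE x in lebesgue. norm (indicator K x *\<^sub>R (f x * h x)) \<le> norm (C * (indicator K x * f x))"
    proof (rule AE_I2)
      fix x
      show "norm (indicator K x *\<^sub>R (f x * h x)) \<le> norm (C * (indicator K x * f x))"
      proof (cases "x \<in> K")
        case True
        then show ?thesis
          using mult_right_mono[OF order.trans[OF C[OF True] abs_ge_self] abs_ge_zero[of "f x"]]
          by (simp add: abs_mult mult.commute)
      qed simp
    qed
  qed
qed

lemma L1_loc_add: "L1_loc f \<Longrightarrow> L1_loc g \<Longrightarrow> L1_loc (\<lambda>x. f x + g x)"
  unfolding L1_loc_def using set_integral_add(1) by blast

lemma L1_loc_diff: "L1_loc f \<Longrightarrow> L1_loc g \<Longrightarrow> L1_loc (\<lambda>x. f x - g x)"
  unfolding L1_loc_def using set_integral_diff(1) by blast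

lemma L1_loc_const: "L1_loc (\<lambda>x. c)"
  unfolding L1_loc_def set_integrable_def
proof (intro allI impI)
  fix K :: "(real^'a) set" assume "compact K"
  then have "integrable lebesgue (indicator K :: _ \<Rightarrow> real)"
    using lmeasurable_compact lmeasurable_iff_integrable by blast
  then show "integrable lebesgue (\<lambda>x. indicator K x *\<^sub>R c)" by simp
qed

lemma L1_loc_continuous: "continuous_on UNIV h \<Longrightarrow> L1_loc h"
  using L1_loc_mult_continuous[OF L1_loc_const[of 1]] by simp

lemma integrable_L1_loc_mult_continuous:
  assumes "L1_loc f" "continuous_on UNIV h" "compact K" "\<And>x. x \<notin> K \<Longrightarrow> h x = 0"
  shows "integrable lebesgue (\<lambda>x. f x * h x)"
proof -
  have "(\<lambda>x. indicator K x * (f x * h x)) = (\<lambda>x. f x * h x)"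
    using assms(4) by (fastforce simp: indicator_def fun_eq_iff)
  then show ?thesis using L1_locD[OF L1_loc_mult_continuous[OF assms(1,2)] assms(3)] by simp
qed

lemma weak_partial_unique:
  assumes "has_weak_partial i u g" "has_weak_partial i v h" "AE x in lebesgue. u x = v x"
  shows "AE x in lebesgue. g x = h x"
proof -
  have L: "L1_loc u" "L1_loc g" "L1_loc v" "L1_loc h" using assms by (auto simp: has_weak_partial_def)
  have "AE x in lebesgue. g x - h x = 0"
  proof (rule AE_eq_0_if_test_fun[OF L1_loc_diff[OF L(2,4)]])
    fix \<phi> :: "real^'a \<Rightarrow> real" assume t: "test_fun \<phi>"
    then have c: "continuous_on UNIV \<phi>" and K: "compact (closure {x. \<phi> x \<noteq> 0})"
      unfolding test_fun_def using C_class.simps(1) by blast+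
    have z: "x \<notin> closure {x. \<phi> x \<noteq> 0} \<Longrightarrow> \<phi> x = 0" for x
      using closure_subset[of "{x. \<phi> x \<noteq> 0}"] by blast
    have i: "integrable lebesgue (\<lambda>x. g x * \<phi> x)" "integrable lebesgue (\<lambda>x. h x * \<phi> x)"
      using integrable_L1_loc_mult_continuous[OF _ c K z] L by auto
    have "C_class 1 \<phi>" using t unfolding test_fun_def by blast
    then have "continuous_on UNIV (partial_deriv i \<phi>)" by simp
    then have "(LINT x|lebesgue. u x * partial_deriv i \<phi> x) = (LINT x|lebesgue. v x * partial_deriv i \<phi> x)"
      using assms(3) L1_loc_measurable[OF L(1)] L1_loc_measurable[OF L(3)]
        continuous_lebesgue_measurable[of "partial_deriv i \<phi>"]
      by (intro integral_cong_AE borel_measurable_times) auto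
    then have "(LINT x|lebesgue. g x * \<phi> x) = (LINT x|lebesgue. h x * \<phi> x)"
      using assms(1,2) t by (auto simp: has_weak_partial_def)
    then show "(LINT x|lebesgue. (g x - h x) * \<phi> x) = 0"
      using i by (simp add: left_diff_distrib)
  qed
  then show ?thesis by simp
qed

lemma bounded_compact_support:
  assumes "continuous_on UNIV (h :: real ^ 'n::finite \<Rightarrow> real)" "compact K" "\<And>x. x \<notin> K \<Longrightarrow> h x = 0"
  obtains C where "C > 0" "\<And>x. \<bar>h x\<bar> \<le> C"
proof -
  have "bounded (h ` K)"
    using compact_continuous_image[OF continuous_on_subset[OF assms(1)] assms(2)] compact_imp_bounded by auto
  then obtain C where C: "C > 0" "\<And>x. x \<in> K \<Longrightarrow> \<bar>h x\<bar> \<le> C" unfolding bounded_pos by auto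
  have "\<bar>h x\<bar> \<le> C" for x using C assms(3)[of x] by (cases "x \<in> K") auto
  then show ?thesis using that C by blast
qed

definition directional_deriv ::
  "'n::finite \<Rightarrow> (real ^ 'n \<Rightarrow> real) \<Rightarrow> (real ^ 'n \<Rightarrow> real) \<Rightarrow> bool" where
  "directional_deriv i f f' \<longleftrightarrow>
     (\<forall>x. ((\<lambda>t. f (x + t *\<^sub>R axis i 1)) has_real_derivative f' x) (at 0))"

lemma directional_derivD:
  assumes "directional_deriv i f f'"
  shows "((\<lambda>t. f (x + t *\<^sub>R axis i 1)) has_real_derivative f' (x + s *\<^sub>R axis i 1)) (at s)"
proof -
  have "((\<lambda>t. f (x + s *\<^sub>R axis i 1 + t *\<^sub>R axis i 1)) has_real_derivative f' (x + s *\<^sub>R axis i 1)) (at 0)"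
    using assms by (simp add: directional_deriv_def)
  moreover have "(\<lambda>t. f (x + s *\<^sub>R axis i 1 + t *\<^sub>R axis i 1)) = (\<lambda>t. f (x + (s + t) *\<^sub>R axis i 1))"
    by (simp add: algebra_simps)
  ultimately show ?thesis
    using DERIV_shift[of "\<lambda>t. f (x + t *\<^sub>R axis i 1)" "f' (x + s *\<^sub>R axis i 1)" 0 s]
    by (simp add: add.commute)
qed

lemma integral_directional_deriv_eq_0:
  fixes h :: "real ^ 'n::finite \<Rightarrow> real"
  assumes d: "directional_deriv i h h'" and c: "continuous_on UNIV h" "continuous_on UNIV h'"
    and K: "compact K" "\<And>x. x \<notin> K \<Longrightarrow> h x = 0" "\<And>x. x \<notin> K \<Longrightarrow> h' x = 0"
  shows "(LINT x|lebesgue. h' x) = 0"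
proof -
  define e :: "real^'n" where "e = axis i 1"
  obtain C where C: "C > 0" "\<And>x. \<bar>h' x\<bar> \<le> C" using bounded_compact_support[OF c(2) K(1,3)] by blast
  define q where "q n x = (h (x + (1 / real (Suc n)) *\<^sub>R e) - h x) * real (Suc n)" for n x
  define K' where "K' = (\<lambda>p. fst p - snd p *\<^sub>R e) ` (K \<times> {0..1::real})"
  have K': "compact K'" unfolding K'_def
    by (intro compact_continuous_image compact_Times K(1) compact_Icc continuous_intros)
  have hi: "integrable lebesgue h"
    using integrable_L1_loc_mult_continuous[OF L1_loc_const[of 1] c(1) K(1,2)] by simp
  have "(LINT x|lebesgue. q n x) = 0" for n
    unfolding q_def using hi integrable_lebesgue_shift[OF hi, of "(1 / real (Suc n)) *\<^sub>R e"]
      lebesgue_integral_shift[of h "(1 / real (Suc n)) *\<^sub>R e"] borel_measurable_integrable[OF hi]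
    by (simp del: of_nat_Suc)
  moreover have "(\<lambda>n. LINT x|lebesgue. q n x) \<longlonglongrightarrow> (LINT x|lebesgue. h' x)"
  proof (rule integral_dominated_convergence)
    show "integrable lebesgue (\<lambda>x. C * indicator K' x)"
      using lmeasurable_compact[OF K'] by (simp add: lmeasurable_iff_integrable)
    show "h' \<in> borel_measurable lebesgue" by (rule continuous_lebesgue_measurable[OF c(2)])
    show "q n \<in> borel_measurable lebesgue" for n
      unfolding q_def
      by (intro continuous_lebesgue_measurable continuous_intros continuous_on_compose2[OF c(1)]) auto
    show "AE x in lebesgue. (\<lambda>n. q n x) \<longlonglongrightarrow> h' x"
    proof (rule AE_I2)
      fix x
      have "((\<lambda>t. (h (x + t *\<^sub>R e) - h x) / t) \<longlongrightarrow> h' x) (at 0)"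
        using directional_derivD[OF d, of x 0] by (simp add: e_def has_field_derivative_iff)
      then have "((\<lambda>t. (h (x + t *\<^sub>R e) - h x) / t) \<longlongrightarrow> h' x) (at_right 0)"
        by (rule filterlim_mono) (auto simp: at_le)
      moreover have "filterlim (\<lambda>n. 1 / real (Suc n)) (at_right 0) sequentially"
        unfolding filterlim_at using LIMSEQ_inverse_real_of_nat
        by (auto simp: inverse_eq_divide)
      ultimately have "(\<lambda>n. (h (x + (1 / real (Suc n)) *\<^sub>R e) - h x) / (1 / real (Suc n))) \<longlonglongrightarrow> h' x"
        by (rule filterlim_compose)
      then show "(\<lambda>n. q n x) \<longlonglongrightarrow> h' x" by (simp add: q_def)
    qed
    show "AE x in lebesgue. norm (q n x) \<le> C * indicator K' x" for n
    proof (rule AE_I2)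
      fix x
      define t where "t = 1 / real (Suc n)"
      have t: "0 < t" "t \<le> 1" by (auto simp: t_def)
      show "norm (q n x) \<le> C * indicator K' x"
      proof (cases "x \<in> K'")
        case False
        have "y \<notin> K" if "y = x + s *\<^sub>R e" "0 \<le> s" "s \<le> 1" for s y
        proof
          assume "y \<in> K"
          then have "x \<in> K'" unfolding K'_def using that by (intro image_eqI[of _ _ "(y, s)"]) auto
          then show False using False by simp
        qed
        then have "h (x + t *\<^sub>R e) = 0" "h x = 0" using t K(2) by (metis less_imp_le, metis add_0_right order_refl scaleR_zero_left zero_le_one)
        then show ?thesis by (simp add: q_def t_def C less_imp_le)
      next
        case True
        obtain z where "0 < z" "z < t" "h (x + t *\<^sub>R e) - h (x + 0 *\<^sub>R e) = (t - 0) * h' (x + z *\<^sub>R e)"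
          using MVT2[OF t(1), of "\<lambda>s. h (x + s *\<^sub>R e)" "\<lambda>s. h' (x + s *\<^sub>R e)"] directional_derivD[OF d]
          unfolding e_def by blast
        then have "q n x = h' (x + z *\<^sub>R e)" by (simp add: q_def t_def)
        then show ?thesis using C True by simp
      qed
    qed
  qed
  ultimately show ?thesis by (simp add: LIMSEQ_const_iff)
qed

lemma has_weak_partial_classical:
  assumes d: "directional_deriv i g g'" and c: "continuous_on UNIV g" "continuous_on UNIV g'"
  shows "has_weak_partial i g g'"
  unfolding has_weak_partial_def
proof (intro conjI allI impI)
  show L: "L1_loc g" "L1_loc g'" using c by (auto intro: L1_loc_continuous)
  fix \<phi> :: "real^'a \<Rightarrow> real" assume t: "test_fun \<phi>"
  define K where "K = closure {x. \<phi> x \<noteq> 0}"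
  have "C_class 0 \<phi>" and C1: "C_class 1 \<phi>" and K: "compact K"
    using t unfolding test_fun_def K_def by blast+
  then have c\<phi>: "continuous_on UNIV \<phi>" by simp
  have c\<phi>': "continuous_on UNIV (partial_deriv i \<phi>)" and d\<phi>: "\<phi> differentiable (at x)" for x using C1 by auto
  have z: "x \<notin> K \<Longrightarrow> \<phi> x = 0" for x unfolding K_def using closure_subset[of "{x. \<phi> x \<noteq> 0}"] by blast
  have z': "partial_deriv i \<phi> x = 0" if "x \<notin> K" for x
  proof -
    have "open (- K)" unfolding K_def by auto
    then have "(\<phi> has_derivative (\<lambda>_. 0)) (at x)"
      by (rule has_derivative_transform_within_open[OF has_derivative_const[of 0]]) (use that z in auto)
    then show ?thesis unfolding partial_deriv_def using frechet_derivative_at by metis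
  qed
  have dir: "directional_deriv i \<phi> (partial_deriv i \<phi>)"
    unfolding directional_deriv_def
  proof
    fix x
    have f: "(\<phi> has_derivative frechet_derivative \<phi> (at x)) (at (x + 0 *\<^sub>R axis i 1))"
      using d\<phi> frechet_derivative_works by auto
    have "((\<lambda>t. x + t *\<^sub>R axis i 1) has_derivative (\<lambda>t. t *\<^sub>R axis i 1)) (at 0)"
      by (auto intro!: derivative_eq_intros)
    from has_derivative_compose[OF this f]
    have "((\<lambda>t. \<phi> (x + t *\<^sub>R axis i 1)) has_derivative (\<lambda>t. frechet_derivative \<phi> (at x) (t *\<^sub>R axis i 1))) (at 0)" .
    moreover have "frechet_derivative \<phi> (at x) (t *\<^sub>R axis i 1) = partial_deriv i \<phi> x * t" for t
      unfolding partial_deriv_def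
      using linear_scale[OF linear_frechet_derivative[OF d\<phi>]] by simp
    ultimately show "((\<lambda>t. \<phi> (x + t *\<^sub>R axis i 1)) has_real_derivative partial_deriv i \<phi> x) (at 0)"
      by (simp add: has_field_derivative_def)
  qed
  have "directional_deriv i (\<lambda>x. g x * \<phi> x) (\<lambda>x. g x * partial_deriv i \<phi> x + g' x * \<phi> x)"
    unfolding directional_deriv_def
  proof
    fix x
    show "((\<lambda>t. g (x + t *\<^sub>R axis i 1) * \<phi> (x + t *\<^sub>R axis i 1)) has_real_derivative
         g x * partial_deriv i \<phi> x + g' x * \<phi> x) (at 0)"
      using DERIV_mult[of "\<lambda>t. g (x + t *\<^sub>R axis i 1)" "g' x" 0 UNIV "\<lambda>t. \<phi> (x + t *\<^sub>R axis i 1)" "partial_deriv i \<phi> x"]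
        d dir by (simp add: directional_deriv_def algebra_simps)
  qed
  then have "(LINT x|lebesgue. g x * partial_deriv i \<phi> x + g' x * \<phi> x) = 0"
    by (rule integral_directional_deriv_eq_0[OF _ _ _ K]) (use z z' c c\<phi> c\<phi>' in \<open>auto intro!: continuous_intros\<close>)
  moreover have "integrable lebesgue (\<lambda>x. g x * partial_deriv i \<phi> x)" "integrable lebesgue (\<lambda>x. g' x * \<phi> x)"
    using integrable_L1_loc_mult_continuous[OF L(1) c\<phi>' K z'] integrable_L1_loc_mult_continuous[OF L(2) c\<phi> K z] by auto
  ultimately show "(LINT x|lebesgue. g x * partial_deriv i \<phi> x) = - (LINT x|lebesgue. g' x * \<phi> x)"
    by simp
qed

text \<open>The derivative of the cut-off is a difference \<open>\<omega> x - \<omega> (x - e\<^sub>i)\<close>, so that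
  its contribution cancels by periodicity.\<close>

lemma weak_partial_periodic_integral:
  fixes u g :: "real ^ 'n::finite \<Rightarrow> real"
  assumes w: "has_weak_partial i u g" and per: "periodic_ae u"
    and F: "\<And>j. smooth (F j)" "\<And>j t. F j (t + 1) = F j t"
  shows "(LINT x:left_open_box 0 1|lebesgue. u x * tensor (F(i := deriv (F i))) x + g x * tensor F x) = 0"
proof -
  let ?P = "tensor (F(i := deriv (F i)))" and ?E = "tensor F"
  have L: "L1_loc u" "L1_loc g" using w by (auto simp: has_weak_partial_def)
  have smoothP: "smooth ((F(i := deriv (F i))) j)" for j using F(1) smooth_deriv by simp
  have cP: "continuous_on UNIV ?P" and cE: "continuous_on UNIV ?E"
    using smoothP F(1) by (auto intro!: tensor_continuous smooth_continuous simp del: fun_upd_apply)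
  have "(LINT x|lebesgue. (u x * ?P x + g x * ?E x) * tensor (\<lambda>j. smooth_cut N (0 $ j) (1 $ j)) x) = 0" for N
  proof -
    let ?h = "smooth_cut N 0 1"
    define \<beta> where "\<beta> t = deriv smooth_step (real (Suc N) * t) * real (Suc N)" for t
    have \<beta>: "((\<lambda>t. smooth_step (real (Suc N) * (t - c))) has_real_derivative \<beta> (t - c)) (at t)" for c t
    proof -
      have "((\<lambda>t. real (Suc N) * (t - c)) has_real_derivative real (Suc N)) (at t)"
        by (auto intro!: derivative_eq_intros)
      from DERIV_chain2[OF smooth_DERIV[OF smooth_smooth_step] this] show ?thesis by (simp add: \<beta>_def)
    qed
    have h': "deriv ?h t = \<beta> t - \<beta> (t - 1)" for t
      unfolding smooth_cut_def using \<beta>[of 0 t] \<beta>[of 1 t] by (intro DERIV_imp_deriv DERIV_diff) auto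
    have \<beta>0: "\<beta> t = 0" if "t \<notin> {0..1}" for t
    proof -
      have "((\<lambda>t. smooth_step (real (Suc N) * (t - 0))) has_real_derivative 0) (at t)"
      proof (cases "t < 0")
        case True
        show ?thesis
          by (rule has_field_derivative_transform_within_open[of "\<lambda>_. 0" _ _ "{..<0}"])
            (use True in \<open>auto simp: smooth_step_props(1) mult_nonneg_nonpos simp del: of_nat_Suc\<close>)
      next
        case False
        have eq1: "1 = smooth_step (real (Suc N) * (s - 0))" if "s \<in> {1<..}" for s
          using mult_mono[of 1 "real (Suc N)" 1 s] that by (subst smooth_step_props(2)) auto
        have t1: "t \<in> {1<..}" using False that by auto
        show ?thesis
          by (rule has_field_derivative_transform_within_open[OF DERIV_const[of 1] open_greaterThan t1 eq1])
      qed
      then show ?thesis using \<beta>[of 0 t] DERIV_unique by fastforce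
    qed
    define \<omega> where "\<omega> = tensor ((\<lambda>_. ?h)(i := \<beta>))"
    let ?H = "tensor (\<lambda>_::'n. ?h)" and ?e = "axis i 1 :: real^'n"
    have \<beta>c: "continuous_on UNIV \<beta>"
      unfolding \<beta>_def[abs_def]
      by (intro continuous_intros continuous_on_compose2[OF smooth_continuous[OF smooth_deriv[OF smooth_smooth_step]]]) auto
    have h0: "?h t = 0" if "t \<notin> {0..2}" for t using smooth_cut_eq_0[of 0 1 t N] that by simp
    have c\<omega>: "continuous_on UNIV \<omega>" and cH: "continuous_on UNIV ?H"
      unfolding \<omega>_def using \<beta>c smooth_continuous[OF smooth_smooth_cut] by (auto intro!: tensor_continuous)
    let ?K = "cbox 0 2 :: (real^'n) set"
    have \<omega>0: "\<omega> x = 0" and H0: "?H x = 0" if "x \<notin> ?K" for x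
      unfolding \<omega>_def using h0 \<beta>0 that by (auto intro!: tensor_eq_0[OF _ that] split: if_splits)
    define G where "G j t = F j t * ?h t" for j t
    have G: "smooth (G j)" for j unfolding G_def[abs_def] by (intro smooth_mult F smooth_smooth_cut)
    have "test_fun (tensor G)"
      by (rule test_fun_tensor[of G 0 2, OF G]) (use h0 in \<open>auto simp: G_def\<close>)
    then have *: "(LINT x|lebesgue. u x * partial_deriv i (tensor G) x) = - (LINT x|lebesgue. g x * tensor G x)"
      using w by (simp add: has_weak_partial_def)
    have GE: "tensor G x = ?E x * ?H x" for x by (simp add: tensor_mult G_def[abs_def])
    have \<omega>shift: "\<omega> (x - ?e) = \<beta> (x $ i - 1) * (\<Prod>j\<in>UNIV - {i}. ?h (x $ j))" for x
      unfolding \<omega>_def tensor_upd by (auto simp: axis_def intro!: arg_cong2[where f="(*)"] prod.cong)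
    have dG: "deriv (G i) t = deriv (F i) t * ?h t + F i t * (\<beta> t - \<beta> (t - 1))" for t
    proof -
      have "(G i has_real_derivative deriv (F i) t * ?h t + deriv ?h t * F i t) (at t)"
        unfolding G_def by (intro DERIV_mult smooth_DERIV F smooth_smooth_cut)
      then show ?thesis using h' by (simp add: DERIV_imp_deriv mult.commute)
    qed
    have pG: "partial_deriv i (tensor G) x = ?P x * ?H x + ?E x * (\<omega> x - \<omega> (x - ?e))" for x
    proof -
      have "partial_deriv i (tensor G) x = deriv (G i) (x $ i) * (\<Prod>j\<in>UNIV - {i}. G j (x $ j))"
        by (simp add: partial_deriv_tensor(2)[of G, OF G] tensor_upd)
      also have "(\<Prod>j\<in>UNIV - {i}. G j (x $ j)) = (\<Prod>j\<in>UNIV - {i}. F j (x $ j)) * (\<Prod>j\<in>UNIV - {i}. ?h (x $ j))"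
        by (simp add: G_def prod.distrib)
      finally show ?thesis
        unfolding \<omega>shift unfolding \<omega>_def tensor_upd tensor_remove[of F _ i] tensor_remove[of "\<lambda>_. ?h" _ i] dG
        by (simp add: algebra_simps)
    qed
    have i1: "integrable lebesgue (\<lambda>x. u x * (?P x * ?H x))"
      using L(1) by (rule integrable_L1_loc_mult_continuous[OF _ _ compact_cbox[of 0 2]]) (auto intro!: continuous_intros cP cH simp: H0)
    have i2: "integrable lebesgue (\<lambda>x. g x * (?E x * ?H x))"
      using L(2) by (rule integrable_L1_loc_mult_continuous[OF _ _ compact_cbox[of 0 2]]) (auto intro!: continuous_intros cE cH simp: H0)
    have i3: "integrable lebesgue (\<lambda>x. u x * (?E x * \<omega> x))"
      using L(1) by (rule integrable_L1_loc_mult_continuous[OF _ _ compact_cbox[of 0 2]]) (auto intro!: continuous_intros cE c\<omega> simp: \<omega>0)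
    have E1: "?E (x + ?e) = ?E x" for x
      using tensor_shift[of F x 1 i] F(2) by simp
    have mu: "u \<in> borel_measurable lebesgue" by (rule L1_loc_measurable[OF L(1)])
    have "continuous_on UNIV (\<lambda>x. ?E x * \<omega> (x - ?e))"
      by (intro continuous_intros cE continuous_on_compose2[OF c\<omega>]) auto
    then have m4: "(\<lambda>x. u x * (?E x * \<omega> (x - ?e))) \<in> borel_measurable lebesgue"
      by (rule borel_measurable_times[OF mu continuous_lebesgue_measurable])
    have ae: "AE x in lebesgue. u (x + ?e) * (?E (x + ?e) * \<omega> (x + ?e - ?e)) = u x * (?E x * \<omega> x)"
      using per unfolding periodic_ae_def E1 by (auto elim: eventually_mono dest!: spec[of _ i])
    have m4': "(\<lambda>x. u (x + ?e) * (?E (x + ?e) * \<omega> (x + ?e - ?e))) \<in> borel_measurable lebesgue"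
      using measurable_compose[OF lebesgue_measurable_shift m4] .
    have "integrable lebesgue (\<lambda>x. u (x + ?e) * (?E (x + ?e) * \<omega> (x + ?e - ?e)))"
      using i3 integrable_cong_AE[OF m4' borel_measurable_integrable[OF i3] ae] by simp
    from integrable_lebesgue_shift[OF this, of "- ?e"]
    have i4: "integrable lebesgue (\<lambda>x. u x * (?E x * \<omega> (x - ?e)))" by simp
    have "(LINT x|lebesgue. u x * (?E x * \<omega> (x - ?e))) = (LINT x|lebesgue. u (x + ?e) * (?E (x + ?e) * \<omega> (x + ?e - ?e)))"
      by (rule lebesgue_integral_shift[OF m4, symmetric])
    also have "\<dots> = (LINT x|lebesgue. u x * (?E x * \<omega> x))"
      by (rule integral_cong_AE[OF m4' borel_measurable_integrable[OF i3] ae])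
    finally have cancel: "(LINT x|lebesgue. u x * (?E x * \<omega> (x - ?e))) = (LINT x|lebesgue. u x * (?E x * \<omega> x))" .
    have "(LINT x|lebesgue. u x * partial_deriv i (tensor G) x)
        = (LINT x|lebesgue. u x * (?P x * ?H x) + u x * (?E x * \<omega> x) - u x * (?E x * \<omega> (x - ?e)))"
      by (simp add: pG algebra_simps)
    also have "\<dots> = (LINT x|lebesgue. u x * (?P x * ?H x))"
      using i1 i3 i4 cancel by simp
    finally have "(LINT x|lebesgue. u x * (?P x * ?H x)) + (LINT x|lebesgue. g x * (?E x * ?H x)) = 0"
      using * by (simp add: GE)
    then have "(LINT x|lebesgue. u x * (?P x * ?H x) + g x * (?E x * ?H x)) = 0"
      using i1 i2 by simp
    then show ?thesis by (simp add: algebra_simps)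
  qed
  moreover have "L1_loc (\<lambda>x. u x * ?P x + g x * ?E x)"
    using L cP cE by (intro L1_loc_add L1_loc_mult_continuous)
  from smooth_cut_tensor_tendsto[OF this, of 0 1]
  have "(\<lambda>N. LINT x|lebesgue. (u x * ?P x + g x * ?E x) * tensor (\<lambda>j. smooth_cut N (0 $ j) (1 $ j)) x)
    \<longlonglongrightarrow> (LINT x:left_open_box 0 1|lebesgue. u x * ?P x + g x * ?E x)" by simp
  ultimately show ?thesis by (simp add: LIMSEQ_const_iff)
qed

subsection \<open>The trigonometric basis\<close>

abbreviation cell :: "(real ^ 'n::finite) measure" where
  "cell \<equiv> lebesgue_on unit_cell"

lemma unit_cell_box: "unit_cell = box 0 1"
  by (auto simp: unit_cell_def mem_box_cart)

lemma unit_cell_lmeasurable: "unit_cell \<in> lmeasurable"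
  by (simp add: unit_cell_box)

lemma unit_cell_sets [measurable, simp]: "unit_cell \<in> sets lebesgue"
  by (rule fmeasurableD[OF unit_cell_lmeasurable])

lemma emeasure_cell: "emeasure cell (unit_cell :: (real ^ 'n::finite) set) = 1"
proof -
  have "emeasure lebesgue (box 0 1 :: (real^'n) set) = emeasure lborel (cbox 0 1 :: (real^'n) set)"
    by (simp add: emeasure_lborel_box_eq emeasure_lborel_cbox_eq)
  also have "\<dots> = ennreal (\<Prod>b\<in>Basis. (1 - 0 :: real^'n) \<bullet> b)"
    by (rule emeasure_lborel_cbox) (auto simp: Basis_vec_def inner_axis)
  also have "(\<Prod>b\<in>Basis. (1 - 0 :: real^'n) \<bullet> b) = 1"
    by (rule prod.neutral) (auto simp: Basis_vec_def inner_axis)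
  finally show ?thesis by (simp add: emeasure_restrict_space unit_cell_box)
qed

interpretation cell: finite_measure "cell :: (real ^ 'n::finite) measure"
  by standard (simp add: emeasure_cell)

lemma measure_cell [simp]: "measure cell (unit_cell :: (real ^ 'n::finite) set) = 1"
  by (simp add: measure_def emeasure_cell)

lemma cell_measurable: "f \<in> borel_measurable lebesgue \<Longrightarrow> f \<in> borel_measurable cell"
  by (rule measurable_restrict_space1)

lemma set_integral_unit_cell:
  fixes f :: "real ^ 'n::finite \<Rightarrow> real"
  shows "(LINT x:unit_cell|lebesgue. f x) = (\<integral>x. f x \<partial>cell)"
  unfolding set_lebesgue_integral_def by (rule integral_restrict_space[symmetric]) simp

lemma AE_cell_if_lebesgue: "AE x in lebesgue. P x \<Longrightarrow> AE x in cell. P x"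
  by (subst AE_restrict_space_iff) (auto elim: eventually_mono)

lemma AE_component_neq: "AE x in lebesgue. (x :: real ^ 'n::finite) $ i \<noteq> c"
proof -
  have "negligible {x :: real^'n. x $ i = c}"
    using negligible_hyperplane[of "axis i 1 :: real^'n" c] by (simp add: inner_axis' axis_eq_0_iff)
  then show ?thesis using AE_not_in[of "{x :: real^'n. x $ i = c}"] by (simp add: negligible_iff_null_sets)
qed

lemma AE_unit_cell_iff:
  "AE x in lebesgue. (x \<in> unit_cell) = (x \<in> cbox (0 :: real ^ 'n::finite) 1)"
  "AE x in lebesgue. (x \<in> unit_cell) = (x \<in> left_open_box (0 :: real ^ 'n) 1)"
proof -
  have "AE x in lebesgue. \<forall>i. (x :: real^'n) $ i \<noteq> 0 \<and> x $ i \<noteq> 1"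
    by (subst AE_all_countable) (intro allI AE_conjI AE_component_neq)
  then have "AE x in lebesgue. (x \<in> unit_cell) = (x \<in> cbox (0 :: real^'n) 1) \<and>
      (x \<in> unit_cell) = (x \<in> left_open_box (0 :: real^'n) 1)"
  proof eventually_elim
    case (elim x)
    then show ?case
      by (auto simp: unit_cell_def mem_box_cart left_open_box_def less_le)
  qed
  then show "AE x in lebesgue. (x \<in> unit_cell) = (x \<in> cbox (0 :: real ^ 'n::finite) 1)"
    "AE x in lebesgue. (x \<in> unit_cell) = (x \<in> left_open_box (0 :: real ^ 'n) 1)"
    by (auto elim: eventually_mono)
qed

lemma integral_cell_eq:
  fixes f :: "real ^ 'n::finite \<Rightarrow> real"
  assumes f: "f \<in> borel_measurable lebesgue"
    and S: "S \<in> sets lebesgue" "AE x in lebesgue. (x \<in> unit_cell) = (x \<in> S)"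
  shows "(\<integral>x. f x \<partial>cell) = (LINT x:S|lebesgue. f x)"
proof -
  have "(LINT x:unit_cell|lebesgue. f x) = (LINT x:S|lebesgue. f x)"
    unfolding set_lebesgue_integral_def
  proof (rule integral_cong_AE)
    show "(\<lambda>x. indicat_real unit_cell x *\<^sub>R f x) \<in> borel_measurable lebesgue"
      "(\<lambda>x. indicat_real S x *\<^sub>R f x) \<in> borel_measurable lebesgue"
      using f S(1) by (intro borel_measurable_scaleR borel_measurable_indicator; simp)+
    show "AE x in lebesgue. indicat_real unit_cell x *\<^sub>R f x = indicat_real S x *\<^sub>R f x"
      using S(2) by eventually_elim (simp add: indicator_def)
  qed
  then show ?thesis by (simp add: set_integral_unit_cell)
qed

lemma integral_tensor:
  fixes G :: "'n::finite \<Rightarrow> real \<Rightarrow> real"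
  assumes "\<And>j. integrable lborel (G j)"
  shows "(\<integral>x. tensor G x \<partial>lborel) = (\<Prod>j\<in>UNIV. \<integral>t. G j t \<partial>lborel)"
proof -
  interpret product_sigma_finite "\<lambda>_. lborel" by standard
  let ?T = "\<lambda>f. \<Sum>b\<in>Basis. f b *\<^sub>R b :: real^'n"
  let ?a = "\<lambda>j. axis j 1 :: real^'n"
  have B: "Basis = range ?a" by (auto simp: Basis_vec_def)
  have inj: "inj ?a" by (auto simp: inj_def axis_eq_axis)
  have T: "?T f $ j = f (?a j)" for f j
  proof -
    have "?T f $ j = (\<Sum>i\<in>UNIV. f (?a i) * ?a i $ j)"
      unfolding B sum.reindex[OF inj] by (simp add: sum_component)
    also have "\<dots> = (\<Sum>i\<in>UNIV. if i = j then f (?a i) else 0)"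
      by (intro sum.cong) (auto simp: axis_def)
    finally show ?thesis by simp
  qed
  define H where "H b = G (inv ?a b)" for b
  have H: "H (?a j) = G j" for j by (simp add: H_def inv_f_f[OF inj])
  have m: "tensor G \<in> borel_measurable borel"
    unfolding tensor_def[abs_def]
  proof (rule borel_measurable_prod)
    fix j
    have "G j \<in> borel_measurable borel" using borel_measurable_integrable[OF assms[of j]] by simp
    then show "(\<lambda>x :: real^'n. G j (x $ j)) \<in> borel_measurable borel"
      by (rule measurable_compose[rotated]) (intro borel_measurable_continuous_onI continuous_intros)
  qed
  have mT: "?T \<in> (\<Pi>\<^sub>M b\<in>Basis. lborel) \<rightarrow>\<^sub>M borel" by measurable
  have "(\<integral>x. tensor G x \<partial>lborel) = (\<integral>f. tensor G (?T f) \<partial>(\<Pi>\<^sub>M b\<in>Basis. lborel))"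
    by (subst lborel_eq) (rule integral_distr[OF mT m])
  also have "\<dots> = (\<integral>f. (\<Prod>b\<in>Basis. H b (f b)) \<partial>(\<Pi>\<^sub>M b\<in>Basis. lborel))"
    unfolding tensor_def T unfolding B prod.reindex[OF inj] by (simp add: H)
  also have "\<dots> = (\<Prod>b\<in>Basis. \<integral>t. H b t \<partial>lborel)"
    by (rule product_integral_prod) (auto simp: B H assms)
  also have "\<dots> = (\<Prod>j\<in>UNIV. \<integral>t. G j t \<partial>lborel)"
    unfolding B prod.reindex[OF inj] by (simp add: H)
  finally show ?thesis .
qed

lemma integral_cell_tensor:
  fixes F :: "'n::finite \<Rightarrow> real \<Rightarrow> real"
  assumes F: "\<And>j. continuous_on UNIV (F j)"
  shows "(\<integral>x. tensor F x \<partial>cell) = (\<Prod>j\<in>UNIV. LINT t:{0..1}|lborel. F j t)"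
proof -
  have mF: "tensor F \<in> borel_measurable borel"
    using tensor_continuous[of F, OF F] by (rule borel_measurable_continuous_onI)
  have eq: "indicator (cbox 0 1) x *\<^sub>R tensor F x = tensor (\<lambda>j t. indicator {0..1} t * F j t) x" for x :: "real^'n"
  proof -
    have "indicat_real (cbox 0 1) x = (\<Prod>j\<in>UNIV. indicator {0..1} (x $ j))"
      by (auto simp: indicator_def mem_box_cart prod_zero_iff)
    then show ?thesis by (simp add: tensor_def prod.distrib)
  qed
  have "(\<integral>x. tensor F x \<partial>cell) = (LINT x:cbox 0 1|lebesgue. tensor F x)"
    by (rule integral_cell_eq[OF _ _ AE_unit_cell_iff(1)])
      (use F in \<open>auto intro!: continuous_lebesgue_measurable tensor_continuous\<close>)
  also have "\<dots> = (\<integral>x. tensor (\<lambda>j t. indicator {0..1} t * F j t) x \<partial>lebesgue)"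
    by (simp add: set_lebesgue_integral_def eq[simplified])
  also have "\<dots> = (\<integral>x. tensor (\<lambda>j t. indicator {0..1} t * F j t) x \<partial>lborel)"
  proof (rule integral_completion)
    have "(\<lambda>x. indicator (cbox 0 1) x *\<^sub>R tensor F x) \<in> borel_measurable lborel"
      using mF by (intro borel_measurable_scaleR borel_measurable_indicator) auto
    then show "tensor (\<lambda>j t. indicator {0..1} t * F j t) \<in> borel_measurable lborel" unfolding eq by simp
  qed
  also have "\<dots> = (\<Prod>j\<in>UNIV. \<integral>t. indicator {0..1} t * F j t \<partial>lborel)"
  proof (rule integral_tensor)
    fix j
    have "continuous_on {0..1} (F j)" using F continuous_on_subset by blast
    from borel_integrable_compact[OF compact_Icc this]
    show "integrable lborel (\<lambda>t. indicator {0..1} t * F j t)" by (simp add: indicator_times_eq_if(1) )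
  qed
  finally show ?thesis by (simp add: set_lebesgue_integral_def)
qed

definition trig1 :: "int \<Rightarrow> real \<Rightarrow> real" where
  "trig1 m t = (if m = 0 then 1 else if m > 0 then sqrt 2 * cos (2 * pi * of_int m * t)
     else sqrt 2 * sin (2 * pi * of_int (- m) * t))"

lemma trig1_DERIV: "(trig1 m has_real_derivative - (2 * pi * of_int m * trig1 (- m) t)) (at t)"
proof -
  consider "m = 0" | "m > 0" | "m < 0" by linarith
  then show ?thesis
  proof cases
    case 1
    then have "trig1 m = (\<lambda>_. 1)" by (simp add: trig1_def[abs_def])
    then show ?thesis using 1 by simp
  next
    case 2
    then have "trig1 m = (\<lambda>t. sqrt 2 * cos (2 * pi * of_int m * t))" by (simp add: trig1_def[abs_def])
    then show ?thesis using 2 by (auto simp: trig1_def intro!: derivative_eq_intros)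
  next
    case 3
    then have "trig1 m = (\<lambda>t. sqrt 2 * sin (2 * pi * of_int (- m) * t))" by (simp add: trig1_def[abs_def])
    then show ?thesis using 3 by (auto simp: trig1_def intro!: derivative_eq_intros)
  qed
qed

lemma smooth_trig1: "smooth (trig1 m)"
proof -
  have "Ck k (trig1 m)" for k m
  proof (induction k arbitrary: m)
    case 0
    show ?case using DERIV_continuous_on[OF trig1_DERIV] by simp
  next
    case (Suc k)
    have "Ck k (\<lambda>t. - (2 * pi * of_int m) * trig1 (- m) t)" by (intro Ck_mult Ck_const Suc)
    then show ?case using trig1_DERIV by (intro Ck_SucI[of _ "\<lambda>t. - (2 * pi * of_int m) * trig1 (- m) t"]) auto
  qed
  then show ?thesis by (simp add: smooth_def)
qed

lemma trig1_periodic: "trig1 m (t + 1) = trig1 m t"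
proof -
  have c: "cos (2 * pi * of_int m * (t + 1)) = cos (2 * pi * of_int m * t)" for m
    using cos_int_2pin[of m] sin_int_2pin[of m] by (simp add: distrib_left cos_add mult.assoc)
  have s: "sin (2 * pi * of_int m * (t + 1)) = sin (2 * pi * of_int m * t)" for m
    using cos_int_2pin[of m] sin_int_2pin[of m] by (simp add: distrib_left sin_add mult.assoc)
  show ?thesis unfolding trig1_def c s ..
qed

lemma set_integral_FTC:
  fixes F f :: "real \<Rightarrow> real"
  assumes "a \<le> b" "\<And>x. (F has_real_derivative f x) (at x)" "continuous_on UNIV f"
  shows "(LINT t:{a..b}|lborel. f t) = F b - F a"
  using integral_FTC_Icc_real[of a b F f] assms
  by (simp add: set_lebesgue_integral_def mult.commute continuous_on_eq_continuous_at)

lemma integral_cos_int: "(LINT t:{0..1}|lborel. cos (2 * pi * of_int m * t)) = (if m = 0 then 1 else 0)"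
proof (cases "m = 0")
  case True then show ?thesis by (simp add: set_lebesgue_integral_def)
next
  case False
  have "(LINT t:{0..1}|lborel. cos (2 * pi * of_int m * t)) =
      sin (2 * pi * of_int m * 1) / (2 * pi * of_int m) - sin (2 * pi * of_int m * 0) / (2 * pi * of_int m)"
    by (rule set_integral_FTC) (use False in \<open>auto intro!: derivative_eq_intros continuous_intros\<close>)
  then show ?thesis using False sin_int_2pin[of m] by simp
qed

lemma integral_sin_int: "(LINT t:{0..1}|lborel. sin (2 * pi * of_int m * t)) = 0"
proof (cases "m = 0")
  case True then show ?thesis by (simp add: set_lebesgue_integral_def)
next
  case False
  have "(LINT t:{0..1}|lborel. sin (2 * pi * of_int m * t)) =
      - cos (2 * pi * of_int m * 1) / (2 * pi * of_int m) - - cos (2 * pi * of_int m * 0) / (2 * pi * of_int m)"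
    by (rule set_integral_FTC) (use False in \<open>auto intro!: derivative_eq_intros continuous_intros\<close>)
  then show ?thesis using False cos_int_2pin[of m] by simp
qed

lemma set_integrable_Icc_continuous: "continuous_on UNIV f \<Longrightarrow> set_integrable lborel {a..b::real} (f :: real \<Rightarrow> real)"
  using borel_integrable_compact[OF compact_Icc, of a b f] continuous_on_subset[of UNIV f "{a..b}"]
  by (simp add: set_integrable_def indicator_times_eq_if(1))

lemma trig1_orthonormal: "(LINT t:{0..1}|lborel. trig1 m t * trig1 n t) = (if m = n then 1 else 0)"
proof -
  have pr: "cos (2 * pi * of_int a * t) * cos (2 * pi * of_int b * t) =
      (cos (2 * pi * of_int (a - b) * t) + cos (2 * pi * of_int (a + b) * t)) / 2"
    "sin (2 * pi * of_int a * t) * sin (2 * pi * of_int b * t) =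
      (cos (2 * pi * of_int (a - b) * t) - cos (2 * pi * of_int (a + b) * t)) / 2"
    "sin (2 * pi * of_int a * t) * cos (2 * pi * of_int b * t) =
      (sin (2 * pi * of_int (a + b) * t) + sin (2 * pi * of_int (a - b) * t)) / 2" for a b :: int and t :: real
    by (simp_all add: distrib_left distrib_right left_diff_distrib right_diff_distrib cos_add cos_diff sin_add sin_diff)
  have ic: "set_integrable lborel {0..1} (\<lambda>t. cos (2 * pi * of_int a * t))" 
    "set_integrable lborel {0..1} (\<lambda>t. sin (2 * pi * of_int a * t))" for a
    by (intro set_integrable_Icc_continuous continuous_intros)+
  have add: "(LINT t:{0..1}|lborel. (f t + g t) / 2) = ((LINT t:{0..1}|lborel. f t) + (LINT t:{0..1}|lborel. g t)) / 2"
    and diff: "(LINT t:{0..1}|lborel. (f t - g t) / 2) = ((LINT t:{0..1}|lborel. f t) - (LINT t:{0..1}|lborel. g t)) / 2"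
    if "set_integrable lborel {0..1} f" "set_integrable lborel {0..1} g" for f g :: "real \<Rightarrow> real"
    using that by (simp_all add: set_integral_add set_integral_diff)
  have cc: "(LINT t:{0..1}|lborel. cos (2 * pi * of_int a * t) * cos (2 * pi * of_int b * t)) =
      ((if a = b then 1 else 0) + (if a + b = 0 then 1 else 0)) / 2" for a b
    unfolding pr add[OF ic(1) ic(1)] integral_cos_int by simp
  have ss: "(LINT t:{0..1}|lborel. sin (2 * pi * of_int a * t) * sin (2 * pi * of_int b * t)) =
      ((if a = b then 1 else 0) - (if a + b = 0 then 1 else 0)) / 2" for a b
    unfolding pr diff[OF ic(1) ic(1)] integral_cos_int by simp
  have sc: "(LINT t:{0..1}|lborel. sin (2 * pi * of_int a * t) * cos (2 * pi * of_int b * t)) = 0" for a b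
    unfolding pr add[OF ic(2) ic(2)] integral_sin_int by simp
  have cs: "(LINT t:{0..1}|lborel. cos (2 * pi * of_int b * t) * sin (2 * pi * of_int a * t)) = 0" for a b
    using sc by (simp add: mult.commute)
  have tp: "trig1 a = (\<lambda>t. sqrt 2 * cos (2 * pi * of_int a * t))" if "a > 0" for a
    using that by (simp add: trig1_def[abs_def])
  have tn: "trig1 a = (\<lambda>t. sqrt 2 * sin (2 * pi * of_int (- a) * t))" if "a < 0" for a
    using that by (simp add: trig1_def[abs_def])
  have t0: "trig1 0 = (\<lambda>t. 1)" by (simp add: trig1_def[abs_def])
  have r: "(sqrt 2 * x) * (sqrt 2 * y) = 2 * (x * y)" for x y :: real by simp
  consider "m = 0" | "m > 0" | "m < 0" by linarith
  then show ?thesis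
  proof cases
    case 1
    consider "n = 0" | "n > 0" | "n < 0" by linarith
    then show ?thesis
      by cases (use 1 integral_cos_int[of n] integral_sin_int[of "- n"] in
          \<open>simp_all add: t0 tp tn set_lebesgue_integral_def del: of_int_minus\<close>)
  next
    case 2
    consider "n = 0" | "n > 0" | "n < 0" by linarith
    then show ?thesis
      by cases (use 2 integral_cos_int[of m] in \<open>simp_all add: t0 tp tn r cc cs del: of_int_minus\<close>)
  next
    case 3
    consider "n = 0" | "n > 0" | "n < 0" by linarith
    then show ?thesis
      by cases (use 3 integral_sin_int[of "- m"] in \<open>simp_all add: t0 tp tn r ss sc del: of_int_minus\<close>)
  qed
qed

definition basis :: "('n::finite \<Rightarrow> int) \<Rightarrow> real ^ 'n \<Rightarrow> real" where
  "basis k = tensor (\<lambda>j. trig1 (k j))"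

lemma basis_0: "basis (\<lambda>_. 0) = (\<lambda>x. 1)"
  by (simp add: basis_def tensor_def[abs_def] trig1_def)

lemma basis_orthonormal:
  fixes k l :: "'n::finite \<Rightarrow> int"
  shows "(\<integral>x. basis k x * basis l x \<partial>cell) = (if k = l then 1 else 0)"
proof -
  have "(\<integral>x. basis k x * basis l x \<partial>cell) = (\<integral>x. tensor (\<lambda>j t. trig1 (k j) t * trig1 (l j) t) x \<partial>(cell :: (real^'n) measure))"
    by (simp add: basis_def tensor_mult)
  also have "\<dots> = (\<Prod>j\<in>UNIV. LINT t:{0..1}|lborel. trig1 (k j) t * trig1 (l j) t)"
    by (intro integral_cell_tensor continuous_intros smooth_continuous smooth_trig1)
  also have "\<dots> = (\<Prod>j\<in>UNIV. if k j = l j then 1 else 0)" by (simp add: trig1_orthonormal)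
  also have "\<dots> = (if k = l then 1 else 0)"
    by (auto simp: fun_eq_iff prod_zero_iff)
  finally show ?thesis .
qed

subsection \<open>Trigonometric polynomials\<close>

definition D :: "'n::finite \<Rightarrow> (real ^ 'n \<Rightarrow> real) \<Rightarrow> real ^ 'n \<Rightarrow> real" where
  "D i f x = deriv (\<lambda>t. f (x + t *\<^sub>R axis i 1)) 0"

definition flip :: "'n \<Rightarrow> ('n \<Rightarrow> int) \<Rightarrow> 'n \<Rightarrow> int" where
  "flip i k = k(i := - k i)"

lemma flip_flip [simp]: "flip i (flip i k) = k"
  by (auto simp: flip_def)

lemma flip_apply [simp]: "flip i k i = - k i"
  by (simp add: flip_def)

lemma directional_deriv_D: "directional_deriv i f f' \<Longrightarrow> D i f = f'"
  by (rule ext) (simp add: directional_deriv_def D_def DERIV_imp_deriv)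

lemma directional_deriv_add:
  "directional_deriv i f f' \<Longrightarrow> directional_deriv i g g' \<Longrightarrow> directional_deriv i (\<lambda>x. f x + g x) (\<lambda>x. f' x + g' x)"
  unfolding directional_deriv_def by (auto intro: DERIV_add)

lemma directional_deriv_scale:
  "directional_deriv i f f' \<Longrightarrow> directional_deriv i (\<lambda>x. c * f x) (\<lambda>x. c * f' x)"
  unfolding directional_deriv_def by (auto intro: DERIV_cmult)

lemma directional_deriv_mult:
  assumes "directional_deriv i f f'" "directional_deriv i g g'"
  shows "directional_deriv i (\<lambda>x. f x * g x) (\<lambda>x. f' x * g x + f x * g' x)"
  unfolding directional_deriv_def
proof
  fix x
  show "((\<lambda>t. f (x + t *\<^sub>R axis i 1) * g (x + t *\<^sub>R axis i 1)) has_real_derivative f' x * g x + f x * g' x) (at 0)"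
    using DERIV_mult[of "\<lambda>t. f (x + t *\<^sub>R axis i 1)" "f' x" 0 UNIV "\<lambda>t. g (x + t *\<^sub>R axis i 1)" "g' x"] assms
    by (simp add: directional_deriv_def algebra_simps)
qed

lemma directional_deriv_compose:
  assumes "directional_deriv i f f'" "\<And>t. (\<beta> has_real_derivative \<beta>' t) (at t)"
  shows "directional_deriv i (\<lambda>x. \<beta> (f x)) (\<lambda>x. \<beta>' (f x) * f' x)"
  unfolding directional_deriv_def
proof
  fix x
  show "((\<lambda>t. \<beta> (f (x + t *\<^sub>R axis i 1))) has_real_derivative \<beta>' (f x) * f' x) (at 0)"
    using DERIV_chain2[OF assms(2), of "\<lambda>t. f (x + t *\<^sub>R axis i 1)" "f' x" 0 UNIV] assms(1)
    by (simp add: directional_deriv_def)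
qed

lemma basis_directional_deriv:
  "directional_deriv i (basis k) (\<lambda>x. - (2 * pi * of_int (k i)) * basis (flip i k) x)"
  unfolding directional_deriv_def
proof
  fix x
  have b: "basis k (x + t *\<^sub>R axis i 1) = trig1 (k i) (x $ i + t) * (\<Prod>j\<in>UNIV - {i}. trig1 (k j) (x $ j))" for t
    unfolding basis_def tensor_shift by (simp add: tensor_upd)
  have f: "basis (flip i k) x = trig1 (- k i) (x $ i) * (\<Prod>j\<in>UNIV - {i}. trig1 (k j) (x $ j))"
    unfolding basis_def tensor_remove[of _ _ i] by (auto simp: flip_def intro!: arg_cong2[where f="(*)"] prod.cong)
  have "((\<lambda>t. trig1 (k i) (x $ i + t)) has_real_derivative - (2 * pi * of_int (k i) * trig1 (- k i) (x $ i))) (at 0)"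
    using DERIV_shift[of "trig1 (k i)" "- (2 * pi * of_int (k i) * trig1 (- k i) (x $ i))" 0 "x $ i"]
      trig1_DERIV[of "k i" "x $ i"] by (simp add: add.commute)
  from DERIV_cmult_right[OF this]
  show "((\<lambda>t. basis k (x + t *\<^sub>R axis i 1)) has_real_derivative - (2 * pi * of_int (k i)) * basis (flip i k) x) (at 0)"
    unfolding b f by (simp add: mult.assoc)
qed

lemma D_basis: "D i (basis k) = (\<lambda>x. - (2 * pi * of_int (k i)) * basis (flip i k) x)"
  by (rule directional_deriv_D[OF basis_directional_deriv])

inductive trig_poly :: "(real ^ 'n::finite \<Rightarrow> real) \<Rightarrow> bool" where
  basis: "trig_poly (basis k)"
| add: "trig_poly f \<Longrightarrow> trig_poly g \<Longrightarrow> trig_poly (\<lambda>x. f x + g x)"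
| scale: "trig_poly f \<Longrightarrow> trig_poly (\<lambda>x. c * f x)"

lemma trig_poly_const: "trig_poly (\<lambda>x. c)"
  using trig_poly.scale[OF trig_poly.basis[of "\<lambda>_. 0"], of c] by (simp add: basis_0)

lemma trig_poly_diff: "trig_poly f \<Longrightarrow> trig_poly g \<Longrightarrow> trig_poly (\<lambda>x. f x - g x)"
  using trig_poly.add[of f "\<lambda>x. (-1) * g x"] trig_poly.scale[of g "-1"] by simp

lemma trig_poly_minus: "trig_poly f \<Longrightarrow> trig_poly (\<lambda>x. - f x)"
  using trig_poly.scale[of f "-1"] by simp

lemma trig_poly_sum: "(\<And>i. i \<in> I \<Longrightarrow> trig_poly (f i)) \<Longrightarrow> trig_poly (\<lambda>x. \<Sum>i\<in>I. f i x)"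
  by (induction I rule: infinite_finite_induct) (auto intro: trig_poly_const trig_poly.add)

lemma trig_poly_directional_deriv_ex:
  "trig_poly f \<Longrightarrow> \<exists>f'. trig_poly f' \<and> directional_deriv i f f'"
proof (induction rule: trig_poly.induct)
  case (basis k)
  show ?case using basis_directional_deriv trig_poly.scale[OF trig_poly.basis] by blast
next
  case (add f g)
  then show ?case using directional_deriv_add trig_poly.add by blast
next
  case (scale f c)
  then show ?case using directional_deriv_scale trig_poly.scale by blast
qed

lemma trig_poly_directional_deriv: "trig_poly f \<Longrightarrow> directional_deriv i f (D i f)"
  and trig_poly_D: "trig_poly f \<Longrightarrow> trig_poly (D i f)"
  using trig_poly_directional_deriv_ex[of f i] directional_deriv_D by blast+

lemma D_add: "trig_poly f \<Longrightarrow> trig_poly g \<Longrightarrow> D i (\<lambda>x. f x + g x) = (\<lambda>x. D i f x + D i g x)"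
  by (intro directional_deriv_D directional_deriv_add trig_poly_directional_deriv)

lemma D_scale: "trig_poly f \<Longrightarrow> D i (\<lambda>x. c * f x) = (\<lambda>x. c * D i f x)"
  by (intro directional_deriv_D directional_deriv_scale trig_poly_directional_deriv)

lemma D_const: "D i (\<lambda>x. c) = (\<lambda>x. 0)"
  by (rule directional_deriv_D) (simp add: directional_deriv_def)

lemma D_commute: "trig_poly f \<Longrightarrow> D i (D j f) = D j (D i f)"
proof (induction rule: trig_poly.induct)
  case (basis k)
  have "flip i (flip j k) = flip j (flip i k)" by (auto simp: flip_def)
  moreover have "flip j k i = k i" "flip i k j = k j" if "i \<noteq> j" using that by (auto simp: flip_def)
  ultimately show ?case
    unfolding D_basis D_scale[OF trig_poly.basis] by (cases "i = j") (simp_all add: mult_ac)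
next
  case (add f g)
  then show ?case by (simp add: D_add trig_poly_D)
next
  case (scale f c)
  then show ?case by (simp add: D_scale trig_poly_D)
qed

lemma basis_continuous: "continuous_on S (basis k)"
  unfolding basis_def by (intro tensor_continuous smooth_continuous smooth_trig1)

lemma basis_shift: "basis k (x + axis i 1) = basis k x"
  using tensor_shift[of "\<lambda>j. trig1 (k j)" x 1 i] by (simp add: basis_def trig1_periodic fun_upd_idem)

lemma basis_bound: "\<bar>basis k x\<bar> \<le> sqrt 2 ^ CARD('n)" for x :: "real ^ 'n::finite"
proof -
  have "\<bar>trig1 m t\<bar> \<le> sqrt 2" for m t
    by (auto simp: trig1_def abs_mult mult_le_cancel_left1)
  then have "\<bar>basis k x\<bar> \<le> (\<Prod>j\<in>(UNIV :: 'n set). sqrt 2)"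
    unfolding basis_def tensor_def abs_prod by (intro prod_mono) auto
  then show ?thesis by simp
qed

lemma trig_poly_continuous: "trig_poly f \<Longrightarrow> continuous_on S f"
  by (induction rule: trig_poly.induct) (auto intro: basis_continuous continuous_intros)

lemma trig_poly_shift: "trig_poly f \<Longrightarrow> f (x + axis i 1) = f x"
  by (induction rule: trig_poly.induct) (auto simp: basis_shift)

lemma trig_poly_periodic: "trig_poly f \<Longrightarrow> periodic_ae f"
  by (simp add: periodic_ae_def trig_poly_shift)

lemma trig_poly_bounded: "trig_poly f \<Longrightarrow> \<exists>C\<ge>0. \<forall>x. \<bar>f x\<bar> \<le> C"
proof (induction rule: trig_poly.induct)
  case (basis k)
  show ?case using basis_bound[of k] by (intro exI[of _ "sqrt 2 ^ CARD('a)"]) simp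
next
  case (add f g)
  then obtain C D where "C \<ge> 0" "D \<ge> 0" "\<forall>x. \<bar>f x\<bar> \<le> C" "\<forall>x. \<bar>g x\<bar> \<le> D" by blast
  then show ?case by (intro exI[of _ "C + D"]) (auto intro: order.trans[OF abs_triangle_ineq] add_mono)
next
  case (scale f c)
  then obtain C where "C \<ge> 0" "\<forall>x. \<bar>f x\<bar> \<le> C" by blast
  then show ?case by (intro exI[of _ "\<bar>c\<bar> * C"]) (auto simp: abs_mult intro: mult_left_mono)
qed

lemma trig_poly_measurable: "trig_poly f \<Longrightarrow> f \<in> borel_measurable lebesgue"
  by (intro continuous_lebesgue_measurable trig_poly_continuous)

lemma trig_poly_square_integrable: 
  assumes "trig_poly f" shows "square_integrable cell f"
proof -
  obtain C where "\<forall>x. \<bar>f x\<bar> \<le> C" using trig_poly_bounded[OF assms] by blast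
  then show ?thesis
    using cell_measurable[OF trig_poly_measurable[OF assms]] by (intro cell.square_integrable_bounded[of f C]) auto
qed

lemma trig_poly_has_weak_partial: "trig_poly f \<Longrightarrow> has_weak_partial i f (D i f)"
  by (intro has_weak_partial_classical trig_poly_directional_deriv trig_poly_continuous trig_poly_D)

lemma L1_loc_integrable_cell:
  assumes "L1_loc f" shows "integrable cell f"
proof -
  have "integrable lebesgue (\<lambda>x. indicator unit_cell x *\<^sub>R (indicator (cbox 0 1) x * f x))"
    by (intro integrable_mult_indicator L1_locD[OF assms]) auto
  also have "(\<lambda>x. indicator unit_cell x *\<^sub>R (indicator (cbox 0 1) x * f x)) = (\<lambda>x. indicator unit_cell x *\<^sub>R f x)"
  proof
    fix x :: "real^'a"
    show "indicator unit_cell x *\<^sub>R (indicator (cbox 0 1) x * f x) = indicator unit_cell x *\<^sub>R f x"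
      using box_subset_cbox[of 0 "1 :: real^'a"] by (cases "x \<in> unit_cell") (auto simp: unit_cell_box)
  qed
  finally show ?thesis by (subst integrable_restrict_space) auto
qed

definition coef :: "(real ^ 'n::finite \<Rightarrow> real) \<Rightarrow> ('n \<Rightarrow> int) \<Rightarrow> real" where
  "coef f k = (\<integral>x. f x * basis k x \<partial>cell)"

lemma weak_partial_integral_0:
  fixes u g :: "real ^ 'n::finite \<Rightarrow> real"
  assumes "has_weak_partial i u g" "periodic_ae u"
  shows "(\<integral>x. g x \<partial>cell) = 0"
proof -
  have "(LINT x:left_open_box 0 1|lebesgue. u x * tensor ((\<lambda>_ _. 1)(i := deriv (\<lambda>_. 1))) x + g x * tensor (\<lambda>_ _. 1) x) = 0"
    using weak_partial_periodic_integral[OF assms, of "\<lambda>_ _. 1"] by simp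
  moreover have "tensor ((\<lambda>_ _. 1)(i := deriv (\<lambda>_. 1))) x = 0" for x :: "real^'n"
    unfolding tensor_upd by simp
  moreover have "tensor (\<lambda>_ _. 1) x = 1" for x :: "real^'n" by (simp add: tensor_def)
  ultimately have "(LINT x:left_open_box 0 1|lebesgue. g x) = 0" by simp
  then show ?thesis
    using assms L1_loc_measurable[of g]
    by (subst integral_cell_eq[OF _ _ AE_unit_cell_iff(2)]) (auto simp: has_weak_partial_def)
qed

lemma coef_weak_partial:
  fixes u g :: "real ^ 'n::finite \<Rightarrow> real"
  assumes w: "has_weak_partial i u g" and per: "periodic_ae u"
  shows "coef g k = 2 * pi * of_int (k i) * coef u (flip i k)"
proof -
  have L: "L1_loc u" "L1_loc g" using w by (auto simp: has_weak_partial_def)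
  have d: "deriv (trig1 m) = (\<lambda>t. - (2 * pi * of_int m * trig1 (- m) t))" for m
    using trig1_DERIV by (auto intro: DERIV_imp_deriv)
  have t: "tensor ((\<lambda>j. trig1 (k j))(i := deriv (trig1 (k i)))) x = - (2 * pi * of_int (k i)) * basis (flip i k) x" for x
  proof -
    have "basis (flip i k) x = trig1 (- k i) (x $ i) * (\<Prod>j\<in>UNIV - {i}. trig1 (k j) (x $ j))"
      unfolding basis_def tensor_remove[of _ _ i] by (auto simp: flip_def intro!: arg_cong2[where f="(*)"] prod.cong)
    then show ?thesis unfolding tensor_upd d by simp
  qed
  let ?f = "\<lambda>x. u x * (- (2 * pi * of_int (k i)) * basis (flip i k) x) + g x * basis k x"
  have Lf: "L1_loc (\<lambda>x. u x * basis (flip i k) x)" "L1_loc (\<lambda>x. g x * basis k x)"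
    using L basis_continuous by (auto intro: L1_loc_mult_continuous)
  have "(LINT x:left_open_box 0 1|lebesgue. ?f x) = 0"
    using weak_partial_periodic_integral[OF w per, of "\<lambda>j. trig1 (k j)", OF smooth_trig1 trig1_periodic]
    unfolding t basis_def[symmetric] .
  moreover have "?f \<in> borel_measurable lebesgue"
    using L1_loc_measurable[OF L(1)] L1_loc_measurable[OF L(2)]
      continuous_lebesgue_measurable[OF basis_continuous, of k]
      continuous_lebesgue_measurable[OF basis_continuous, of "flip i k"]
    by (intro borel_measurable_add borel_measurable_times borel_measurable_const) auto
  ultimately have "(\<integral>x. ?f x \<partial>cell) = 0"
    by (subst integral_cell_eq[OF _ _ AE_unit_cell_iff(2)]) auto
  moreover have "(\<integral>x. ?f x \<partial>cell) = (\<integral>x. - (2 * pi * of_int (k i)) * (u x * basis (flip i k) x) + g x * basis k x \<partial>cell)"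
    by (simp add: algebra_simps)
  moreover have "\<dots> = - (2 * pi * of_int (k i)) * coef u (flip i k) + coef g k"
    unfolding coef_def using Lf[THEN L1_loc_integrable_cell] by simp
  ultimately show ?thesis by simp
qed

lemma cell_integration_by_parts:
  fixes f g :: "real ^ 'n::finite \<Rightarrow> real"
  assumes d: "directional_deriv i f f'" "directional_deriv i g g'"
    and c: "continuous_on UNIV f" "continuous_on UNIV f'" "continuous_on UNIV g" "continuous_on UNIV g'"
    and p: "\<And>j x. f (x + axis j 1) = f x" "\<And>j x. g (x + axis j 1) = g x"
  shows "(\<integral>x. f' x * g x \<partial>cell) = - (\<integral>x. f x * g' x \<partial>cell)"
proof -
  have "has_weak_partial i (\<lambda>x. f x * g x) (\<lambda>x. f' x * g x + f x * g' x)"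
    using directional_deriv_mult[OF d] c by (intro has_weak_partial_classical continuous_intros)
  moreover have "periodic_ae (\<lambda>x. f x * g x)"
    unfolding periodic_ae_def by (simp add: p)
  ultimately have "(\<integral>x. f' x * g x + f x * g' x \<partial>cell) = 0" by (rule weak_partial_integral_0)
  moreover have "integrable cell (\<lambda>x. f' x * g x)" "integrable cell (\<lambda>x. f x * g' x)"
    using c by (auto intro!: L1_loc_integrable_cell L1_loc_continuous continuous_intros)
  ultimately show ?thesis by simp
qed

lemma trig_poly_integration_by_parts:
  assumes "trig_poly f" "trig_poly g"
  shows "(\<integral>x. D i f x * g x \<partial>cell) = - (\<integral>x. f x * D i g x \<partial>cell)"
  using assms by (intro cell_integration_by_parts)
    (auto intro: trig_poly_directional_deriv trig_poly_continuous trig_poly_D trig_poly_shift)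

lemma coef_sum_basis:
  assumes "finite K"
  shows "coef (\<lambda>x. \<Sum>k\<in>K. c k * basis k x) l = (if l \<in> K then c l else 0)"
proof -
  have "coef (\<lambda>x. \<Sum>k\<in>K. c k * basis k x) l = (\<integral>x. (\<Sum>k\<in>K. c k * (basis k x * basis l x)) \<partial>cell)"
    by (simp add: coef_def sum_distrib_right mult.assoc)
  also have "\<dots> = (\<Sum>k\<in>K. c k * (\<integral>x. basis k x * basis l x \<partial>cell))"
    by (subst Bochner_Integration.integral_sum)
      (auto intro!: square_integrable_mult trig_poly_square_integrable trig_poly.basis)
  also have "\<dots> = (\<Sum>k\<in>K. if k = l then c k else 0)"
    by (intro sum.cong) (auto simp: basis_orthonormal)
  finally show ?thesis using assms by simp
qed

lemma trig_poly_basis_sum: "trig_poly (\<lambda>x. \<Sum>k\<in>K. c k * basis k x)"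
  by (intro trig_poly_sum trig_poly.scale trig_poly.basis)

lemma trig_poly_representation:
  "trig_poly f \<Longrightarrow> \<exists>K. finite K \<and> f = (\<lambda>x. \<Sum>k\<in>K. coef f k * basis k x) \<and> (\<forall>k. k \<notin> K \<longrightarrow> coef f k = 0)"
proof -
  assume "trig_poly f"
  then have "\<exists>K c. finite K \<and> f = (\<lambda>x. \<Sum>k\<in>K. c k * basis k x)"
  proof (induction rule: trig_poly.induct)
    case (basis k)
    show ?case by (intro exI[of _ "{k}"] exI[of _ "\<lambda>_. 1"]) simp
  next
    case (add f g)
    then obtain K c L d where K: "finite K" "f = (\<lambda>x. \<Sum>k\<in>K. c k * basis k x)"
      and L: "finite L" "g = (\<lambda>x. \<Sum>k\<in>L. d k * basis k x)" by blast
    define c' where "c' k = (if k \<in> K then c k else 0)" for k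
    define d' where "d' k = (if k \<in> L then d k else 0)" for k
    have "f x = (\<Sum>k\<in>K \<union> L. c' k * basis k x)" for x
      unfolding K(2) c'_def using K(1) L(1) by (intro sum.mono_neutral_cong_left) auto
    moreover have "g x = (\<Sum>k\<in>K \<union> L. d' k * basis k x)" for x
      unfolding L(2) d'_def using K(1) L(1) by (intro sum.mono_neutral_cong_left) auto
    ultimately show ?case using K(1) L(1)
      by (intro exI[of _ "K \<union> L"] exI[of _ "\<lambda>k. c' k + d' k"]) (auto simp: distrib_right sum.distrib)
  next
    case (scale f a)
    then obtain K c where K: "finite K" "f = (\<lambda>x. \<Sum>k\<in>K. c k * basis k x)" by blast
    then show ?case
      by (intro exI[of _ K] exI[of _ "\<lambda>k. a * c k"]) (auto simp: sum_distrib_left mult.assoc)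
  qed
  then obtain K c where K: "finite K" "f = (\<lambda>x. \<Sum>k\<in>K. c k * basis k x)" by blast
  then have "coef f l = (if l \<in> K then c l else 0)" for l using coef_sum_basis[OF K(1), of c l] by simp
  with K show ?thesis by (intro exI[of _ K]) auto
qed

subsection \<open>Energy identities\<close>

definition Lap :: "(real ^ 'n::finite \<Rightarrow> real) \<Rightarrow> real ^ 'n \<Rightarrow> real" where
  "Lap f x = (\<Sum>i\<in>UNIV. D i (D i f) x)"

definition freq :: "('n::finite \<Rightarrow> int) \<Rightarrow> real" where
  "freq k = 4 * pi\<^sup>2 * (\<Sum>i\<in>UNIV. (of_int (k i))\<^sup>2)"

lemma freq_nonneg: "freq k \<ge> 0"
  by (simp add: freq_def sum_nonneg)

lemma freq_ge: "k \<noteq> (\<lambda>_. 0) \<Longrightarrow> freq k \<ge> 4 * pi\<^sup>2"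
proof -
  assume "k \<noteq> (\<lambda>_. 0)"
  then obtain i where i: "k i \<noteq> 0" by auto
  have "1 \<le> (real_of_int (k i))\<^sup>2"
    using i by (metis abs_square_le_1 linorder_le_cases of_int_abs of_int_1_le_iff one_le_power power2_abs zero_less_abs_iff int_one_le_iff_zero_less)
  also have "\<dots> \<le> (\<Sum>i\<in>UNIV. (of_int (k i))\<^sup>2)" by (rule member_le_sum) auto
  finally show ?thesis by (simp add: freq_def)
qed

lemma freq_0 [simp]: "freq (\<lambda>_. 0) = 0"
  by (simp add: freq_def)

lemma trig_poly_Lap: "trig_poly f \<Longrightarrow> trig_poly (Lap f)"
  unfolding Lap_def[abs_def] by (intro trig_poly_sum trig_poly_D)

lemma Lap_add: "trig_poly f \<Longrightarrow> trig_poly g \<Longrightarrow> Lap (\<lambda>x. f x + g x) = (\<lambda>x. Lap f x + Lap g x)"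
  unfolding Lap_def[abs_def] by (simp add: D_add trig_poly_D sum.distrib)

lemma Lap_scale: "trig_poly f \<Longrightarrow> Lap (\<lambda>x. c * f x) = (\<lambda>x. c * Lap f x)"
  unfolding Lap_def[abs_def] by (simp add: D_scale trig_poly_D sum_distrib_left)

lemma Lap_basis: "Lap (basis k) = (\<lambda>x. - freq k * basis k x)"
  unfolding Lap_def[abs_def] D_basis D_scale[OF trig_poly.basis] freq_def
  by (simp add: fun_eq_iff sum_distrib_left sum_distrib_right power2_eq_square sum_negf[symmetric] mult_ac)

lemma coef_add:
  "square_integrable cell f \<Longrightarrow> square_integrable cell g \<Longrightarrow> coef (\<lambda>x. f x + g x) k = coef f k + coef g k"
  unfolding coef_def using trig_poly_square_integrable[OF trig_poly.basis, of k]
  by (simp add: distrib_right)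

lemma coef_scale: "coef (\<lambda>x. c * f x) k = c * coef f k"
  unfolding coef_def by (simp add: mult.assoc)

lemma coef_diff:
  "square_integrable cell f \<Longrightarrow> square_integrable cell g \<Longrightarrow> coef (\<lambda>x. f x - g x) k = coef f k - coef g k"
  using coef_add[of f "\<lambda>x. (-1) * g x" k] coef_scale[of "-1" g k] by simp

lemma coef_const: "coef (\<lambda>x :: real ^ 'n::finite. c) k = (if k = (\<lambda>_. 0) then c else 0)"
  using coef_scale[of c "basis (\<lambda>_. 0)" k] basis_orthonormal[of "\<lambda>_. 0 :: int" k]
  by (auto simp: basis_0 coef_def)

lemma coef_0: "coef f (\<lambda>_. 0) = (\<integral>x. f x \<partial>cell)"
  by (simp add: coef_def basis_0)

lemma coef_Lap: 
  assumes "trig_poly f"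
  shows "coef (Lap f) k = - freq k * coef f k"
  using assms
proof (induction rule: trig_poly.induct)
  case (basis l)
  have "coef (basis l) k = (if l = k then 1 else 0)" unfolding coef_def by (rule basis_orthonormal)
  then show ?case unfolding Lap_basis coef_scale by auto
next
  case (add f g)
  then show ?case
    by (simp add: Lap_add coef_add trig_poly_square_integrable trig_poly_Lap distrib_left)
next
  case (scale f c)
  then show ?case by (simp add: Lap_scale coef_scale)
qed

lemma inner_basis_sum:
  assumes "square_integrable cell f" "finite K"
  shows "(\<integral>x. f x * (\<Sum>k\<in>K. c k * basis k x) \<partial>cell) = (\<Sum>k\<in>K. c k * coef f k)"
proof -
  have i: "integrable cell (\<lambda>x. f x * basis k x)" for k
    using assms(1) trig_poly_square_integrable[OF trig_poly.basis] by (rule square_integrable_mult)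
  have "(\<integral>x. f x * (\<Sum>k\<in>K. c k * basis k x) \<partial>cell) = (\<integral>x. (\<Sum>k\<in>K. c k * (f x * basis k x)) \<partial>cell)"
    by (simp add: sum_distrib_left mult_ac)
  also have "\<dots> = (\<Sum>k\<in>K. c k * coef f k)"
    using i by (subst Bochner_Integration.integral_sum) (auto simp: coef_def)
  finally show ?thesis .
qed

lemma trig_poly_parseval:
  assumes "trig_poly f" "trig_poly g"
  shows "\<exists>K. finite K \<and> (\<forall>L. finite L \<longrightarrow> K \<subseteq> L \<longrightarrow> (\<integral>x. f x * g x \<partial>cell) = (\<Sum>k\<in>L. coef f k * coef g k))"
proof -
  obtain K where K: "finite K" "g = (\<lambda>x. \<Sum>k\<in>K. coef g k * basis k x)" "\<And>k. k \<notin> K \<Longrightarrow> coef g k = 0"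
    using trig_poly_representation[OF assms(2)] by blast
  have "(\<integral>x. f x * g x \<partial>cell) = (\<Sum>k\<in>L. coef f k * coef g k)" if "finite L" "K \<subseteq> L" for L
  proof -
    have "(\<Sum>k\<in>K. coef g k * basis k x) = g x" for x using fun_cong[OF K(2), of x] by simp
    then have "(\<integral>x. f x * g x \<partial>cell) = (\<Sum>k\<in>K. coef g k * coef f k)"
      using inner_basis_sum[OF trig_poly_square_integrable[OF assms(1)] K(1), of "coef g"] by simp
    also have "\<dots> = (\<Sum>k\<in>L. coef g k * coef f k)"
      using that K(3) by (intro sum.mono_neutral_left) auto
    finally show ?thesis by (simp add: mult.commute)
  qed
  then show ?thesis using K(1) by blast
qed

lemma trig_poly_norm_mono:
  assumes "trig_poly f" "trig_poly g" "\<And>k. \<bar>coef f k\<bar> \<le> \<bar>coef g k\<bar>"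
  shows "L2norm cell f \<le> L2norm cell g"
proof -
  obtain K where K: "finite K" "\<And>L. finite L \<Longrightarrow> K \<subseteq> L \<Longrightarrow> (\<integral>x. f x * f x \<partial>cell) = (\<Sum>k\<in>L. coef f k * coef f k)"
    using trig_poly_parseval[OF assms(1,1)] by blast
  obtain L where L: "finite L" "\<And>M. finite M \<Longrightarrow> L \<subseteq> M \<Longrightarrow> (\<integral>x. g x * g x \<partial>cell) = (\<Sum>k\<in>M. coef g k * coef g k)"
    using trig_poly_parseval[OF assms(2,2)] by blast
  have "(\<Sum>k\<in>K \<union> L. coef f k * coef f k) \<le> (\<Sum>k\<in>K \<union> L. coef g k * coef g k)"
    using assms(3) by (intro sum_mono) (metis abs_le_square_iff power2_eq_square)
  then show ?thesis
    using K(1) K(2)[of "K \<union> L"] L(1) L(2)[of "K \<union> L"] by (simp add: L2norm_def power2_eq_square)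
qed

lemma L2norm_power2_inner: "(L2norm M f)\<^sup>2 = (\<integral>x. f x * f x \<partial>M)"
  using L2norm_power2[of M f] by (simp add: power2_eq_square)

lemma gradient_energy:
  assumes "trig_poly f"
  shows "(\<Sum>i\<in>UNIV. (L2norm cell (D i f))\<^sup>2) = - (\<integral>x. f x * Lap f x \<partial>cell)"
proof -
  have "(L2norm cell (D i f))\<^sup>2 = - (\<integral>x. f x * D i (D i f) x \<partial>cell)" for i
    using trig_poly_integration_by_parts[OF assms trig_poly_D[OF assms], of i i]
    by (simp add: L2norm_power2_inner)
  moreover have "(\<integral>x. f x * Lap f x \<partial>cell) = (\<Sum>i\<in>UNIV. \<integral>x. f x * D i (D i f) x \<partial>cell)"
    unfolding Lap_def sum_distrib_left
    by (rule Bochner_Integration.integral_sum)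
      (intro square_integrable_mult trig_poly_square_integrable trig_poly_D assms)
  ultimately show ?thesis by (simp add: sum_negf)
qed

lemma hessian_energy:
  assumes f: "trig_poly f"
  shows "(\<Sum>i\<in>UNIV. \<Sum>j\<in>UNIV. (L2norm cell (D i (D j f)))\<^sup>2) = (L2norm cell (Lap f))\<^sup>2"
proof -
  have "(L2norm cell (D i (D j f)))\<^sup>2 = (\<integral>x. D i (D i f) x * D j (D j f) x \<partial>cell)" for i j
  proof -
    have "(L2norm cell (D i (D j f)))\<^sup>2 = (\<integral>x. D i (D j f) x * D i (D j f) x \<partial>cell)"
      by (rule L2norm_power2_inner)
    also have "\<dots> = - (\<integral>x. D i (D i (D j f)) x * D j f x \<partial>cell)"
      using trig_poly_integration_by_parts[of "D j f" "D i (D j f)" i] f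
      by (simp add: trig_poly_D mult.commute)
    also have "D i (D i (D j f)) = D j (D i (D i f))"
      using D_commute[OF f, of i j] D_commute[OF trig_poly_D[OF f], of i j i] by simp
    also have "- (\<integral>x. D j (D i (D i f)) x * D j f x \<partial>cell) = (\<integral>x. D i (D i f) x * D j (D j f) x \<partial>cell)"
      using trig_poly_integration_by_parts[of "D i (D i f)" "D j f" j] f by (simp add: trig_poly_D)
    finally show ?thesis .
  qed
  moreover have "(L2norm cell (Lap f))\<^sup>2 = (\<Sum>i\<in>UNIV. \<Sum>j\<in>UNIV. \<integral>x. D i (D i f) x * D j (D j f) x \<partial>cell)"
  proof -
    have i: "integrable cell (\<lambda>x. D i (D i f) x * D j (D j f) x)" for i j
      by (intro square_integrable_mult trig_poly_square_integrable trig_poly_D f)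
    have "(L2norm cell (Lap f))\<^sup>2 = (\<integral>x. (\<Sum>i\<in>UNIV. \<Sum>j\<in>UNIV. D i (D i f) x * D j (D j f) x) \<partial>cell)"
      unfolding L2norm_power2_inner Lap_def sum_product ..
    also have "\<dots> = (\<Sum>i\<in>UNIV. \<Sum>j\<in>UNIV. \<integral>x. D i (D i f) x * D j (D j f) x \<partial>cell)"
      using i by (simp add: Bochner_Integration.integral_sum)
    finally show ?thesis .
  qed
  ultimately show ?thesis by simp
qed

lemma poincare:
  fixes f :: "real ^ 'n::finite \<Rightarrow> real"
  assumes f: "trig_poly f"
  shows "(\<Sum>i\<in>UNIV. (L2norm cell (D i f))\<^sup>2) \<le> (L2norm cell (Lap f))\<^sup>2 / (4 * pi\<^sup>2)"
proof -
  have L: "trig_poly (Lap f)" by (rule trig_poly_Lap[OF f])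
  obtain K1 where K1: "finite K1" "\<And>L. finite L \<Longrightarrow> K1 \<subseteq> L \<Longrightarrow> (\<integral>x. f x * Lap f x \<partial>cell) = (\<Sum>k\<in>L. coef f k * coef (Lap f) k)"
    using trig_poly_parseval[OF f L] by blast
  obtain K2 where K2: "finite K2" "\<And>M. finite M \<Longrightarrow> K2 \<subseteq> M \<Longrightarrow> (\<integral>x. Lap f x * Lap f x \<partial>cell) = (\<Sum>k\<in>M. coef (Lap f) k * coef (Lap f) k)"
    using trig_poly_parseval[OF L L] by blast
  let ?K = "K1 \<union> K2"
  have "(\<Sum>i\<in>UNIV. (L2norm cell (D i f))\<^sup>2) = (\<Sum>k\<in>?K. freq k * (coef f k)\<^sup>2)"
    using K1(1) K2(1) K1(2)[of ?K]
    unfolding gradient_energy[OF f] by (simp add: coef_Lap[OF f] power2_eq_square sum_negf mult_ac)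
  also have "\<dots> \<le> (\<Sum>k\<in>?K. (freq k)\<^sup>2 * (coef f k)\<^sup>2 / (4 * pi\<^sup>2))"
  proof (rule sum_mono)
    fix k :: "'n \<Rightarrow> int"
    have "freq k * (4 * pi\<^sup>2) \<le> (freq k)\<^sup>2"
      using freq_ge[of k] freq_nonneg[of k] by (cases "k = (\<lambda>_. 0)") (auto simp: power2_eq_square intro: mult_left_mono)
    then have "freq k * (4 * pi\<^sup>2) * (coef f k)\<^sup>2 \<le> (freq k)\<^sup>2 * (coef f k)\<^sup>2" by (rule mult_right_mono) simp
    then show "freq k * (coef f k)\<^sup>2 \<le> (freq k)\<^sup>2 * (coef f k)\<^sup>2 / (4 * pi\<^sup>2)" by (simp add: field_simps)
  qed
  also have "\<dots> = (L2norm cell (Lap f))\<^sup>2 / (4 * pi\<^sup>2)"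
    using K1(1) K2(1) K2(2)[of ?K] unfolding L2norm_power2_inner
    by (simp add: coef_Lap[OF f] power2_eq_square sum_divide_distrib mult_ac)
  finally show ?thesis .
qed

definition resolvent_op :: "real \<Rightarrow> real \<Rightarrow> (real ^ 'n::finite \<Rightarrow> real) \<Rightarrow> real ^ 'n \<Rightarrow> real" where
  "resolvent_op \<mu> \<nu> f x = \<mu> * f x + \<nu> * coef f (\<lambda>_. 0) - Lap f x"

lemma trig_poly_resolvent_op: "trig_poly f \<Longrightarrow> trig_poly (resolvent_op \<mu> \<nu> f)"
  unfolding resolvent_op_def[abs_def]
  by (intro trig_poly_diff trig_poly.add trig_poly.scale trig_poly_const trig_poly_Lap)

lemma resolvent_op_surj:
  assumes "\<mu> \<ge> 0" "\<nu> \<ge> 0" "\<mu> + \<nu> > 0" "trig_poly g"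
  shows "\<exists>f. trig_poly f \<and> resolvent_op \<mu> \<nu> f = g"
  using assms(4)
proof (induction rule: trig_poly.induct)
  case (basis k)
  define m where "m = \<mu> + (if k = (\<lambda>_. 0) then \<nu> else 0) + freq k"
  have m: "m > 0"
    using assms freq_ge[of k] by (auto simp: m_def intro!: add_nonneg_pos less_le_trans[of 0 "4 * pi\<^sup>2" "freq k"])
  have c: "coef (basis k) (\<lambda>_. 0) = (if k = (\<lambda>_. 0) then 1 else 0)" unfolding coef_def by (rule basis_orthonormal)
  have "resolvent_op \<mu> \<nu> (\<lambda>x. r * basis k x) x = r * (m * basis k x)" for x :: "real ^ 'a" and r
    unfolding resolvent_op_def coef_scale Lap_scale[OF trig_poly.basis] Lap_basis c m_def
    by (cases "k = (\<lambda>_. 0)") (simp_all only: basis_0 if_True if_False freq_0, simp_all add: algebra_simps)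
  then have "resolvent_op \<mu> \<nu> (\<lambda>x. (1 / m) * basis k x) = basis k"
    using m by (intro ext) (simp only: mult.assoc[symmetric], simp)
  then show ?case using trig_poly.scale[OF trig_poly.basis] by blast
next
  case (add f g)
  then obtain f' g' where "trig_poly f'" "resolvent_op \<mu> \<nu> f' = f" "trig_poly g'" "resolvent_op \<mu> \<nu> g' = g" by blast
  then have "resolvent_op \<mu> \<nu> (\<lambda>x. f' x + g' x) = (\<lambda>x. f x + g x)"
    by (auto simp: resolvent_op_def fun_eq_iff Lap_add coef_add trig_poly_square_integrable algebra_simps)
  then show ?case using \<open>trig_poly f'\<close> \<open>trig_poly g'\<close> trig_poly.add by blast
next
  case (scale f c)
  then obtain f' where "trig_poly f'" "resolvent_op \<mu> \<nu> f' = f" by blast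
  have "resolvent_op \<mu> \<nu> (\<lambda>x. c * f' x) x = c * resolvent_op \<mu> \<nu> f' x" for x
    using \<open>trig_poly f'\<close> by (simp add: resolvent_op_def Lap_scale coef_scale algebra_simps)
  then have "resolvent_op \<mu> \<nu> (\<lambda>x. c * f' x) = (\<lambda>x. c * f x)"
    using \<open>resolvent_op \<mu> \<nu> f' = f\<close> by auto
  then show ?case using \<open>trig_poly f'\<close> trig_poly.scale by blast
qed

lemma Lap_le_resolvent_op:
  assumes "\<mu> \<ge> 0" "\<nu> \<ge> 0" "trig_poly f"
  shows "L2norm cell (Lap f) \<le> L2norm cell (resolvent_op \<mu> \<nu> f)"
proof (rule trig_poly_norm_mono[OF trig_poly_Lap trig_poly_resolvent_op, OF assms(3,3)])
  fix k
  have sq: "square_integrable cell f" "square_integrable cell (Lap f)"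
    using assms(3) by (auto intro: trig_poly_square_integrable trig_poly_Lap)
  have "coef (resolvent_op \<mu> \<nu> f) k = (\<mu> + (if k = (\<lambda>_. 0) then \<nu> else 0) + freq k) * coef f k"
    unfolding resolvent_op_def[abs_def] using sq
    by (subst coef_diff, simp, simp, subst coef_add)
      (simp_all add: coef_scale coef_const coef_Lap[OF assms(3)] algebra_simps)
  moreover have "freq k \<le> \<mu> + (if k = (\<lambda>_. 0) then \<nu> else 0) + freq k" using assms by auto
  ultimately show "\<bar>coef (Lap f) k\<bar> \<le> \<bar>coef (resolvent_op \<mu> \<nu> f) k\<bar>"
    using freq_nonneg[of k] by (simp add: coef_Lap[OF assms(3)] abs_mult mult_right_mono)
qed

subsection \<open>Completeness of the trigonometric basis\<close>

definition trig_poly1 :: "(real \<Rightarrow> real) \<Rightarrow> bool" where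
  "trig_poly1 f \<longleftrightarrow> (\<exists>A c. finite A \<and> f = (\<lambda>t. \<Sum>a\<in>A. c a * trig1 a t))"

lemma trig_poly1_add:
  assumes "trig_poly1 f" "trig_poly1 g" shows "trig_poly1 (\<lambda>t. f t + g t)"
proof -
  obtain A c B d where A: "finite A" "f = (\<lambda>t. \<Sum>a\<in>A. c a * trig1 a t)"
    and B: "finite B" "g = (\<lambda>t. \<Sum>a\<in>B. d a * trig1 a t)" using assms by (auto simp: trig_poly1_def)
  define c' where "c' a = (if a \<in> A then c a else 0)" for a
  define d' where "d' a = (if a \<in> B then d a else 0)" for a
  have "f t = (\<Sum>a\<in>A \<union> B. c' a * trig1 a t)" for t
    unfolding A(2) c'_def using A(1) B(1) by (intro sum.mono_neutral_cong_left) auto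
  moreover have "g t = (\<Sum>a\<in>A \<union> B. d' a * trig1 a t)" for t
    unfolding B(2) d'_def using A(1) B(1) by (intro sum.mono_neutral_cong_left) auto
  ultimately show ?thesis unfolding trig_poly1_def using A(1) B(1)
    by (intro exI[of _ "A \<union> B"] exI[of _ "\<lambda>a. c' a + d' a"]) (auto simp: distrib_right sum.distrib)
qed

lemma trig_poly1_scale:
  assumes "trig_poly1 f" shows "trig_poly1 (\<lambda>t. r * f t)"
proof -
  obtain A c where A: "finite A" "f = (\<lambda>t. \<Sum>a\<in>A. c a * trig1 a t)" using assms by (auto simp: trig_poly1_def)
  then show ?thesis unfolding trig_poly1_def
    by (intro exI[of _ A] exI[of _ "\<lambda>a. r * c a"]) (auto simp: sum_distrib_left mult.assoc)
qed

lemma trig_poly1_trig1: "trig_poly1 (trig1 m)"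
  unfolding trig_poly1_def by (intro exI[of _ "{m}"] exI[of _ "\<lambda>_. 1"]) simp

lemma trig_poly1_const: "trig_poly1 (\<lambda>t. r)"
  using trig_poly1_scale[OF trig_poly1_trig1, of r 0] by (simp add: trig1_def)

lemma trig_poly1_sum: "(\<And>i. i \<in> I \<Longrightarrow> trig_poly1 (f i)) \<Longrightarrow> trig_poly1 (\<lambda>t. \<Sum>i\<in>I. f i t)"
  by (induction I rule: infinite_finite_induct) (auto intro: trig_poly1_const trig_poly1_add)

lemma trig_poly1_cos: "trig_poly1 (\<lambda>t. cos (2 * pi * of_int m * t))"
proof (cases "m = 0")
  case False
  have "(\<lambda>t. cos (2 * pi * of_int m * t)) = (\<lambda>t. (1 / sqrt 2) * trig1 \<bar>m\<bar> t)"
    using False by (cases "m > 0") (auto simp: trig1_def fun_eq_iff)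
  then show ?thesis by (simp only: trig_poly1_scale[OF trig_poly1_trig1])
qed (simp add: trig_poly1_const)

lemma trig_poly1_sin: "trig_poly1 (\<lambda>t. sin (2 * pi * of_int m * t))"
proof -
  consider "m = 0" | "m > 0" | "m < 0" by linarith
  then show ?thesis
  proof cases
    case 1 then show ?thesis by (simp add: trig_poly1_const)
  next
    case 2
    then have "(\<lambda>t. sin (2 * pi * of_int m * t)) = (\<lambda>t. (1 / sqrt 2) * trig1 (- m) t)"
      by (auto simp: trig1_def fun_eq_iff)
    then show ?thesis by (simp only: trig_poly1_scale[OF trig_poly1_trig1])
  next
    case 3
    then have "(\<lambda>t. sin (2 * pi * of_int m * t)) = (\<lambda>t. (- 1 / sqrt 2) * trig1 m t)"
      by (auto simp: trig1_def fun_eq_iff)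
    then show ?thesis by (simp only: trig_poly1_scale[OF trig_poly1_trig1])
  qed
qed

lemma trig_poly1_trig1_mult: "trig_poly1 (\<lambda>t. trig1 m t * trig1 n t)"
proof -
  have cc: "trig_poly1 (\<lambda>t. cos (2 * pi * of_int a * t) * cos (2 * pi * of_int b * t))" for a b
  proof -
    have "cos (2 * pi * of_int a * t) * cos (2 * pi * of_int b * t) =
      (1/2) * (cos (2 * pi * of_int (a - b) * t) + cos (2 * pi * of_int (a + b) * t))" for t
      by (simp add: distrib_left distrib_right left_diff_distrib right_diff_distrib cos_add cos_diff)
    then show ?thesis by (simp only:) (intro trig_poly1_scale trig_poly1_add trig_poly1_cos)
  qed
  have ss: "trig_poly1 (\<lambda>t. sin (2 * pi * of_int a * t) * sin (2 * pi * of_int b * t))" for a b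
  proof -
    have "sin (2 * pi * of_int a * t) * sin (2 * pi * of_int b * t) =
      (1/2) * (cos (2 * pi * of_int (a - b) * t) + (-1) * cos (2 * pi * of_int (a + b) * t))" for t
      by (simp add: distrib_left distrib_right left_diff_distrib right_diff_distrib cos_add cos_diff)
    then show ?thesis by (simp only:) (intro trig_poly1_scale trig_poly1_add trig_poly1_cos)
  qed
  have sc: "trig_poly1 (\<lambda>t. sin (2 * pi * of_int a * t) * cos (2 * pi * of_int b * t))" for a b
  proof -
    have "sin (2 * pi * of_int a * t) * cos (2 * pi * of_int b * t) =
      (1/2) * (sin (2 * pi * of_int (a + b) * t) + sin (2 * pi * of_int (a - b) * t))" for t
      by (simp add: distrib_left distrib_right left_diff_distrib right_diff_distrib sin_add sin_diff)
    then show ?thesis by (simp only:) (intro trig_poly1_scale trig_poly1_add trig_poly1_sin)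
  qed
  have cs: "trig_poly1 (\<lambda>t. cos (2 * pi * of_int b * t) * sin (2 * pi * of_int a * t))" for a b
    using sc by (simp add: mult.commute)
  have tp: "trig1 a = (\<lambda>t. sqrt 2 * cos (2 * pi * of_int a * t))" if "a > 0" for a
    using that by (simp add: trig1_def[abs_def])
  have tn: "trig1 a = (\<lambda>t. sqrt 2 * sin (2 * pi * of_int (- a) * t))" if "a < 0" for a
    using that by (simp add: trig1_def[abs_def])
  have t0: "trig1 0 = (\<lambda>t. 1)" by (simp add: trig1_def[abs_def])
  have r: "(sqrt 2 * x) * (sqrt 2 * y) = 2 * (x * y)" for x y :: real by simp
  consider "m = 0" | "n = 0" | "m > 0" "n > 0" | "m > 0" "n < 0" | "m < 0" "n > 0" | "m < 0" "n < 0" by linarith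
  then show ?thesis
  proof cases
    case 1 then show ?thesis using trig_poly1_trig1[of n] by (simp add: t0)
  next
    case 2 then show ?thesis using trig_poly1_trig1[of m] by (simp add: t0)
  next
    case 3 then show ?thesis unfolding tp[OF 3(1)] tp[OF 3(2)] r by (intro trig_poly1_scale cc)
  next
    case 4 then show ?thesis unfolding tp[OF 4(1)] tn[OF 4(2)] r by (intro trig_poly1_scale cs)
  next
    case 5 then show ?thesis unfolding tn[OF 5(1)] tp[OF 5(2)] r by (intro trig_poly1_scale sc)
  next
    case 6 then show ?thesis unfolding tn[OF 6(1)] tn[OF 6(2)] r by (intro trig_poly1_scale ss)
  qed
qed

lemma trig_poly1_mult:
  assumes "trig_poly1 f" "trig_poly1 g" shows "trig_poly1 (\<lambda>t. f t * g t)"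
proof -
  obtain A c B d where A: "f = (\<lambda>t. \<Sum>a\<in>A. c a * trig1 a t)"
    and B: "g = (\<lambda>t. \<Sum>a\<in>B. d a * trig1 a t)" using assms by (auto simp: trig_poly1_def)
  have "(\<lambda>t. f t * g t) = (\<lambda>t. \<Sum>a\<in>A. \<Sum>b\<in>B. (c a * d b) * (trig1 a t * trig1 b t))"
    unfolding A B sum_product by (simp add: mult_ac)
  then show ?thesis by (simp only:) (intro trig_poly1_sum trig_poly1_scale trig_poly1_trig1_mult)
qed

lemma trig_poly1_real_polynomial:
  fixes Q :: "real \<Rightarrow> real"
  assumes "real_polynomial_function Q" "trig_poly1 p"
  shows "trig_poly1 (\<lambda>t. Q (p t))"
  using assms(1)
proof (induction rule: real_polynomial_function.induct)
  case (linear f)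
  then obtain c where "f = (\<lambda>x. x * c)" using real_bounded_linear by auto
  then show ?case using trig_poly1_scale[OF assms(2), of c] by (simp add: mult.commute)
qed (auto intro: trig_poly1_const trig_poly1_add trig_poly1_mult)

lemma trig_poly_tensor:
  fixes F :: "'n::finite \<Rightarrow> real \<Rightarrow> real"
  assumes "\<And>j. trig_poly1 (F j)"
  shows "trig_poly (tensor F)"
proof -
  have "\<forall>j. \<exists>A c. finite A \<and> F j = (\<lambda>t. \<Sum>a\<in>A. c a * trig1 a t)" using assms by (simp add: trig_poly1_def)
  then obtain A c where A: "\<And>j. finite (A j)" "\<And>j. F j = (\<lambda>t. \<Sum>a\<in>A j. c j a * trig1 a t)" by metis
  have "tensor F x = (\<Sum>k\<in>PiE UNIV A. (\<Prod>j\<in>UNIV. c j (k j)) * basis k x)" for x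
    unfolding tensor_def A(2) basis_def using A(1)
    by (subst prod_sum_PiE) (auto simp: prod.distrib)
  then have "tensor F = (\<lambda>x. \<Sum>k\<in>PiE UNIV A. (\<Prod>j\<in>UNIV. c j (k j)) * basis k x)" by auto
  then show ?thesis using trig_poly_basis_sum by simp
qed

text \<open>Polynomials in \<open>cos (2\<pi>(t - m)) - cos (\<pi>(b - a))\<close>, \<open>m = (a + b)/2\<close>, approximate the
  indicator of its positivity set boundedly.\<close>

lemma trig_poly1_indicator:
  assumes "0 \<le> a" "a < b" "b \<le> 1"
  shows "\<exists>P. (\<forall>N. trig_poly1 (P N)) \<and> (\<forall>N t. \<bar>P N t\<bar> \<le> 2) \<and>
    (\<forall>t. 0 < t \<longrightarrow> t < 1 \<longrightarrow> t \<noteq> b \<longrightarrow> (\<lambda>N::nat. P N t) \<longlonglongrightarrow> indicator {a<..b} t)"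
proof -
  define m w where "m = (a + b) / 2" and "w = (b - a) / 2"
  define p where "p t = cos (2 * pi * (t - m)) - cos (2 * pi * w)" for t
  define ramp where "ramp N s = max 0 (min 1 (real N * s))" for N s
  have "\<exists>Q. real_polynomial_function Q \<and> (\<forall>s\<in>{-2..2::real}. \<bar>ramp N s - Q s\<bar> < 1 / real (Suc N))" for N
  proof -
    have "continuous_on {-2..2} (ramp N)" unfolding ramp_def[abs_def] by (intro continuous_intros)
    from Stone_Weierstrass_real_polynomial_function[OF compact_Icc this, of "1 / real (Suc N)"]
    obtain g where "real_polynomial_function g" "\<And>x. x \<in> {-2..2} \<Longrightarrow> \<bar>ramp N x - g x\<bar> < 1 / real (Suc N)" by auto
    then show ?thesis by blast
  qed
  then obtain Q where Q: "\<And>N. real_polynomial_function (Q N)"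
    "\<And>N s. s \<in> {-2..2} \<Longrightarrow> \<bar>ramp N s - Q N s\<bar> < 1 / real (Suc N)" by metis
  have p2: "p t \<in> {-2..2}" for t
    using cos_le_one[of "2 * pi * (t - m)"] cos_ge_minus_one[of "2 * pi * (t - m)"]
      cos_le_one[of "2 * pi * w"] cos_ge_minus_one[of "2 * pi * w"] by (simp only: p_def atLeastAtMost_iff) linarith
  have "trig_poly1 p"
  proof -
    have "p = (\<lambda>t. (cos (2 * pi * m) * cos (2 * pi * of_int 1 * t) + sin (2 * pi * m) * sin (2 * pi * of_int 1 * t)) + - cos (2 * pi * w))"
      by (simp add: p_def[abs_def] right_diff_distrib cos_diff mult_ac)
    then show ?thesis
      by (simp only:) (intro trig_poly1_add trig_poly1_scale trig_poly1_const trig_poly1_cos trig_poly1_sin)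
  qed
  then have tp: "trig_poly1 (\<lambda>t. Q N (p t))" for N using trig_poly1_real_polynomial[OF Q(1)] by blast
  have bd: "\<bar>Q N (p t)\<bar> \<le> 2" for N t
  proof -
    have "\<bar>ramp N (p t)\<bar> \<le> 1" by (auto simp: ramp_def)
    moreover have "1 / real (Suc N) \<le> 1" by simp
    ultimately show ?thesis using Q(2)[OF p2, of N t] by linarith
  qed
  have lim: "(\<lambda>N. Q N s) \<longlonglongrightarrow> (if s > 0 then 1 else 0)" if "s \<in> {-2..2}" for s
  proof -
    have r: "(\<lambda>N. ramp N s) \<longlonglongrightarrow> (if s > 0 then 1 else 0)"
    proof (cases "s > 0")
      case True
      obtain M where M: "1 / s < real M" using reals_Archimedean2 by blast
      have "ramp N s = 1" if "N \<ge> M" for N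
      proof -
        have "1 / s \<le> real N" using M that by simp
        then have "1 \<le> real N * s" using True by (simp add: divide_le_eq)
        then show ?thesis by (simp add: ramp_def)
      qed
      then show ?thesis using True by (intro tendsto_eventually eventually_sequentiallyI[of M]) auto
    next
      case False
      then have "real N * s \<le> 0" for N by (intro mult_nonneg_nonpos) auto
      then have "ramp N s = 0" for N unfolding ramp_def by (metis max.absorb1 min.coboundedI2)
      then show ?thesis using False by simp
    qed
    have "(\<lambda>N. Q N s - ramp N s) \<longlonglongrightarrow> 0"
    proof (rule Lim_null_comparison)
      show "(\<lambda>N. 1 / real (Suc N)) \<longlonglongrightarrow> 0" by (rule LIMSEQ_Suc[OF lim_1_over_n])
      show "\<forall>\<^sub>F N in sequentially. norm (Q N s - ramp N s) \<le> 1 / real (Suc N)"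
        using Q(2)[OF that] by (intro always_eventually) (auto simp: abs_minus_commute less_imp_le)
    qed
    from tendsto_add[OF this r] show ?thesis by simp
  qed
  have sgn: "(p t > 0) = (t \<in> {a<..b})" if t: "0 < t" "t < 1" "t \<noteq> b" for t
  proof -
    define d where "d = \<bar>t - m\<bar>"
    have w: "0 < w" "w \<le> 1/2" using assms by (auto simp: w_def)
    have d: "0 \<le> d" "d < 1 - w" 
    proof -
      have "m + w = b" "m - w = a" by (simp_all add: m_def w_def field_simps)
      then have "t - m < 1 - w" "m - t < 1 - w" using assms t by linarith+
      then show "0 \<le> d" "d < 1 - w" by (simp_all add: d_def abs_less_iff)
    qed
    have cd: "cos (2 * pi * (t - m)) = cos (2 * pi * d)"
    proof (cases "t \<ge> m")
      case False
      then have "2 * pi * d = - (2 * pi * (t - m))" by (simp add: d_def algebra_simps)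
      then show ?thesis by (simp only: cos_minus)
    qed (simp add: d_def)
    have "(p t > 0) = (d < w)"
    proof (cases "d \<le> 1/2")
      case True
      have "(cos (2 * pi * w) < cos (2 * pi * d)) = (2 * pi * d < 2 * pi * w)"
        by (rule cos_mono_less_eq) (use True d w in auto)
      then show ?thesis unfolding p_def cd by simp
    next
      case False
      have "cos (2 * pi * d) = cos (2 * pi - 2 * pi * (1 - d))" by (simp add: algebra_simps)
      also have "\<dots> = cos (2 * pi * (1 - d))" using cos_2pi_minus by blast
      finally have c: "cos (2 * pi * d) = cos (2 * pi * (1 - d))" .
      have "(cos (2 * pi * w) < cos (2 * pi * (1 - d))) = (2 * pi * (1 - d) < 2 * pi * w)"
        by (rule cos_mono_less_eq) (use False d w in auto)
      then show ?thesis unfolding p_def cd c using False d w by simp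
    qed
    also have "\<dots> = (t \<in> {a<..b})"
    proof -
      have "m + w = b" "m - w = a" by (simp_all add: m_def w_def field_simps)
      then have "(d < w) = (a < t \<and> t < b)" unfolding d_def abs_less_iff by linarith
      then show ?thesis using t(3) by auto
    qed
    finally show ?thesis .
  qed
  show ?thesis
  proof (intro exI[of _ "\<lambda>N t. Q N (p t)"] conjI allI impI)
    show "trig_poly1 (\<lambda>t. Q N (p t))" for N by (rule tp)
    show "\<bar>Q N (p t)\<bar> \<le> 2" for N t by (rule bd)
    fix t :: real assume "0 < t" "t < 1" "t \<noteq> b"
    then show "(\<lambda>N. Q N (p t)) \<longlonglongrightarrow> indicator {a<..b} t"
      using lim[OF p2, of t] sgn[of t] by (simp add: indicator_def of_bool_def)
  qed
qed

lemma inner_trig_poly_eq_0: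
  assumes "square_integrable cell f" "\<And>k. coef f k = 0" "trig_poly g"
  shows "(\<integral>x. f x * g x \<partial>cell) = 0"
proof -
  obtain K where K: "finite K" "g = (\<lambda>x. \<Sum>k\<in>K. coef g k * basis k x)"
    using trig_poly_representation[OF assms(3)] by blast
  have "(\<Sum>k\<in>K. coef g k * basis k x) = g x" for x using fun_cong[OF K(2), of x] by simp
  then show ?thesis using inner_basis_sum[OF assms(1) K(1), of "coef g"] assms(2) by simp
qed

lemma trig_basis_complete:
  fixes f :: "real ^ 'n::finite \<Rightarrow> real"
  assumes f: "square_integrable cell f" and 0: "\<And>k. coef f k = 0"
  shows "AE x in cell. f x = 0"
proof -
  define w where "w x = indicator unit_cell x * f x" for x
  have fi: "integrable cell f" by (rule cell.square_integrable_integrable[OF f])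
  then have wi: "integrable lebesgue w" unfolding w_def by (simp add: integrable_restrict_space)
  have "AE x in lebesgue. w x = 0"
  proof (rule AE_eq_0_if_left_open_boxes)
    show "set_integrable lebesgue (left_open_box a b) w" for a b
      unfolding set_integrable_def by (rule integrable_mult_indicator[OF left_open_box_lebesgue wi])
    fix a b :: "real^'n" assume ab: "\<And>i. a $ i \<le> b $ i"
    define a' b' where "a' i = max 0 (a $ i)" and "b' i = min 1 (b $ i)" for i
    show "(LINT x:left_open_box a b|lebesgue. w x) = 0"
    proof (cases "\<forall>i. a' i < b' i")
      case False
      then obtain i where "b' i \<le> a' i" by (auto simp: not_less)
      then have eq: "(\<lambda>x. indicator (left_open_box a b) x *\<^sub>R w x) = (\<lambda>x. 0)"
      proof -
        have "x \<notin> left_open_box a b \<inter> unit_cell" for x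
        proof
          assume "x \<in> left_open_box a b \<inter> unit_cell"
          then have "a' i < x $ i" "x $ i \<le> b' i"
            by (auto simp: left_open_box_def unit_cell_def a'_def b'_def less_imp_le)
          then show False using \<open>b' i \<le> a' i\<close> by linarith
        qed
        then show ?thesis by (auto simp: w_def indicator_def fun_eq_iff)
      qed
      show ?thesis unfolding set_lebesgue_integral_def eq by simp
    next
      case True
      then have "\<forall>i. \<exists>P. (\<forall>N. trig_poly1 (P N)) \<and> (\<forall>N t. \<bar>P N t\<bar> \<le> 2) \<and>
        (\<forall>t. 0 < t \<longrightarrow> t < 1 \<longrightarrow> t \<noteq> b' i \<longrightarrow> (\<lambda>N::nat. P N t) \<longlonglongrightarrow> indicator {a' i<..b' i} t)"
        by (intro allI trig_poly1_indicator) (auto simp: a'_def b'_def)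
      then obtain P where P: "\<And>i N. trig_poly1 (P i N)" "\<And>i N t. \<bar>P i N t\<bar> \<le> 2"
        "\<And>i t. 0 < t \<Longrightarrow> t < 1 \<Longrightarrow> t \<noteq> b' i \<Longrightarrow> (\<lambda>N::nat. P i N t) \<longlonglongrightarrow> indicator {a' i<..b' i} t" by metis
      define G where "G N = tensor (\<lambda>i. P i N)" for N
      have tG: "trig_poly (G N)" for N unfolding G_def using P(1) by (rule trig_poly_tensor)
      have "(\<lambda>N. \<integral>x. f x * G N x \<partial>cell) \<longlonglongrightarrow> (\<integral>x. f x * indicator (left_open_box a b) x \<partial>cell)"
      proof (rule integral_dominated_convergence)
        show "integrable cell (\<lambda>x. 2 ^ CARD('n) * \<bar>f x\<bar>)" using fi by simp
        show "(\<lambda>x. f x * indicator (left_open_box a b) x) \<in> borel_measurable cell"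
          using borel_measurable_integrable[OF fi] cell_measurable[OF borel_measurable_indicator[OF left_open_box_lebesgue[of a b]]]
          by (intro borel_measurable_times)
        show "(\<lambda>x. f x * G N x) \<in> borel_measurable cell" for N
          using borel_measurable_integrable[OF fi] cell_measurable[OF trig_poly_measurable[OF tG]]
          by (intro borel_measurable_times)
        have "\<bar>G N x\<bar> \<le> 2 ^ CARD('n)" for N x
        proof -
          have "\<bar>G N x\<bar> \<le> (\<Prod>j\<in>(UNIV :: 'n set). 2)"
            unfolding G_def tensor_def abs_prod by (intro prod_mono) (use P(2) in auto)
          then show ?thesis by simp
        qed
        then show "AE x in cell. norm (f x * G N x) \<le> 2 ^ CARD('n) * \<bar>f x\<bar>" for N
          by (intro AE_I2) (auto simp: abs_mult mult.commute intro: mult_left_mono)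
        have "AE x in lebesgue. \<forall>i. (x :: real^'n) $ i \<noteq> b' i"
          by (subst AE_all_countable) (intro allI AE_component_neq)
        then have "AE x in cell. \<forall>i. (x :: real^'n) $ i \<noteq> b' i" by (rule AE_cell_if_lebesgue)
        moreover have "AE x in cell. (x :: real^'n) \<in> unit_cell" by (rule AE_I2) simp
        ultimately show "AE x in cell. (\<lambda>N. f x * G N x) \<longlonglongrightarrow> f x * indicator (left_open_box a b) x"
        proof eventually_elim
          case (elim x)
          have "(\<lambda>N. G N x) \<longlonglongrightarrow> (\<Prod>i\<in>UNIV. indicator {a' i<..b' i} (x $ i))"
            unfolding G_def tensor_def using elim by (intro tendsto_prod P(3)) (auto simp: unit_cell_def)
          moreover have "(\<Prod>i\<in>UNIV. indicator {a' i<..b' i} (x $ i)) = (indicator (left_open_box a b) x :: real)"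
          proof -
            have "(x \<in> left_open_box a b) = (\<forall>i. x $ i \<in> {a' i<..b' i})"
              using elim(2) by (auto simp: left_open_box_def unit_cell_def a'_def b'_def less_imp_le)
            then show ?thesis by (auto simp: indicator_def prod_zero_iff)
          qed
          ultimately show ?case by (intro tendsto_mult tendsto_const) simp
        qed
      qed
      then have "(\<integral>x. f x * indicator (left_open_box a b) x \<partial>cell) = 0"
        using inner_trig_poly_eq_0[OF f 0 tG] by (simp add: LIMSEQ_const_iff)
      moreover have "(\<integral>x. f x * indicator (left_open_box a b) x \<partial>cell) = (LINT x:left_open_box a b|lebesgue. w x)"
        unfolding set_lebesgue_integral_def w_def
        by (subst integral_restrict_space) (auto simp: mult_ac)
      ultimately show ?thesis by simp
    qed
  qed
  then show ?thesis
    by (subst AE_restrict_space_iff) (auto simp: w_def elim: eventually_mono)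
qed

subsection \<open>Fejer means\<close>

lemma square_integrable_basis: "square_integrable cell (basis k)"
  by (intro trig_poly_square_integrable trig_poly.basis)

lemma norm_basis_sum:
  assumes "finite K"
  shows "(L2norm cell (\<lambda>x. \<Sum>k\<in>K. c k * basis k x))\<^sup>2 = (\<Sum>k\<in>K. (c k)\<^sup>2)"
proof -
  have "(L2norm cell (\<lambda>x. \<Sum>k\<in>K. c k * basis k x))\<^sup>2 = (\<Sum>k\<in>K. c k * coef (\<lambda>x. \<Sum>k\<in>K. c k * basis k x) k)"
    unfolding L2norm_power2_inner
    by (rule inner_basis_sum[OF trig_poly_square_integrable[OF trig_poly_basis_sum] assms])
  then show ?thesis using assms by (simp add: coef_sum_basis power2_eq_square)
qed

lemma bessel:
  assumes f: "square_integrable cell f" and K: "finite K"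
  shows "(\<Sum>k\<in>K. (coef f k)\<^sup>2) \<le> (L2norm cell f)\<^sup>2"
proof -
  let ?S = "\<lambda>x. \<Sum>k\<in>K. - coef f k * basis k x"
  have "0 \<le> (L2norm cell (\<lambda>x. f x + ?S x))\<^sup>2" by simp
  also have "\<dots> = (L2norm cell f)\<^sup>2 + 2 * (\<integral>x. f x * ?S x \<partial>cell) + (L2norm cell ?S)\<^sup>2"
    by (rule L2_inner_add_power2[OF f trig_poly_square_integrable[OF trig_poly_basis_sum]])
  also have "(\<integral>x. f x * ?S x \<partial>cell) = - (\<Sum>k\<in>K. (coef f k)\<^sup>2)"
    by (subst inner_basis_sum[OF f K]) (simp add: power2_eq_square sum_negf)
  also have "(L2norm cell ?S)\<^sup>2 = (\<Sum>k\<in>K. (coef f k)\<^sup>2)"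
    by (subst norm_basis_sum[OF K]) simp
  finally show ?thesis by simp
qed

definition cube :: "nat \<Rightarrow> ('n::finite \<Rightarrow> int) set" where
  "cube N = PiE UNIV (\<lambda>_. {- int N..int N})"

lemma finite_cube [simp]: "finite (cube N)"
  unfolding cube_def by (intro finite_PiE) auto

lemma mem_cube: "k \<in> cube N \<longleftrightarrow> (\<forall>j. \<bar>k j\<bar> \<le> int N)"
proof -
  have "k \<in> cube N \<longleftrightarrow> (\<forall>j. k j \<in> {- int N..int N})" by (simp add: cube_def PiE_def Pi_def)
  moreover have "\<bar>k j\<bar> \<le> int N \<longleftrightarrow> k j \<in> {- int N..int N}" for j by auto
  ultimately show ?thesis by simp
qed

lemma cube_mono: "M \<le> N \<Longrightarrow> cube M \<subseteq> cube N"
  unfolding mem_cube subset_iff by (metis of_nat_mono order_trans)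

lemma mem_cube_ex: "\<exists>N. k \<in> cube N"
proof -
  have "\<bar>k j\<bar> \<le> int (\<Sum>j\<in>UNIV. nat \<bar>k j\<bar>)" for j
  proof -
    have "nat \<bar>k j\<bar> \<le> (\<Sum>j\<in>UNIV. nat \<bar>k j\<bar>)" by (rule member_le_sum) auto
    then show ?thesis by linarith
  qed
  then show ?thesis unfolding mem_cube by blast
qed

definition fourier_sum :: "nat \<Rightarrow> (real ^ 'n::finite \<Rightarrow> real) \<Rightarrow> real ^ 'n \<Rightarrow> real" where
  "fourier_sum N f x = (\<Sum>k\<in>cube N. coef f k * basis k x)"

lemma trig_poly_fourier_sum: "trig_poly (fourier_sum N f)"
  unfolding fourier_sum_def[abs_def] by (rule trig_poly_basis_sum)

lemma coef_fourier_sum: "coef (fourier_sum N f) k = (if k \<in> cube N then coef f k else 0)"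
  unfolding fourier_sum_def[abs_def] by (rule coef_sum_basis) simp

lemma coef_tendsto:
  assumes "\<And>n. square_integrable cell (u n)" "square_integrable cell v"
    "(\<lambda>n. L2norm cell (\<lambda>x. u n x - v x)) \<longlonglongrightarrow> 0"
  shows "(\<lambda>n. coef (u n) k) \<longlonglongrightarrow> coef v k"
  unfolding coef_def by (rule L2_inner_tendsto[OF assms(1,2) square_integrable_basis assms(3)])

lemma fourier_sum_tendsto:
  fixes f :: "real ^ 'n::finite \<Rightarrow> real"
  assumes f: "square_integrable cell f"
  shows "(\<lambda>N. L2norm cell (\<lambda>x. fourier_sum N f x - f x)) \<longlonglongrightarrow> 0"
proof -
  let ?S = "\<lambda>N. fourier_sum N f"
  define a where "a N = (\<Sum>k\<in>(cube N :: ('n \<Rightarrow> int) set). (coef f k)\<^sup>2)" for N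
  have sq: "square_integrable cell (?S N)" for N by (intro trig_poly_square_integrable trig_poly_fourier_sum)
  have inc: "incseq a" unfolding a_def by (intro incseq_SucI sum_mono2 cube_mono) auto
  have bd: "a N \<le> (L2norm cell f)\<^sup>2" for N unfolding a_def by (rule bessel[OF f finite_cube])
  obtain l where l: "a \<longlonglongrightarrow> l" using incseq_convergent[OF inc] bd by blast
  have Sd: "(L2norm cell (\<lambda>x. ?S M x - ?S N x))\<^sup>2 = a M - a N" if "N \<le> M" for M N
  proof -
    have sub: "cube N \<subseteq> (cube M :: ('n \<Rightarrow> int) set)" using that by (rule cube_mono)
    have "?S M x - ?S N x = (\<Sum>k\<in>cube M - cube N. coef f k * basis k x)" for x
      unfolding fourier_sum_def using sub by (simp add: sum_diff)
    then have "(L2norm cell (\<lambda>x. ?S M x - ?S N x))\<^sup>2 = (\<Sum>k\<in>cube M - cube N. (coef f k)\<^sup>2)"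
      by (simp add: norm_basis_sum)
    also have "\<dots> = a M - a N" unfolding a_def using sub by (simp add: sum_diff)
    finally show ?thesis .
  qed
  have "\<exists>r. square_integrable cell (\<lambda>x. lim (\<lambda>k. ?S (r k) x)) \<and>
    (\<lambda>n. L2norm cell (\<lambda>x. ?S n x - lim (\<lambda>k. ?S (r k) x))) \<longlonglongrightarrow> 0"
  proof (rule cell.L2_complete[OF sq])
    fix e :: real assume e: "e > 0"
    then have "e\<^sup>2 > 0" by simp
    then obtain N where N: "\<And>m n. m \<ge> N \<Longrightarrow> n \<ge> N \<Longrightarrow> \<bar>a m - a n\<bar> < e\<^sup>2"
      using LIMSEQ_imp_Cauchy[OF l] unfolding Cauchy_def dist_real_def by blast
    have le: "L2norm cell (\<lambda>x. ?S m x - ?S n x) < e" if "n \<ge> N" "n \<le> m" for m n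
    proof (rule power2_less_imp_less)
      show "(L2norm cell (\<lambda>x. ?S m x - ?S n x))\<^sup>2 < e\<^sup>2"
        using N[of m n] that unfolding Sd[OF that(2)] by auto
    qed (use e in simp)
    show "\<exists>N. \<forall>m\<ge>N. \<forall>n\<ge>N. L2norm cell (\<lambda>x. ?S m x - ?S n x) < e"
    proof (intro exI[of _ N] allI impI)
      fix m n assume "m \<ge> N" "n \<ge> N"
      then show "L2norm cell (\<lambda>x. ?S m x - ?S n x) < e"
        using le[of n m] le[of m n] L2norm_minus_commute[of cell "?S m" "?S n"] by (cases "n \<le> m") auto
    qed
  qed
  then obtain r where r: "square_integrable cell (\<lambda>x. lim (\<lambda>k. ?S (r k) x))"
    "(\<lambda>n. L2norm cell (\<lambda>x. ?S n x - lim (\<lambda>k. ?S (r k) x))) \<longlonglongrightarrow> 0" by blast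
  define g where "g x = lim (\<lambda>k. ?S (r k) x)" for x
  have g: "square_integrable cell g" and gl: "(\<lambda>n. L2norm cell (\<lambda>x. ?S n x - g x)) \<longlonglongrightarrow> 0"
    using r by (simp_all add: g_def[abs_def])
  have "coef g k = coef f k" for k
  proof -
    obtain N where N: "k \<in> cube N" using mem_cube_ex by blast
    have "k \<in> cube n" if "n \<ge> N" for n using N cube_mono[OF that] by blast
    then have "(\<lambda>n. coef (?S n) k) \<longlonglongrightarrow> coef f k"
      by (intro tendsto_eventually eventually_sequentiallyI[of N]) (simp add: coef_fourier_sum)
    with coef_tendsto[OF sq g gl] show ?thesis by (rule LIMSEQ_unique)
  qed
  then have "AE x in cell. f x - g x = 0"
    using f g by (intro trig_basis_complete) (auto simp: coef_diff)
  then have ae: "AE x in cell. ?S N x - f x = ?S N x - g x" for N by (auto elim: eventually_mono)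
  have "L2norm cell (\<lambda>x. ?S N x - f x) = L2norm cell (\<lambda>x. ?S N x - g x)" for N
    using f g sq by (intro L2norm_cong_AE[OF ae] square_integrable_measurable) auto
  then show ?thesis using gl by simp
qed

definition weight :: "nat \<Rightarrow> int \<Rightarrow> real" where
  "weight N m = 1 - of_int \<bar>m\<bar> / (real N + 1)"

definition fejer :: "nat \<Rightarrow> (real ^ 'n::finite \<Rightarrow> real) \<Rightarrow> real ^ 'n \<Rightarrow> real" where
  "fejer N f x = (\<Sum>k\<in>cube N. (\<Prod>j\<in>UNIV. weight N (k j)) * coef f k * basis k x)"

lemma weight_bounds: "\<bar>m\<bar> \<le> int N \<Longrightarrow> 0 \<le> weight N m" "weight N m \<le> 1"
proof -
  assume "\<bar>m\<bar> \<le> int N"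
  then have "real_of_int \<bar>m\<bar> \<le> real N + 1" by linarith
  then show "0 \<le> weight N m" by (simp add: weight_def)
qed (simp add: weight_def)

lemma weight_prod_bounds:
  assumes "k \<in> cube N"
  shows "0 \<le> (\<Prod>j\<in>UNIV. weight N (k j))" "(\<Prod>j\<in>UNIV. weight N (k j)) \<le> 1"
  using assms by (auto simp: mem_cube weight_bounds intro!: prod_nonneg prod_le_1)

lemma weight_tendsto:
  fixes k :: "'a::finite \<Rightarrow> int"
  shows "(\<lambda>N. \<Prod>j\<in>UNIV. weight N (k j)) \<longlonglongrightarrow> 1"
proof -
  have w: "(\<lambda>N. weight N m) \<longlonglongrightarrow> 1 - 0" for m
  proof -
    have "(\<lambda>N. of_int \<bar>m\<bar> * inverse (real (Suc N))) \<longlonglongrightarrow> of_int \<bar>m\<bar> * 0"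
      by (intro tendsto_mult tendsto_const LIMSEQ_inverse_real_of_nat)
    then show ?thesis unfolding weight_def
      by (intro tendsto_diff tendsto_const) (simp add: divide_inverse add.commute)
  qed
  have "(\<lambda>N. \<Prod>j\<in>UNIV. weight N (k j)) \<longlonglongrightarrow> (\<Prod>j\<in>(UNIV :: 'a set). 1 - 0)"
    by (rule tendsto_prod) (rule w)
  then show ?thesis by simp
qed

lemma trig_poly_fejer: "trig_poly (fejer N f)"
  unfolding fejer_def[abs_def] by (rule trig_poly_basis_sum)

lemma fejer_norm_le:
  fixes f :: "real ^ 'n::finite \<Rightarrow> real"
  assumes "square_integrable cell f" shows "L2norm cell (fejer N f) \<le> L2norm cell f"
proof (rule power2_le_imp_le)
  have "(L2norm cell (fejer N f))\<^sup>2 = (\<Sum>k\<in>cube N. ((\<Prod>j\<in>UNIV. weight N (k j)) * coef f k)\<^sup>2)"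
    unfolding fejer_def[abs_def] by (rule norm_basis_sum) simp
  also have "\<dots> \<le> (\<Sum>k\<in>cube N. (coef f k)\<^sup>2)"
  proof (rule sum_mono)
    fix k :: "'n \<Rightarrow> int" assume "k \<in> cube N"
    then have "((\<Prod>j\<in>UNIV. weight N (k j)))\<^sup>2 \<le> 1\<^sup>2" by (intro power_mono weight_prod_bounds)
    then show "((\<Prod>j\<in>UNIV. weight N (k j)) * coef f k)\<^sup>2 \<le> (coef f k)\<^sup>2"
      by (simp add: power_mult_distrib mult_left_le_one_le)
  qed
  also have "\<dots> \<le> (L2norm cell f)\<^sup>2" by (rule bessel[OF assms]) simp
  finally show "(L2norm cell (fejer N f))\<^sup>2 \<le> (L2norm cell f)\<^sup>2" .
qed simp

lemma fejer_diff:
  assumes "square_integrable cell f" "square_integrable cell g"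
  shows "fejer N (\<lambda>x. f x - g x) x = fejer N f x - fejer N g x"
  unfolding fejer_def coef_diff[OF assms] by (simp add: algebra_simps sum_subtractf)

lemma fejer_add:
  assumes "square_integrable cell f" "square_integrable cell g"
  shows "fejer N (\<lambda>x. f x + g x) x = fejer N f x + fejer N g x"
  unfolding fejer_def coef_add[OF assms] by (simp add: algebra_simps sum.distrib)

lemma fejer_scale: "fejer N (\<lambda>x. c * f x) x = c * fejer N f x"
  unfolding fejer_def coef_scale by (simp add: sum_distrib_left mult_ac)

lemma fejer_sum:
  assumes "\<And>i. i \<in> I \<Longrightarrow> square_integrable cell (f i)"
  shows "fejer N (\<lambda>x. \<Sum>i\<in>I. f i x) x = (\<Sum>i\<in>I. fejer N (f i) x)"
  using assms
proof (induction I rule: infinite_finite_induct)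
  case (insert i I)
  then show ?case by (simp add: fejer_add)
qed (auto simp: fejer_def coef_def)

lemma fejer_tendsto:
  fixes f :: "real ^ 'n::finite \<Rightarrow> real"
  assumes f: "square_integrable cell f"
  shows "(\<lambda>N. L2norm cell (\<lambda>x. fejer N f x - f x)) \<longlonglongrightarrow> 0"
proof (rule LIMSEQ_I)
  fix e :: real assume e: "e > 0"
  let ?W = "\<lambda>N k. \<Prod>j\<in>(UNIV :: 'n set). weight N (k j)"
  obtain M where M: "L2norm cell (\<lambda>x. fourier_sum M f x - f x) < e / 3"
    using LIMSEQ_D[OF fourier_sum_tendsto[OF f], of "e / 3"] e by auto
  let ?g = "fourier_sum M f"
  have g: "square_integrable cell ?g" by (intro trig_poly_square_integrable trig_poly_fourier_sum)
  have fj: "square_integrable cell (fejer N h)" for N h by (intro trig_poly_square_integrable trig_poly_fejer)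
  have "(\<lambda>N. \<Sum>k\<in>cube M. ((?W N k - 1) * coef f k)\<^sup>2) \<longlonglongrightarrow> (\<Sum>k\<in>(cube M :: ('n \<Rightarrow> int) set). ((1 - 1) * coef f k)\<^sup>2)"
    by (intro tendsto_intros weight_tendsto)
  then have "\<forall>\<^sub>F N in sequentially. (\<Sum>k\<in>cube M. ((?W N k - 1) * coef f k)\<^sup>2) < (e/3)\<^sup>2"
    by (rule order_tendstoD) (use e in simp)
  then obtain N0 where N0: "\<And>N. N \<ge> N0 \<Longrightarrow> (\<Sum>k\<in>cube M. ((?W N k - 1) * coef f k)\<^sup>2) < (e/3)\<^sup>2"
    by (auto simp: eventually_sequentially)
  show "\<exists>no. \<forall>n\<ge>no. norm (L2norm cell (\<lambda>x. fejer n f x - f x) - 0) < e"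
  proof (intro exI[of _ "max M N0"] allI impI)
    fix N assume N: "N \<ge> max M N0"
    have cs: "cube M \<subseteq> (cube N :: ('n \<Rightarrow> int) set)" using N by (intro cube_mono) auto
    have "fejer N ?g x - ?g x = (\<Sum>k\<in>cube M. ((?W N k - 1) * coef f k) * basis k x)" for x
    proof -
      have "fejer N ?g x = (\<Sum>k\<in>cube M. ?W N k * coef f k * basis k x)"
        unfolding fejer_def coef_fourier_sum using cs by (intro sum.mono_neutral_cong_right) auto
      then show ?thesis unfolding fourier_sum_def by (simp add: sum_subtractf algebra_simps)
    qed
    then have "(L2norm cell (\<lambda>x. fejer N ?g x - ?g x))\<^sup>2 < (e/3)\<^sup>2"
      using N0[of N] N by (simp add: norm_basis_sum)
    then have 2: "L2norm cell (\<lambda>x. fejer N ?g x - ?g x) < e / 3" by (rule power2_less_imp_less) (use e in simp)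
    have "L2norm cell (\<lambda>x. fejer N f x - fejer N ?g x) = L2norm cell (fejer N (\<lambda>x. f x - ?g x))"
      by (simp add: fejer_diff[OF f g, abs_def] fejer_diff[OF f g])
    also have "\<dots> \<le> L2norm cell (\<lambda>x. f x - ?g x)" using f g by (intro fejer_norm_le) simp
    finally have 1: "L2norm cell (\<lambda>x. fejer N f x - fejer N ?g x) < e / 3"
      using M by (simp add: L2norm_minus_commute[of _ f])
    have "L2norm cell (\<lambda>x. fejer N f x - f x) \<le> L2norm cell (\<lambda>x. fejer N f x - fejer N ?g x) + L2norm cell (\<lambda>x. fejer N ?g x - f x)"
      by (rule L2norm_triangle_diff[OF fj fj f])
    also have "L2norm cell (\<lambda>x. fejer N ?g x - f x) \<le> L2norm cell (\<lambda>x. fejer N ?g x - ?g x) + L2norm cell (\<lambda>x. ?g x - f x)"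
      by (rule L2norm_triangle_diff[OF fj g f])
    finally show "norm (L2norm cell (\<lambda>x. fejer N f x - f x) - 0) < e" using 1 2 M by simp
  qed
qed

lemma fejer_kernel1_nonneg:
  "0 \<le> (\<Sum>m\<in>{- int N..int N}. weight N m * (trig1 m s * trig1 m t))"
proof -
  define g where "g m = trig1 m s * trig1 m t" for m
  define \<theta> where "\<theta> = 2 * pi * (s - t)"
  have g0: "g 0 = 1" by (simp add: g_def trig1_def)
  have gm: "g (int n) + g (- int n) = 2 * cos (real n * \<theta>)" if "n > 0" for n
  proof -
    have "real n * \<theta> = 2 * pi * real n * s - 2 * pi * real n * t" by (simp add: \<theta>_def algebra_simps)
    moreover have r: "sqrt 2 * x * (sqrt 2 * y) = 2 * (x * y)" for x y :: real by simp
    ultimately show ?thesis using that by (simp add: g_def trig1_def cos_diff r)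
  qed
  have step: "{- int (Suc n)..int (Suc n)} = insert (int (Suc n)) (insert (- int (Suc n)) {- int n..int n})" for n
    by auto
  have sumS: "(\<Sum>m\<in>{- int (Suc n)..int (Suc n)}. h m) = h (int (Suc n)) + h (- int (Suc n)) + (\<Sum>m\<in>{- int n..int n}. h m)"
    for n and h :: "int \<Rightarrow> real" unfolding step by (subst sum.insert; simp)+
  have dir: "(\<Sum>m\<in>{- int n..int n}. g m) = 1 + 2 * (\<Sum>m\<in>{1..n}. cos (real m * \<theta>))" for n
  proof (induction n)
    case 0 then show ?case by (simp add: g0)
  next
    case (Suc n)
    then show ?case unfolding sumS using gm[of "Suc n"] by simp
  qed
  define C where "C n = (\<Sum>j\<le>n. cos (real j * \<theta>))" for n
  define S where "S n = (\<Sum>j\<le>n. sin (real j * \<theta>))" for n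
  have "(\<Sum>m\<in>{- int n..int n}. (real n + 1 - of_int \<bar>m\<bar>) * g m) = (C n)\<^sup>2 + (S n)\<^sup>2" for n
  proof (induction n)
    case 0 then show ?case by (simp add: g0 C_def S_def)
  next
    case (Suc n)
    have "(\<Sum>m\<in>{- int (Suc n)..int (Suc n)}. (real (Suc n) + 1 - of_int \<bar>m\<bar>) * g m)
        = g (int (Suc n)) + g (- int (Suc n)) + (\<Sum>m\<in>{- int n..int n}. (real n + 1 - of_int \<bar>m\<bar>) * g m + g m)"
      unfolding sumS by (simp add: algebra_simps)
    also have "\<dots> = (C n)\<^sup>2 + (S n)\<^sup>2 + (\<Sum>m\<in>{- int (Suc n)..int (Suc n)}. g m)"
      unfolding sumS sum.distrib Suc.IH by simp
    also have "(\<Sum>m\<in>{- int (Suc n)..int (Suc n)}. g m) = 1 + 2 * (\<Sum>m\<in>{1..Suc n}. cos (real m * \<theta>))" by (rule dir)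
    also have "(\<Sum>m\<in>{1..Suc n}. cos (real m * \<theta>)) = (\<Sum>j\<le>n. cos (real (Suc n) * \<theta> - real j * \<theta>))"
      by (rule sum.reindex_bij_witness[of _ "\<lambda>j. Suc n - j" "\<lambda>m. Suc n - m"])
        (auto simp: of_nat_diff left_diff_distrib algebra_simps)
    also have "\<dots> = cos (real (Suc n) * \<theta>) * C n + sin (real (Suc n) * \<theta>) * S n"
      unfolding cos_diff C_def S_def by (simp add: sum.distrib sum_distrib_left)
    also have "(C n)\<^sup>2 + (S n)\<^sup>2 + (1 + 2 * (cos (real (Suc n) * \<theta>) * C n + sin (real (Suc n) * \<theta>) * S n))
       = (C n + cos (real (Suc n) * \<theta>))\<^sup>2 + (S n + sin (real (Suc n) * \<theta>))\<^sup>2"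
      using sin_cos_squared_add[of "real (Suc n) * \<theta>"] by (simp add: power2_sum algebra_simps del: of_nat_Suc)
    also have "\<dots> = (C (Suc n))\<^sup>2 + (S (Suc n))\<^sup>2" by (simp add: C_def S_def)
    finally show ?case .
  qed
  then have "0 \<le> (\<Sum>m\<in>{- int N..int N}. (real N + 1 - of_int \<bar>m\<bar>) * g m) / (real N + 1)" by simp
  also have "\<dots> = (\<Sum>m\<in>{- int N..int N}. weight N m * g m)"
    unfolding sum_divide_distrib weight_def by (intro sum.cong) (auto simp: field_simps)
  finally show ?thesis by (simp add: g_def)
qed

lemma fejer_le:
  fixes f :: "real ^ 'n::finite \<Rightarrow> real"
  assumes f: "square_integrable cell f" and le: "AE x in cell. f x \<le> C"
  shows "fejer N f x \<le> C"
proof -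
  define K where "K y = (\<Sum>k\<in>cube N. ((\<Prod>j\<in>UNIV. weight N (k j)) * basis k x) * basis k y)" for y :: "real^'n"
  have Kp: "K y = (\<Prod>j\<in>UNIV. \<Sum>m\<in>{- int N..int N}. weight N m * (trig1 m (x $ j) * trig1 m (y $ j)))" for y
    unfolding K_def cube_def basis_def tensor_def
    by (subst prod_sum_PiE) (auto simp: prod.distrib mult_ac)
  have K0: "K y \<ge> 0" for y unfolding Kp by (intro prod_nonneg ballI fejer_kernel1_nonneg)
  have Ksq: "square_integrable cell K"
    unfolding K_def[abs_def] by (intro trig_poly_square_integrable trig_poly_basis_sum)
  have fK: "(\<integral>y. h y * K y \<partial>cell) = fejer N h x" if "square_integrable cell h" for h
    unfolding K_def fejer_def by (subst inner_basis_sum[OF that finite_cube]) (simp add: mult_ac)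
  have one: "fejer N (\<lambda>_. C) x = C"
  proof -
    have "fejer N (\<lambda>_. C) x = (\<Sum>k\<in>(cube N :: ('n \<Rightarrow> int) set). if k = (\<lambda>_. 0) then C else 0)"
      unfolding fejer_def coef_const by (intro sum.cong) (auto simp: weight_def basis_0)
    then show ?thesis by (simp add: mem_cube)
  qed
  have "(\<integral>y. f y * K y \<partial>cell) \<le> (\<integral>y. C * K y \<partial>cell)"
  proof (rule integral_mono_AE)
    show "integrable cell (\<lambda>y. f y * K y)" "integrable cell (\<lambda>y. C * K y)"
      using f Ksq cell.square_integrable_integrable[OF Ksq] by auto
    show "AE y in cell. f y * K y \<le> C * K y"
      using le by eventually_elim (intro mult_right_mono K0)
  qed
  then show ?thesis using fK[OF f] fK[OF cell.square_integrable_const] one by simp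
qed

lemma directional_deriv_sum:
  assumes "\<And>k. k \<in> K \<Longrightarrow> directional_deriv i (f k) (f' k)"
  shows "directional_deriv i (\<lambda>x. \<Sum>k\<in>K. f k x) (\<lambda>x. \<Sum>k\<in>K. f' k x)"
  using assms unfolding directional_deriv_def by (auto intro!: DERIV_sum)

lemma D_fejer:
  assumes "has_weak_partial i u g" "periodic_ae u"
  shows "D i (fejer N u) = fejer N g"
proof -
  let ?W = "\<lambda>k. \<Prod>j\<in>UNIV. weight N (k j)"
  have "directional_deriv i (fejer N u) (\<lambda>x. \<Sum>k\<in>cube N. ?W k * coef u k * (- (2 * pi * of_int (k i)) * basis (flip i k) x))"
    unfolding fejer_def[abs_def] by (intro directional_deriv_sum directional_deriv_scale basis_directional_deriv)
  then have "D i (fejer N u) = (\<lambda>x. \<Sum>k\<in>cube N. ?W k * coef u k * (- (2 * pi * of_int (k i)) * basis (flip i k) x))"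
    by (rule directional_deriv_D)
  also have "\<dots> = fejer N g"
  proof
    fix x
    have W: "?W (flip i k) = ?W k" for k
      by (rule prod.cong) (auto simp: flip_def weight_def)
    have c: "flip i k \<in> cube N" if "k \<in> cube N" for k using that by (auto simp: mem_cube flip_def)
    have "fejer N g x = (\<Sum>k\<in>cube N. ?W k * (2 * pi * of_int (k i) * coef u (flip i k)) * basis k x)"
      unfolding fejer_def coef_weak_partial[OF assms] ..
    also have "\<dots> = (\<Sum>k\<in>cube N. ?W k * coef u k * (- (2 * pi * of_int (k i)) * basis (flip i k) x))"
      by (rule sum.reindex_bij_witness[of _ "flip i" "flip i"]) (auto simp: c W)
    finally show "(\<Sum>k\<in>cube N. ?W k * coef u k * (- (2 * pi * of_int (k i)) * basis (flip i k) x)) = fejer N g x" ..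
  qed
  finally show ?thesis .
qed

subsection \<open>Periodic Sobolev functions\<close>

lemma has_weak_partial_cong_AE:
  assumes w: "has_weak_partial i u g" and ae: "AE x in lebesgue. u x = v x" and L: "L1_loc v"
  shows "has_weak_partial i v g"
  unfolding has_weak_partial_def
proof (intro conjI allI impI)
  show "L1_loc v" by (rule L)
  show "L1_loc g" using w by (simp add: has_weak_partial_def)
  fix \<phi> :: "real^'a \<Rightarrow> real" assume t: "test_fun \<phi>"
  then have "C_class 1 \<phi>" unfolding test_fun_def by blast
  then have "continuous_on UNIV (partial_deriv i \<phi>)" by simp
  then have "(LINT x|lebesgue. u x * partial_deriv i \<phi> x) = (LINT x|lebesgue. v x * partial_deriv i \<phi> x)"
    using ae L1_loc_measurable[OF L] w L1_loc_measurable[of u]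
      continuous_lebesgue_measurable[of "partial_deriv i \<phi>"]
    by (intro integral_cong_AE borel_measurable_times) (auto simp: has_weak_partial_def)
  then show "(LINT x|lebesgue. v x * partial_deriv i \<phi> x) = - (LINT x|lebesgue. g x * \<phi> x)"
    using w t by (simp add: has_weak_partial_def)
qed

lemma C_class_shift:
  "C_class k f \<Longrightarrow> C_class k (\<lambda>x. f (x + c))" 
  "C_class (Suc k) f \<Longrightarrow> partial_deriv i (\<lambda>x. f (x + c)) = (\<lambda>x. partial_deriv i f (x + c))"
proof -
  have d: "((\<lambda>x. f (x + c)) has_derivative frechet_derivative f (at (x + c))) (at x)"
    if "\<forall>x. f differentiable (at x)" for f :: "real ^ 'n::finite \<Rightarrow> real" and x c
  proof -
    have "((\<lambda>x. x + c) has_derivative (\<lambda>h. h)) (at x)" by (auto intro!: derivative_eq_intros)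
    from has_derivative_compose[OF this, of f "frechet_derivative f (at (x + c))"]
    show ?thesis using that frechet_derivative_works by blast
  qed
  have p: "partial_deriv i (\<lambda>x. f (x + c)) = (\<lambda>x. partial_deriv i f (x + c))"
    if "\<forall>x. f differentiable (at x)" for f :: "real ^ 'n::finite \<Rightarrow> real" and i c
    unfolding partial_deriv_def using frechet_derivative_at[OF d[OF that]] by metis
  show "C_class (Suc k) f \<Longrightarrow> partial_deriv i (\<lambda>x. f (x + c)) = (\<lambda>x. partial_deriv i f (x + c))"
    by (rule p) simp
  show "C_class k f \<Longrightarrow> C_class k (\<lambda>x. f (x + c))"
  proof (induction k arbitrary: f)
    case 0
    then show ?case by (auto intro!: continuous_intros continuous_on_compose2[of UNIV f])
  next
    case (Suc k)
    then have f: "\<forall>x. f differentiable (at x)" by simp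
    have "(\<lambda>x. f (x + c)) differentiable (at x)" for x using d[OF f] unfolding differentiable_def by blast
    moreover have "C_class k (partial_deriv i (\<lambda>x. f (x + c)))" for i
      unfolding p[OF f] using Suc by simp
    ultimately show ?case by simp
  qed
qed

lemma test_fun_shift:
  assumes "test_fun \<phi>" shows "test_fun (\<lambda>x. \<phi> (x + c))"
  unfolding test_fun_def
proof
  show "\<forall>k. C_class k (\<lambda>x. \<phi> (x + c))" using assms C_class_shift(1) by (auto simp: test_fun_def)
  have "{x. \<phi> (x + c) \<noteq> 0} = (\<lambda>x. - c + x) ` {x. \<phi> x \<noteq> 0}"
    by (auto simp: image_iff intro!: exI[of _ "_ + c"])
  then have "closure {x. \<phi> (x + c) \<noteq> 0} = (\<lambda>x. - c + x) ` closure {x. \<phi> x \<noteq> 0}"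
    by (simp only: closure_translation)
  then show "compact (closure {x. \<phi> (x + c) \<noteq> 0})"
    using assms compact_translation[of "closure {x. \<phi> x \<noteq> 0}" "- c"] by (simp only: test_fun_def)
qed

lemma L1_loc_shift:
  assumes "L1_loc f" shows "L1_loc (\<lambda>x. f (x + c))"
  unfolding L1_loc_def set_integrable_def
proof (intro allI impI)
  fix K :: "(real^'a) set" assume "compact K"
  then have "compact ((\<lambda>x. c + x) ` K)" by (rule compact_translation)
  from integrable_lebesgue_shift[OF L1_locD[OF assms this], of c]
  have "integrable lebesgue (\<lambda>x. indicator ((\<lambda>x. c + x) ` K) (x + c) * f (x + c))" .
  moreover have "indicator ((\<lambda>x. c + x) ` K) (x + c) = (indicator K x :: real)" for x
    by (auto simp: indicator_def image_iff add.commute)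
  ultimately show "integrable lebesgue (\<lambda>x. indicator K x *\<^sub>R f (x + c))" by simp
qed

lemma has_weak_partial_shift:
  assumes w: "has_weak_partial i u g"
  shows "has_weak_partial i (\<lambda>x. u (x + c)) (\<lambda>x. g (x + c))"
  unfolding has_weak_partial_def
proof (intro conjI allI impI)
  have L: "L1_loc u" "L1_loc g" using w by (auto simp: has_weak_partial_def)
  show "L1_loc (\<lambda>x. u (x + c))" by (rule L1_loc_shift[OF L(1)])
  show "L1_loc (\<lambda>x. g (x + c))" by (rule L1_loc_shift[OF L(2)])
  fix \<phi> :: "real^'a \<Rightarrow> real" assume t: "test_fun \<phi>"
  let ?\<psi> = "\<lambda>x. \<phi> (x + - c)"
  have t': "test_fun ?\<psi>" by (rule test_fun_shift[OF t])
  have C: "C_class 1 \<phi>" "C_class 0 \<phi>" using t unfolding test_fun_def by blast+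
  then have c: "continuous_on UNIV (partial_deriv i \<phi>)" "continuous_on UNIV \<phi>" by auto
  have p: "partial_deriv i ?\<psi> = (\<lambda>x. partial_deriv i \<phi> (x + - c))"
    using C(1) C_class_shift(2)[of 0 \<phi> i "- c"] by simp
  have m: "(\<lambda>x. u x * partial_deriv i \<phi> (x + - c)) \<in> borel_measurable lebesgue"
    "(\<lambda>x. g x * \<phi> (x + - c)) \<in> borel_measurable lebesgue"
    by (rule borel_measurable_times[OF L1_loc_measurable[OF L(1)]
          measurable_compose[OF lebesgue_measurable_shift continuous_lebesgue_measurable[OF c(1)]]],
        rule borel_measurable_times[OF L1_loc_measurable[OF L(2)]
          measurable_compose[OF lebesgue_measurable_shift continuous_lebesgue_measurable[OF c(2)]]])
  have "(LINT x|lebesgue. u (x + c) * partial_deriv i \<phi> x) = (LINT x|lebesgue. u x * partial_deriv i \<phi> (x + - c))"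
    using lebesgue_integral_shift[OF m(1), of c] by (simp only: add.assoc add.right_inverse add_0_right)
  also have "\<dots> = - (LINT x|lebesgue. g x * ?\<psi> x)"
    using spec[OF conjunct2[OF conjunct2[OF w[unfolded has_weak_partial_def]]], of ?\<psi>] t' by (simp only: p)
  also have "(LINT x|lebesgue. g x * ?\<psi> x) = (LINT x|lebesgue. g (x + c) * \<phi> x)"
    using lebesgue_integral_shift[OF m(2), of c] by (simp only: add.assoc add.right_inverse add_0_right)
  finally show "(LINT x|lebesgue. u (x + c) * partial_deriv i \<phi> x) = - (LINT x|lebesgue. g (x + c) * \<phi> x)" .
qed

lemma weak_partial_periodic:
  assumes w: "has_weak_partial i u g" and per: "periodic_ae u"
  shows "periodic_ae g"
  unfolding periodic_ae_def
proof
  fix j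
  show "AE x in lebesgue. g (x + axis j 1) = g x"
    using weak_partial_unique[OF has_weak_partial_shift[OF w, of "axis j 1"] w] per
    by (simp add: periodic_ae_def)
qed

lemma has_weak_partial_weak_partial:
  "has_weak_partial i u g \<Longrightarrow> has_weak_partial i u (weak_partial i u)"
  using someI[of "has_weak_partial i u" g] by (simp add: weak_partial_def)

lemma weak_partial_AE_eq:
  assumes "has_weak_partial i u g" shows "AE x in lebesgue. weak_partial i u x = g x"
  by (rule weak_partial_unique[OF has_weak_partial_weak_partial[OF assms] assms]) simp

lemma L2_loc_square_integrable:
  assumes "L2_loc f" shows "square_integrable cell f"
proof -
  have "L1_loc (\<lambda>x. (f x)\<^sup>2)" using assms by (simp add: L2_loc_def L1_loc_def)
  from L1_loc_integrable_cell[OF this] show ?thesis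
    using assms cell_measurable by (auto simp: square_integrable_def L2_loc_def)
qed

lemma H_loc_weak_partial:
  assumes "H_loc (Suc k) u"
  shows "has_weak_partial i u (weak_partial i u) \<and> (\<exists>g. H_loc k g \<and> (AE x in lebesgue. weak_partial i u x = g x))"
proof -
  obtain g where g: "has_weak_partial i u g" "H_loc k g" using assms by auto
  then show ?thesis using has_weak_partial_weak_partial weak_partial_AE_eq by blast
qed

lemma has_weak_partial_L1_loc: "has_weak_partial i u g \<Longrightarrow> L1_loc g"
  by (simp add: has_weak_partial_def)

lemma H2_per_weak_partials:
  fixes \<phi> :: "real ^ 'n::finite \<Rightarrow> real"
  assumes "H2_per \<phi>"
  shows "square_integrable cell \<phi>" "periodic_ae \<phi>"
    "has_weak_partial j \<phi> (weak_partial j \<phi>)" "square_integrable cell (weak_partial j \<phi>)"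
    "periodic_ae (weak_partial j \<phi>)"
    "has_weak_partial i (weak_partial j \<phi>) (weak_partial i (weak_partial j \<phi>))"
    "square_integrable cell (weak_partial i (weak_partial j \<phi>))"
proof -
  have H: "H_loc (Suc (Suc 0)) \<phi>" and per: "periodic_ae \<phi>"
    using assms by (simp_all add: H2_per_def numeral_2_eq_2)
  show "periodic_ae \<phi>" by (rule per)
  show "square_integrable cell \<phi>" using H by (auto intro: L2_loc_square_integrable)
  show w: "has_weak_partial j \<phi> (weak_partial j \<phi>)" using H_loc_weak_partial[OF H] by blast
  show "periodic_ae (weak_partial j \<phi>)" by (rule weak_partial_periodic[OF w per])
  obtain g where g: "H_loc (Suc 0) g" "AE x in lebesgue. weak_partial j \<phi> x = g x"
    using H_loc_weak_partial[OF H] by blast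
  have g': "AE x in lebesgue. g x = weak_partial j \<phi> x" using g(2) by (auto elim: eventually_mono)
  have L: "L1_loc (weak_partial j \<phi>)" using w by (rule has_weak_partial_L1_loc)
  have sq: "square_integrable cell g" using g(1) by (auto intro: L2_loc_square_integrable)
  show "square_integrable cell (weak_partial j \<phi>)"
    by (rule square_integrable_cong_AE[OF sq AE_cell_if_lebesgue[OF g'] cell_measurable[OF L1_loc_measurable[OF L]]])
  obtain h where h: "has_weak_partial i g h" "L2_loc h" using g(1) by auto
  have h': "has_weak_partial i (weak_partial j \<phi>) h" by (rule has_weak_partial_cong_AE[OF h(1) g' L])
  show w2: "has_weak_partial i (weak_partial j \<phi>) (weak_partial i (weak_partial j \<phi>))"
    by (rule has_weak_partial_weak_partial[OF h'])
  have ae: "AE x in lebesgue. h x = weak_partial i (weak_partial j \<phi>) x"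
    using weak_partial_AE_eq[OF h'] by (auto elim: eventually_mono)
  show "square_integrable cell (weak_partial i (weak_partial j \<phi>))"
    by (rule square_integrable_cong_AE[OF L2_loc_square_integrable[OF h(2)] AE_cell_if_lebesgue[OF ae]
          cell_measurable[OF L1_loc_measurable[OF has_weak_partial_L1_loc[OF w2]]]])
qed

lemma trig_poly_L2_loc: "trig_poly f \<Longrightarrow> L2_loc f"
  using L1_loc_continuous[of "\<lambda>x. (f x)\<^sup>2"] trig_poly_continuous[of f UNIV] trig_poly_measurable[of f]
  by (auto simp: L2_loc_def L1_loc_def intro: continuous_intros)

lemma trig_poly_H2_per:
  assumes "trig_poly f" shows "H2_per f"
proof -
  have "H_loc (Suc 0) f" if "trig_poly f" for f :: "real ^ 'a \<Rightarrow> real"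
    using trig_poly_L2_loc[OF that] trig_poly_has_weak_partial[OF that] trig_poly_L2_loc[OF trig_poly_D[OF that]]
    by auto
  then have "H_loc (Suc (Suc 0)) f"
    using trig_poly_L2_loc[OF assms] trig_poly_has_weak_partial[OF assms] trig_poly_D[OF assms] by (auto simp del: H_loc.simps(2) simp: H_loc.simps(2)[of "Suc 0"])
  then show ?thesis using trig_poly_periodic[OF assms] by (simp add: H2_per_def numeral_2_eq_2)
qed

lemma trig_poly_weak_partial:
  assumes f: "trig_poly f"
  shows "AE x in lebesgue. weak_partial j f x = D j f x"
    "AE x in lebesgue. weak_partial i (weak_partial j f) x = D i (D j f) x"
proof -
  have w: "has_weak_partial j f (D j f)" by (rule trig_poly_has_weak_partial[OF f])
  show ae: "AE x in lebesgue. weak_partial j f x = D j f x" by (rule weak_partial_AE_eq[OF w])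
  have ae': "AE x in lebesgue. D j f x = weak_partial j f x" using ae by (auto elim: eventually_mono)
  have "has_weak_partial i (weak_partial j f) (D i (D j f))"
    by (rule has_weak_partial_cong_AE[OF trig_poly_has_weak_partial[OF trig_poly_D[OF f]] ae'
          has_weak_partial_L1_loc[OF has_weak_partial_weak_partial[OF w]]])
  then show "AE x in lebesgue. weak_partial i (weak_partial j f) x = D i (D j f) x" by (rule weak_partial_AE_eq)
qed

lemma H2_per_fejer_tendsto:
  assumes "H2_per \<phi>"
  shows "(\<lambda>N. L2norm cell (\<lambda>x. D j (fejer N \<phi>) x - weak_partial j \<phi> x)) \<longlonglongrightarrow> 0"
    "(\<lambda>N. L2norm cell (\<lambda>x. D i (D j (fejer N \<phi>)) x - weak_partial i (weak_partial j \<phi>) x)) \<longlonglongrightarrow> 0"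
  using fejer_tendsto[OF H2_per_weak_partials(4)[OF assms]]
    fejer_tendsto[OF H2_per_weak_partials(7)[OF assms]]
    D_fejer[OF H2_per_weak_partials(3)[OF assms] H2_per_weak_partials(2)[OF assms]]
    D_fejer[OF H2_per_weak_partials(6)[OF assms] H2_per_weak_partials(5)[OF assms]]
  by simp_all

subsection \<open>Periodic extension\<close>

lemma periodic_ae_int_shift:
  fixes f :: "real ^ 'n::finite \<Rightarrow> 'b"
  assumes per: "periodic_ae f"
  shows "AE x in lebesgue. f (x + (\<chi> i. of_int (k i))) = f x"
proof -
  have s1: "AE x in lebesgue. f (x + of_int m *\<^sub>R axis i 1) = f x" for m :: int and i
  proof (induction m rule: int_induct[of _ 0])
    case base show ?case by simp
  next
    case (step1 m)
    have "AE x in lebesgue. f (x + of_int m *\<^sub>R axis i 1 + axis i 1) = f (x + of_int m *\<^sub>R axis i 1)"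
      using per AE_lebesgue_shift unfolding periodic_ae_def by blast
    with step1(2) show ?case
      by eventually_elim (simp add: algebra_simps)
  next
    case (step2 m)
    have "AE x in lebesgue. f (x + of_int (m - 1) *\<^sub>R axis i 1 + axis i 1) = f (x + of_int (m - 1) *\<^sub>R axis i 1)"
      using per AE_lebesgue_shift unfolding periodic_ae_def by blast
    with step2(2) show ?case
      by eventually_elim (simp add: algebra_simps)
  qed
  have "AE x in lebesgue. f (x + (\<Sum>i\<in>S. of_int (k i) *\<^sub>R axis i 1)) = f x" if "finite S" for S
    using that
  proof (induction S rule: finite_induct)
    case (insert i S)
    have "AE x in lebesgue. f (x + of_int (k i) *\<^sub>R axis i 1 + (\<Sum>i\<in>S. of_int (k i) *\<^sub>R axis i 1)) = f (x + of_int (k i) *\<^sub>R axis i 1)"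
      by (rule AE_lebesgue_shift[OF insert.IH])
    with s1[of "k i" i] show ?case
      by eventually_elim (use insert.hyps in \<open>simp add: add.assoc\<close>)
  qed simp
  from this[of UNIV] have "AE x in lebesgue. f (x + (\<Sum>i\<in>UNIV. of_int (k i) *\<^sub>R axis i 1)) = f x" by simp
  moreover have "(\<Sum>i\<in>UNIV. of_int (k i) *\<^sub>R axis i 1 :: real^'n) = (\<chi> i. of_int (k i))"
    by (simp add: vec_eq_iff sum_component axis_def if_distrib sum.delta cong: if_cong)
  ultimately show ?thesis by simp
qed

lemma L2_per_if_square_integrable:
  fixes f :: "real ^ 'n::finite \<Rightarrow> real"
  assumes m: "f \<in> borel_measurable lebesgue" and per: "periodic_ae f" and sq: "square_integrable cell f"
  shows "L2_per f"
  unfolding L2_per_def L2_loc_def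
proof (intro conjI m per allI impI)
  fix K :: "(real^'n) set" assume K: "compact K"
  obtain R where R: "\<And>x. x \<in> K \<Longrightarrow> norm x \<le> R"
    using compact_imp_bounded[OF K] unfolding bounded_iff by blast
  define M where "M = nat \<lceil>R\<rceil> + 1"
  define z :: "('n \<Rightarrow> int) \<Rightarrow> real^'n" where "z k = (\<chi> i. of_int (k i))" for k
  have i0: "integrable lebesgue (\<lambda>x. indicator unit_cell x * (f x)\<^sup>2)"
    using square_integrable_square[OF sq] by (simp add: integrable_restrict_space)
  have i1: "integrable lebesgue (\<lambda>x. indicator unit_cell (x - z k) * (f x)\<^sup>2)" for k
  proof -
    have mk: "(\<lambda>x. indicator unit_cell x * (f (x + z k))\<^sup>2) \<in> borel_measurable lebesgue"
      by (rule borel_measurable_times[OF borel_measurable_indicator[OF unit_cell_sets]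
            borel_measurable_power[OF measurable_compose[OF lebesgue_measurable_shift m]]])
    have "AE x in lebesgue. indicator unit_cell x * (f x)\<^sup>2 = indicator unit_cell x * (f (x + z k))\<^sup>2"
      using periodic_ae_int_shift[OF per, of k] by eventually_elim (simp add: z_def)
    then have "integrable lebesgue (\<lambda>x. indicator unit_cell x * (f (x + z k))\<^sup>2)"
      using i0 integrable_cong_AE[OF borel_measurable_integrable[OF i0] mk] by simp
    from integrable_lebesgue_shift[OF this, of "- z k"] show ?thesis by simp
  qed
  show "set_integrable lebesgue K (\<lambda>x. (f x)\<^sup>2)"
    unfolding set_integrable_def
  proof (rule Bochner_Integration.integrable_bound)
    show "integrable lebesgue (\<lambda>x. \<Sum>k\<in>cube M. indicator unit_cell (x - z k) * (f x)\<^sup>2)"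
      using i1 by (intro Bochner_Integration.integrable_sum)
    show "(\<lambda>x. indicat_real K x *\<^sub>R (f x)\<^sup>2) \<in> borel_measurable lebesgue"
      by (rule borel_measurable_scaleR[OF borel_measurable_indicator[OF fmeasurableD[OF lmeasurable_compact[OF K]]]
            borel_measurable_power[OF m]])
    have "AE x in lebesgue. \<forall>i. \<forall>c::int. (x :: real^'n) $ i \<noteq> of_int c"
      by (simp add: AE_all_countable AE_component_neq)
    then show "AE x in lebesgue. norm (indicat_real K x *\<^sub>R (f x)\<^sup>2)
        \<le> norm (\<Sum>k\<in>cube M. indicator unit_cell (x - z k) * (f x)\<^sup>2)"
    proof eventually_elim
      case (elim x)
      have s0: "0 \<le> (\<Sum>k\<in>cube M. indicat_real unit_cell (x - z k) * (f x)\<^sup>2)" by (intro sum_nonneg) auto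
      show ?case
      proof (cases "x \<in> K")
        case True
        define k where "k i = \<lfloor>x $ i\<rfloor>" for i
        have xR: "\<bar>x $ i\<bar> \<le> R" for i using R[OF True] component_le_norm_cart[of x i] by linarith
        have kM: "k \<in> cube M" unfolding mem_cube
        proof
          fix i
          have "\<lfloor>x $ i\<rfloor> \<le> \<lceil>R\<rceil>" "- \<lceil>R\<rceil> - 1 \<le> \<lfloor>x $ i\<rfloor>"
            using xR[of i] by linarith+
          moreover have "0 \<le> \<lceil>R\<rceil>" using order.trans[OF norm_ge_zero R[OF True]] by simp
          ultimately show "\<bar>k i\<bar> \<le> int M" unfolding k_def M_def by linarith
        qed
        have "x - z k \<in> unit_cell"
        proof -
          have "0 < x $ i - of_int \<lfloor>x $ i\<rfloor>" "x $ i - of_int \<lfloor>x $ i\<rfloor> < 1" for i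
            using elim[rule_format, of i "\<lfloor>x $ i\<rfloor>"] by linarith+
          then show ?thesis by (simp add: unit_cell_def z_def k_def)
        qed
        then have "(f x)\<^sup>2 = indicat_real unit_cell (x - z k) * (f x)\<^sup>2" by simp
        also have "\<dots> \<le> (\<Sum>k\<in>cube M. indicat_real unit_cell (x - z k) * (f x)\<^sup>2)"
          by (rule member_le_sum[OF kM]) auto
        finally show ?thesis using True s0 by simp
      qed (use s0 in simp)
    qed
  qed
qed

subsection \<open>Orthogonal projections\<close>

lemma quadratic_nonneg_imp_zero:
  fixes a c :: real
  assumes "\<And>t. 0 \<le> - 2 * t * a + t\<^sup>2 * c" "c \<ge> 0"
  shows "a = 0"
proof (rule ccontr)
  assume a: "a \<noteq> 0"
  define t where "t = a / (c + 1)"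
  have ta: "a = t * (c + 1)" using assms(2) by (simp add: t_def)
  have "- 2 * t * a + t\<^sup>2 * c = - (t\<^sup>2 * (c + 2))" unfolding ta by (simp add: power2_eq_square algebra_simps)
  moreover have "t \<noteq> 0" using a assms(2) by (simp add: t_def)
  then have "t\<^sup>2 * (c + 2) > 0" using assms(2) by (intro mult_pos_pos) auto
  ultimately show False using assms(1)[of t] by linarith
qed

lemma (in finite_measure) L2_projection:
  fixes h :: "'a \<Rightarrow> real" and V :: "('a \<Rightarrow> real) set"
  assumes h: "square_integrable M h" and V: "\<And>v. v \<in> V \<Longrightarrow> square_integrable M v"
    and V0: "(\<lambda>x. 0) \<in> V"
    and add: "\<And>u v. u \<in> V \<Longrightarrow> v \<in> V \<Longrightarrow> (\<lambda>x. u x + v x) \<in> V"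
    and scale: "\<And>v c. v \<in> V \<Longrightarrow> (\<lambda>x. c * v x) \<in> V"
  shows "\<exists>(v :: nat \<Rightarrow> 'a \<Rightarrow> real) w (r :: nat \<Rightarrow> nat). (\<forall>n. v n \<in> V) \<and> w = (\<lambda>x. lim (\<lambda>k. h x - v (r k) x)) \<and>
    square_integrable M w \<and> (\<lambda>n. L2norm M (\<lambda>x. h x - v n x - w x)) \<longlonglongrightarrow> 0 \<and>
    (\<forall>g\<in>V. (\<integral>x. w x * g x \<partial>M) = 0)"
proof -
  define Q where "Q = (\<lambda>v. (L2norm M (\<lambda>x. h x - v x))\<^sup>2) ` V"
  define d where "d = Inf Q"
  have Q: "Q \<noteq> {}" "bdd_below Q" using V0 by (auto simp: Q_def intro!: bdd_belowI[of _ 0])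
  have dl: "d \<le> (L2norm M (\<lambda>x. h x - v x))\<^sup>2" if "v \<in> V" for v
    unfolding d_def using Q that by (intro cInf_lower) (auto simp: Q_def)
  have "\<exists>v\<in>V. (L2norm M (\<lambda>x. h x - v x))\<^sup>2 < d + 1 / real (Suc n)" for n
    using cInf_lessD[OF Q(1), of "d + 1 / real (Suc n)"] by (auto simp: d_def Q_def)
  then obtain v where v: "\<And>n. v n \<in> V" "\<And>n. (L2norm M (\<lambda>x. h x - v n x))\<^sup>2 < d + 1 / real (Suc n)" by metis
  define u where "u n x = h x - v n x" for n x
  have u: "square_integrable M (u n)" for n using h V[OF v(1)] by (simp add: u_def[abs_def])
  have par: "(L2norm M (\<lambda>x. u m x - u n x))\<^sup>2 \<le> 2 / real (Suc m) + 2 / real (Suc n)" for m n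
  proof -
    have un: "square_integrable M (\<lambda>x. (-1) * u n x)" using u by simp
    have 1: "(L2norm M (\<lambda>x. u m x + u n x))\<^sup>2 = (L2norm M (u m))\<^sup>2 + 2 * (\<integral>x. u m x * u n x \<partial>M) + (L2norm M (u n))\<^sup>2"
      by (rule L2_inner_add_power2[OF u u])
    have 2: "(L2norm M (\<lambda>x. u m x - u n x))\<^sup>2 = (L2norm M (u m))\<^sup>2 - 2 * (\<integral>x. u m x * u n x \<partial>M) + (L2norm M (u n))\<^sup>2"
      using L2_inner_add_power2[OF u un, of m] L2norm_scale[of M "-1" "u n"] by simp
    have "(\<lambda>x. (1/2) * (v m x + v n x)) \<in> V" by (intro scale add v)
    from dl[OF this] have "d \<le> (L2norm M (\<lambda>x. (1/2) * (u m x + u n x)))\<^sup>2"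
      by (simp add: u_def field_simps)
    also have "\<dots> = (1/4) * (L2norm M (\<lambda>x. u m x + u n x))\<^sup>2" 
      unfolding L2norm_scale by (simp add: power2_eq_square)
    finally have "4 * d \<le> (L2norm M (\<lambda>x. u m x + u n x))\<^sup>2" by simp
    then show ?thesis using 1 2 v(2)[of m] v(2)[of n] unfolding u_def[symmetric] by linarith
  qed
  have "\<exists>r::nat\<Rightarrow>nat. square_integrable M (\<lambda>x. lim (\<lambda>k. u (r k) x)) \<and>
    (\<lambda>n. L2norm M (\<lambda>x. u n x - lim (\<lambda>k. u (r k) x))) \<longlonglongrightarrow> 0"
  proof (rule L2_complete[OF u])
    fix e :: real assume e: "e > 0"
    then have "e\<^sup>2 / 4 > 0" by simp
    then obtain N where N: "1 / real (Suc N) < e\<^sup>2 / 4" using nat_approx_posE by blast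
    show "\<exists>N. \<forall>m\<ge>N. \<forall>n\<ge>N. L2norm M (\<lambda>x. u m x - u n x) < e"
    proof (intro exI[of _ N] allI impI)
      fix m n assume mn: "m \<ge> N" "n \<ge> N"
      have "1 / real (Suc m) \<le> 1 / real (Suc N)" "1 / real (Suc n) \<le> 1 / real (Suc N)"
        using mn by (auto intro!: divide_left_mono)
      then have "(L2norm M (\<lambda>x. u m x - u n x))\<^sup>2 < e\<^sup>2" using par[of m n] N by simp
      then show "L2norm M (\<lambda>x. u m x - u n x) < e" by (rule power2_less_imp_less) (use e in simp)
    qed
  qed
  then obtain r :: "nat \<Rightarrow> nat" where r: "square_integrable M (\<lambda>x. lim (\<lambda>k. u (r k) x))"
    "(\<lambda>n. L2norm M (\<lambda>x. u n x - lim (\<lambda>k. u (r k) x))) \<longlonglongrightarrow> 0" by blast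
  define w where "w x = lim (\<lambda>k. u (r k) x)" for x
  have w: "square_integrable M w" and wl: "(\<lambda>n. L2norm M (\<lambda>x. u n x - w x)) \<longlonglongrightarrow> 0"
    using r by (simp_all add: w_def[abs_def])
  have "(\<integral>x. w x * g x \<partial>M) = 0" if g: "g \<in> V" for g
  proof (rule quadratic_nonneg_imp_zero)
    fix t :: real
    have gs: "square_integrable M g" by (rule V[OF g])
    have "d \<le> (L2norm M (u n))\<^sup>2 - 2 * t * (\<integral>x. u n x * g x \<partial>M) + t\<^sup>2 * (L2norm M g)\<^sup>2" for n
    proof -
      have "(\<lambda>x. v n x + t * g x) \<in> V" by (intro add scale v g)
      from dl[OF this] have "d \<le> (L2norm M (\<lambda>x. u n x + (- t) * g x))\<^sup>2" by (simp add: u_def algebra_simps)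
      also have "\<dots> = (L2norm M (u n))\<^sup>2 + 2 * (\<integral>x. u n x * ((- t) * g x) \<partial>M) + (L2norm M (\<lambda>x. (- t) * g x))\<^sup>2"
        by (rule L2_inner_add_power2[OF u square_integrable_scale[OF gs]])
      also have "(\<integral>x. u n x * ((- t) * g x) \<partial>M) = - t * (\<integral>x. u n x * g x \<partial>M)"
        by (subst integral_mult_right_zero[symmetric]) (simp add: mult_ac)
      finally show ?thesis unfolding L2norm_scale by (simp add: power_mult_distrib)
    qed
    moreover have "(\<lambda>n. (L2norm M (u n))\<^sup>2 - 2 * t * (\<integral>x. u n x * g x \<partial>M) + t\<^sup>2 * (L2norm M g)\<^sup>2)
      \<longlonglongrightarrow> (L2norm M w)\<^sup>2 - 2 * t * (\<integral>x. w x * g x \<partial>M) + t\<^sup>2 * (L2norm M g)\<^sup>2"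
      by (intro tendsto_intros L2norm_tendsto[OF u w wl] L2_inner_tendsto[OF u w gs wl])
    ultimately have "d \<le> (L2norm M w)\<^sup>2 - 2 * t * (\<integral>x. w x * g x \<partial>M) + t\<^sup>2 * (L2norm M g)\<^sup>2"
      by (intro LIMSEQ_le_const) auto
    moreover have "(L2norm M w)\<^sup>2 \<le> d"
    proof (rule LIMSEQ_le)
      show "(\<lambda>n. (L2norm M (u n))\<^sup>2) \<longlonglongrightarrow> (L2norm M w)\<^sup>2" by (intro tendsto_intros L2norm_tendsto[OF u w wl])
      show "(\<lambda>n. d + 1 / real (Suc n)) \<longlonglongrightarrow> d"
        using tendsto_add[OF tendsto_const LIMSEQ_Suc[OF lim_1_over_n], of d] by simp
      show "\<exists>N. \<forall>n\<ge>N. (L2norm M (u n))\<^sup>2 \<le> d + 1 / real (Suc n)"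
        using less_imp_le[OF v(2)] by (auto simp: u_def[abs_def])
    qed
    ultimately show "0 \<le> - 2 * t * (\<integral>x. w x * g x \<partial>M) + t\<^sup>2 * (L2norm M g)\<^sup>2" by linarith
  qed simp
  then show ?thesis
    by (intro exI[of _ v] exI[of _ w] exI[of _ r]) (use v(1) w wl in \<open>auto simp: w_def[abs_def] u_def\<close>)
qed

subsection \<open>Nondivergence operators under a Cordes condition\<close>

definition hess :: "(real ^ 'n::finite \<Rightarrow> real) \<Rightarrow> real ^ 'n \<Rightarrow> real ^ 'n ^ 'n" where
  "hess \<phi> x = (\<chi> i j. D i (D j \<phi>) x)"

definition grad :: "(real ^ 'n::finite \<Rightarrow> real) \<Rightarrow> real ^ 'n \<Rightarrow> real ^ 'n" where
  "grad \<phi> x = (\<chi> i. D i \<phi> x)"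

definition nondiv ::
  "(real ^ 'n::finite \<Rightarrow> real ^ 'n ^ 'n) \<Rightarrow> (real ^ 'n \<Rightarrow> real ^ 'n) \<Rightarrow> (real ^ 'n \<Rightarrow> real) \<Rightarrow> real ^ 'n \<Rightarrow> real" where
  "nondiv A b \<phi> x = A x \<bullet> hess \<phi> x + b x \<bullet> grad \<phi> x"

lemma inner_matrix: "A \<bullet> B = (\<Sum>i\<in>UNIV. \<Sum>j\<in>UNIV. A $ i $ j * B $ i $ j)" for A B :: "real ^ 'n::finite ^ 'm::finite"
  by (simp add: inner_vec_def)

lemma inner_vector: "a \<bullet> b = (\<Sum>i\<in>UNIV. a $ i * b $ i)" for a b :: "real ^ 'n::finite"
  by (simp add: inner_vec_def)

lemma nondiv_alt:
  "nondiv A b \<phi> x = (\<Sum>i\<in>UNIV. \<Sum>j\<in>UNIV. A x $ i $ j * D i (D j \<phi>) x) + (\<Sum>i\<in>UNIV. b x $ i * D i \<phi> x)"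
  by (simp add: nondiv_def inner_matrix inner_vector hess_def grad_def)

lemma nondiv_add:
  "trig_poly \<phi> \<Longrightarrow> trig_poly \<psi> \<Longrightarrow> nondiv A b (\<lambda>x. \<phi> x + \<psi> x) x = nondiv A b \<phi> x + nondiv A b \<psi> x"
  by (simp add: nondiv_alt D_add trig_poly_D distrib_left sum.distrib)

lemma nondiv_scale: "trig_poly \<phi> \<Longrightarrow> nondiv A b (\<lambda>x. c * \<phi> x) x = c * nondiv A b \<phi> x"
  by (simp add: nondiv_alt D_scale trig_poly_D sum_distrib_left distrib_left mult_ac)

lemma nondiv_diff:
  "trig_poly \<phi> \<Longrightarrow> trig_poly \<psi> \<Longrightarrow> nondiv A b (\<lambda>x. \<phi> x - \<psi> x) x = nondiv A b \<phi> x - nondiv A b \<psi> x"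
  using nondiv_add[of \<phi> "\<lambda>x. (-1) * \<psi> x" A b x] nondiv_scale[of \<psi> A b "-1" x] trig_poly.scale[of \<psi> "-1"] by simp

lemma nondiv_const: "nondiv A b (\<lambda>x. c) x = 0"
  by (simp add: nondiv_alt D_const)

lemma inner_mat_1_hess: "mat 1 \<bullet> hess \<phi> x = Lap \<phi> x"
proof -
  have "(\<Sum>j\<in>UNIV. mat 1 $ i $ j * D i (D j \<phi>) x) = D i (D i \<phi>) x" for i
  proof -
    have "(\<Sum>j\<in>UNIV. mat 1 $ i $ j * D i (D j \<phi>) x) = (\<Sum>j\<in>UNIV. if i = j then D i (D j \<phi>) x else 0)"
      by (intro sum.cong) (auto simp: mat_def)
    then show ?thesis by simp
  qed
  then show ?thesis by (simp add: inner_matrix hess_def Lap_def)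
qed

lemma nondiv_minus_Lap: "nondiv A b \<phi> x - Lap \<phi> x = (A x - mat 1) \<bullet> hess \<phi> x + b x \<bullet> grad \<phi> x"
  by (simp add: nondiv_def inner_diff_left inner_mat_1_hess)

lemma cauchy_schwarz_pair:
  fixes a b :: "'a::real_inner" and c d :: "'b::real_inner"
  shows "\<bar>a \<bullet> b + c \<bullet> d\<bar>\<^sup>2 \<le> ((norm a)\<^sup>2 + (norm c)\<^sup>2) * ((norm b)\<^sup>2 + (norm d)\<^sup>2)"
  using Cauchy_Schwarz_ineq[of "(a, c)" "(b, d)"]
  by (simp add: power2_norm_eq_inner)

lemma measurable_component:
  fixes a :: "'a \<Rightarrow> real ^ 'n::finite"
  assumes a: "a \<in> borel_measurable M"
  shows "(\<lambda>x. a x $ i) \<in> borel_measurable M"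
proof -
  have c: "continuous_on UNIV (\<lambda>v :: real ^ 'n. v $ i)" by (intro continuous_intros)
  show ?thesis by (rule measurable_compose[OF a borel_measurable_continuous_onI[OF c]])
qed

lemma measurable_component2:
  fixes A :: "'a \<Rightarrow> real ^ 'n::finite ^ 'm::finite"
  assumes A: "A \<in> borel_measurable M"
  shows "(\<lambda>x. A x $ i $ j) \<in> borel_measurable M"
proof -
  have c: "continuous_on UNIV (\<lambda>v :: real ^ 'n ^ 'm. v $ i $ j)" by (intro continuous_intros)
  show ?thesis by (rule measurable_compose[OF A borel_measurable_continuous_onI[OF c]])
qed

locale cordes =
  fixes A :: "real ^ 'n::finite \<Rightarrow> real ^ 'n ^ 'n" and b :: "real ^ 'n \<Rightarrow> real ^ 'n" and \<rho> \<kappa> :: real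
  assumes A_measurable: "A \<in> borel_measurable lebesgue"
    and b_measurable: "b \<in> borel_measurable lebesgue"
    and near_identity: "AE x in lebesgue. (norm (A x - mat 1))\<^sup>2 + (norm (b x))\<^sup>2 \<le> \<rho>\<^sup>2"
    and \<kappa>: "0 \<le> \<kappa>" "\<kappa> < 1" "\<rho>\<^sup>2 * (1 + 1 / (4 * pi\<^sup>2)) \<le> \<kappa>\<^sup>2"
begin

lemma nondiv_measurable: "trig_poly \<phi> \<Longrightarrow> nondiv A b \<phi> \<in> borel_measurable lebesgue"
  unfolding nondiv_alt[abs_def]
  by (intro borel_measurable_add borel_measurable_sum borel_measurable_times measurable_component
      measurable_component2 A_measurable b_measurable trig_poly_measurable trig_poly_D)

lemma perturbation:
  assumes \<phi>: "trig_poly \<phi>"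
  shows "square_integrable cell (\<lambda>x. nondiv A b \<phi> x - Lap \<phi> x)"
    and "L2norm cell (\<lambda>x. nondiv A b \<phi> x - Lap \<phi> x) \<le> \<kappa> * L2norm cell (Lap \<phi>)"
proof -
  let ?E = "\<lambda>x. nondiv A b \<phi> x - Lap \<phi> x"
  let ?G = "\<lambda>x. (\<Sum>i\<in>UNIV. \<Sum>j\<in>UNIV. (D i (D j \<phi>) x)\<^sup>2) + (\<Sum>i\<in>UNIV. (D i \<phi> x)\<^sup>2)"
  have G: "(norm (hess \<phi> x))\<^sup>2 + (norm (grad \<phi> x))\<^sup>2 = ?G x" for x
    unfolding power2_norm_eq_inner inner_matrix inner_vector hess_def grad_def by (simp add: power2_eq_square)
  have i: "integrable cell (\<lambda>x. (D i (D j \<phi>) x)\<^sup>2)" "integrable cell (\<lambda>x. (D i \<phi> x)\<^sup>2)" for i j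
    by (intro square_integrable_square trig_poly_square_integrable trig_poly_D \<phi>)+
  then have Gi: "integrable cell ?G" by (intro Bochner_Integration.integrable_add Bochner_Integration.integrable_sum)
  have m: "?E \<in> borel_measurable cell"
    by (intro cell_measurable borel_measurable_diff nondiv_measurable trig_poly_measurable trig_poly_Lap \<phi>)
  have le: "AE x in cell. (?E x)\<^sup>2 \<le> \<rho>\<^sup>2 * ?G x"
    using AE_cell_if_lebesgue[OF near_identity]
  proof eventually_elim
    case (elim x)
    have "(?E x)\<^sup>2 \<le> ((norm (A x - mat 1))\<^sup>2 + (norm (b x))\<^sup>2) * ?G x"
      unfolding nondiv_minus_Lap G[symmetric] using cauchy_schwarz_pair[of "A x - mat 1" "hess \<phi> x" "b x" "grad \<phi> x"] by simp
    also have "\<dots> \<le> \<rho>\<^sup>2 * ?G x" unfolding G[symmetric] by (intro mult_right_mono elim) simp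
    finally show ?case .
  qed
  have sq: "integrable cell (\<lambda>x. (?E x)\<^sup>2)"
  proof (rule Bochner_Integration.integrable_bound)
    show "integrable cell (\<lambda>x. \<rho>\<^sup>2 * ?G x)" using Gi by (rule integrable_mult_right)
    show "(\<lambda>x. (?E x)\<^sup>2) \<in> borel_measurable cell" using m by (rule borel_measurable_power)
    show "AE x in cell. norm ((?E x)\<^sup>2) \<le> norm (\<rho>\<^sup>2 * ?G x)" using le by eventually_elim auto
  qed
  with m show "square_integrable cell ?E" by (simp add: square_integrable_def)
  have "(L2norm cell ?E)\<^sup>2 \<le> (\<integral>x. \<rho>\<^sup>2 * ?G x \<partial>cell)"
    unfolding L2norm_power2 by (rule integral_mono_AE[OF sq integrable_mult_right[OF Gi] le])
  also have "\<dots> = \<rho>\<^sup>2 * ((\<Sum>i\<in>UNIV. \<Sum>j\<in>UNIV. (L2norm cell (D i (D j \<phi>)))\<^sup>2) + (\<Sum>i\<in>UNIV. (L2norm cell (D i \<phi>))\<^sup>2))"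
    unfolding L2norm_power2 using i by (simp add: Bochner_Integration.integral_sum)
  also have "\<dots> \<le> \<rho>\<^sup>2 * ((L2norm cell (Lap \<phi>))\<^sup>2 + (L2norm cell (Lap \<phi>))\<^sup>2 / (4 * pi\<^sup>2))"
    unfolding hessian_energy[OF \<phi>] using poincare[OF \<phi>] by (intro mult_left_mono add_left_mono) auto
  also have "\<dots> = (\<rho>\<^sup>2 * (1 + 1 / (4 * pi\<^sup>2))) * (L2norm cell (Lap \<phi>))\<^sup>2" by (simp add: algebra_simps)
  also have "\<dots> \<le> \<kappa>\<^sup>2 * (L2norm cell (Lap \<phi>))\<^sup>2" by (intro mult_right_mono \<kappa>) simp
  finally show "L2norm cell ?E \<le> \<kappa> * L2norm cell (Lap \<phi>)"
    using \<kappa> by (intro power2_le_imp_le[of "L2norm cell ?E"]) (auto simp: power_mult_distrib)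
qed

lemma square_integrable_Lap: "trig_poly \<phi> \<Longrightarrow> square_integrable cell (Lap \<phi>)"
  by (intro trig_poly_square_integrable trig_poly_Lap)

lemma nondiv_square_integrable:
  assumes \<phi>: "trig_poly \<phi>" shows "square_integrable cell (nondiv A b \<phi>)"
  using square_integrable_add[OF perturbation(1)[OF \<phi>] square_integrable_Lap[OF \<phi>]] by simp

lemma integral_Lap: "trig_poly \<phi> \<Longrightarrow> (\<integral>x. Lap \<phi> x \<partial>cell) = 0"
  using coef_Lap[of \<phi> "\<lambda>_. 0"] by (simp add: coef_0)

lemma adjoint_kernel_bound:
  assumes r: "square_integrable cell r"
    and ker: "\<And>\<phi>. trig_poly \<phi> \<Longrightarrow> (\<integral>x. r x * nondiv A b \<phi> x \<partial>cell) = 0"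
  shows "(1 - \<kappa>) * L2norm cell (\<lambda>x. r x - (\<integral>x. r x \<partial>cell)) \<le> \<kappa> * \<bar>\<integral>x. r x \<partial>cell\<bar>"
proof -
  define m where "m = (\<integral>x. r x \<partial>cell)"
  define s where "s x = r x - m" for x
  have s: "square_integrable cell s" unfolding s_def[abs_def] using r by simp
  have sr: "r = (\<lambda>x. s x + m)" by (simp add: s_def)
  have one: "L2norm cell (\<lambda>x :: real^'n. m) = \<bar>m\<bar>" by (simp add: L2norm_def)
  have rle: "L2norm cell r \<le> L2norm cell s + \<bar>m\<bar>"
    using L2norm_triangle[OF s cell.square_integrable_const[of m]] unfolding one sr[symmetric] .
  have s0: "coef s (\<lambda>_. 0) = 0"
    using r by (simp add: coef_0 s_def[abs_def] m_def cell.square_integrable_integrable)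
  have bound: "\<bar>\<integral>x. s x * fejer N s x \<partial>cell\<bar> \<le> (L2norm cell s + \<bar>m\<bar>) * (\<kappa> * L2norm cell s)" for N
  proof -
    let ?p = "fejer N s"
    have p: "trig_poly ?p" by (rule trig_poly_fejer)
    obtain \<phi> where \<phi>: "trig_poly \<phi>" "resolvent_op 0 1 \<phi> = ?p"
      using resolvent_op_surj[of 0 1 ?p] p by auto
    have pe: "?p x = coef \<phi> (\<lambda>_. 0) - Lap \<phi> x" for x using fun_cong[OF \<phi>(2), of x] by (simp add: resolvent_op_def)
    have "coef ?p (\<lambda>_. 0) = 0" unfolding fejer_def[abs_def] by (subst coef_sum_basis) (auto simp: s0)
    moreover have "coef ?p (\<lambda>_. 0) = coef \<phi> (\<lambda>_. 0)"
      unfolding coef_0[of ?p] pe using square_integrable_Lap[OF \<phi>(1)] integral_Lap[OF \<phi>(1)]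
      by (simp add: cell.square_integrable_integrable)
    ultimately have pL: "?p x = - Lap \<phi> x" for x using pe by simp
    let ?E = "\<lambda>x. nondiv A b \<phi> x - Lap \<phi> x"
    have E: "square_integrable cell ?E" by (rule perturbation(1)[OF \<phi>(1)])
    have "0 = (\<integral>x. r x * nondiv A b \<phi> x \<partial>cell)" using ker[OF \<phi>(1)] by simp
    also have "\<dots> = (\<integral>x. s x * Lap \<phi> x + m * Lap \<phi> x + r x * ?E x \<partial>cell)"
      by (simp add: s_def algebra_simps)
    also have "\<dots> = (\<integral>x. s x * Lap \<phi> x \<partial>cell) + m * (\<integral>x. Lap \<phi> x \<partial>cell) + (\<integral>x. r x * ?E x \<partial>cell)"
      using square_integrable_mult[OF s square_integrable_Lap[OF \<phi>(1)]] square_integrable_mult[OF r E]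
        cell.square_integrable_integrable[OF square_integrable_Lap[OF \<phi>(1)]] by simp
    finally have "(\<integral>x. s x * ?p x \<partial>cell) = (\<integral>x. r x * ?E x \<partial>cell)"
      unfolding pL integral_Lap[OF \<phi>(1)] by simp
    also have "\<bar>\<dots>\<bar> \<le> L2norm cell r * L2norm cell ?E" by (rule L2_Cauchy_Schwarz[OF r E])
    also have "\<dots> \<le> (L2norm cell s + \<bar>m\<bar>) * (\<kappa> * L2norm cell s)"
    proof (intro mult_mono rle)
      have "L2norm cell ?E \<le> \<kappa> * L2norm cell (Lap \<phi>)" by (rule perturbation(2)[OF \<phi>(1)])
      also have "L2norm cell (Lap \<phi>) = L2norm cell ?p" by (simp add: L2norm_def pL)
      also have "\<kappa> * L2norm cell ?p \<le> \<kappa> * L2norm cell s" by (intro mult_left_mono fejer_norm_le s \<kappa>)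
      finally show "L2norm cell ?E \<le> \<kappa> * L2norm cell s" .
    qed auto
    finally show ?thesis .
  qed
  have "(\<lambda>N. \<integral>x. fejer N s x * s x \<partial>cell) \<longlonglongrightarrow> (\<integral>x. s x * s x \<partial>cell)"
    by (intro L2_inner_tendsto trig_poly_square_integrable trig_poly_fejer s fejer_tendsto)
  then have "(\<lambda>N. \<bar>\<integral>x. s x * fejer N s x \<partial>cell\<bar>) \<longlonglongrightarrow> \<bar>(L2norm cell s)\<^sup>2\<bar>"
    unfolding L2norm_power2_inner by (intro tendsto_rabs) (simp add: mult.commute)
  then have "\<bar>(L2norm cell s)\<^sup>2\<bar> \<le> (L2norm cell s + \<bar>m\<bar>) * (\<kappa> * L2norm cell s)"
    by (rule LIMSEQ_le_const2) (use bound in blast)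
  then have "L2norm cell s * L2norm cell s \<le> ((L2norm cell s + \<bar>m\<bar>) * \<kappa>) * L2norm cell s"
    by (simp add: power2_eq_square mult_ac)
  then have "L2norm cell s \<le> (L2norm cell s + \<bar>m\<bar>) * \<kappa>"
    using \<kappa> L2norm_nonneg[of cell s] by (cases "L2norm cell s = 0") (auto simp: mult_le_cancel_right)
  then show ?thesis unfolding s_def[abs_def] m_def[symmetric] by (simp add: algebra_simps)
qed

lemma adjoint_kernel_mean_zero:
  assumes "square_integrable cell r" "\<And>\<phi>. trig_poly \<phi> \<Longrightarrow> (\<integral>x. r x * nondiv A b \<phi> x \<partial>cell) = 0"
    and "(\<integral>x. r x \<partial>cell) = 0"
  shows "AE x in cell. r x = 0"
proof (rule L2norm_eq_0[OF assms(1)])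
  have "(1 - \<kappa>) * L2norm cell r \<le> 0" using adjoint_kernel_bound[OF assms(1,2)] assms(3) by simp
  moreover have "(1 - \<kappa>) * L2norm cell r \<ge> 0" using \<kappa> by simp
  ultimately have "(1 - \<kappa>) * L2norm cell r = 0" by linarith
  then show "L2norm cell r = 0" using \<kappa> by simp
qed

lemma one_not_in_range:
  assumes \<phi>: "trig_poly \<phi>"
  shows "1 - \<kappa> \<le> 2 * L2norm cell (\<lambda>x. 1 - nondiv A b \<phi> x)"
proof -
  let ?u = "\<lambda>x. 1 - nondiv A b \<phi> x" and ?E = "\<lambda>x. nondiv A b \<phi> x - Lap \<phi> x" and ?l = "L2norm cell (Lap \<phi>)"
  note L = square_integrable_Lap[OF \<phi>] and N = nondiv_square_integrable[OF \<phi>] and E = perturbation[OF \<phi>]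
  have u: "square_integrable cell ?u" using N by simp
  have "?l\<^sup>2 = - (\<integral>x. ?u x * Lap \<phi> x \<partial>cell) - (\<integral>x. ?E x * Lap \<phi> x \<partial>cell)"
  proof -
    have "(\<integral>x. ?u x * Lap \<phi> x \<partial>cell) + (\<integral>x. ?E x * Lap \<phi> x \<partial>cell) = (\<integral>x. Lap \<phi> x - Lap \<phi> x * Lap \<phi> x \<partial>cell)"
      using square_integrable_mult[OF u L] square_integrable_mult[OF E(1) L]
      by (subst Bochner_Integration.integral_add[symmetric]) (auto intro!: Bochner_Integration.integral_cong simp: algebra_simps)
    also have "\<dots> = (\<integral>x. Lap \<phi> x \<partial>cell) - ?l\<^sup>2"
      unfolding L2norm_power2_inner
      by (rule Bochner_Integration.integral_diff[OF cell.square_integrable_integrable[OF L] square_integrable_mult[OF L L]])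
    finally show ?thesis using integral_Lap[OF \<phi>] by simp
  qed
  also have "\<dots> \<le> L2norm cell ?u * ?l + (\<kappa> * ?l) * ?l"
    using L2_Cauchy_Schwarz[OF u L] L2_Cauchy_Schwarz[OF E(1) L] mult_right_mono[OF E(2), of ?l] by (simp add: abs_le_iff)
  finally have "?l * ?l \<le> (L2norm cell ?u + \<kappa> * ?l) * ?l" by (simp add: power2_eq_square algebra_simps)
  then have l: "?l \<le> L2norm cell ?u + \<kappa> * ?l"
    using \<kappa> L2norm_nonneg[of cell "Lap \<phi>"] L2norm_nonneg[of cell ?u] by (cases "?l = 0") (auto simp: mult_le_cancel_right)
  have "1 = L2norm cell (\<lambda>x :: real^'n. 1)" by (simp add: L2norm_def)
  also have "\<dots> = L2norm cell (\<lambda>x. ?u x + (Lap \<phi> x + ?E x))" by simp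
  also have "\<dots> \<le> L2norm cell ?u + L2norm cell (\<lambda>x. Lap \<phi> x + ?E x)" by (rule L2norm_triangle[OF u square_integrable_add[OF L E(1)]])
  also have "L2norm cell (\<lambda>x. Lap \<phi> x + ?E x) \<le> ?l + L2norm cell ?E" by (rule L2norm_triangle[OF L E(1)])
  finally have "1 \<le> L2norm cell ?u + (1 + \<kappa>) * ?l" using E(2) by (simp add: algebra_simps)
  then have "(1 - \<kappa>) * 1 \<le> (1 - \<kappa>) * (L2norm cell ?u + (1 + \<kappa>) * ?l)" using \<kappa> by (intro mult_left_mono) auto
  also have "\<dots> = (1 - \<kappa>) * L2norm cell ?u + (1 + \<kappa>) * ((1 - \<kappa>) * ?l)" by (simp add: algebra_simps)
  also have "\<dots> \<le> (1 - \<kappa>) * L2norm cell ?u + (1 + \<kappa>) * L2norm cell ?u"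
    using l \<kappa> by (intro add_left_mono mult_left_mono) (auto simp: algebra_simps)
  finally show ?thesis by (simp add: algebra_simps)
qed

lemma adjoint_kernel_exists:
  assumes perA: "periodic_ae A" and perb: "periodic_ae b"
  shows "\<exists>r. L2_per r \<and> (\<integral>x. r x \<partial>cell) = 1 \<and> (\<forall>\<phi>. trig_poly \<phi> \<longrightarrow> (\<integral>x. r x * nondiv A b \<phi> x \<partial>cell) = 0)"
proof -
  define V where "V = {nondiv A b \<phi> | \<phi>. trig_poly \<phi>}"
  have "\<exists>(v :: nat \<Rightarrow> real^'n \<Rightarrow> real) w (r :: nat \<Rightarrow> nat). (\<forall>n. v n \<in> V) \<and> w = (\<lambda>x. lim (\<lambda>k. 1 - v (r k) x)) \<and>
    square_integrable cell w \<and> (\<lambda>n. L2norm cell (\<lambda>x. 1 - v n x - w x)) \<longlonglongrightarrow> 0 \<and>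
    (\<forall>g\<in>V. (\<integral>x. w x * g x \<partial>cell) = 0)"
  proof (rule cell.L2_projection)
    show "square_integrable cell (\<lambda>x. 1)" by simp
    show "square_integrable cell v" if "v \<in> V" for v using that nondiv_square_integrable by (auto simp: V_def)
    show "(\<lambda>x. 0) \<in> V" unfolding V_def using nondiv_const[of A b 0] trig_poly_const[of 0] by force
    show "(\<lambda>x. u x + v x) \<in> V" if uv: "u \<in> V" "v \<in> V" for u v
    proof -
      obtain \<phi> \<psi> where "u = nondiv A b \<phi>" "trig_poly \<phi>" "v = nondiv A b \<psi>" "trig_poly \<psi>" using uv by (auto simp: V_def)
      then have "(\<lambda>x. u x + v x) = nondiv A b (\<lambda>x. \<phi> x + \<psi> x)" "trig_poly (\<lambda>x. \<phi> x + \<psi> x)"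
        by (auto simp: nondiv_add intro: trig_poly.add)
      then show ?thesis unfolding V_def by blast
    qed
    show "(\<lambda>x. c * v x) \<in> V" if v: "v \<in> V" for v c
    proof -
      obtain \<psi> where "v = nondiv A b \<psi>" "trig_poly \<psi>" using v by (auto simp: V_def)
      then have "(\<lambda>x. c * v x) = nondiv A b (\<lambda>x. c * \<psi> x)" "trig_poly (\<lambda>x. c * \<psi> x)"
        by (auto simp: nondiv_scale intro: trig_poly.scale)
      then show ?thesis unfolding V_def by blast
    qed
  qed
  then obtain v :: "nat \<Rightarrow> real^'n \<Rightarrow> real" and w and r :: "nat \<Rightarrow> nat" where
    v: "\<And>n. v n \<in> V" and w: "w = (\<lambda>x. lim (\<lambda>k. 1 - v (r k) x))" and sw: "square_integrable cell w"
    and lim: "(\<lambda>n. L2norm cell (\<lambda>x. 1 - v n x - w x)) \<longlonglongrightarrow> 0"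
    and orth: "\<And>g. g \<in> V \<Longrightarrow> (\<integral>x. w x * g x \<partial>cell) = 0" by blast
  have "\<forall>n. \<exists>\<phi>. v n = nondiv A b \<phi> \<and> trig_poly \<phi>" using v by (auto simp: V_def)
  then obtain \<phi> where \<phi>: "\<And>n. v n = nondiv A b (\<phi> n)" "\<And>n. trig_poly (\<phi> n)" by metis
  have ker: "(\<integral>x. w x * nondiv A b \<psi> x \<partial>cell) = 0" if "trig_poly \<psi>" for \<psi> using orth that by (auto simp: V_def)
  have mw: "w \<in> borel_measurable lebesgue"
    unfolding w using nondiv_measurable[OF \<phi>(2)] \<phi>(1) by (intro borel_measurable_lim_metric) auto
  have perw: "periodic_ae w"
    unfolding periodic_ae_def
  proof
    fix i
    have "AE x in lebesgue. A (x + axis i 1) = A x" "AE x in lebesgue. b (x + axis i 1) = b x"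
      using perA perb by (auto simp: periodic_ae_def)
    then show "AE x in lebesgue. w (x + axis i 1) = w x"
    proof eventually_elim
      case (elim x)
      have "v n (x + axis i 1) = v n x" for n
        unfolding \<phi>(1) nondiv_alt using elim by (simp add: trig_poly_shift trig_poly_D \<phi>(2))
      then show ?case by (simp add: w)
    qed
  qed
  have "(\<integral>x. w x \<partial>cell) \<noteq> 0"
  proof
    assume "(\<integral>x. w x \<partial>cell) = 0"
    with adjoint_kernel_mean_zero[of w] sw ker have "AE x in cell. w x = 0" by blast
    then have ae: "AE x in cell. 1 - v n x - w x = 1 - v n x" for n by eventually_elim simp
    have "L2norm cell (\<lambda>x. 1 - v n x - w x) = L2norm cell (\<lambda>x. 1 - v n x)" for n
      using sw nondiv_square_integrable[OF \<phi>(2)] \<phi>(1)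
      by (intro L2norm_cong_AE[OF ae] square_integrable_measurable) auto
    then have "(1 - \<kappa>) / 2 \<le> L2norm cell (\<lambda>x. 1 - v n x - w x)" for n
      using one_not_in_range[OF \<phi>(2), of n] \<phi>(1) by simp
    then have "(1 - \<kappa>) / 2 \<le> 0" using lim by (intro LIMSEQ_le_const) auto
    then show False using \<kappa> by simp
  qed
  define m where "m = (\<integral>x. w x \<partial>cell)"
  show ?thesis
  proof (intro exI[of _ "\<lambda>x. (1 / m) * w x"] conjI allI impI)
    show "L2_per (\<lambda>x. (1 / m) * w x)"
    proof (rule L2_per_if_square_integrable)
      show "(\<lambda>x. (1 / m) * w x) \<in> borel_measurable lebesgue" using mw by (intro borel_measurable_times) auto
      show "periodic_ae (\<lambda>x. (1 / m) * w x)" using perw by (auto simp: periodic_ae_def elim: eventually_mono)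
      show "square_integrable cell (\<lambda>x. (1 / m) * w x)" by (rule square_integrable_scale[OF sw])
    qed
    show "(\<integral>x. (1 / m) * w x \<partial>cell) = 1" using \<open>(\<integral>x. w x \<partial>cell) \<noteq> 0\<close> by (simp add: m_def)
    show "(\<integral>x. (1 / m) * w x * nondiv A b \<psi> x \<partial>cell) = 0" if "trig_poly \<psi>" for \<psi>
      using ker[OF that] by (simp add: mult.assoc)
  qed
qed

lemma dense_range:
  assumes \<mu>: "\<mu> \<ge> 0" "\<nu> \<ge> 0" "\<mu> + \<nu> > 0" and f: "square_integrable cell f" and e: "e > 0"
  shows "\<exists>\<phi>. trig_poly \<phi> \<and>
    L2norm cell (\<lambda>x. f x - (\<mu> * \<phi> x + \<nu> * coef \<phi> (\<lambda>_. 0) - nondiv A b \<phi> x)) < e"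
proof -
  define T where "T \<phi> x = \<mu> * \<phi> x + \<nu> * coef \<phi> (\<lambda>_. 0) - nondiv A b \<phi> x" for \<phi> x
  have Tsq: "square_integrable cell (T \<phi>)" if "trig_poly \<phi>" for \<phi>
    unfolding T_def[abs_def]
    using trig_poly_square_integrable[OF that] nondiv_square_integrable[OF that] by simp
  have Tadd: "T (\<lambda>x. \<phi> x + \<psi> x) x = T \<phi> x + T \<psi> x" if "trig_poly \<phi>" "trig_poly \<psi>" for \<phi> \<psi> x
    using that by (simp add: T_def nondiv_add coef_add trig_poly_square_integrable algebra_simps)
  define \<eta> where "\<eta> = e / 2"
  have \<eta>: "\<eta> > 0" using e by (simp add: \<eta>_def)
  have "\<exists>\<phi>. trig_poly \<phi> \<and> L2norm cell (\<lambda>x. f x - T \<phi> x) \<le> \<kappa> ^ n * L2norm cell f + \<eta>" for n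
  proof (induction n)
    case 0
    have "T (\<lambda>x. 0) x = 0" for x by (simp add: T_def nondiv_const coef_const)
    then show ?case using \<eta> trig_poly_const[of 0] by (intro exI[of _ "\<lambda>x. 0"]) simp
  next
    case (Suc n)
    then obtain \<phi> where \<phi>: "trig_poly \<phi>" "L2norm cell (\<lambda>x. f x - T \<phi> x) \<le> \<kappa> ^ n * L2norm cell f + \<eta>" by blast
    let ?r = "\<lambda>x. f x - T \<phi> x"
    define \<zeta> where "\<zeta> = \<eta> * (1 - \<kappa>) / 2"
    have \<zeta>: "\<zeta> > 0" using \<eta> \<kappa> by (simp add: \<zeta>_def)
    have r: "square_integrable cell ?r" using f Tsq[OF \<phi>(1)] by simp
    obtain N where N: "L2norm cell (\<lambda>x. fejer N ?r x - ?r x) < \<zeta>"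
      using LIMSEQ_D[OF fejer_tendsto[OF r] \<zeta>] by auto
    let ?g = "fejer N ?r"
    have g: "trig_poly ?g" by (rule trig_poly_fejer)
    obtain \<psi> where \<psi>: "trig_poly \<psi>" "resolvent_op \<mu> \<nu> \<psi> = ?g" using resolvent_op_surj[OF \<mu> g] by blast
    let ?E = "\<lambda>x. nondiv A b \<psi> x - Lap \<psi> x"
    have E: "square_integrable cell ?E" "L2norm cell ?E \<le> \<kappa> * L2norm cell (Lap \<psi>)"
      by (rule perturbation[OF \<psi>(1)])+
    have T\<psi>: "T \<psi> x = ?g x - ?E x" for x
      using fun_cong[OF \<psi>(2), of x] by (simp add: T_def resolvent_op_def)
    have "L2norm cell (\<lambda>x. f x - T (\<lambda>x. \<phi> x + \<psi> x) x) = L2norm cell (\<lambda>x. (?r x - ?g x) + ?E x)"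
      by (rule arg_cong[of _ _ "L2norm cell"]) (simp add: Tadd[OF \<phi>(1) \<psi>(1)] T\<psi> algebra_simps)
    also have "\<dots> \<le> L2norm cell (\<lambda>x. ?r x - ?g x) + L2norm cell ?E"
      by (rule L2norm_triangle[OF square_integrable_diff[OF r trig_poly_square_integrable[OF g]] E(1)])
    also have "L2norm cell (\<lambda>x. ?r x - ?g x) \<le> \<zeta>" using N L2norm_minus_commute[of cell ?r ?g] by simp
    also have "L2norm cell ?E \<le> \<kappa> * L2norm cell ?r"
    proof -
      have "L2norm cell (Lap \<psi>) \<le> L2norm cell ?g"
        using Lap_le_resolvent_op[OF \<mu>(1,2) \<psi>(1)] \<psi>(2) by simp
      also have "\<dots> \<le> L2norm cell ?r" by (rule fejer_norm_le[OF r])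
      finally show ?thesis using E(2) mult_left_mono[of "L2norm cell (Lap \<psi>)" "L2norm cell ?r" \<kappa>] \<kappa>(1) by linarith
    qed
    also have "\<kappa> * L2norm cell ?r \<le> \<kappa> * (\<kappa> ^ n * L2norm cell f + \<eta>)" by (intro mult_left_mono \<phi>(2) \<kappa>)
    also have "\<zeta> + \<kappa> * (\<kappa> ^ n * L2norm cell f + \<eta>) \<le> \<kappa> ^ Suc n * L2norm cell f + \<eta>"
      using \<eta> \<kappa>(2) by (simp add: \<zeta>_def field_simps)
    finally show ?case using trig_poly.add[OF \<phi>(1) \<psi>(1)] by auto
  qed
  moreover have "\<exists>n. \<kappa> ^ n * L2norm cell f < \<eta>"
  proof -
    have "(\<lambda>n. \<kappa> ^ n * L2norm cell f) \<longlonglongrightarrow> 0 * L2norm cell f"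
      using \<kappa> by (intro tendsto_mult tendsto_const LIMSEQ_power_zero) auto
    then have "\<forall>\<^sub>F n in sequentially. \<kappa> ^ n * L2norm cell f < \<eta>" using \<eta> by (intro order_tendstoD) auto
    then show ?thesis by (auto simp: eventually_sequentially)
  qed
  ultimately obtain n \<phi> where "trig_poly \<phi>" "L2norm cell (\<lambda>x. f x - T \<phi> x) \<le> \<kappa> ^ n * L2norm cell f + \<eta>"
    "\<kappa> ^ n * L2norm cell f < \<eta>" by blast
  then show ?thesis unfolding T_def[abs_def] \<eta>_def by (intro exI[of _ \<phi>]) auto
qed

end

subsection \<open>Positivity for smooth coefficients\<close>

definition soft_plus :: "real \<Rightarrow> real \<Rightarrow> real" where
  "soft_plus \<epsilon> t = (t + sqrt (t\<^sup>2 + \<epsilon>\<^sup>2)) / 2"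

context
  fixes \<epsilon> :: real
  assumes \<epsilon>: "\<epsilon> > 0"
begin

lemma sqrt_pos_eps: "sqrt (t\<^sup>2 + \<epsilon>\<^sup>2) > 0"
  using \<epsilon> by (simp add: add_nonneg_pos)

lemma abs_le_sqrt_eps: "\<bar>t\<bar> \<le> sqrt (t\<^sup>2 + \<epsilon>\<^sup>2)"
  by (rule real_le_rsqrt) simp

lemma sqrt_eps_DERIV: "((\<lambda>t. sqrt (t\<^sup>2 + \<epsilon>\<^sup>2)) has_real_derivative t / sqrt (t\<^sup>2 + \<epsilon>\<^sup>2)) (at t)"
proof -
  have p: "t\<^sup>2 + \<epsilon>\<^sup>2 > 0" using \<epsilon> by (simp add: add_nonneg_pos)
  have "((\<lambda>t. t\<^sup>2 + \<epsilon>\<^sup>2) has_real_derivative 2 * t) (at t)" by (auto intro!: derivative_eq_intros)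
  from DERIV_chain2[OF DERIV_real_sqrt[OF p] this] show ?thesis
    by (rule DERIV_cong) (simp only: divide_inverse, algebra)
qed

lemma soft_plus_DERIV: "(soft_plus \<epsilon> has_real_derivative soft_plus \<epsilon> t / sqrt (t\<^sup>2 + \<epsilon>\<^sup>2)) (at t)"
proof -
  have "(1 + t / sqrt (t\<^sup>2 + \<epsilon>\<^sup>2)) / 2 = soft_plus \<epsilon> t / sqrt (t\<^sup>2 + \<epsilon>\<^sup>2)"
  proof -
    have "(1 + t / q) / 2 = ((t + q) / 2) / q" if "q > 0" for q using that by (simp add: field_simps)
    then show ?thesis using sqrt_pos_eps[of t] unfolding soft_plus_def by blast
  qed
  with DERIV_cdivide[OF DERIV_add[OF DERIV_ident sqrt_eps_DERIV[of t]], of 2]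
  show ?thesis by (simp add: soft_plus_def[abs_def])
qed

lemma soft_plus_square_DERIV:
  "((\<lambda>t. (soft_plus \<epsilon> t)\<^sup>2 / 2) has_real_derivative (soft_plus \<epsilon> t)\<^sup>2 / sqrt (t\<^sup>2 + \<epsilon>\<^sup>2)) (at t)"
  using soft_plus_DERIV[of t] by (auto intro!: derivative_eq_intros simp: power2_eq_square)

lemma soft_plus_square_DERIV2:
  "((\<lambda>t. (soft_plus \<epsilon> t)\<^sup>2 / sqrt (t\<^sup>2 + \<epsilon>\<^sup>2)) has_real_derivative
     (soft_plus \<epsilon> t)\<^sup>2 * (2 - t / sqrt (t\<^sup>2 + \<epsilon>\<^sup>2)) / (t\<^sup>2 + \<epsilon>\<^sup>2)) (at t)"
proof -
  let ?q = "sqrt (t\<^sup>2 + \<epsilon>\<^sup>2)"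
  have p: "t\<^sup>2 + \<epsilon>\<^sup>2 > 0" using \<epsilon> by (simp add: add_nonneg_pos)
  have q: "?q > 0" "?q * ?q = t\<^sup>2 + \<epsilon>\<^sup>2" using p by auto
  note d1 = sqrt_eps_DERIV[of t]
  have d2: "((\<lambda>t. (soft_plus \<epsilon> t)\<^sup>2) has_real_derivative 2 * (soft_plus \<epsilon> t)\<^sup>2 / ?q) (at t)"
    using soft_plus_DERIV[of t] by (auto intro!: derivative_eq_intros simp: power2_eq_square)
  have "((\<lambda>t. (soft_plus \<epsilon> t)\<^sup>2 / sqrt (t\<^sup>2 + \<epsilon>\<^sup>2)) has_real_derivative
     (2 * (soft_plus \<epsilon> t)\<^sup>2 / ?q * ?q - (soft_plus \<epsilon> t)\<^sup>2 * (t / ?q)) / (?q * ?q)) (at t)"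
    by (rule DERIV_divide[OF d2 d1]) (use q(1) in linarith)
  moreover have "(2 * (soft_plus \<epsilon> t)\<^sup>2 / ?q * ?q - (soft_plus \<epsilon> t)\<^sup>2 * (t / ?q)) / (?q * ?q) =
      (soft_plus \<epsilon> t)\<^sup>2 * (2 - t / ?q) / (t\<^sup>2 + \<epsilon>\<^sup>2)"
    unfolding q(2) using q(1) by (simp add: right_diff_distrib mult.commute)
  ultimately show ?thesis by (simp only:)
qed

lemma soft_plus_convex: "0 \<le> (soft_plus \<epsilon> t)\<^sup>2 * (2 - t / sqrt (t\<^sup>2 + \<epsilon>\<^sup>2)) / (t\<^sup>2 + \<epsilon>\<^sup>2)"
proof -
  have "t \<le> sqrt (t\<^sup>2 + \<epsilon>\<^sup>2)" using abs_le_sqrt_eps[of t] by linarith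
  then have "t / sqrt (t\<^sup>2 + \<epsilon>\<^sup>2) \<le> 1" using sqrt_pos_eps[of t] by simp
  then show ?thesis by (intro divide_nonneg_nonneg mult_nonneg_nonneg) auto
qed

lemma soft_plus_bounds: 
  assumes "\<epsilon> \<le> 1"
  shows "0 \<le> soft_plus \<epsilon> t" "soft_plus \<epsilon> t \<le> \<bar>t\<bar> + 1"
    "0 \<le> (soft_plus \<epsilon> t)\<^sup>2 / sqrt (t\<^sup>2 + \<epsilon>\<^sup>2)" "(soft_plus \<epsilon> t)\<^sup>2 / sqrt (t\<^sup>2 + \<epsilon>\<^sup>2) \<le> \<bar>t\<bar> + 1"
proof -
  let ?q = "sqrt (t\<^sup>2 + \<epsilon>\<^sup>2)"
  have "t\<^sup>2 + \<epsilon>\<^sup>2 \<le> (\<bar>t\<bar> + \<epsilon>)\<^sup>2" using \<epsilon> by (simp add: power2_sum)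
  then have q: "?q \<le> \<bar>t\<bar> + \<epsilon>" using \<epsilon> by (intro real_le_lsqrt) auto
  have "0 \<le> t + ?q" using abs_le_sqrt_eps[of t] by linarith
  then show s0: "0 \<le> soft_plus \<epsilon> t" by (simp add: soft_plus_def)
  show s1: "soft_plus \<epsilon> t \<le> \<bar>t\<bar> + 1" unfolding soft_plus_def using q assms by simp
  show "0 \<le> (soft_plus \<epsilon> t)\<^sup>2 / ?q" using sqrt_pos_eps[of t] by simp
  have "soft_plus \<epsilon> t \<le> ?q" unfolding soft_plus_def using abs_le_sqrt_eps[of t] by simp
  then have "(soft_plus \<epsilon> t)\<^sup>2 \<le> ?q * soft_plus \<epsilon> t"
    unfolding power2_eq_square by (intro mult_right_mono s0)
  then have "(soft_plus \<epsilon> t)\<^sup>2 / ?q \<le> soft_plus \<epsilon> t"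
    using sqrt_pos_eps[of t] by (simp add: divide_le_eq mult.commute)
  then show "(soft_plus \<epsilon> t)\<^sup>2 / ?q \<le> \<bar>t\<bar> + 1" using s1 by linarith
qed

end

lemma soft_plus_tendsto:
  "(\<lambda>n. (soft_plus (1 / real (Suc n)) t)\<^sup>2 / 2) \<longlonglongrightarrow> (max 0 t)\<^sup>2 / 2"
  "(\<lambda>n. (soft_plus (1 / real (Suc n)) t)\<^sup>2 / sqrt (t\<^sup>2 + (1 / real (Suc n))\<^sup>2)) \<longlonglongrightarrow> max 0 t"
proof -
  have e: "(\<lambda>n. 1 / real (Suc n)) \<longlonglongrightarrow> 0" by (rule LIMSEQ_Suc[OF lim_1_over_n])
  have q: "(\<lambda>n. sqrt (t\<^sup>2 + (1 / real (Suc n))\<^sup>2)) \<longlonglongrightarrow> sqrt (t\<^sup>2 + 0\<^sup>2)"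
    by (intro tendsto_intros e)
  then have q: "(\<lambda>n. sqrt (t\<^sup>2 + (1 / real (Suc n))\<^sup>2)) \<longlonglongrightarrow> \<bar>t\<bar>" by simp
  then have "(\<lambda>n. soft_plus (1 / real (Suc n)) t) \<longlonglongrightarrow> (t + \<bar>t\<bar>) / 2"
    unfolding soft_plus_def by (intro tendsto_intros) auto
  moreover have "(t + \<bar>t\<bar>) / 2 = max 0 t" by (auto simp: max_def)
  ultimately have s: "(\<lambda>n. soft_plus (1 / real (Suc n)) t) \<longlonglongrightarrow> max 0 t" by simp
  then show "(\<lambda>n. (soft_plus (1 / real (Suc n)) t)\<^sup>2 / 2) \<longlonglongrightarrow> (max 0 t)\<^sup>2 / 2" by (intro tendsto_intros) auto
  show "(\<lambda>n. (soft_plus (1 / real (Suc n)) t)\<^sup>2 / sqrt (t\<^sup>2 + (1 / real (Suc n))\<^sup>2)) \<longlonglongrightarrow> max 0 t"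
  proof (cases "t = 0")
    case False
    then have "(\<lambda>n. (soft_plus (1 / real (Suc n)) t)\<^sup>2 / sqrt (t\<^sup>2 + (1 / real (Suc n))\<^sup>2)) \<longlonglongrightarrow> (max 0 t)\<^sup>2 / \<bar>t\<bar>"
      by (intro tendsto_divide tendsto_power s q) auto
    moreover have "(max 0 t)\<^sup>2 / \<bar>t\<bar> = max 0 t" using False by (auto simp: max_def power2_eq_square)
    ultimately show ?thesis by simp
  next
    case True
    have *: "(soft_plus \<epsilon> t)\<^sup>2 / sqrt (t\<^sup>2 + \<epsilon>\<^sup>2) = \<epsilon> / 4" if "\<epsilon> > 0" for \<epsilon>
      using that True by (simp add: soft_plus_def power2_eq_square)
    have "(\<lambda>n. (soft_plus (1 / real (Suc n)) t)\<^sup>2 / sqrt (t\<^sup>2 + (1 / real (Suc n))\<^sup>2)) = (\<lambda>n. (1 / real (Suc n)) / 4)"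
      by (intro ext, rule *) simp
    moreover have "(\<lambda>n. (1 / real (Suc n)) / 4) \<longlonglongrightarrow> 0 / 4" by (intro tendsto_intros e) auto
    ultimately show ?thesis using True by simp
  qed
qed

locale smooth_cordes = cordes A b \<rho> \<kappa>
  for A :: "real ^ 'n::finite \<Rightarrow> real ^ 'n ^ 'n" and b :: "real ^ 'n \<Rightarrow> real ^ 'n" and \<rho> \<kappa> +
  assumes trig_A: "\<And>i j. trig_poly (\<lambda>x. A x $ i $ j)"
    and trig_b: "\<And>i. trig_poly (\<lambda>x. b x $ i)"
    and near_identity_everywhere: "\<And>x. (norm (A x - mat 1))\<^sup>2 + (norm (b x))\<^sup>2 \<le> \<rho>\<^sup>2"
begin

lemma rho_less_1: "\<rho>\<^sup>2 < 1"
proof -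
  have "\<rho>\<^sup>2 * 1 \<le> \<rho>\<^sup>2 * (1 + 1 / (4 * pi\<^sup>2))" by (intro mult_left_mono) auto
  also have "\<dots> \<le> \<kappa>\<^sup>2" by (rule \<kappa>)
  also have "\<kappa>\<^sup>2 < 1" using \<kappa> by (simp add: power_less_one_iff)
  finally show ?thesis by simp
qed

lemma quadratic_form_nonneg: "0 \<le> (\<Sum>i\<in>UNIV. \<Sum>j\<in>UNIV. A x $ i $ j * (\<xi> $ i * \<xi> $ j))"
proof -
  define X :: "real^'n^'n" where "X = (\<chi> i j. \<xi> $ i * \<xi> $ j)"
  have "(norm X)\<^sup>2 = (\<Sum>i\<in>UNIV. \<Sum>j\<in>UNIV. (\<xi> $ i * \<xi> $ i) * (\<xi> $ j * \<xi> $ j))"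
    unfolding power2_norm_eq_inner inner_matrix X_def by (simp add: mult_ac)
  also have "\<dots> = (\<xi> \<bullet> \<xi>)\<^sup>2" unfolding inner_vector power2_eq_square by (rule sum_product[symmetric])
  finally have nX: "norm X = \<xi> \<bullet> \<xi>" by (simp add: power2_eq_iff_nonneg)
  have "(norm (A x - mat 1))\<^sup>2 \<le> 1\<^sup>2"
    using near_identity_everywhere[of x] rho_less_1 zero_le_power2[of "norm (b x)"]
    unfolding one_power2 by linarith
  then have n1: "norm (A x - mat 1) \<le> 1" by (rule power2_le_imp_le) simp
  have "\<bar>(A x - mat 1) \<bullet> X\<bar> \<le> norm (A x - mat 1) * norm X" by (rule Cauchy_Schwarz_ineq2)
  also have "\<dots> \<le> 1 * (\<xi> \<bullet> \<xi>)" unfolding nX by (intro mult_right_mono n1) simp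
  finally have "- (\<xi> \<bullet> \<xi>) \<le> (A x - mat 1) \<bullet> X" by simp
  moreover have "mat 1 \<bullet> X = \<xi> \<bullet> \<xi>"
  proof -
    have "(\<Sum>j\<in>UNIV. mat 1 $ i $ j * X $ i $ j) = \<xi> $ i * \<xi> $ i" for i
    proof -
      have "(\<Sum>j\<in>UNIV. mat 1 $ i $ j * X $ i $ j) = (\<Sum>j\<in>UNIV. if i = j then \<xi> $ i * \<xi> $ j else 0)"
        by (intro sum.cong) (auto simp: mat_def X_def)
      then show ?thesis by simp
    qed
    then show ?thesis by (simp add: inner_matrix inner_vector)
  qed
  ultimately have "0 \<le> A x \<bullet> X" by (simp add: inner_diff_left)
  then show ?thesis by (simp add: inner_matrix X_def)
qed

definition adjoint_one :: "real ^ 'n \<Rightarrow> real" where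
  "adjoint_one x = (\<Sum>i\<in>UNIV. \<Sum>j\<in>UNIV. D j (D i (\<lambda>x. A x $ i $ j)) x) - (\<Sum>i\<in>UNIV. D i (\<lambda>x. b x $ i) x)"

lemma trig_poly_adjoint_one: "trig_poly adjoint_one"
  unfolding adjoint_one_def[abs_def] by (intro trig_poly_diff trig_poly_sum trig_poly_D trig_A trig_b)

lemma cell_integrable_continuous: "continuous_on UNIV f \<Longrightarrow> integrable cell (f :: real^'n \<Rightarrow> real)"
  by (intro L1_loc_integrable_cell L1_loc_continuous)

text \<open>\<open>L (\<beta> \<circ> \<phi>) = \<beta>'(\<phi>) L \<phi> + \<beta>''(\<phi>) \<nabla>\<phi> \<bullet> A \<nabla>\<phi>\<close> with nonnegative last term, integrated against \<open>1\<close>.\<close>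

lemma convex_test:
  assumes \<phi>: "trig_poly \<phi>"
    and \<beta>: "\<And>t. (\<beta> has_real_derivative \<beta>' t) (at t)" "\<And>t. (\<beta>' has_real_derivative \<beta>'' t) (at t)"
      "continuous_on UNIV \<beta>''" "\<And>t. 0 \<le> \<beta>'' t"
  shows "(\<integral>x. \<beta>' (\<phi> x) * nondiv A b \<phi> x \<partial>cell) \<le> (\<integral>x. adjoint_one x * \<beta> (\<phi> x) \<partial>cell)"
proof -
  have c\<beta>: "continuous_on UNIV \<beta>" "continuous_on UNIV \<beta>'"
    using DERIV_continuous_on[of UNIV \<beta>] DERIV_continuous_on[of UNIV \<beta>'] \<beta>(1,2) by blast+
  note tc = trig_poly_continuous[OF \<phi>] trig_poly_continuous[OF trig_poly_D[OF \<phi>]]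
    trig_poly_continuous[OF trig_poly_D[OF trig_poly_D[OF \<phi>]]]
    trig_poly_continuous[OF trig_A] trig_poly_continuous[OF trig_b]
    trig_poly_continuous[OF trig_poly_D[OF trig_A]] trig_poly_continuous[OF trig_poly_D[OF trig_b]]
    trig_poly_continuous[OF trig_poly_D[OF trig_poly_D[OF trig_A]]]
  define F where "F x = \<beta> (\<phi> x)" for x
  define F1 where "F1 j x = \<beta>' (\<phi> x) * D j \<phi> x" for j x
  define F2 where "F2 i j x = \<beta>'' (\<phi> x) * D i \<phi> x * D j \<phi> x + \<beta>' (\<phi> x) * D i (D j \<phi>) x" for i j x
  have cF: "continuous_on UNIV F" "continuous_on UNIV (F1 j)" "continuous_on UNIV (F2 i j)" for i j
    unfolding F_def[abs_def] F1_def[abs_def] F2_def[abs_def]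
    by (intro continuous_intros tc continuous_on_compose2[OF c\<beta>(1) tc(1)] continuous_on_compose2[OF c\<beta>(2) tc(1)]
        continuous_on_compose2[OF \<beta>(3) tc(1)]; simp)+
  have dF: "directional_deriv j F (F1 j)" for j
    unfolding F_def[abs_def] F1_def[abs_def]
    by (rule directional_deriv_compose[OF trig_poly_directional_deriv[OF \<phi>] \<beta>(1)])
  have dF1: "directional_deriv i (F1 j) (F2 i j)" for i j
    unfolding F1_def[abs_def] F2_def[abs_def]
    by (rule directional_deriv_mult[OF directional_deriv_compose[OF trig_poly_directional_deriv[OF \<phi>] \<beta>(2)]
          trig_poly_directional_deriv[OF trig_poly_D[OF \<phi>]]])
  have pF: "F (x + axis k 1) = F x" "F1 j (x + axis k 1) = F1 j x" for j k x
    by (simp_all add: F_def F1_def trig_poly_shift \<phi> trig_poly_D)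
  have A2: "(\<integral>x. A x $ i $ j * F2 i j x \<partial>cell) = (\<integral>x. D j (D i (\<lambda>x. A x $ i $ j)) x * F x \<partial>cell)" for i j
  proof -
    have "(\<integral>x. F2 i j x * A x $ i $ j \<partial>cell) = - (\<integral>x. F1 j x * D i (\<lambda>x. A x $ i $ j) x \<partial>cell)"
      by (rule cell_integration_by_parts[OF dF1 trig_poly_directional_deriv[OF trig_A]])
        (intro cF tc pF trig_poly_shift[OF trig_A])+
    also have "(\<integral>x. F1 j x * D i (\<lambda>x. A x $ i $ j) x \<partial>cell) = - (\<integral>x. F x * D j (D i (\<lambda>x. A x $ i $ j)) x \<partial>cell)"
      by (rule cell_integration_by_parts[OF dF trig_poly_directional_deriv[OF trig_poly_D[OF trig_A]]])
        (intro cF tc pF trig_poly_shift[OF trig_poly_D[OF trig_A]])+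
    finally show ?thesis by (simp add: mult.commute)
  qed
  have b1: "(\<integral>x. b x $ i * F1 i x \<partial>cell) = - (\<integral>x. D i (\<lambda>x. b x $ i) x * F x \<partial>cell)" for i
  proof -
    have "(\<integral>x. F1 i x * b x $ i \<partial>cell) = - (\<integral>x. F x * D i (\<lambda>x. b x $ i) x \<partial>cell)"
      by (rule cell_integration_by_parts[OF dF trig_poly_directional_deriv[OF trig_b]])
        (intro cF tc pF trig_poly_shift[OF trig_b])+
    then show ?thesis by (simp add: mult.commute)
  qed
  have i1: "integrable cell (\<lambda>x. A x $ i $ j * F2 i j x)" "integrable cell (\<lambda>x. b x $ i * F1 i x)"
    "integrable cell (\<lambda>x. D j (D i (\<lambda>x. A x $ i $ j)) x * F x)" "integrable cell (\<lambda>x. D i (\<lambda>x. b x $ i) x * F x)" for i j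
    by (intro cell_integrable_continuous continuous_intros cF tc)+
  have "(\<integral>x. \<beta>' (\<phi> x) * nondiv A b \<phi> x \<partial>cell) \<le>
      (\<integral>x. (\<Sum>i\<in>UNIV. \<Sum>j\<in>UNIV. A x $ i $ j * F2 i j x) + (\<Sum>i\<in>UNIV. b x $ i * F1 i x) \<partial>cell)"
  proof (rule integral_mono)
    show "integrable cell (\<lambda>x. \<beta>' (\<phi> x) * nondiv A b \<phi> x)"
      unfolding nondiv_alt
      by (intro cell_integrable_continuous continuous_on_add continuous_on_mult continuous_on_sum tc
          continuous_on_compose2[OF c\<beta>(2) tc(1)] subset_UNIV)
    show "integrable cell (\<lambda>x. (\<Sum>i\<in>UNIV. \<Sum>j\<in>UNIV. A x $ i $ j * F2 i j x) + (\<Sum>i\<in>UNIV. b x $ i * F1 i x))"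
      by (intro Bochner_Integration.integrable_add Bochner_Integration.integrable_sum i1)
    fix x
    have "(\<Sum>i\<in>UNIV. \<Sum>j\<in>UNIV. A x $ i $ j * F2 i j x) + (\<Sum>i\<in>UNIV. b x $ i * F1 i x)
      = \<beta>'' (\<phi> x) * (\<Sum>i\<in>UNIV. \<Sum>j\<in>UNIV. A x $ i $ j * (grad \<phi> x $ i * grad \<phi> x $ j)) + \<beta>' (\<phi> x) * nondiv A b \<phi> x"
      unfolding nondiv_alt F1_def F2_def grad_def
      by (simp add: sum_distrib_left distrib_left sum.distrib mult_ac)
    then show "\<beta>' (\<phi> x) * nondiv A b \<phi> x \<le> (\<Sum>i\<in>UNIV. \<Sum>j\<in>UNIV. A x $ i $ j * F2 i j x) + (\<Sum>i\<in>UNIV. b x $ i * F1 i x)"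
      using mult_nonneg_nonneg[OF \<beta>(4)[of "\<phi> x"] quadratic_form_nonneg[of x "grad \<phi> x"]] by linarith
  qed
  also have "\<dots> = (\<Sum>i\<in>UNIV. \<Sum>j\<in>UNIV. \<integral>x. A x $ i $ j * F2 i j x \<partial>cell) + (\<Sum>i\<in>UNIV. \<integral>x. b x $ i * F1 i x \<partial>cell)"
    using i1 by (simp add: Bochner_Integration.integral_sum)
  also have "\<dots> = (\<integral>x. adjoint_one x * F x \<partial>cell)"
    unfolding A2 b1 adjoint_one_def left_diff_distrib sum_distrib_right
    using i1 by (simp add: Bochner_Integration.integral_sum sum_negf)
  finally show ?thesis by (simp add: F_def)
qed

lemma accretive:
  "\<exists>\<omega>\<ge>0. \<forall>\<phi>. trig_poly \<phi> \<longrightarrow> (\<integral>x. max 0 (\<phi> x) * nondiv A b \<phi> x \<partial>cell) \<le> \<omega> * (L2norm cell (\<lambda>x. max 0 (\<phi> x)))\<^sup>2"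
proof -
  obtain \<omega> where \<omega>: "\<omega> \<ge> 0" "\<And>x. \<bar>adjoint_one x\<bar> \<le> \<omega>" using trig_poly_bounded[OF trig_poly_adjoint_one] by blast
  have "(\<integral>x. max 0 (\<phi> x) * nondiv A b \<phi> x \<partial>cell) \<le> \<omega> * (L2norm cell (\<lambda>x. max 0 (\<phi> x)))\<^sup>2" if \<phi>: "trig_poly \<phi>" for \<phi>
  proof -
    let ?\<epsilon> = "\<lambda>n. 1 / real (Suc n)"
    let ?\<beta> = "\<lambda>n t. (soft_plus (?\<epsilon> n) t)\<^sup>2 / 2"
    let ?\<beta>' = "\<lambda>n t. (soft_plus (?\<epsilon> n) t)\<^sup>2 / sqrt (t\<^sup>2 + (?\<epsilon> n)\<^sup>2)"
    let ?\<beta>'' = "\<lambda>n t. (soft_plus (?\<epsilon> n) t)\<^sup>2 * (2 - t / sqrt (t\<^sup>2 + (?\<epsilon> n)\<^sup>2)) / (t\<^sup>2 + (?\<epsilon> n)\<^sup>2)"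
    have \<epsilon>: "?\<epsilon> n > 0" "?\<epsilon> n \<le> 1" for n by auto
    have c\<beta>: "continuous_on UNIV (?\<beta> n)" "continuous_on UNIV (?\<beta>' n)" for n
      using DERIV_continuous_on[of UNIV "?\<beta> n" "?\<beta>' n"] DERIV_continuous_on[of UNIV "?\<beta>' n" "?\<beta>'' n"]
        soft_plus_square_DERIV[OF \<epsilon>(1)] soft_plus_square_DERIV2[OF \<epsilon>(1)] by blast+
    have "continuous_on UNIV (?\<beta>'' n)" for n
    proof -
      have "t\<^sup>2 + (?\<epsilon> n)\<^sup>2 \<noteq> 0" for t using \<epsilon>(1)[of n] by (metis add_nonneg_pos less_irrefl zero_le_power2 zero_less_power)
      then show ?thesis unfolding soft_plus_def by (intro continuous_intros) auto
    qed
    then have main: "(\<integral>x. ?\<beta>' n (\<phi> x) * nondiv A b \<phi> x \<partial>cell) \<le> (\<integral>x. adjoint_one x * ?\<beta> n (\<phi> x) \<partial>cell)" for n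
      using soft_plus_square_DERIV[OF \<epsilon>(1)] soft_plus_square_DERIV2[OF \<epsilon>(1)] soft_plus_convex[OF \<epsilon>(1)]
      by (intro convex_test[OF \<phi>, of _ _ "?\<beta>'' n"]) auto
    obtain C where C: "C \<ge> 0" "\<And>x. \<bar>\<phi> x\<bar> \<le> C" using trig_poly_bounded[OF \<phi>] by blast
    have m\<phi>: "\<phi> \<in> borel_measurable cell" by (intro cell_measurable trig_poly_measurable \<phi>)
    have mN: "nondiv A b \<phi> \<in> borel_measurable cell" by (intro cell_measurable nondiv_measurable \<phi>)
    have ma: "adjoint_one \<in> borel_measurable cell" by (intro cell_measurable trig_poly_measurable trig_poly_adjoint_one)
    have m\<beta>: "(\<lambda>x. ?\<beta> n (\<phi> x)) \<in> borel_measurable cell" "(\<lambda>x. ?\<beta>' n (\<phi> x)) \<in> borel_measurable cell" for n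
      by (rule measurable_compose[OF m\<phi> borel_measurable_continuous_onI[OF c\<beta>(1)]],
        rule measurable_compose[OF m\<phi> borel_measurable_continuous_onI[OF c\<beta>(2)]])
    have Ni: "integrable cell (nondiv A b \<phi>)"
      by (rule cell.square_integrable_integrable[OF nondiv_square_integrable[OF \<phi>]])
    have l1: "(\<lambda>n. \<integral>x. ?\<beta>' n (\<phi> x) * nondiv A b \<phi> x \<partial>cell) \<longlonglongrightarrow> (\<integral>x. max 0 (\<phi> x) * nondiv A b \<phi> x \<partial>cell)"
    proof (rule integral_dominated_convergence)
      show "integrable cell (\<lambda>x. (C + 1) * \<bar>nondiv A b \<phi> x\<bar>)" using Ni by simp
      show "(\<lambda>x. max 0 (\<phi> x) * nondiv A b \<phi> x) \<in> borel_measurable cell"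
        using m\<phi> mN by (intro borel_measurable_times borel_measurable_max) auto
      show "(\<lambda>x. ?\<beta>' n (\<phi> x) * nondiv A b \<phi> x) \<in> borel_measurable cell" for n
        by (rule borel_measurable_times[OF m\<beta>(2) mN])
      show "AE x in cell. (\<lambda>n. ?\<beta>' n (\<phi> x) * nondiv A b \<phi> x) \<longlonglongrightarrow> max 0 (\<phi> x) * nondiv A b \<phi> x"
        by (intro AE_I2 tendsto_mult tendsto_const soft_plus_tendsto(2))
      show "AE x in cell. norm (?\<beta>' n (\<phi> x) * nondiv A b \<phi> x) \<le> (C + 1) * \<bar>nondiv A b \<phi> x\<bar>" for n
      proof (rule AE_I2)
        fix x
        have "\<bar>?\<beta>' n (\<phi> x)\<bar> \<le> C + 1"
          using soft_plus_bounds(3,4)[OF \<epsilon>, of n "\<phi> x"] C(2)[of x] by linarith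
        then show "norm (?\<beta>' n (\<phi> x) * nondiv A b \<phi> x) \<le> (C + 1) * \<bar>nondiv A b \<phi> x\<bar>"
          unfolding real_norm_def abs_mult by (rule mult_right_mono) simp
      qed
    qed
    have l2: "(\<lambda>n. \<integral>x. adjoint_one x * ?\<beta> n (\<phi> x) \<partial>cell) \<longlonglongrightarrow> (\<integral>x. adjoint_one x * ((max 0 (\<phi> x))\<^sup>2 / 2) \<partial>cell)"
    proof (rule integral_dominated_convergence)
      show "integrable cell (\<lambda>x :: real^'n. \<omega> * (C + 1)\<^sup>2)" by simp
      show "(\<lambda>x. adjoint_one x * ((max 0 (\<phi> x))\<^sup>2 / 2)) \<in> borel_measurable cell"
        using m\<phi> ma by (intro borel_measurable_times borel_measurable_divide borel_measurable_power borel_measurable_max) auto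
      show "(\<lambda>x. adjoint_one x * ?\<beta> n (\<phi> x)) \<in> borel_measurable cell" for n
        by (rule borel_measurable_times[OF ma m\<beta>(1)])
      show "AE x in cell. (\<lambda>n. adjoint_one x * ?\<beta> n (\<phi> x)) \<longlonglongrightarrow> adjoint_one x * ((max 0 (\<phi> x))\<^sup>2 / 2)"
        by (intro AE_I2 tendsto_mult tendsto_const soft_plus_tendsto(1))
      show "AE x in cell. norm (adjoint_one x * ?\<beta> n (\<phi> x)) \<le> \<omega> * (C + 1)\<^sup>2" for n
      proof (rule AE_I2)
        fix x
        have "soft_plus (?\<epsilon> n) (\<phi> x) \<le> C + 1" using soft_plus_bounds(2)[OF \<epsilon>, of n "\<phi> x"] C(2)[of x] by linarith
        then have "(soft_plus (?\<epsilon> n) (\<phi> x))\<^sup>2 \<le> (C + 1)\<^sup>2" by (intro power_mono soft_plus_bounds(1)[OF \<epsilon>])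
        then have "\<bar>?\<beta> n (\<phi> x)\<bar> \<le> (C + 1)\<^sup>2" using zero_le_power2[of "soft_plus (?\<epsilon> n) (\<phi> x)"] by linarith
        then show "norm (adjoint_one x * ?\<beta> n (\<phi> x)) \<le> \<omega> * (C + 1)\<^sup>2"
          unfolding real_norm_def abs_mult using \<omega> by (intro mult_mono) auto
      qed
    qed
    have "(\<integral>x. max 0 (\<phi> x) * nondiv A b \<phi> x \<partial>cell) \<le> (\<integral>x. adjoint_one x * ((max 0 (\<phi> x))\<^sup>2 / 2) \<partial>cell)"
      by (rule LIMSEQ_le[OF l1 l2]) (use main in blast)
    also have "\<dots> \<le> (\<integral>x. \<omega> * (max 0 (\<phi> x))\<^sup>2 \<partial>cell)"
    proof (rule integral_mono)
      have sq: "square_integrable cell (\<lambda>x. max 0 (\<phi> x))"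
        by (intro square_integrable_max_0 trig_poly_square_integrable \<phi>)
      then show i: "integrable cell (\<lambda>x. \<omega> * (max 0 (\<phi> x))\<^sup>2)" by simp
      have *: "\<bar>adjoint_one x * ((max 0 (\<phi> x))\<^sup>2 / 2)\<bar> \<le> \<omega> * (max 0 (\<phi> x))\<^sup>2" for x
        unfolding abs_mult using \<omega> by (intro mult_mono) auto
      show "integrable cell (\<lambda>x. adjoint_one x * ((max 0 (\<phi> x))\<^sup>2 / 2))"
      proof (rule Bochner_Integration.integrable_bound[OF i])
        show "(\<lambda>x. adjoint_one x * ((max 0 (\<phi> x))\<^sup>2 / 2)) \<in> borel_measurable cell"
          using m\<phi> ma by (intro borel_measurable_times borel_measurable_divide borel_measurable_power borel_measurable_max) auto
        show "AE x in cell. norm (adjoint_one x * ((max 0 (\<phi> x))\<^sup>2 / 2)) \<le> norm (\<omega> * (max 0 (\<phi> x))\<^sup>2)"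
          using * \<omega>(1) by (intro AE_I2) simp
      qed
      show "adjoint_one x * ((max 0 (\<phi> x))\<^sup>2 / 2) \<le> \<omega> * (max 0 (\<phi> x))\<^sup>2" for x using *[of x] by linarith
    qed
    finally show ?thesis by (simp add: L2norm_power2)
  qed
  then show ?thesis using \<omega>(1) by blast
qed

end

context smooth_cordes
begin

lemma bounded_nondiv:
  assumes \<phi>: "trig_poly \<phi>" shows "\<exists>C. \<forall>x. \<bar>nondiv A b \<phi> x\<bar> \<le> C"
proof -
  have s: "\<exists>C. \<forall>x. \<bar>\<Sum>i\<in>I. f i x\<bar> \<le> C" if b: "\<And>i. \<exists>C. \<forall>x. \<bar>f i x\<bar> \<le> C"
    for I :: "'i set" and f :: "'i \<Rightarrow> real^'n \<Rightarrow> real"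
  proof -
    obtain C where "\<And>i x. \<bar>f i x\<bar> \<le> C i" using b by metis
    then show ?thesis by (intro exI[of _ "\<Sum>i\<in>I. C i"] allI order.trans[OF sum_abs] sum_mono)
  qed
  have p: "\<exists>C. \<forall>x. \<bar>f x * g x\<bar> \<le> C" if t: "trig_poly f" "trig_poly g" for f g :: "real^'n \<Rightarrow> real"
  proof -
    obtain C D where "C \<ge> 0" "\<And>x. \<bar>f x\<bar> \<le> C" "D \<ge> 0" "\<And>x. \<bar>g x\<bar> \<le> D"
      using trig_poly_bounded[OF t(1)] trig_poly_bounded[OF t(2)] by blast
    then show ?thesis by (intro exI[of _ "C * D"]) (auto simp: abs_mult intro: mult_mono)
  qed
  have "\<exists>C. \<forall>x. \<bar>\<Sum>i\<in>UNIV. \<Sum>j\<in>UNIV. A x $ i $ j * D i (D j \<phi>) x\<bar> \<le> C"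
    by (intro s p trig_A trig_poly_D \<phi>)
  moreover have "\<exists>C. \<forall>x. \<bar>\<Sum>i\<in>UNIV. b x $ i * D i \<phi> x\<bar> \<le> C"
    by (intro s p trig_b trig_poly_D \<phi>)
  ultimately obtain C1 C2 where "\<And>x. \<bar>\<Sum>i\<in>UNIV. \<Sum>j\<in>UNIV. A x $ i $ j * D i (D j \<phi>) x\<bar> \<le> C1"
    "\<And>x. \<bar>\<Sum>i\<in>UNIV. b x $ i * D i \<phi> x\<bar> \<le> C2" by blast
  then show ?thesis unfolding nondiv_alt
    by (intro exI[of _ "C1 + C2"] allI order.trans[OF abs_triangle_ineq] add_mono)
qed

lemma positive_part_bound:
  assumes \<omega>: "\<And>\<phi>. trig_poly \<phi> \<Longrightarrow>
      (\<integral>x. max 0 (\<phi> x) * nondiv A b \<phi> x \<partial>cell) \<le> \<omega> * (L2norm cell (\<lambda>x. max 0 (\<phi> x)))\<^sup>2"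
    and \<phi>: "trig_poly \<phi>"
  shows "L2norm cell (\<lambda>x. max 0 (\<phi> x)) \<le> L2norm cell (\<lambda>x. max 0 ((\<omega> + 1) * \<phi> x - nondiv A b \<phi> x))"
proof -
  let ?p = "\<lambda>x. max 0 (\<phi> x)" and ?f = "\<lambda>x. (\<omega> + 1) * \<phi> x - nondiv A b \<phi> x"
  have \<phi>s: "square_integrable cell \<phi>" by (rule trig_poly_square_integrable[OF \<phi>])
  have N: "square_integrable cell (nondiv A b \<phi>)" by (rule nondiv_square_integrable[OF \<phi>])
  have p: "square_integrable cell ?p" by (rule square_integrable_max_0[OF \<phi>s])
  have f: "square_integrable cell ?f" using \<phi>s N by simp
  have fp: "square_integrable cell (\<lambda>x. max 0 (?f x))" by (rule square_integrable_max_0[OF f])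
  have "(\<omega> + 1) * (L2norm cell ?p)\<^sup>2 - (\<integral>x. ?p x * nondiv A b \<phi> x \<partial>cell) = (\<integral>x. ?p x * ?f x \<partial>cell)"
  proof -
    have "?p x * ?f x = (\<omega> + 1) * (?p x * ?p x) - ?p x * nondiv A b \<phi> x" for x
      by (auto simp: max_def algebra_simps)
    then have "(\<integral>x. ?p x * ?f x \<partial>cell) = (\<integral>x. (\<omega> + 1) * (?p x * ?p x) - ?p x * nondiv A b \<phi> x \<partial>cell)" by simp
    also have "\<dots> = (\<omega> + 1) * (\<integral>x. ?p x * ?p x \<partial>cell) - (\<integral>x. ?p x * nondiv A b \<phi> x \<partial>cell)"
      using square_integrable_mult[OF p p] square_integrable_mult[OF p N] by simp
    finally show ?thesis by (simp add: L2norm_power2_inner)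
  qed
  then have "(L2norm cell ?p)\<^sup>2 \<le> (\<integral>x. ?p x * ?f x \<partial>cell)"
    using \<omega>[OF \<phi>] by (simp add: algebra_simps)
  also have "\<dots> \<le> (\<integral>x. ?p x * max 0 (?f x) \<partial>cell)"
    by (rule integral_mono[OF square_integrable_mult[OF p f] square_integrable_mult[OF p fp]]) (intro mult_left_mono; simp)
  also have "\<dots> \<le> L2norm cell ?p * L2norm cell (\<lambda>x. max 0 (?f x))"
    using L2_Cauchy_Schwarz[OF p fp] by simp
  finally have "L2norm cell ?p * L2norm cell ?p \<le> L2norm cell (\<lambda>x. max 0 (?f x)) * L2norm cell ?p"
    by (simp add: power2_eq_square mult.commute)
  then show ?thesis using L2norm_nonneg[of cell ?p] L2norm_nonneg[of cell "\<lambda>x. max 0 (?f x)"]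
    by (cases "L2norm cell ?p = 0") (auto simp: mult_le_cancel_right)
qed

text \<open>With the resolvent \<open>R = (\<omega> + 1 - L)\<^sup>-\<^sup>1\<close>, which preserves positivity, and \<open>h = (\<omega> + 1 - L) \<psi> \<ge> 0\<close>:
  since \<open>r\<close> is a fixed point of the adjoint of \<open>(\<omega> + 1) R\<close>, one has
  \<open>\<integral> r\<^sup>+ h = \<integral> r 1\<^bsub>r > 0\<^esub> h = (\<omega> + 1) \<integral> r R (1\<^bsub>r > 0\<^esub> h) \<le> (\<omega> + 1) \<integral> r\<^sup>+ \<psi>\<close>.
  The resolvent itself is only available approximately, on trigonometric polynomials.\<close>

lemma positive_part_subsolution:
  assumes r: "square_integrable cell r"
    and ker: "\<And>\<phi>. trig_poly \<phi> \<Longrightarrow> (\<integral>x. r x * nondiv A b \<phi> x \<partial>cell) = 0"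
    and \<omega>: "\<omega> \<ge> 0" "\<And>\<phi>. trig_poly \<phi> \<Longrightarrow>
      (\<integral>x. max 0 (\<phi> x) * nondiv A b \<phi> x \<partial>cell) \<le> \<omega> * (L2norm cell (\<lambda>x. max 0 (\<phi> x)))\<^sup>2"
    and \<psi>: "trig_poly \<psi>" and h: "\<And>x. 0 \<le> (\<omega> + 1) * \<psi> x - nondiv A b \<psi> x"
  shows "0 \<le> (\<integral>x. max 0 (r x) * nondiv A b \<psi> x \<partial>cell)"
proof -
  define \<mu> where "\<mu> = \<omega> + 1"
  have \<mu>: "\<mu> > 0" using \<omega> by (simp add: \<mu>_def)
  define T where "T \<phi> x = \<mu> * \<phi> x - nondiv A b \<phi> x" for \<phi> x
  have Ts: "square_integrable cell (T \<phi>)" if "trig_poly \<phi>" for \<phi>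
    unfolding T_def[abs_def] using trig_poly_square_integrable[OF that] nondiv_square_integrable[OF that] by simp
  let ?h = "T \<psi>" and ?rp = "\<lambda>x. max 0 (r x)" and ?rm = "\<lambda>x. max 0 (- r x)"
  have h0: "?h x \<ge> 0" for x using h[of x] by (simp add: T_def \<mu>_def)
  have hs: "square_integrable cell ?h" by (rule Ts[OF \<psi>])
  have rm: "r \<in> borel_measurable cell" by (rule square_integrable_measurable[OF r])
  have rp: "square_integrable cell ?rp" "square_integrable cell ?rm"
    using square_integrable_max_0[OF r] square_integrable_max_0[OF square_integrable_minus[OF r]] by auto
  have nrp: "L2norm cell ?rp \<le> L2norm cell r" "L2norm cell ?rm \<le> L2norm cell r"
    by (intro L2norm_mono r AE_I2; simp add: max_def)+
  have \<psi>s: "square_integrable cell \<psi>" by (rule trig_poly_square_integrable[OF \<psi>])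
  define f where "f x = (if r x > 0 then 1 else 0) * ?h x" for x
  have f: "square_integrable cell f"
    unfolding f_def[abs_def]
  proof (rule square_integrable_bounded_mult[OF _ _ hs])
    show "(\<lambda>x. if r x > 0 then 1 else 0 :: real) \<in> borel_measurable cell" using rm by measurable
  qed (auto intro!: AE_I2)
  have f0: "0 \<le> f x" "f x \<le> ?h x" for x using h0[of x] by (auto simp: f_def)
  have "(\<integral>x. ?rp x * ?h x \<partial>cell) \<le> \<mu> * (\<integral>x. ?rp x * \<psi> x \<partial>cell) + (1 + 2 * \<mu>) * L2norm cell r * e" if e: "e > 0" for e
  proof -
    obtain \<phi> where \<phi>: "trig_poly \<phi>" "L2norm cell (\<lambda>x. f x - T \<phi> x) < e"
      using dense_range[of \<mu> 0 f e] \<mu> f e by (auto simp: T_def[abs_def])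
    have \<phi>s: "square_integrable cell \<phi>" by (rule trig_poly_square_integrable[OF \<phi>(1)])
    note T\<phi> = Ts[OF \<phi>(1)]
    have d: "square_integrable cell (\<lambda>x. f x - T \<phi> x)" using f T\<phi> by simp
    have 1: "(\<integral>x. ?rp x * ?h x \<partial>cell) = (\<integral>x. r x * f x \<partial>cell)"
      by (rule Bochner_Integration.integral_cong) (auto simp: f_def max_def)
    have 2: "(\<integral>x. r x * T \<phi> x \<partial>cell) = \<mu> * (\<integral>x. r x * \<phi> x \<partial>cell)"
    proof -
      have "(\<integral>x. r x * T \<phi> x \<partial>cell) = (\<integral>x. \<mu> * (r x * \<phi> x) - r x * nondiv A b \<phi> x \<partial>cell)"
        by (simp add: T_def algebra_simps)
      also have "\<dots> = \<mu> * (\<integral>x. r x * \<phi> x \<partial>cell) - (\<integral>x. r x * nondiv A b \<phi> x \<partial>cell)"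
        using square_integrable_mult[OF r \<phi>s] square_integrable_mult[OF r nondiv_square_integrable[OF \<phi>(1)]] by simp
      finally show ?thesis using ker[OF \<phi>(1)] by simp
    qed
    have 3: "(\<integral>x. r x * f x \<partial>cell) - (\<integral>x. r x * T \<phi> x \<partial>cell) \<le> L2norm cell r * e"
    proof -
      have "(\<integral>x. r x * f x \<partial>cell) - (\<integral>x. r x * T \<phi> x \<partial>cell) = (\<integral>x. r x * (f x - T \<phi> x) \<partial>cell)"
        using square_integrable_mult[OF r f] square_integrable_mult[OF r T\<phi>] by (simp add: right_diff_distrib)
      also have "\<dots> \<le> L2norm cell r * L2norm cell (\<lambda>x. f x - T \<phi> x)" using L2_Cauchy_Schwarz[OF r d] by simp
      also have "\<dots> \<le> L2norm cell r * e" using \<phi>(2) by (intro mult_left_mono) auto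
      finally show ?thesis .
    qed
    have d1: "trig_poly (\<lambda>x. \<phi> x - \<psi> x)" "trig_poly (\<lambda>x. - \<phi> x)"
      using \<phi>(1) \<psi> by (auto intro: trig_poly_diff trig_poly_minus)
    have n1: "L2norm cell (\<lambda>x. max 0 (\<phi> x - \<psi> x)) \<le> e"
    proof -
      have "L2norm cell (\<lambda>x. max 0 (\<phi> x - \<psi> x)) \<le> L2norm cell (\<lambda>x. max 0 (T \<phi> x - T \<psi> x))"
        using positive_part_bound[OF \<omega>(2) d1(1)]
        by (simp add: nondiv_diff[OF \<phi>(1) \<psi>] T_def \<mu>_def algebra_simps)
      also have "\<dots> \<le> L2norm cell (\<lambda>x. f x - T \<phi> x)"
        by (rule L2norm_mono[OF d]) (use f0 in \<open>auto intro!: AE_I2 simp: max_def abs_if\<close>; smt (verit))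
      finally show ?thesis using \<phi>(2) by simp
    qed
    have n2: "L2norm cell (\<lambda>x. max 0 (- \<phi> x)) \<le> e"
    proof -
      have "L2norm cell (\<lambda>x. max 0 (- \<phi> x)) \<le> L2norm cell (\<lambda>x. max 0 (- T \<phi> x))"
        using positive_part_bound[OF \<omega>(2) d1(2)] nondiv_scale[OF \<phi>(1), of A b "-1"]
        by (simp add: T_def \<mu>_def algebra_simps)
      also have "\<dots> \<le> L2norm cell (\<lambda>x. f x - T \<phi> x)"
        by (rule L2norm_mono[OF d]) (use f0 in \<open>auto intro!: AE_I2 simp: max_def abs_if\<close>; smt (verit))
      finally show ?thesis using \<phi>(2) by simp
    qed
    have s1: "square_integrable cell (\<lambda>x. max 0 (\<phi> x - \<psi> x))" "square_integrable cell (\<lambda>x. max 0 (- \<phi> x))"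
      by (rule square_integrable_max_0[OF trig_poly_square_integrable[OF d1(1)]])
        (rule square_integrable_max_0[OF trig_poly_square_integrable[OF d1(2)]])
    have "(\<integral>x. r x * \<phi> x \<partial>cell) \<le> (\<integral>x. ?rp x * \<psi> x + ?rp x * max 0 (\<phi> x - \<psi> x) + ?rm x * max 0 (- \<phi> x) \<partial>cell)"
    proof (rule integral_mono)
      show "integrable cell (\<lambda>x. r x * \<phi> x)" by (rule square_integrable_mult[OF r \<phi>s])
      show "integrable cell (\<lambda>x. ?rp x * \<psi> x + ?rp x * max 0 (\<phi> x - \<psi> x) + ?rm x * max 0 (- \<phi> x))"
        by (intro Bochner_Integration.integrable_add square_integrable_mult rp \<psi>s s1)
      fix x
      have a: "?rp x * \<phi> x \<le> ?rp x * (\<psi> x + max 0 (\<phi> x - \<psi> x))" by (intro mult_left_mono) auto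
      have b: "?rm x * (- \<phi> x) \<le> ?rm x * max 0 (- \<phi> x)" by (intro mult_left_mono) auto
      have "r x * \<phi> x = ?rp x * \<phi> x + ?rm x * (- \<phi> x)" by (auto simp: max_def)
      then show "r x * \<phi> x \<le> ?rp x * \<psi> x + ?rp x * max 0 (\<phi> x - \<psi> x) + ?rm x * max 0 (- \<phi> x)"
        using a b by (simp only: distrib_left)
    qed
    also have "\<dots> = (\<integral>x. ?rp x * \<psi> x \<partial>cell) + (\<integral>x. ?rp x * max 0 (\<phi> x - \<psi> x) \<partial>cell) + (\<integral>x. ?rm x * max 0 (- \<phi> x) \<partial>cell)"
      using square_integrable_mult[OF rp(1) \<psi>s] square_integrable_mult[OF rp(1) s1(1)] square_integrable_mult[OF rp(2) s1(2)]
      by simp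
    also have "\<dots> \<le> (\<integral>x. ?rp x * \<psi> x \<partial>cell) + L2norm cell r * e + L2norm cell r * e"
    proof (intro add_mono order_refl)
      have "(\<integral>x. ?rp x * max 0 (\<phi> x - \<psi> x) \<partial>cell) \<le> L2norm cell ?rp * L2norm cell (\<lambda>x. max 0 (\<phi> x - \<psi> x))"
        using L2_Cauchy_Schwarz[OF rp(1) s1(1)] by simp
      also have "\<dots> \<le> L2norm cell r * e" by (intro mult_mono nrp n1) auto
      finally show "(\<integral>x. ?rp x * max 0 (\<phi> x - \<psi> x) \<partial>cell) \<le> L2norm cell r * e" .
      have "(\<integral>x. ?rm x * max 0 (- \<phi> x) \<partial>cell) \<le> L2norm cell ?rm * L2norm cell (\<lambda>x. max 0 (- \<phi> x))"
        using L2_Cauchy_Schwarz[OF rp(2) s1(2)] by simp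
      also have "\<dots> \<le> L2norm cell r * e" by (intro mult_mono nrp n2) auto
      finally show "(\<integral>x. ?rm x * max 0 (- \<phi> x) \<partial>cell) \<le> L2norm cell r * e" .
    qed
    finally have "\<mu> * (\<integral>x. r x * \<phi> x \<partial>cell) \<le> \<mu> * ((\<integral>x. ?rp x * \<psi> x \<partial>cell) + L2norm cell r * e + L2norm cell r * e)"
      using \<mu> by (intro mult_left_mono) auto
    then show ?thesis using 1 2 3 by (simp add: algebra_simps)
  qed
  then have "(\<integral>x. ?rp x * ?h x \<partial>cell) \<le> \<mu> * (\<integral>x. ?rp x * \<psi> x \<partial>cell)"
  proof -
    let ?a = "(\<integral>x. ?rp x * ?h x \<partial>cell)" and ?b = "\<mu> * (\<integral>x. ?rp x * \<psi> x \<partial>cell)" and ?c = "(1 + 2 * \<mu>) * L2norm cell r"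
    assume *: "\<And>e. e > 0 \<Longrightarrow> ?a \<le> ?b + ?c * e"
    have c: "?c \<ge> 0" using \<mu> by simp
    show "?a \<le> ?b"
    proof (rule field_le_epsilon)
      fix d :: real assume d: "d > 0"
      have "?a \<le> ?b + ?c * (d / (?c + 1))" using d c by (intro *) simp
      also have "?c * (d / (?c + 1)) \<le> d" using d c by (simp add: field_simps)
      finally show "?a \<le> ?b + d" by simp
    qed
  qed
  moreover have "(\<integral>x. ?rp x * ?h x \<partial>cell) = \<mu> * (\<integral>x. ?rp x * \<psi> x \<partial>cell) - (\<integral>x. ?rp x * nondiv A b \<psi> x \<partial>cell)"
  proof -
    have "(\<integral>x. ?rp x * ?h x \<partial>cell) = (\<integral>x. \<mu> * (?rp x * \<psi> x) - ?rp x * nondiv A b \<psi> x \<partial>cell)"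
      by (simp add: T_def algebra_simps)
    also have "\<dots> = \<mu> * (\<integral>x. ?rp x * \<psi> x \<partial>cell) - (\<integral>x. ?rp x * nondiv A b \<psi> x \<partial>cell)"
      using square_integrable_mult[OF rp(1) \<psi>s] square_integrable_mult[OF rp(1) nondiv_square_integrable[OF \<psi>]] by simp
    finally show ?thesis .
  qed
  ultimately show ?thesis by simp
qed

lemma adjoint_kernel_nonneg:
  assumes r: "square_integrable cell r"
    and ker: "\<And>\<phi>. trig_poly \<phi> \<Longrightarrow> (\<integral>x. r x * nondiv A b \<phi> x \<partial>cell) = 0"
    and one: "(\<integral>x. r x \<partial>cell) = 1"
  shows "AE x in cell. 0 \<le> r x"
proof -
  obtain \<omega> where \<omega>: "\<omega> \<ge> 0" "\<And>\<phi>. trig_poly \<phi> \<Longrightarrow>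
      (\<integral>x. max 0 (\<phi> x) * nondiv A b \<phi> x \<partial>cell) \<le> \<omega> * (L2norm cell (\<lambda>x. max 0 (\<phi> x)))\<^sup>2"
    using accretive by blast
  let ?rp = "\<lambda>x. max 0 (r x)"
  have rp: "square_integrable cell ?rp" by (rule square_integrable_max_0[OF r])
  have sub: "0 \<le> (\<integral>x. ?rp x * nondiv A b \<psi> x \<partial>cell)" if \<psi>: "trig_poly \<psi>" for \<psi>
  proof -
    obtain C where C: "\<And>x. \<bar>nondiv A b \<psi> x\<bar> \<le> C" using bounded_nondiv[OF \<psi>] by blast
    obtain C' where C': "\<And>x. \<bar>\<psi> x\<bar> \<le> C'" using trig_poly_bounded[OF \<psi>] by blast
    define K where "K = C' + \<bar>C\<bar>"
    have t: "trig_poly (\<lambda>x. \<psi> x + K)" by (intro trig_poly.add \<psi> trig_poly_const)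
    have n: "nondiv A b (\<lambda>x. \<psi> x + K) x = nondiv A b \<psi> x" for x
      using nondiv_add[OF \<psi> trig_poly_const[of K], of A b x] by (simp add: nondiv_const)
    have "0 \<le> (\<omega> + 1) * (\<psi> x + K) - nondiv A b (\<lambda>x. \<psi> x + K) x" for x
    proof -
      have a: "\<bar>C\<bar> \<le> \<psi> x + K" using C'[of x] by (simp add: K_def)
      then have "1 * (\<psi> x + K) \<le> (\<omega> + 1) * (\<psi> x + K)" using \<omega>(1) by (intro mult_right_mono) auto
      moreover have "nondiv A b \<psi> x \<le> \<bar>C\<bar>" using C[of x] by linarith
      ultimately have "nondiv A b \<psi> x \<le> (\<omega> + 1) * (\<psi> x + K)" using a by simp
      then show ?thesis unfolding n by simp
    qed
    from positive_part_subsolution[OF r ker \<omega> t this] show ?thesis by (simp add: n)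
  qed
  have rpker: "(\<integral>x. ?rp x * nondiv A b \<psi> x \<partial>cell) = 0" if \<psi>: "trig_poly \<psi>" for \<psi>
  proof -
    have "0 \<le> (\<integral>x. ?rp x * nondiv A b (\<lambda>x. (-1) * \<psi> x) x \<partial>cell)"
      by (rule sub[OF trig_poly.scale[OF \<psi>]])
    then show ?thesis using sub[OF \<psi>] unfolding nondiv_scale[OF \<psi>] by simp
  qed
  define c where "c = (\<integral>x. ?rp x \<partial>cell)"
  have c: "c \<ge> 1"
    unfolding c_def one[symmetric]
    by (rule integral_mono[OF cell.square_integrable_integrable[OF r] cell.square_integrable_integrable[OF rp]]) simp
  let ?s = "\<lambda>x. ?rp x - c * r x"
  have s: "square_integrable cell ?s" using rp r by simp
  have "AE x in cell. ?s x = 0"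
  proof (rule adjoint_kernel_mean_zero[OF s])
    show "(\<integral>x. ?s x \<partial>cell) = 0"
      using one cell.square_integrable_integrable[OF r] cell.square_integrable_integrable[OF rp] by (simp add: c_def)
    fix \<psi> :: "real^'n \<Rightarrow> real" assume \<psi>: "trig_poly \<psi>"
    have "(\<integral>x. ?s x * nondiv A b \<psi> x \<partial>cell) = (\<integral>x. ?rp x * nondiv A b \<psi> x - c * (r x * nondiv A b \<psi> x) \<partial>cell)"
      by (simp add: algebra_simps)
    also have "\<dots> = 0"
      using square_integrable_mult[OF rp nondiv_square_integrable[OF \<psi>]]
        square_integrable_mult[OF r nondiv_square_integrable[OF \<psi>]] rpker[OF \<psi>] ker[OF \<psi>] by simp
    finally show "(\<integral>x. ?s x * nondiv A b \<psi> x \<partial>cell) = 0" .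
  qed
  then show ?thesis
  proof eventually_elim
    case (elim x)
    then have "c * r x = max 0 (r x)" by simp
    then have "c * r x \<ge> 0" by simp
    then show ?case using c by (simp add: zero_le_mult_iff)
  qed
qed

end

subsection \<open>Approximation by smooth coefficients\<close>

definition fejer_A :: "nat \<Rightarrow> (real ^ 'n::finite \<Rightarrow> real ^ 'n ^ 'n) \<Rightarrow> real ^ 'n \<Rightarrow> real ^ 'n ^ 'n" where
  "fejer_A N A x = (\<chi> i j. mat 1 $ i $ j + fejer N (\<lambda>x. A x $ i $ j - mat 1 $ i $ j) x)"

definition fejer_b :: "nat \<Rightarrow> (real ^ 'n::finite \<Rightarrow> real ^ 'n) \<Rightarrow> real ^ 'n \<Rightarrow> real ^ 'n" where
  "fejer_b N b x = (\<chi> i. fejer N (\<lambda>x. b x $ i) x)"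

context cordes
begin

lemma square_integrable_coefficients:
  "square_integrable cell (\<lambda>x. A x $ i $ j - mat 1 $ i $ j)" "square_integrable cell (\<lambda>x. b x $ i)"
proof -
  have n: "norm a \<le> \<bar>\<rho>\<bar>" if "(norm a)\<^sup>2 + y\<^sup>2 \<le> \<rho>\<^sup>2" for a :: "'z::real_normed_vector" and y
    using that abs_le_square_iff[of "norm a" \<rho>] zero_le_power2[of y] by simp
  show "square_integrable cell (\<lambda>x. A x $ i $ j - mat 1 $ i $ j)"
  proof (rule cell.square_integrable_bounded)
    show "(\<lambda>x. A x $ i $ j - mat 1 $ i $ j) \<in> borel_measurable cell"
      by (intro cell_measurable borel_measurable_diff measurable_component2 A_measurable borel_measurable_const)
    show "AE x in cell. \<bar>A x $ i $ j - mat 1 $ i $ j\<bar> \<le> \<bar>\<rho>\<bar>"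
      using AE_cell_if_lebesgue[OF near_identity]
    proof eventually_elim
      case (elim x)
      have "\<bar>(A x - mat 1) $ i $ j\<bar> \<le> norm (A x - mat 1)"
        using component_le_norm_cart[of "(A x - mat 1) $ i" j] Finite_Cartesian_Product.norm_nth_le[of "A x - mat 1" i] by linarith
      then show ?case using n[OF elim] by simp
    qed
  qed
  show "square_integrable cell (\<lambda>x. b x $ i)"
  proof (rule cell.square_integrable_bounded)
    show "(\<lambda>x. b x $ i) \<in> borel_measurable cell"
      by (intro cell_measurable measurable_component b_measurable)
    show "AE x in cell. \<bar>b x $ i\<bar> \<le> \<bar>\<rho>\<bar>"
      using AE_cell_if_lebesgue[OF near_identity]
    proof eventually_elim
      case (elim x)
      then have "(norm (b x))\<^sup>2 + (norm (A x - mat 1))\<^sup>2 \<le> \<rho>\<^sup>2" by simp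
      from n[OF this] show ?case using component_le_norm_cart[of "b x" i] by linarith
    qed
  qed
qed

lemma fejer_smooth_cordes: "smooth_cordes (fejer_A N A) (fejer_b N b) \<rho> \<kappa>"
proof -
  note sq = square_integrable_coefficients
  have tA: "trig_poly (\<lambda>x. fejer_A N A x $ i $ j)" for i j
    unfolding fejer_A_def by simp (intro trig_poly.add trig_poly_const trig_poly_fejer)
  have tb: "trig_poly (\<lambda>x. fejer_b N b x $ i)" for i
    unfolding fejer_b_def by simp (intro trig_poly_fejer)
  have near: "(norm (fejer_A N A x - mat 1))\<^sup>2 + (norm (fejer_b N b x))\<^sup>2 \<le> \<rho>\<^sup>2" for x
  proof -
    define V where "V = fejer_A N A x - mat 1"
    define v where "v = fejer_b N b x"
    define S where "S = (norm V)\<^sup>2 + (norm v)\<^sup>2"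
    have S0: "S \<ge> 0" by (simp add: S_def)
    let ?f = "\<lambda>y. (\<Sum>i\<in>UNIV. \<Sum>j\<in>UNIV. V $ i $ j * (A y $ i $ j - mat 1 $ i $ j)) + (\<Sum>i\<in>UNIV. v $ i * b y $ i)"
    have fs: "square_integrable cell (\<lambda>y. \<Sum>j\<in>UNIV. V $ i $ j * (A y $ i $ j - mat 1 $ i $ j))"
      "square_integrable cell (\<lambda>y. \<Sum>i\<in>UNIV. \<Sum>j\<in>UNIV. V $ i $ j * (A y $ i $ j - mat 1 $ i $ j))"
      "square_integrable cell (\<lambda>y. \<Sum>i\<in>UNIV. v $ i * b y $ i)" for i
      by (intro square_integrable_sum square_integrable_scale sq)+
    have "S = (\<Sum>i\<in>UNIV. \<Sum>j\<in>UNIV. V $ i $ j * fejer N (\<lambda>y. A y $ i $ j - mat 1 $ i $ j) x) + (\<Sum>i\<in>UNIV. v $ i * fejer N (\<lambda>y. b y $ i) x)"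
      unfolding S_def power2_norm_eq_inner inner_matrix inner_vector
      by (simp add: V_def v_def fejer_A_def fejer_b_def)
    also have "\<dots> = fejer N ?f x"
      using fs sq by (simp add: fejer_add fejer_sum fejer_scale)
    also have "\<dots> \<le> sqrt S * \<bar>\<rho>\<bar>"
    proof (rule fejer_le)
      show "square_integrable cell ?f" by (rule square_integrable_add[OF fs(2,3)])
      show "AE y in cell. ?f y \<le> sqrt S * \<bar>\<rho>\<bar>"
        using AE_cell_if_lebesgue[OF near_identity]
      proof eventually_elim
        case (elim y)
        have "?f y = V \<bullet> (A y - mat 1) + v \<bullet> b y" by (simp add: inner_matrix inner_vector)
        then have "(?f y)\<^sup>2 \<le> S * ((norm (A y - mat 1))\<^sup>2 + (norm (b y))\<^sup>2)"
          using cauchy_schwarz_pair[of V "A y - mat 1" v "b y"] by (simp add: S_def)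
        also have "\<dots> \<le> S * \<rho>\<^sup>2" by (intro mult_left_mono elim S0)
        finally have "\<bar>?f y\<bar> \<le> sqrt (S * \<rho>\<^sup>2)" using real_le_rsqrt[of "\<bar>?f y\<bar>"] by simp
        then show ?case by (simp add: real_sqrt_mult)
      qed
    qed
    finally have "S \<le> sqrt S * \<bar>\<rho>\<bar>" .
    then have "sqrt S * sqrt S \<le> sqrt S * \<bar>\<rho>\<bar>" using S0 by simp
    then have "sqrt S \<le> \<bar>\<rho>\<bar>"
      using S0 mult_le_cancel_left_pos[of "sqrt S" "sqrt S" "\<bar>\<rho>\<bar>"] by (cases "S = 0") auto
    then have "(sqrt S)\<^sup>2 \<le> \<bar>\<rho>\<bar>\<^sup>2" by (intro power_mono) (use S0 in auto)
    then show ?thesis using S0 by (simp add: S_def V_def v_def)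
  qed
  have mA: "fejer_A N A \<in> borel_measurable lebesgue"
  proof -
    have "continuous_on UNIV (fejer_A N A)"
      unfolding fejer_A_def[abs_def] by (intro continuous_on_vec_lambda continuous_intros trig_poly_continuous trig_poly_fejer)
    then show ?thesis using continuous_imp_measurable_on_sets_lebesgue[of UNIV "fejer_A N A"] by simp
  qed
  have mb: "fejer_b N b \<in> borel_measurable lebesgue"
  proof -
    have "continuous_on UNIV (fejer_b N b)"
      unfolding fejer_b_def[abs_def] by (intro continuous_on_vec_lambda trig_poly_continuous trig_poly_fejer)
    then show ?thesis using continuous_imp_measurable_on_sets_lebesgue[of UNIV "fejer_b N b"] by simp
  qed
  show ?thesis by standard (use tA tb near mA mb \<kappa> in auto)
qed

lemma fejer_nondiv_tendsto:
  assumes \<phi>: "trig_poly \<phi>"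
  shows "(\<lambda>N. L2norm cell (\<lambda>x. nondiv A b \<phi> x - nondiv (fejer_A N A) (fejer_b N b) \<phi> x)) \<longlonglongrightarrow> 0"
proof -
  note sq = square_integrable_coefficients
  let ?EA = "\<lambda>i j x. A x $ i $ j - mat 1 $ i $ j" and ?Eb = "\<lambda>i x. b x $ i"
  have fj: "square_integrable cell (fejer N f)" for N f by (intro trig_poly_square_integrable trig_poly_fejer)
  have prod: "square_integrable cell (\<lambda>x. g x * (f x - fejer N f x))"
    "\<exists>C\<ge>0. \<forall>N. L2norm cell (\<lambda>x. g x * (f x - fejer N f x)) \<le> C * L2norm cell (\<lambda>x. fejer N f x - f x)"
    if f: "square_integrable cell f" and g: "trig_poly g" for f g N
  proof -
    obtain C where C: "C \<ge> 0" "\<And>x. \<bar>g x\<bar> \<le> C" using trig_poly_bounded[OF g] by blast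
    show "square_integrable cell (\<lambda>x. g x * (f x - fejer N f x))"
      by (rule square_integrable_bounded_mult[OF cell_measurable[OF trig_poly_measurable[OF g]] AE_I2
            square_integrable_diff[OF f fj], of C]) (rule C(2))
    have "L2norm cell (\<lambda>x. g x * (f x - fejer N f x)) \<le> C * L2norm cell (\<lambda>x. fejer N f x - f x)" for N
    proof -
      have "L2norm cell (\<lambda>x. g x * (f x - fejer N f x)) \<le> L2norm cell (\<lambda>x. C * (fejer N f x - f x))"
      proof (rule L2norm_mono)
        show "square_integrable cell (\<lambda>x. C * (fejer N f x - f x))"
          by (intro square_integrable_scale square_integrable_diff f fj)
        show "AE x in cell. \<bar>g x * (f x - fejer N f x)\<bar> \<le> \<bar>C * (fejer N f x - f x)\<bar>"
          using C by (intro AE_I2) (auto simp: abs_mult abs_minus_commute intro!: mult_right_mono)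
      qed
      then show ?thesis using C(1) by (simp add: L2norm_scale)
    qed
    then show "\<exists>C\<ge>0. \<forall>N. L2norm cell (\<lambda>x. g x * (f x - fejer N f x)) \<le> C * L2norm cell (\<lambda>x. fejer N f x - f x)"
      using C(1) by blast
  qed
  have lim: "(\<lambda>N. L2norm cell (\<lambda>x. g x * (f x - fejer N f x))) \<longlonglongrightarrow> 0"
    if f: "square_integrable cell f" and g: "trig_poly g" for f g
  proof -
    obtain C where C: "\<And>N. L2norm cell (\<lambda>x. g x * (f x - fejer N f x)) \<le> C * L2norm cell (\<lambda>x. fejer N f x - f x)"
      using prod(2)[OF f g] by blast
    have l: "(\<lambda>N. C * L2norm cell (\<lambda>x. fejer N f x - f x)) \<longlonglongrightarrow> 0"
      using tendsto_mult[OF tendsto_const fejer_tendsto[OF f], of C] by simp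
    show ?thesis
      by (rule tendsto_sandwich[OF _ _ tendsto_const l]) (use C in \<open>auto intro: always_eventually\<close>)
  qed
  have tri: "L2norm cell (\<lambda>x. \<Sum>i\<in>I. f i x) \<le> (\<Sum>i\<in>I. L2norm cell (f i))"
    if "\<And>i. square_integrable cell (f i)" for I :: "'i set" and f :: "'i \<Rightarrow> real^'n \<Rightarrow> real"
    using that
  proof (induction I rule: infinite_finite_induct)
    case (insert i I)
    have "L2norm cell (\<lambda>x. f i x + (\<Sum>i\<in>I. f i x)) \<le> L2norm cell (f i) + L2norm cell (\<lambda>x. \<Sum>i\<in>I. f i x)"
      by (intro L2norm_triangle square_integrable_sum insert.prems)
    then show ?case using insert by simp
  qed (auto simp: L2norm_def)
  let ?g = "\<lambda>N x. (\<Sum>i\<in>UNIV. \<Sum>j\<in>UNIV. D i (D j \<phi>) x * (?EA i j x - fejer N (?EA i j) x))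
      + (\<Sum>i\<in>UNIV. D i \<phi> x * (?Eb i x - fejer N (?Eb i) x))"
  have eq: "nondiv A b \<phi> x - nondiv (fejer_A N A) (fejer_b N b) \<phi> x = ?g N x" for N x
  proof -
    have "nondiv A b \<phi> x - nondiv (fejer_A N A) (fejer_b N b) \<phi> x =
      (A x - fejer_A N A x) \<bullet> hess \<phi> x + (b x - fejer_b N b x) \<bullet> grad \<phi> x"
      by (simp add: nondiv_def inner_diff_left)
    also have "\<dots> = ?g N x"
      unfolding inner_matrix inner_vector hess_def grad_def fejer_A_def fejer_b_def
      by (intro arg_cong2[where f="(+)"] sum.cong refl) (simp_all add: algebra_simps)
    finally show ?thesis .
  qed
  note t2 = trig_poly_D[OF trig_poly_D[OF \<phi>]] and t1 = trig_poly_D[OF \<phi>]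
  have s: "square_integrable cell (\<lambda>x. D i (D j \<phi>) x * (?EA i j x - fejer N (?EA i j) x))"
    "square_integrable cell (\<lambda>x. D i \<phi> x * (?Eb i x - fejer N (?Eb i) x))" for i j N
    using prod(1)[OF sq(1) t2] prod(1)[OF sq(2) t1] by auto
  have le: "L2norm cell (?g N) \<le> (\<Sum>i\<in>UNIV. \<Sum>j\<in>UNIV. L2norm cell (\<lambda>x. D i (D j \<phi>) x * (?EA i j x - fejer N (?EA i j) x)))
      + (\<Sum>i\<in>UNIV. L2norm cell (\<lambda>x. D i \<phi> x * (?Eb i x - fejer N (?Eb i) x)))" for N
    by (intro order.trans[OF L2norm_triangle] add_mono order.trans[OF tri] sum_mono tri square_integrable_sum s order_refl)
  have l: "(\<lambda>N. (\<Sum>i\<in>UNIV. \<Sum>j\<in>UNIV. L2norm cell (\<lambda>x. D i (D j \<phi>) x * (?EA i j x - fejer N (?EA i j) x)))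
      + (\<Sum>i\<in>UNIV. L2norm cell (\<lambda>x. D i \<phi> x * (?Eb i x - fejer N (?Eb i) x)))) \<longlonglongrightarrow>
      (\<Sum>i\<in>(UNIV :: 'n set). \<Sum>j\<in>(UNIV :: 'n set). 0) + (\<Sum>i\<in>(UNIV :: 'n set). 0)"
    by (intro tendsto_add tendsto_sum lim sq t1 t2)
  show ?thesis unfolding eq
    by (rule tendsto_sandwich[OF _ _ tendsto_const l[simplified]]) (use le in \<open>auto intro!: always_eventually\<close>)
qed

lemma adjoint_kernel_norm_bound:
  assumes r: "square_integrable cell r"
    and ker: "\<And>\<phi>. trig_poly \<phi> \<Longrightarrow> (\<integral>x. r x * nondiv A b \<phi> x \<partial>cell) = 0"
    and one: "(\<integral>x. r x \<partial>cell) = 1"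
  shows "L2norm cell r \<le> 1 / (1 - \<kappa>)"
proof -
  have "(1 - \<kappa>) * L2norm cell (\<lambda>x. r x - 1) \<le> \<kappa>" using adjoint_kernel_bound[OF r ker] one by simp
  moreover have "L2norm cell r \<le> L2norm cell (\<lambda>x. r x - 1) + 1"
    using L2norm_triangle[of cell "\<lambda>x. r x - 1" "\<lambda>x. 1"] r by (simp add: L2norm_def[of _ "\<lambda>x. 1"])
  then have "(1 - \<kappa>) * L2norm cell r \<le> (1 - \<kappa>) * (L2norm cell (\<lambda>x. r x - 1) + 1)"
    using \<kappa> by (intro mult_left_mono) auto
  ultimately have "(1 - \<kappa>) * L2norm cell r \<le> 1" by (simp add: distrib_left)
  then show ?thesis using \<kappa> by (simp add: field_simps)
qed

text \<open>The densities \<open>r\<^sub>N\<close> of the smoothed coefficients converge weakly to \<open>r\<close>, because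
  \<open>\<integral> (r\<^sub>N - r) (c - L \<phi>) = \<integral> r\<^sub>N (L\<^sub>N - L) \<phi>\<close> and the functions \<open>c - L \<phi>\<close> are dense.\<close>

lemma adjoint_kernel_nonneg:
  assumes r: "square_integrable cell r"
    and ker: "\<And>\<phi>. trig_poly \<phi> \<Longrightarrow> (\<integral>x. r x * nondiv A b \<phi> x \<partial>cell) = 0"
    and one: "(\<integral>x. r x \<partial>cell) = 1"
  shows "AE x in cell. 0 \<le> r x"
proof -
  have rm: "r \<in> borel_measurable cell" by (rule square_integrable_measurable[OF r])
  have ex: "\<forall>N. \<exists>s. square_integrable cell s \<and> (\<integral>x. s x \<partial>cell) = 1 \<and> (AE x in cell. 0 \<le> s x) \<and> L2norm cell s \<le> 1 / (1 - \<kappa>) \<and>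
      (\<forall>\<phi>. trig_poly \<phi> \<longrightarrow> (\<integral>x. s x * nondiv (fejer_A N A) (fejer_b N b) \<phi> x \<partial>cell) = 0)"
  proof
    fix N
    interpret S: smooth_cordes "fejer_A N A" "fejer_b N b" \<rho> \<kappa> by (rule fejer_smooth_cordes)
    have "periodic_ae (fejer_A N A)" "periodic_ae (fejer_b N b)"
      unfolding periodic_ae_def fejer_A_def fejer_b_def by (simp_all add: trig_poly_shift trig_poly_fejer)
    then obtain s where s: "L2_per s" "(\<integral>x. s x \<partial>cell) = 1"
      "\<And>\<phi>. trig_poly \<phi> \<Longrightarrow> (\<integral>x. s x * nondiv (fejer_A N A) (fejer_b N b) \<phi> x \<partial>cell) = 0"
      using S.adjoint_kernel_exists by blast
    have ss: "square_integrable cell s" using s(1) by (simp add: L2_per_def L2_loc_square_integrable)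
    show "\<exists>s. square_integrable cell s \<and> (\<integral>x. s x \<partial>cell) = 1 \<and> (AE x in cell. 0 \<le> s x) \<and> L2norm cell s \<le> 1 / (1 - \<kappa>) \<and>
      (\<forall>\<phi>. trig_poly \<phi> \<longrightarrow> (\<integral>x. s x * nondiv (fejer_A N A) (fejer_b N b) \<phi> x \<partial>cell) = 0)"
      by (intro exI[of _ s] conjI ss s(2) S.adjoint_kernel_nonneg S.adjoint_kernel_norm_bound allI impI s(3))
  qed
  obtain s where "\<forall>N. square_integrable cell (s N) \<and> (\<integral>x. s N x \<partial>cell) = 1 \<and> (AE x in cell. 0 \<le> s N x) \<and>
      L2norm cell (s N) \<le> 1 / (1 - \<kappa>) \<and>
      (\<forall>\<phi>. trig_poly \<phi> \<longrightarrow> (\<integral>x. s N x * nondiv (fejer_A N A) (fejer_b N b) \<phi> x \<partial>cell) = 0)"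
    using choice[OF ex] by blast
  then have s: "\<And>N. square_integrable cell (s N)" "\<And>N. (\<integral>x. s N x \<partial>cell) = 1" "\<And>N. AE x in cell. 0 \<le> s N x"
      "\<And>N. L2norm cell (s N) \<le> 1 / (1 - \<kappa>)"
      "\<And>N \<phi>. trig_poly \<phi> \<Longrightarrow> (\<integral>x. s N x * nondiv (fejer_A N A) (fejer_b N b) \<phi> x \<partial>cell) = 0"
    by simp_all
  define f where "f x = (if r x < 0 then 1 else 0 :: real)" for x
  have fm: "f \<in> borel_measurable cell" unfolding f_def[abs_def] using rm by measurable
  have f: "square_integrable cell f"
    by (rule cell.square_integrable_bounded[OF fm, of 1]) (auto simp: f_def)
  define C where "C = 1 / (1 - \<kappa>) + L2norm cell r"
  have C: "C \<ge> 0" using \<kappa> by (simp add: C_def)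
  have "- (C * e) \<le> (\<integral>x. r x * f x \<partial>cell)" if e: "e > 0" for e
  proof -
    obtain \<phi> where \<phi>: "trig_poly \<phi>" "L2norm cell (\<lambda>x. f x - (coef \<phi> (\<lambda>_. 0) - nondiv A b \<phi> x)) < e"
      using dense_range[of 0 1 f e] f e by auto
    define m where "m = coef \<phi> (\<lambda>_. 0)"
    let ?g = "\<lambda>x. f x - (m - nondiv A b \<phi> x)"
    have N: "square_integrable cell (nondiv A b \<phi>)" by (rule nondiv_square_integrable[OF \<phi>(1)])
    have g: "square_integrable cell ?g" using f N by simp
    have ge: "L2norm cell ?g \<le> e" using \<phi>(2) by (simp add: m_def)
    let ?d = "\<lambda>K. L2norm cell (\<lambda>x. nondiv A b \<phi> x - nondiv (fejer_A K A) (fejer_b K b) \<phi> x)"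
    have split: "(\<integral>x. q x * f x \<partial>cell) = (\<integral>x. q x * ?g x \<partial>cell) + m - (\<integral>x. q x * nondiv A b \<phi> x \<partial>cell)"
      if q: "square_integrable cell q" "(\<integral>x. q x \<partial>cell) = 1" for q
    proof -
      have "(\<integral>x. q x * f x \<partial>cell) = (\<integral>x. q x * ?g x + m * q x - q x * nondiv A b \<phi> x \<partial>cell)"
        by (simp add: algebra_simps)
      also have "\<dots> = (\<integral>x. q x * ?g x \<partial>cell) + m * (\<integral>x. q x \<partial>cell) - (\<integral>x. q x * nondiv A b \<phi> x \<partial>cell)"
        using square_integrable_mult[OF q(1) g] square_integrable_mult[OF q(1) N] cell.square_integrable_integrable[OF q(1)]
        by simp
      finally show ?thesis using q(2) by simp
    qed
    have "- (C * e) - 1 / (1 - \<kappa>) * ?d K \<le> (\<integral>x. r x * f x \<partial>cell)" for K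
    proof -
      interpret S: smooth_cordes "fejer_A K A" "fejer_b K b" \<rho> \<kappa> by (rule fejer_smooth_cordes)
      have NK: "square_integrable cell (nondiv (fejer_A K A) (fejer_b K b) \<phi>)" by (rule S.nondiv_square_integrable[OF \<phi>(1)])
      have "0 \<le> (\<integral>x. s K x * f x \<partial>cell)"
        by (rule integral_nonneg_AE) (use s(3)[of K] in \<open>eventually_elim, auto simp: f_def\<close>)
      also have "\<dots> = (\<integral>x. s K x * ?g x \<partial>cell) + m - (\<integral>x. s K x * nondiv A b \<phi> x \<partial>cell)"
        by (rule split[OF s(1,2)])
      finally have a: "0 \<le> (\<integral>x. s K x * ?g x \<partial>cell) + m - (\<integral>x. s K x * nondiv A b \<phi> x \<partial>cell)" .
      have b: "(\<integral>x. r x * f x \<partial>cell) = (\<integral>x. r x * ?g x \<partial>cell) + m"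
        using split[OF r one] ker[OF \<phi>(1)] by simp
      have c1: "\<bar>\<integral>x. s K x * ?g x \<partial>cell\<bar> \<le> 1 / (1 - \<kappa>) * e"
        by (rule order.trans[OF L2_Cauchy_Schwarz[OF s(1) g]]) (intro mult_mono s(4) ge; use \<kappa> in simp)
      have c2: "\<bar>\<integral>x. r x * ?g x \<partial>cell\<bar> \<le> L2norm cell r * e"
        by (rule order.trans[OF L2_Cauchy_Schwarz[OF r g]]) (intro mult_left_mono ge; simp)
      have e1: "(\<integral>x. s K x * nondiv A b \<phi> x \<partial>cell) = (\<integral>x. s K x * (nondiv A b \<phi> x - nondiv (fejer_A K A) (fejer_b K b) \<phi> x) \<partial>cell)"
        using square_integrable_mult[OF s(1) N] square_integrable_mult[OF s(1) NK] s(5)[OF \<phi>(1)]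
        by (simp add: right_diff_distrib)
      have c3: "\<bar>\<integral>x. s K x * nondiv A b \<phi> x \<partial>cell\<bar> \<le> 1 / (1 - \<kappa>) * ?d K"
        unfolding e1
        by (rule order.trans[OF L2_Cauchy_Schwarz[OF s(1) square_integrable_diff[OF N NK]]])
          (intro mult_right_mono s(4) L2norm_nonneg)
      from a b c1 c2 c3 show ?thesis unfolding C_def distrib_right by linarith
    qed
    moreover have "(\<lambda>K. - (C * e) - 1 / (1 - \<kappa>) * ?d K) \<longlonglongrightarrow> - (C * e) - 1 / (1 - \<kappa>) * 0"
      by (intro tendsto_diff tendsto_mult tendsto_const fejer_nondiv_tendsto \<phi>(1))
    ultimately show ?thesis using LIMSEQ_le_const2[of _ "- (C * e) - 1 / (1 - \<kappa>) * 0"] by auto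
  qed
  then have "0 \<le> (\<integral>x. r x * f x \<partial>cell)"
  proof -
    assume *: "\<And>e. e > 0 \<Longrightarrow> - (C * e) \<le> (\<integral>x. r x * f x \<partial>cell)"
    show "0 \<le> (\<integral>x. r x * f x \<partial>cell)"
    proof (rule field_le_epsilon)
      fix d :: real assume d: "d > 0"
      have "C * (d / (C + 1)) \<le> d" using d C by (simp add: field_simps)
      then show "0 \<le> (\<integral>x. r x * f x \<partial>cell) + d" using *[of "d / (C + 1)"] d C by simp
    qed
  qed
  moreover have "0 \<le> - (r x * f x)" for x by (simp add: f_def)
  ultimately have "(\<integral>x. - (r x * f x) \<partial>cell) = 0"
    using Bochner_Integration.integral_nonneg[of cell "\<lambda>x. - (r x * f x)"] by simp
  then have "AE x in cell. - (r x * f x) = 0"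
    using integral_nonneg_eq_0_iff_AE[of cell "\<lambda>x. - (r x * f x)"] square_integrable_mult[OF r f]
      \<open>\<And>x. 0 \<le> - (r x * f x)\<close> by simp
  then show ?thesis by eventually_elim (auto simp: f_def split: if_splits)
qed

end

subsection \<open>Very weak solutions\<close>

lemma AE_lebesgue_if_cell:
  fixes f :: "real ^ 'n::finite \<Rightarrow> 'b"
  assumes per: "periodic_ae f" and P: "AE x in cell. P (f x)"
  shows "AE x in lebesgue. P (f x)"
proof -
  have P': "AE x in lebesgue. x \<in> unit_cell \<longrightarrow> P (f x)"
    using P by (subst (asm) AE_restrict_space_iff) auto
  define z :: "('n \<Rightarrow> int) \<Rightarrow> real^'n" where "z k = (\<chi> i. of_int (k i))" for k
  have shift: "AE x in lebesgue. x - z k \<in> unit_cell \<longrightarrow> P (f x)" for k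
  proof -
    have "AE x in lebesgue. x + - z k \<in> unit_cell \<longrightarrow> P (f (x + - z k))" by (rule AE_lebesgue_shift[OF P'])
    moreover have "AE x in lebesgue. f (x + - z k + z k) = f (x + - z k)"
      unfolding z_def by (rule AE_lebesgue_shift[OF periodic_ae_int_shift[OF per]])
    ultimately show ?thesis by eventually_elim simp
  qed
  have "AE x in lebesgue. \<forall>k. x - z k \<in> unit_cell \<longrightarrow> P (f x)"
    by (subst AE_all_countable) (intro allI shift)
  moreover have "AE x in lebesgue. \<forall>i. \<forall>c::int. (x :: real^'n) $ i \<noteq> of_int c"
    by (simp add: AE_all_countable AE_component_neq)
  ultimately show ?thesis
  proof eventually_elim
    case (elim x)
    have "0 < x $ i - of_int \<lfloor>x $ i\<rfloor>" "x $ i - of_int \<lfloor>x $ i\<rfloor> < 1" for i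
      using elim(2)[rule_format, of i "\<lfloor>x $ i\<rfloor>"] by linarith+
    then have "x - z (\<lambda>i. \<lfloor>x $ i\<rfloor>) \<in> unit_cell" by (simp add: unit_cell_def z_def)
    then show ?case using elim(1) by blast
  qed
qed

lemma periodic_ae_combine:
  assumes "periodic_ae f" "periodic_ae g" shows "periodic_ae (\<lambda>x. h (f x) (g x))"
  unfolding periodic_ae_def
proof
  fix i
  have "AE x in lebesgue. f (x + axis i 1) = f x" "AE x in lebesgue. g (x + axis i 1) = g x"
    using assms by (simp_all add: periodic_ae_def)
  then show "AE x in lebesgue. h (f (x + axis i 1)) (g (x + axis i 1)) = h (f x) (g x)"
    by eventually_elim simp
qed

lemma L2_perD:
  assumes "L2_per u"
  shows "u \<in> borel_measurable lebesgue" "periodic_ae u" "square_integrable cell u"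
  using assms by (auto simp: L2_per_def L2_loc_def intro: L2_loc_square_integrable)

lemma weak_nondiv_alt:
  "A \<bullet> weak_hessian \<phi> x + b \<bullet> weak_grad \<phi> x =
    (\<Sum>i\<in>UNIV. \<Sum>j\<in>UNIV. A $ i $ j * weak_partial i (weak_partial j \<phi>) x) + (\<Sum>i\<in>UNIV. b $ i * weak_partial i \<phi> x)"
  by (simp add: inner_matrix inner_vector weak_hessian_def weak_grad_def)

lemma AE_component_bounds:
  fixes A :: "real ^ 'n::finite \<Rightarrow> real ^ 'n ^ 'n" and b :: "real ^ 'n \<Rightarrow> real ^ 'n"
  assumes "AE x in lebesgue. norm (A x) \<le> C" "AE x in lebesgue. norm (b x) \<le> C'"
  shows "AE x in cell. \<bar>A x $ i $ j\<bar> \<le> C" "AE x in cell. \<bar>b x $ i\<bar> \<le> C'"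
proof -
  show "AE x in cell. \<bar>A x $ i $ j\<bar> \<le> C"
    using AE_cell_if_lebesgue[OF assms(1)]
  proof eventually_elim
    case (elim x)
    then show ?case
      using component_le_norm_cart[of "A x $ i" j] Finite_Cartesian_Product.norm_nth_le[of "A x" i] by linarith
  qed
  show "AE x in cell. \<bar>b x $ i\<bar> \<le> C'"
    using AE_cell_if_lebesgue[OF assms(2)]
  proof eventually_elim
    case (elim x)
    then show ?case using component_le_norm_cart[of "b x" i] by linarith
  qed
qed

lemma very_weak_solution_iff:
  fixes A :: "real ^ 'n::finite \<Rightarrow> real ^ 'n ^ 'n" and b :: "real ^ 'n \<Rightarrow> real ^ 'n"
  assumes mA: "A \<in> borel_measurable lebesgue" and mb: "b \<in> borel_measurable lebesgue"
    and bd: "AE x in lebesgue. norm (A x) \<le> C" "AE x in lebesgue. norm (b x) \<le> C'"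
  shows "very_weak_solution A b u \<longleftrightarrow>
    L2_per u \<and> (\<forall>\<phi>. trig_poly \<phi> \<longrightarrow> (\<integral>x. u x * nondiv A b \<phi> x \<partial>cell) = 0)"
proof (intro iffI conjI allI impI)
  assume v: "very_weak_solution A b u"
  then show L: "L2_per u" by (simp add: very_weak_solution_def)
  fix \<phi> :: "real^'n \<Rightarrow> real" assume \<phi>: "trig_poly \<phi>"
  have H: "H2_per \<phi>" by (rule trig_poly_H2_per[OF \<phi>])
  have "AE x in lebesgue. \<forall>i j. weak_partial j \<phi> x = D j \<phi> x \<and> weak_partial i (weak_partial j \<phi>) x = D i (D j \<phi>) x"
    unfolding AE_all_countable by (intro allI AE_conjI trig_poly_weak_partial[OF \<phi>])
  then have "AE x in cell. \<forall>i j. weak_partial j \<phi> x = D j \<phi> x \<and> weak_partial i (weak_partial j \<phi>) x = D i (D j \<phi>) x"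
    by (rule AE_cell_if_lebesgue)
  then have ae: "AE x in cell. u x * (A x \<bullet> weak_hessian \<phi> x + b x \<bullet> weak_grad \<phi> x) = u x * nondiv A b \<phi> x"
    by eventually_elim (simp add: weak_nondiv_alt nondiv_alt)
  have mu: "u \<in> borel_measurable cell" by (rule cell_measurable[OF L2_perD(1)[OF L]])
  have m: "(\<lambda>x. A x $ i $ j) \<in> borel_measurable cell" "(\<lambda>x. b x $ i) \<in> borel_measurable cell" for i j
    by (intro cell_measurable measurable_component measurable_component2 mA mb)+
  have m1: "(\<lambda>x. u x * (A x \<bullet> weak_hessian \<phi> x + b x \<bullet> weak_grad \<phi> x)) \<in> borel_measurable cell"
    unfolding weak_nondiv_alt using H2_per_weak_partials(4,7)[OF H, THEN square_integrable_measurable]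
    by (intro borel_measurable_times borel_measurable_add borel_measurable_sum m mu)
  have m2: "(\<lambda>x. u x * nondiv A b \<phi> x) \<in> borel_measurable cell"
    unfolding nondiv_alt
    by (intro borel_measurable_times borel_measurable_add borel_measurable_sum m mu cell_measurable[OF trig_poly_measurable] trig_poly_D \<phi>)
  have "(\<integral>x. u x * (A x \<bullet> weak_hessian \<phi> x + b x \<bullet> weak_grad \<phi> x) \<partial>cell) = 0"
    using v H unfolding very_weak_solution_def set_integral_unit_cell by blast
  then show "(\<integral>x. u x * nondiv A b \<phi> x \<partial>cell) = 0"
    using integral_cong_AE[OF m1 m2 ae] by simp
next
  assume R: "L2_per u \<and> (\<forall>\<phi>. trig_poly \<phi> \<longrightarrow> (\<integral>x. u x * nondiv A b \<phi> x \<partial>cell) = 0)"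
  then have L: "L2_per u" and ker: "\<And>\<phi>. trig_poly \<phi> \<Longrightarrow> (\<integral>x. u x * nondiv A b \<phi> x \<partial>cell) = 0" by auto
  note us = L2_perD(3)[OF L]
  have uA: "square_integrable cell (\<lambda>x. A x $ i $ j * u x)" for i j
    by (rule square_integrable_bounded_mult[OF cell_measurable[OF measurable_component2[OF mA]] AE_component_bounds(1)[OF bd] us])
  have ub: "square_integrable cell (\<lambda>x. b x $ i * u x)" for i
    by (rule square_integrable_bounded_mult[OF cell_measurable[OF measurable_component[OF mb]] AE_component_bounds(2)[OF bd] us])
  have expand: "(\<integral>x. u x * ((\<Sum>i\<in>UNIV. \<Sum>j\<in>UNIV. A x $ i $ j * G i j x) + (\<Sum>i\<in>UNIV. b x $ i * g i x)) \<partial>cell)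
      = (\<Sum>i\<in>UNIV. \<Sum>j\<in>UNIV. \<integral>x. G i j x * (A x $ i $ j * u x) \<partial>cell) + (\<Sum>i\<in>UNIV. \<integral>x. g i x * (b x $ i * u x) \<partial>cell)"
    if G: "\<And>i j. square_integrable cell (G i j)" "\<And>i. square_integrable cell (g i)"
    for G :: "'n \<Rightarrow> 'n \<Rightarrow> real^'n \<Rightarrow> real" and g :: "'n \<Rightarrow> real^'n \<Rightarrow> real"
  proof -
    have "(\<integral>x. u x * ((\<Sum>i\<in>UNIV. \<Sum>j\<in>UNIV. A x $ i $ j * G i j x) + (\<Sum>i\<in>UNIV. b x $ i * g i x)) \<partial>cell)
      = (\<integral>x. (\<Sum>i\<in>UNIV. \<Sum>j\<in>UNIV. G i j x * (A x $ i $ j * u x)) + (\<Sum>i\<in>UNIV. g i x * (b x $ i * u x)) \<partial>cell)"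
      by (simp add: distrib_left sum_distrib_left mult_ac)
    then show ?thesis
      using square_integrable_mult[OF G(1) uA] square_integrable_mult[OF G(2) ub]
      by (simp add: Bochner_Integration.integral_sum)
  qed
  show "very_weak_solution A b u"
    unfolding very_weak_solution_def set_integral_unit_cell
  proof (intro conjI L allI impI)
    fix \<phi> :: "real^'n \<Rightarrow> real" assume H: "H2_per \<phi>"
    note W = H2_per_weak_partials(4,7)[OF H]
    let ?p = "\<lambda>N. fejer N \<phi>"
    have tp: "trig_poly (?p N)" for N by (rule trig_poly_fejer)
    have s: "square_integrable cell (D j (?p N))" "square_integrable cell (D i (D j (?p N)))" for i j N
      by (intro trig_poly_square_integrable trig_poly_D tp)+
    have "0 = (\<Sum>i\<in>UNIV. \<Sum>j\<in>UNIV. \<integral>x. D i (D j (?p N)) x * (A x $ i $ j * u x) \<partial>cell) + (\<Sum>i\<in>UNIV. \<integral>x. D i (?p N) x * (b x $ i * u x) \<partial>cell)" for N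
      using ker[OF tp[of N]] unfolding nondiv_alt expand[OF s(2) s(1)] by simp
    moreover have "(\<lambda>N. (\<Sum>i\<in>UNIV. \<Sum>j\<in>UNIV. \<integral>x. D i (D j (?p N)) x * (A x $ i $ j * u x) \<partial>cell) + (\<Sum>i\<in>UNIV. \<integral>x. D i (?p N) x * (b x $ i * u x) \<partial>cell))
      \<longlonglongrightarrow> (\<Sum>i\<in>UNIV. \<Sum>j\<in>UNIV. \<integral>x. weak_partial i (weak_partial j \<phi>) x * (A x $ i $ j * u x) \<partial>cell) + (\<Sum>i\<in>UNIV. \<integral>x. weak_partial i \<phi> x * (b x $ i * u x) \<partial>cell)"
      by (intro tendsto_add tendsto_sum L2_inner_tendsto s W uA ub H2_per_fejer_tendsto[OF H])
    ultimately have "(\<lambda>N. 0) \<longlonglongrightarrow> (\<Sum>i\<in>UNIV. \<Sum>j\<in>UNIV. \<integral>x. weak_partial i (weak_partial j \<phi>) x * (A x $ i $ j * u x) \<partial>cell) + (\<Sum>i\<in>UNIV. \<integral>x. weak_partial i \<phi> x * (b x $ i * u x) \<partial>cell)"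
      by simp
    then have "(\<Sum>i\<in>UNIV. \<Sum>j\<in>UNIV. \<integral>x. weak_partial i (weak_partial j \<phi>) x * (A x $ i $ j * u x) \<partial>cell) + (\<Sum>i\<in>UNIV. \<integral>x. weak_partial i \<phi> x * (b x $ i * u x) \<partial>cell) = 0"
      by (simp only: LIMSEQ_const_iff)
    then show "(\<integral>x. u x * (A x \<bullet> weak_hessian \<phi> x + b x \<bullet> weak_grad \<phi> x) \<partial>cell) = 0"
      unfolding weak_nondiv_alt expand[OF W(2) W(1)] by simp
  qed
qed

subsection \<open>Renormalization\<close>

lemma inner_mat_1: "A \<bullet> mat 1 = trace A" for A :: "real ^ 'n::finite ^ 'n"
proof -
  have "(\<Sum>j\<in>UNIV. A $ i $ j * mat 1 $ i $ j) = A $ i $ i" for i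
  proof -
    have "(\<Sum>j\<in>UNIV. A $ i $ j * mat 1 $ i $ j) = (\<Sum>j\<in>UNIV. if i = j then A $ i $ j else 0)"
      by (intro sum.cong) (auto simp: mat_def)
    then show ?thesis by simp
  qed
  then show ?thesis by (simp add: inner_matrix trace_def)
qed

lemma trace_ge:
  fixes A :: "real ^ 'n::finite ^ 'n"
  assumes "\<And>\<xi>. lam * (\<xi> \<bullet> \<xi>) \<le> \<xi> \<bullet> (A *v \<xi>)"
  shows "real CARD('n) * lam \<le> trace A"
proof -
  have "lam \<le> A $ i $ i" for i
    using assms[of "axis i 1"] by (simp add: inner_axis_axis inner_axis' matrix_vector_mul_component inner_axis)
  then have "(\<Sum>i\<in>(UNIV :: 'n set). lam) \<le> trace A" unfolding trace_def by (intro sum_mono)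
  then show ?thesis by simp
qed

lemma renormalized_near_identity:
  fixes A :: "real ^ 'n::finite ^ 'n" and b :: "real ^ 'n"
  defines "q \<equiv> (norm A)\<^sup>2 + (norm b)\<^sup>2"
  assumes tr: "trace A > 0" and \<delta>: "real CARD('n) - 1 + \<delta> > 0"
    and cordes: "q / (trace A)\<^sup>2 \<le> 1 / (real CARD('n) - 1 + \<delta>)"
  shows "(norm ((trace A / q) *\<^sub>R A - mat 1))\<^sup>2 + (norm ((trace A / q) *\<^sub>R b))\<^sup>2 \<le> 1 - \<delta>"
    and "q > 0" and "trace A / q \<le> real CARD('n) / trace A"
proof -
  let ?t = "trace A" and ?\<gamma> = "trace A / q"
  have "A \<noteq> 0" using tr by (auto simp: trace_def)
  then show q: "q > 0" unfolding q_def by (simp add: add_pos_nonneg)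
  have "(norm (g *\<^sub>R A - mat 1))\<^sup>2 = g\<^sup>2 * (norm A)\<^sup>2 - 2 * g * ?t + real CARD('n)" for g
  proof -
    have "mat 1 \<bullet> (mat 1 :: real^'n^'n) = real CARD('n)" unfolding inner_mat_1 by (simp add: trace_I)
    moreover have "(norm (X - Y))\<^sup>2 = (norm X)\<^sup>2 - 2 * (X \<bullet> Y) + Y \<bullet> Y" for X Y :: "real^'n^'n"
      by (simp add: power2_norm_eq_inner inner_diff_left inner_diff_right inner_commute)
    moreover have "trace (g *\<^sub>R A) = g * trace A" by (simp add: trace_def sum_distrib_left)
    ultimately show ?thesis
      by (simp only: inner_mat_1 norm_scaleR power_mult_distrib power2_abs mult.assoc)
  qed
  note this[of ?\<gamma>]
  moreover have "(norm (?\<gamma> *\<^sub>R b))\<^sup>2 = ?\<gamma>\<^sup>2 * (norm b)\<^sup>2"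
    by (simp only: norm_scaleR power_mult_distrib power2_abs)
  ultimately have "(norm (?\<gamma> *\<^sub>R A - mat 1))\<^sup>2 + (norm (?\<gamma> *\<^sub>R b))\<^sup>2 = ?\<gamma>\<^sup>2 * q - 2 * ?\<gamma> * ?t + real CARD('n)"
    by (simp add: q_def algebra_simps)
  also have "\<dots> = real CARD('n) - ?t\<^sup>2 / q" using q by (simp add: power2_eq_square field_simps)
  also have "\<dots> \<le> 1 - \<delta>"
  proof -
    have "q * (real CARD('n) - 1 + \<delta>) \<le> ?t\<^sup>2" using cordes tr \<delta> by (simp add: field_simps)
    then have "real CARD('n) - 1 + \<delta> \<le> ?t\<^sup>2 / q" using q by (simp add: pos_le_divide_eq mult.commute)
    then show ?thesis by simp
  qed
  finally show "(norm (?\<gamma> *\<^sub>R A - mat 1))\<^sup>2 + (norm (?\<gamma> *\<^sub>R b))\<^sup>2 \<le> 1 - \<delta>" .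
  have "?t\<^sup>2 \<le> (norm A)\<^sup>2 * real CARD('n)"
    using Cauchy_Schwarz_ineq[of A "mat 1"] unfolding inner_mat_1 trace_I by (simp only: power2_norm_eq_inner)
  also have "\<dots> \<le> q * real CARD('n)" by (intro mult_right_mono) (auto simp: q_def)
  finally show "?t / q \<le> real CARD('n) / ?t" using q tr by (simp add: field_simps power2_eq_square)
qed

lemma measurable_trace:
  fixes A :: "'a \<Rightarrow> real ^ 'n::finite ^ 'n"
  assumes "A \<in> borel_measurable M" shows "(\<lambda>x. trace (A x)) \<in> borel_measurable M"
  unfolding trace_def by (intro borel_measurable_sum measurable_component2 assms)

lemma normalized_solution_iff:
  "normalized_solution A b u \<longleftrightarrow> very_weak_solution A b u \<and> (\<integral>x. u x \<partial>cell) = 1"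
  by (simp add: normalized_solution_def set_integral_unit_cell)

theorem corollary2p1:
  fixes A :: "real ^ 'n::finite \<Rightarrow> real ^ 'n ^ 'n"
    and b :: "real ^ 'n \<Rightarrow> real ^ 'n"
  assumes "setting_B A b"
  shows "\<exists>r r'.
    unique_normalized_solution A b r \<and>
    (AE x in lebesgue. r x \<ge> 0) \<and>
    unique_normalized_solution (\<lambda>x. renorm A b x *\<^sub>R A x) (\<lambda>x. renorm A b x *\<^sub>R b x) r' \<and>
    (AE x in lebesgue.
       r x = 1 / (LINT y:unit_cell|lebesgue. renorm A b y * r' y) * (renorm A b x * r' x))"
proof -
  define n where "n = real CARD('n)"
  have n1: "n \<ge> 1" using zero_less_card_finite[where 'a='n] by (simp add: n_def Suc_le_eq)
  from assms obtain lam Lam \<delta> CA Cb where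
    mA: "A \<in> borel_measurable lebesgue" and perA: "periodic_ae A" and CA: "AE x in lebesgue. norm (A x) \<le> CA"
    and mb: "b \<in> borel_measurable lebesgue" and perb: "periodic_ae b" and Cb: "AE x in lebesgue. norm (b x) \<le> Cb"
    and lam: "lam > 0" and ell: "AE x in lebesgue. \<forall>\<xi>. lam * (\<xi> \<bullet> \<xi>) \<le> \<xi> \<bullet> (A x *v \<xi>) \<and> \<xi> \<bullet> (A x *v \<xi>) \<le> Lam * (\<xi> \<bullet> \<xi>)"
    and \<delta>: "n / (n + pi\<^sup>2) < \<delta>" "\<delta> \<le> 1"
    and cor: "AE x in lebesgue. ((norm (A x))\<^sup>2 + (norm (b x))\<^sup>2) / (trace (A x))\<^sup>2 \<le> 1 / (n - 1 + \<delta>)"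
    unfolding setting_B_def Linf_per_def n_def by blast
  define \<gamma> where "\<gamma> = renorm A b"
  define A' where "A' x = \<gamma> x *\<^sub>R A x" for x
  define b' where "b' x = \<gamma> x *\<^sub>R b x" for x
  have np: "n + pi\<^sup>2 > 0" using n1 by (simp add: add_pos_nonneg)
  have \<delta>0: "\<delta> > 0" using \<delta>(1) n1 np by (meson divide_nonneg_pos less_le_trans not_less order_less_imp_le order_trans zero_le_one)
  have facts: "AE x in lebesgue. trace (A x) \<ge> n * lam \<and>
      (norm (A' x - mat 1))\<^sup>2 + (norm (b' x))\<^sup>2 \<le> 1 - \<delta> \<and> 0 < \<gamma> x \<and> \<gamma> x \<le> 1 / lam \<and>
      1 / \<gamma> x \<le> (CA\<^sup>2 + Cb\<^sup>2) / (n * lam)"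
    using ell cor CA Cb
  proof eventually_elim
    case (elim x)
    have nl: "n * lam > 0" using n1 lam by simp
    have t: "n * lam \<le> trace (A x)" unfolding n_def by (rule trace_ge) (use elim(1) in blast)
    then have t0: "trace (A x) > 0" using nl by linarith
    define q where "q = (norm (A x))\<^sup>2 + (norm (b x))\<^sup>2"
    note N = renormalized_near_identity[of "A x" \<delta> "b x", folded q_def n_def, OF t0 _ elim(2)[folded q_def]]
    have \<gamma>q: "\<gamma> x = trace (A x) / q" by (simp add: \<gamma>_def renorm_def q_def)
    have nd: "n - 1 + \<delta> > 0" using n1 \<delta>0 by simp
    have "trace (A x) / q \<le> n / trace (A x)" by (rule N(3)[OF nd])
    also have "\<dots> \<le> n / (n * lam)" using n1 by (intro divide_left_mono[OF t] mult_pos_pos[OF t0 nl]) simp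
    also have "\<dots> = 1 / lam" using n1 by simp
    finally have ub: "\<gamma> x \<le> 1 / lam" by (simp add: \<gamma>q)
    have "q \<le> CA\<^sup>2 + Cb\<^sup>2" unfolding q_def by (intro add_mono power_mono elim) auto
    then have "q / trace (A x) \<le> (CA\<^sup>2 + Cb\<^sup>2) / (n * lam)" using N(2)[OF nd] nl t by (intro frac_le) auto
    then show ?case using N(1,2)[OF nd] t t0 ub by (simp add: A'_def b'_def \<gamma>q)
  qed
  have m\<gamma>: "\<gamma> \<in> borel_measurable lebesgue"
    unfolding \<gamma>_def renorm_def[abs_def]
    by (intro borel_measurable_divide borel_measurable_add borel_measurable_power measurable_trace mA
        measurable_compose[OF mA borel_measurable_continuous_onI[OF continuous_on_norm_id]]
        measurable_compose[OF mb borel_measurable_continuous_onI[OF continuous_on_norm_id]])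
  have per\<gamma>: "periodic_ae \<gamma>"
    unfolding \<gamma>_def renorm_def[abs_def] by (rule periodic_ae_combine[OF perA perb])
  define \<rho> where "\<rho> = sqrt (1 - \<delta>)"
  define \<kappa> where "\<kappa> = sqrt ((1 - \<delta>) * (1 + 1 / (4 * pi\<^sup>2)))"
  have \<rho>2: "\<rho>\<^sup>2 = 1 - \<delta>" using \<delta> by (simp add: \<rho>_def)
  have \<kappa>2: "\<kappa>\<^sup>2 = (1 - \<delta>) * (1 + 1 / (4 * pi\<^sup>2))" using \<delta> by (simp add: \<kappa>_def)
  have "\<kappa>\<^sup>2 < 1"
  proof -
    have id: "(1 - n / (n + p)) * (1 + n / p) = 1" if "p > 0" for p
    proof -
      have "1 - n / (n + p) = p / (n + p)" "1 + n / p = (n + p) / p" using that n1 by (simp_all add: field_simps)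
      then show ?thesis using that n1 by simp
    qed
    have "(1 - \<delta>) * (1 + 1 / (4 * pi\<^sup>2)) \<le> (1 - \<delta>) * (1 + n / pi\<^sup>2)"
      using \<delta>(2) n1 by (intro mult_left_mono add_left_mono frac_le) auto
    also have "\<dots> < (1 - n / (n + pi\<^sup>2)) * (1 + n / pi\<^sup>2)"
      using \<delta>(1) n1 by (intro mult_strict_right_mono) (auto intro: add_pos_nonneg)
    also have "\<dots> = 1" by (rule id) simp
    finally show ?thesis by (simp add: \<kappa>2)
  qed
  then have \<kappa>: "0 \<le> \<kappa>" "\<kappa> < 1" using \<delta> by (auto simp: \<kappa>_def)
  have mA': "A' \<in> borel_measurable lebesgue" and mb': "b' \<in> borel_measurable lebesgue"
    unfolding A'_def[abs_def] b'_def[abs_def] using m\<gamma> mA mb by (auto intro: borel_measurable_scaleR)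
  interpret cordes A' b' \<rho> \<kappa>
  proof
    show "AE x in lebesgue. (norm (A' x - mat 1))\<^sup>2 + (norm (b' x))\<^sup>2 \<le> \<rho>\<^sup>2"
      using facts unfolding \<rho>2 by eventually_elim simp
    show "\<rho>\<^sup>2 * (1 + 1 / (4 * pi\<^sup>2)) \<le> \<kappa>\<^sup>2" by (simp add: \<rho>2 \<kappa>2)
  qed (fact mA' mb' \<kappa>)+
  have bdA': "AE x in lebesgue. norm (A' x) \<le> 1 / lam * CA" and bdb': "AE x in lebesgue. norm (b' x) \<le> 1 / lam * Cb"
  proof -
    have "norm (\<gamma> x *\<^sub>R v) \<le> 1 / lam * K" if "0 < \<gamma> x" "\<gamma> x \<le> 1 / lam" "norm v \<le> K"
      for x K and v :: "'v::real_normed_vector"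
      unfolding norm_scaleR using that lam by (intro mult_mono) auto
    note bound = this
    show "AE x in lebesgue. norm (A' x) \<le> 1 / lam * CA"
      using facts CA unfolding A'_def by eventually_elim (intro bound; simp)
    show "AE x in lebesgue. norm (b' x) \<le> 1 / lam * Cb"
      using facts Cb unfolding b'_def by eventually_elim (intro bound; simp)
  qed
  note vw' = very_weak_solution_iff[OF mA' mb' bdA' bdb'] and vw = very_weak_solution_iff[OF mA mb CA Cb]
  have perA': "periodic_ae A'" and perb': "periodic_ae b'"
    unfolding A'_def[abs_def] b'_def[abs_def]
    by (rule periodic_ae_combine[OF per\<gamma> perA], rule periodic_ae_combine[OF per\<gamma> perb])
  have scale: "nondiv A' b' \<phi> x = \<gamma> x * nondiv A b \<phi> x" for \<phi> x
    by (simp add: nondiv_def A'_def b'_def distrib_left)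
  obtain r' where r': "L2_per r'" "(\<integral>x. r' x \<partial>cell) = 1"
    and ker': "\<And>\<phi>. trig_poly \<phi> \<Longrightarrow> (\<integral>x. r' x * nondiv A' b' \<phi> x \<partial>cell) = 0"
    using adjoint_kernel_exists[OF perA' perb'] by blast
  note r'm = L2_perD(1)[OF r'(1)] and r'p = L2_perD(2)[OF r'(1)] and r's = L2_perD(3)[OF r'(1)]
  have r'0: "AE x in cell. 0 \<le> r' x" using adjoint_kernel_nonneg[OF r's ker' r'(2)] .
  have multiple: "AE x in lebesgue. w x = (\<integral>x. w x \<partial>cell) * r' x"
    if w: "L2_per w" and wk: "\<And>\<phi>. trig_poly \<phi> \<Longrightarrow> (\<integral>x. w x * nondiv A' b' \<phi> x \<partial>cell) = 0" for w
  proof -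
    define m where "m = (\<integral>x. w x \<partial>cell)"
    note ws = L2_perD(3)[OF w]
    let ?s = "\<lambda>x. w x - m * r' x"
    have s: "square_integrable cell ?s" using ws r's by simp
    have "AE x in cell. ?s x = 0"
    proof (rule adjoint_kernel_mean_zero[OF s])
      show "(\<integral>x. ?s x \<partial>cell) = 0"
        using cell.square_integrable_integrable[OF ws] cell.square_integrable_integrable[OF r's] r'(2) by (simp add: m_def)
      fix \<phi> :: "real^'n \<Rightarrow> real" assume \<phi>: "trig_poly \<phi>"
      have "(\<integral>x. ?s x * nondiv A' b' \<phi> x \<partial>cell) = (\<integral>x. w x * nondiv A' b' \<phi> x - m * (r' x * nondiv A' b' \<phi> x) \<partial>cell)"
        by (simp add: algebra_simps)
      also have "\<dots> = 0"
        using square_integrable_mult[OF ws nondiv_square_integrable[OF \<phi>]]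
          square_integrable_mult[OF r's nondiv_square_integrable[OF \<phi>]] wk[OF \<phi>] ker'[OF \<phi>] by simp
      finally show "(\<integral>x. ?s x * nondiv A' b' \<phi> x \<partial>cell) = 0" .
    qed
    moreover have "periodic_ae ?s"
      by (rule periodic_ae_combine[OF L2_perD(2)[OF w] r'p])
    ultimately have "AE x in lebesgue. ?s x = 0" by (intro AE_lebesgue_if_cell)
    then show ?thesis by eventually_elim (simp add: m_def)
  qed
  have "AE x in lebesgue. v x = r' x"
    if "L2_per v" "(\<integral>x. v x \<partial>cell) = 1" "\<And>\<phi>. trig_poly \<phi> \<Longrightarrow> (\<integral>x. v x * nondiv A' b' \<phi> x \<partial>cell) = 0" for v
    using multiple[OF that(1,3)] unfolding that(2) by simp
  then have unique': "unique_normalized_solution A' b' r'"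
    unfolding unique_normalized_solution_def normalized_solution_iff vw'
    using r' ker' by blast
  define c where "c = (\<integral>x. \<gamma> x * r' x \<partial>cell)"
  have \<gamma>ae: "AE x in cell. 0 < \<gamma> x" "AE x in cell. \<bar>\<gamma> x\<bar> \<le> 1 / lam"
    using AE_cell_if_lebesgue[OF facts] by (eventually_elim, simp)+
  have \<gamma>r's: "square_integrable cell (\<lambda>x. \<gamma> x * r' x)"
    by (rule square_integrable_bounded_mult[OF cell_measurable[OF m\<gamma>] \<gamma>ae(2) r's])
  have \<gamma>r'0: "AE x in cell. 0 \<le> \<gamma> x * r' x" using \<gamma>ae(1) r'0 by eventually_elim simp
  have c: "c > 0"
  proof -
    have "c \<ge> 0" unfolding c_def by (rule integral_nonneg_AE[OF \<gamma>r'0])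
    moreover have "c \<noteq> 0"
    proof
      assume "c = 0"
      then have "AE x in cell. \<gamma> x * r' x = 0"
        using integral_nonneg_eq_0_iff_AE[OF cell.square_integrable_integrable[OF \<gamma>r's] \<gamma>r'0] by (simp add: c_def)
      then have "AE x in cell. r' x = 0" using \<gamma>ae(1) by eventually_elim auto
      then have "(\<integral>x. r' x \<partial>cell) = 0" by (rule integral_eq_zero_AE)
      then show False using r'(2) by simp
    qed
    ultimately show ?thesis by simp
  qed
  define r where "r x = 1 / c * (\<gamma> x * r' x)" for x
  have rL: "L2_per r"
  proof (rule L2_per_if_square_integrable)
    show "r \<in> borel_measurable lebesgue"
      unfolding r_def[abs_def] by (intro borel_measurable_times borel_measurable_const m\<gamma> r'm)
    show "periodic_ae r"
      unfolding r_def[abs_def] by (rule periodic_ae_combine[OF per\<gamma> r'p])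
    show "square_integrable cell r" unfolding r_def[abs_def] by (rule square_integrable_scale[OF \<gamma>r's])
  qed
  have r1: "(\<integral>x. r x \<partial>cell) = 1" using c by (simp add: r_def c_def)
  have rk: "(\<integral>x. r x * nondiv A b \<phi> x \<partial>cell) = 0" if "trig_poly \<phi>" for \<phi>
  proof -
    have "(\<integral>x. r x * nondiv A b \<phi> x \<partial>cell) = (\<integral>x. 1 / c * (r' x * nondiv A' b' \<phi> x) \<partial>cell)"
      by (intro Bochner_Integration.integral_cong) (auto simp: r_def scale)
    then show ?thesis using ker'[OF that] by simp
  qed
  have r0: "AE x in lebesgue. r x \<ge> 0"
  proof (rule AE_lebesgue_if_cell[OF L2_perD(2)[OF rL]])
    show "AE x in cell. r x \<ge> 0" using \<gamma>r'0 by eventually_elim (use c in \<open>simp add: r_def\<close>)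
  qed
  have unique: "AE x in lebesgue. v x = r x"
    if v: "L2_per v" "(\<integral>x. v x \<partial>cell) = 1" and vk: "\<And>\<phi>. trig_poly \<phi> \<Longrightarrow> (\<integral>x. v x * nondiv A b \<phi> x \<partial>cell) = 0" for v
  proof -
    define w where "w x = 1 / \<gamma> x * v x" for x
    have mw: "w \<in> borel_measurable lebesgue"
      unfolding w_def[abs_def] by (intro borel_measurable_times borel_measurable_divide borel_measurable_const m\<gamma> L2_perD(1)[OF v(1)])
    have "AE x in cell. \<bar>1 / \<gamma> x\<bar> \<le> (CA\<^sup>2 + Cb\<^sup>2) / (n * lam)"
      using AE_cell_if_lebesgue[OF facts] by eventually_elim simp
    then have ws: "square_integrable cell w"
      unfolding w_def[abs_def]
      by (intro square_integrable_bounded_mult[OF _ _ L2_perD(3)[OF v(1)]] borel_measurable_divide borel_measurable_const cell_measurable m\<gamma>)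
    have wL: "L2_per w"
    proof (rule L2_per_if_square_integrable[OF mw _ ws])
      show "periodic_ae w"
        unfolding w_def[abs_def] by (rule periodic_ae_combine[OF per\<gamma> L2_perD(2)[OF v(1)]])
    qed
    have wk: "(\<integral>x. w x * nondiv A' b' \<phi> x \<partial>cell) = 0" if \<phi>: "trig_poly \<phi>" for \<phi>
    proof -
      have ae: "AE x in cell. w x * nondiv A' b' \<phi> x = v x * nondiv A b \<phi> x"
        using \<gamma>ae(1) by eventually_elim (simp add: w_def scale)
      have m: "nondiv A b \<phi> \<in> borel_measurable lebesgue"
        unfolding nondiv_alt[abs_def]
        by (intro borel_measurable_add borel_measurable_sum borel_measurable_times measurable_component
            measurable_component2 mA mb trig_poly_measurable trig_poly_D \<phi>)
      have "(\<integral>x. w x * nondiv A' b' \<phi> x \<partial>cell) = (\<integral>x. v x * nondiv A b \<phi> x \<partial>cell)"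
        by (rule integral_cong_AE[OF _ _ ae])
          (intro borel_measurable_times cell_measurable mw m L2_perD(1)[OF v(1)] nondiv_measurable \<phi>)+
      then show ?thesis using vk[OF \<phi>] by simp
    qed
    define m where "m = (\<integral>x. w x \<partial>cell)"
    have "AE x in lebesgue. w x = m * r' x" unfolding m_def by (rule multiple[OF wL wk])
    then have vr: "AE x in lebesgue. v x = m * c * r x"
      using facts by eventually_elim (use c in \<open>auto simp: w_def r_def field_simps\<close>)
    have "(\<integral>x. v x \<partial>cell) = (\<integral>x. m * c * r x \<partial>cell)"
      by (rule integral_cong_AE[OF _ _ AE_cell_if_lebesgue[OF vr]])
        (intro cell_measurable borel_measurable_times borel_measurable_const L2_perD(1)[OF v(1)] L2_perD(1)[OF rL])+
    then have "m * c = 1" using v(2) r1 by simp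
    then show ?thesis using vr by simp
  qed
  have "unique_normalized_solution A b r"
    unfolding unique_normalized_solution_def normalized_solution_iff vw
    using rL r1 rk unique by blast
  moreover have "AE x in lebesgue. r x = 1 / (LINT y:unit_cell|lebesgue. renorm A b y * r' y) * (renorm A b x * r' x)"
    unfolding set_integral_unit_cell by (simp add: r_def c_def \<gamma>_def)
  ultimately show ?thesis
    using r0 unique' unfolding A'_def[abs_def] b'_def[abs_def] \<gamma>_def by blast
qed

end
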